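(* For each $\gamma>0$ and $\Delta\in\mathbb{N}$ there exist $\beta>0$ and $C$ such that if $p\ge C\big(\tfrac{\log n}{n}\big)^{1/\Delta}$, then asymptotically almost surely $\Gamma=G(n,p)$ has the following property. If $H$ is a $(1-\gamma)n$-vertex graph with maximum degree $\Delta(H)\le\Delta$, chromatic number $\chi(H)$, and bandwidth $\mathrm{bw}(H)\le\beta n$, and $G$ is an $n$-vertex subgraph of $\Gamma$ with minimum degree $\delta(G)\ge\big(\tfrac{\chi(H)-1}{\chi(H)}+\gamma\big)pn$, then $H$ is a subgraph of $G$.
   Context: $G(n,p)$ is the binomial random graph; a.a.s. means with probability tending to $1$ as $n\to\infty$. Logarithms are to base $2$. The bandwidth $\mathrm{bw}(H)$ is the least $b$ such that there is a labelling of $V(H)$ by $1,\dots,v(H)$ with $|i-j|\le b$ for every edge $ij$. *)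

theory Defs
  imports "HOL-Probability.Probability" "HOL-Library.Ramsey"
begin

record 'a ugraph =
  verts :: "'a set"
  edges :: "'a set set"

definition simple_graph :: "'a ugraph \<Rightarrow> bool" where
  "simple_graph G \<longleftrightarrow> finite (verts G) \<and> edges G \<subseteq> nsets (verts G) 2"

definition subgraph :: "'a ugraph \<Rightarrow> 'a ugraph \<Rightarrow> bool" where
  "subgraph G K \<longleftrightarrow> simple_graph G \<and> verts G \<subseteq> verts K \<and> edges G \<subseteq> edges K"

(* H is a subgraph of G up to isomorphism; the image of H need not be induced in G. *)
definition contains_copy :: "'a ugraph \<Rightarrow> 'b ugraph \<Rightarrow> bool" where
  "contains_copy G H \<longleftrightarrow>
    (\<exists>f. inj_on f (verts H) \<and> f ` verts H \<subseteq> verts G \<and> (\<forall>e\<in>edges H. f ` e \<in> edges G))"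

definition degree :: "'a ugraph \<Rightarrow> 'a \<Rightarrow> nat" where
  "degree G v = card {e \<in> edges G. v \<in> e}"

(* Max and Min are taken over a nonempty set unless G has no vertices, in which case
   both values are unspecified. *)
definition max_degree :: "'a ugraph \<Rightarrow> nat" where
  "max_degree G = Max (degree G ` verts G)"

definition min_degree :: "'a ugraph \<Rightarrow> nat" where
  "min_degree G = Min (degree G ` verts G)"

definition proper_colouring :: "'a ugraph \<Rightarrow> nat \<Rightarrow> ('a \<Rightarrow> nat) \<Rightarrow> bool" where
  "proper_colouring G k c \<longleftrightarrow>
    c ` verts G \<subseteq> {..<k} \<and> (\<forall>u v. {u, v} \<in> edges G \<longrightarrow> c u \<noteq> c v)"

definition chromatic_number :: "'a ugraph \<Rightarrow> nat" where
  "chromatic_number G = (LEAST k. \<exists>c. proper_colouring G k c)"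

definition bandwidth :: "'a ugraph \<Rightarrow> nat" where
  "bandwidth G = (LEAST b. \<exists>l :: 'a \<Rightarrow> nat. bij_betw l (verts G) {1..card (verts G)} \<and>
    (\<forall>u v. {u, v} \<in> edges G \<longrightarrow> \<bar>int (l u) - int (l v)\<bar> \<le> int b))"

definition gnp :: "nat \<Rightarrow> real \<Rightarrow> nat ugraph pmf" where
  "gnp n p = map_pmf (\<lambda>X. \<lparr>verts = {..<n}, edges = {e \<in> nsets {..<n} 2. X e}\<rparr>)
    (Pi_pmf (nsets {..<n} 2) False (\<lambda>_. bernoulli_pmf p))"

definition asymptotically_almost_surely ::
    "(nat \<Rightarrow> 'a pmf) \<Rightarrow> (nat \<Rightarrow> 'a \<Rightarrow> bool) \<Rightarrow> bool" where
  "asymptotically_almost_surely M P \<longleftrightarrow>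
    (\<lambda>n. measure_pmf.prob (M n) {x. P n x}) \<longlonglongrightarrow> 1"

end

theory Submission
  imports Defs
begin

text \<open>All that is used of the random graph is a one-sided density condition on subpairs: a dense pair
  has at least the expected number of edges between any two large subsets. Weighted containers show
  that only a tiny proportion of small random subsets contain a sparse subpair, and a first moment
  argument turns this into inheritance: for all but \<open>O(log n / p)\<close>, respectively
  \<open>O(log n / p\<^sup>2)\<close>, vertices \<open>v\<close>, a dense pair stays dense when one side, respectively both
  sides, are restricted to the neighbourhood of \<open>v\<close>. An energy increment yields clusters almost all
  of whose pairs are dense or have few edges, so by the minimum degree any \<open>\<chi>(H)\<close> clusters have a
  common neighbour in the cluster graph. Hence any two \<open>\<chi>(H)\<close>-cliques of clusters are joined by a
  walk of bounded length. Cut the bandwidth ordering of \<open>H\<close> into short blocks, and map each long run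
  of blocks to one clique, chosen greedily according to current loads; a quadratic potential shows that
  every cluster gets its fair share of vertices, and the walks serve as transitions. Finally \<open>H\<close> is
  embedded block by block and, within a block, colour class by colour class of a proper colouring of
  the cube of \<open>H\<close>. Each class is embedded by Hall's theorem into the candidate sets from which the
  few vertices violating inheritance are deleted; Hall's condition holds because in the random graph no
  small set contains many common neighbours for each of a larger family of disjoint tuples.\<close>

section \<open>Dense pairs and containers\<close>

text \<open>The exponent 1/\<Delta> has three sources. A vertex of \<open>H\<close> with j embedded
  neighbours has a candidate set of order p^j n. Inheritance needs order log n / p candidates where
  one neighbour is still to come, so j \<le> \<Delta> - 1, and order log n / p^2 only where two are
  to come, so j \<le> \<Delta> - 2; Hall's condition needs order log n at j \<le> \<Delta>. All
  three amount to p^\<Delta> n \<ge> C log n. The obstacle is that candidate sets are far smaller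
  than the linear size at which density of a pair of clusters says anything, and that
  \<open>G\<close> is chosen after the random graph: the bound on exceptional vertices has to hold
  for all dense subpairs of all subgraphs at once. Hence sparse subpairs are counted through
  containers. The spare \<gamma>n vertices give every colour a reserve in its cluster, so a vertex
  without embedded neighbours always keeps a fixed proportion of the cluster. Regularity parameters
  are chosen backwards, from edges with all neighbours embedded down to pairs of clusters; then the
  number of clusters, then \<beta>, and C last.\<close>

definition ec :: "('a \<Rightarrow> 'b \<Rightarrow> bool) \<Rightarrow> 'a set \<Rightarrow> 'b set \<Rightarrow> real" where
  "ec R A B = (\<Sum>a\<in>A. \<Sum>b\<in>B. of_bool (R a b))"

text \<open>Lower regularity at an absolute level: \<open>c\<close> is itself a density, in the
  application a constant times p, and not a ratio to the density of the whole pair.\<close>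

definition dense_pair :: "('a \<Rightarrow> 'b \<Rightarrow> bool) \<Rightarrow> real \<Rightarrow> real \<Rightarrow> 'a set \<Rightarrow> 'b set \<Rightarrow> bool" where
  "dense_pair R c \<epsilon> A B \<longleftrightarrow> (\<forall>A' B'. A' \<subseteq> A \<longrightarrow> B' \<subseteq> B \<longrightarrow>
     \<epsilon> * real (card A) \<le> real (card A') \<longrightarrow> \<epsilon> * real (card B) \<le> real (card B') \<longrightarrow>
     c * real (card A') * real (card B') \<le> ec R A' B')"

lemma dense_pairD:
  assumes "dense_pair R c \<epsilon> A B" "A' \<subseteq> A" "B' \<subseteq> B"
    "\<epsilon> * real (card A) \<le> real (card A')" "\<epsilon> * real (card B) \<le> real (card B')"
  shows "c * real (card A') * real (card B') \<le> ec R A' B'"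
  using assms unfolding dense_pair_def by blast

lemma ec_nonneg: "0 \<le> ec R A B"
  unfolding ec_def by (intro sum_nonneg) auto

lemma ec_swap: "ec R A B = ec (\<lambda>b a. R a b) B A"
  unfolding ec_def by (rule sum.swap)

lemma dense_pair_swap_imp:
  assumes d: "dense_pair R c \<epsilon> A B"
  shows "dense_pair (\<lambda>b a. R a b) c \<epsilon> B A"
  unfolding dense_pair_def
proof (intro allI impI)
  fix B' A' assume *: "B' \<subseteq> B" "A' \<subseteq> A" "\<epsilon> * real (card B) \<le> real (card B')"
    "\<epsilon> * real (card A) \<le> real (card A')"
  have "c * real (card A') * real (card B') \<le> ec R A' B'"
    using * by (intro dense_pairD[OF d])
  also have "ec R A' B' = ec (\<lambda>b a. R a b) B' A'" by (rule ec_swap)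
  finally show "c * real (card B') * real (card A') \<le> ec (\<lambda>b a. R a b) B' A'"
    by (simp add: mult_ac)
qed

lemma ec_mono:
  assumes "finite A" "finite B" "A' \<subseteq> A" "B' \<subseteq> B"
  shows "ec R A' B' \<le> ec R A B"
proof -
  have "ec R A' B' \<le> (\<Sum>a\<in>A'. \<Sum>b\<in>B. of_bool (R a b))"
    unfolding ec_def using assms by (intro sum_mono sum_mono2) auto
  also have "\<dots> \<le> ec R A B"
    unfolding ec_def using assms by (intro sum_mono2 sum_nonneg) auto
  finally show ?thesis .
qed

lemma ec_deg: "finite B \<Longrightarrow> (\<Sum>b\<in>B. of_bool (R a b)) = real (card {b\<in>B. R a b})"
  by (simp add: Int_def conj_commute flip: sum.inter_filter)

lemma dense_pair_mono:
  assumes d: "dense_pair R c \<epsilon> A B" and "c' \<le> c" "\<epsilon> \<le> \<epsilon>'"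
  shows "dense_pair R c' \<epsilon>' A B"
  unfolding dense_pair_def
proof (intro allI impI)
  fix A' B' assume *: "A' \<subseteq> A" "B' \<subseteq> B" "\<epsilon>' * real (card A) \<le> real (card A')"
    "\<epsilon>' * real (card B) \<le> real (card B')"
  have "\<epsilon> * real (card A) \<le> \<epsilon>' * real (card A)" "\<epsilon> * real (card B) \<le> \<epsilon>' * real (card B)"
    using assms by (auto intro: mult_right_mono)
  then have "c * real (card A') * real (card B') \<le> ec R A' B'"
    using * by (intro dense_pairD[OF d]) auto
  moreover have "c' * real (card A') * real (card B') \<le> c * real (card A') * real (card B')"
    using assms by (intro mult_right_mono) auto
  ultimately show "c' * real (card A') * real (card B') \<le> ec R A' B'" by linarith
qed

text \<open>A lower bound at a fixed level passes to subpairs with the same \<open>c\<close>; only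
  the proportion that counts as large changes, by the factor \<open>\<zeta>\<close>.\<close>

lemma dense_pair_subset:
  assumes d: "dense_pair R c \<epsilon> A B" and "A1 \<subseteq> A" "B1 \<subseteq> B"
    and "\<zeta> * real (card A) \<le> real (card A1)" "\<zeta> * real (card B) \<le> real (card B1)"
    and "0 \<le> \<epsilon>'" "\<epsilon> \<le> \<epsilon>' * \<zeta>"
  shows "dense_pair R c \<epsilon>' A1 B1"
  unfolding dense_pair_def
proof (intro allI impI)
  fix A' B' assume *: "A' \<subseteq> A1" "B' \<subseteq> B1" "\<epsilon>' * real (card A1) \<le> real (card A')"
    "\<epsilon>' * real (card B1) \<le> real (card B')"
  have "\<epsilon> * real (card A) \<le> \<epsilon>' * (\<zeta> * real (card A))" "\<epsilon> * real (card B) \<le> \<epsilon>' * (\<zeta> * real (card B))"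
    using assms(7) by (auto simp: mult.assoc[symmetric] intro: mult_right_mono)
  moreover have "\<epsilon>' * (\<zeta> * real (card A)) \<le> \<epsilon>' * real (card A1)" "\<epsilon>' * (\<zeta> * real (card B)) \<le> \<epsilon>' * real (card B1)"
    using assms by (auto intro: mult_left_mono)
  ultimately show "c * real (card A') * real (card B') \<le> ec R A' B'"
    using * assms by (intro dense_pairD[OF d]) auto
qed

section \<open>Exponential weights on subsets and weighted containers\<close>

lemma sum_Pow_power:
  fixes x :: real
  assumes "finite A"
  shows "(\<Sum>Y\<in>Pow A. x ^ card Y) = (1 + x) ^ card A"
proof -
  have "(\<Prod>a\<in>A. x + 1) = (\<Sum>Y\<in>Pow A. (\<Prod>a\<in>Y. x) * (\<Prod>a\<in>A - Y. 1))"
    by (rule prod_add[OF assms])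
  then show ?thesis by (simp add: add.commute)
qed

lemma one_plus_power_le_exp:
  fixes x :: real
  assumes "0 \<le> x"
  shows "(1 + x) ^ n \<le> exp (x * real n)"
proof -
  have "(1 + x) ^ n \<le> exp x ^ n"
    using assms by (intro power_mono) (auto simp: exp_ge_add_one_self)
  also have "\<dots> = exp (x * real n)" by (simp add: exp_of_nat_mult[symmetric] mult.commute)
  finally show ?thesis .
qed

text \<open>Exponential tilting, as in a Chernoff bound: a counted set has at least q elements, so
  replacing \<open>x\<close> by \<open>\<Lambda> * x\<close> gains at least \<Lambda>^q on each
  term, after which the binomial theorem sums over all subsets.\<close>

lemma sum_large_subsets_le:
  fixes x \<Lambda> q :: real
  assumes "finite A" "0 \<le> x" "1 \<le> \<Lambda>"
  shows "(\<Sum>Y\<in>{Y. Y \<subseteq> A \<and> q \<le> real (card Y)}. x ^ card Y)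
         \<le> exp (\<Lambda> * x * real (card A) - q * ln \<Lambda>)"
proof -
  have fin: "finite (Pow A)" using assms by simp
  have "(\<Sum>Y\<in>{Y. Y \<subseteq> A \<and> q \<le> real (card Y)}. x ^ card Y)
      \<le> (\<Sum>Y\<in>{Y. Y \<subseteq> A \<and> q \<le> real (card Y)}. exp (- q * ln \<Lambda>) * (\<Lambda> * x) ^ card Y)"
  proof (rule sum_mono)
    fix Y assume "Y \<in> {Y. Y \<subseteq> A \<and> q \<le> real (card Y)}"
    then have q: "q \<le> real (card Y)" by auto
    have "q * ln \<Lambda> \<le> real (card Y) * ln \<Lambda>"
      using q assms by (intro mult_right_mono) auto
    then have "1 \<le> exp (- q * ln \<Lambda>) * exp (real (card Y) * ln \<Lambda>)"
      by (simp flip: exp_add)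
    also have "exp (real (card Y) * ln \<Lambda>) = \<Lambda> ^ card Y"
      using assms by (simp add: exp_of_nat_mult)
    finally have "1 * x ^ card Y \<le> (exp (- q * ln \<Lambda>) * \<Lambda> ^ card Y) * x ^ card Y"
      using assms by (intro mult_right_mono) auto
    then show "x ^ card Y \<le> exp (- q * ln \<Lambda>) * (\<Lambda> * x) ^ card Y"
      by (simp add: power_mult_distrib mult.assoc)
  qed
  also have "\<dots> \<le> (\<Sum>Y\<in>Pow A. exp (- q * ln \<Lambda>) * (\<Lambda> * x) ^ card Y)"
    using assms fin by (intro sum_mono2) auto
  also have "\<dots> = exp (- q * ln \<Lambda>) * (1 + \<Lambda> * x) ^ card A"
    by (simp add: sum_distrib_left[symmetric] sum_Pow_power assms)
  also have "\<dots> \<le> exp (- q * ln \<Lambda>) * exp (\<Lambda> * x * real (card A))"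
    using assms by (intro mult_left_mono one_plus_power_le_exp) auto
  also have "\<dots> = exp (\<Lambda> * x * real (card A) - q * ln \<Lambda>)"
    by (simp flip: exp_add)
  finally show ?thesis .
qed

text \<open>Multiplicative weights in place of deletion: a vertex of \<open>T\<close> seen by a
  chosen vertex is halved rather than removed, so a large set that is rarely seen keeps much of its
  weight.\<close>

definition wt :: "('a \<Rightarrow> 'b \<Rightarrow> bool) \<Rightarrow> 'a set \<Rightarrow> 'b \<Rightarrow> real" where
  "wt R F t = (1/2) ^ card {f\<in>F. R f t}"

text \<open>The container belonging to the fingerprint \<open>F\<close>; it is determined by
  \<open>F\<close> alone. The threshold is half of what density \<open>c\<close> would give on the
  weighted set.\<close>

definition low_deg :: "('a \<Rightarrow> 'b \<Rightarrow> bool) \<Rightarrow> real \<Rightarrow> 'a set \<Rightarrow> 'b set \<Rightarrow> 'a set \<Rightarrow> 'a set" where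
  "low_deg R c S T F = {u\<in>S. (\<Sum>t\<in>T. of_bool (R u t) * wt R F t) < c / 2 * (\<Sum>t\<in>T. wt R F t)}"

lemma wt_nonneg: "0 \<le> wt R F t" unfolding wt_def by simp
lemma wt_le_1: "wt R F t \<le> 1" unfolding wt_def by (simp add: power_le_one)

lemma wt_insert:
  assumes "finite F" "u \<notin> F"
  shows "wt R (insert u F) t = wt R F t - of_bool (R u t) * wt R F t / 2"
proof -
  have "{f\<in>insert u F. R f t} = (if R u t then insert u {f\<in>F. R f t} else {f\<in>F. R f t})" by auto
  then show ?thesis using assms unfolding wt_def by (auto simp: field_simps)
qed

text \<open>If the container were larger, density would give all but \<epsilon>|T| vertices of
  \<open>T\<close> at least c|Z| neighbours in it. Weights are at most 1 and their total is at least
  2\<epsilon>|T|, so these vertices carry half of the weight, and double counting contradicts the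
  threshold c/2.\<close>

lemma card_low_deg:
  assumes fin: "finite S" "finite T" and d: "dense_pair R c \<epsilon> S T" and c: "0 < c" and e: "0 < \<epsilon>"
    and w: "2 * \<epsilon> * real (card T) \<le> (\<Sum>t\<in>T. wt R F t)"
  shows "real (card (low_deg R c S T F)) \<le> \<epsilon> * real (card S)"
proof (rule ccontr)
  define Z where "Z = low_deg R c S T F"
  define W where "W = (\<Sum>t\<in>T. wt R F t)"
  assume "\<not> ?thesis"
  then have big: "\<epsilon> * real (card S) < real (card Z)" by (simp add: Z_def)
  have ZS: "Z \<subseteq> S" unfolding Z_def low_deg_def by auto
  have finZ: "finite Z" using ZS fin finite_subset by blast
  have Zpos: "0 < real (card Z)" using big e by (smt (verit) mult_nonneg_nonneg of_nat_0_le_iff)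
  define g where "g t = (\<Sum>u\<in>Z. of_bool (R u t) :: real)" for t
  define L where "L = {t\<in>T. g t < c * real (card Z)}"
  have L: "real (card L) < \<epsilon> * real (card T) \<or> L = {}"
  proof (rule ccontr)
    assume "\<not> ?thesis"
    then have *: "\<epsilon> * real (card T) \<le> real (card L)" "L \<noteq> {}" by auto
    have "c * real (card Z) * real (card L) \<le> ec R Z L"
      using * big ZS by (intro dense_pairD[OF d]) (auto simp: L_def)
    also have "ec R Z L = (\<Sum>t\<in>L. g t)" unfolding ec_def g_def by (rule sum.swap)
    also have "\<dots> < (\<Sum>t\<in>L. c * real (card Z))"
      using * fin by (intro sum_strict_mono) (auto simp: L_def)
    finally show False by (simp add: mult.commute)
  qed
  have wL: "(\<Sum>t\<in>L. wt R F t) \<le> real (card L)"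
    using sum_mono[of L "wt R F" "\<lambda>_. 1", OF wt_le_1] by simp
  have cardL: "real (card L) \<le> \<epsilon> * real (card T)" using L e by auto
  have split: "W = (\<Sum>t\<in>T - L. wt R F t) + (\<Sum>t\<in>L. wt R F t)"
    unfolding W_def using fin by (intro sum.subset_diff) (auto simp: L_def)
  have "(\<Sum>u\<in>Z. \<Sum>t\<in>T. of_bool (R u t) * wt R F t) < (\<Sum>u\<in>Z. c / 2 * W)"
    using Zpos finZ by (intro sum_strict_mono) (auto simp: low_deg_def W_def Z_def card_gt_0_iff)
  then have 1: "(\<Sum>u\<in>Z. \<Sum>t\<in>T. of_bool (R u t) * wt R F t) < real (card Z) * (c / 2 * W)" by simp
  have "(\<Sum>u\<in>Z. \<Sum>t\<in>T. of_bool (R u t) * wt R F t) = (\<Sum>t\<in>T. g t * wt R F t)"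
    unfolding g_def sum_distrib_right by (rule sum.swap)
  also have "\<dots> \<ge> (\<Sum>t\<in>T - L. g t * wt R F t)"
    using fin by (intro sum_mono2) (auto simp: g_def wt_nonneg intro!: mult_nonneg_nonneg sum_nonneg)
  also have "(\<Sum>t\<in>T - L. g t * wt R F t) \<ge> (\<Sum>t\<in>T - L. c * real (card Z) * wt R F t)"
    by (intro sum_mono mult_right_mono) (auto simp: L_def wt_nonneg)
  also have "(\<Sum>t\<in>T - L. c * real (card Z) * wt R F t) = c * real (card Z) * (\<Sum>t\<in>T - L. wt R F t)"
    by (simp add: sum_distrib_left)
  finally have "c * real (card Z) * (\<Sum>t\<in>T - L. wt R F t) < real (card Z) * (c / 2 * W)" using 1 by linarith
  then have "c * (\<Sum>t\<in>T - L. wt R F t) < c * (W / 2)"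
    using Zpos by (simp add: mult.assoc mult.left_commute[of c])
  then have "(\<Sum>t\<in>T - L. wt R F t) < W / 2" using c by simp
  then show False using split wL cardL w unfolding W_def by linarith
qed

text \<open>Jensen's inequality by hand: on average a vertex of \<open>T'\<close> is seen at most
  \<open>a * card F\<close> times, 1 + x \<le> exp x deals with the average, and the base 1/2 is at
  least 1/e.\<close>

lemma wt_sum_lower:
  assumes finT: "finite T'" "finite F"
    and deg: "\<And>f. f \<in> F \<Longrightarrow> (\<Sum>t\<in>T'. of_bool (R f t)) \<le> a * real (card T')"
  shows "real (card T') * exp (- (a * real (card F))) \<le> (\<Sum>t\<in>T'. wt R F t)"
proof -
  define m where "m t = real (card {f\<in>F. R f t})" for t
  define b where "b = a * real (card F)"
  have "(\<Sum>t\<in>T'. m t) = (\<Sum>t\<in>T'. \<Sum>f\<in>F. of_bool (R f t))"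
    unfolding m_def using finT by (simp add: Int_def conj_commute flip: sum.inter_filter)
  also have "\<dots> = (\<Sum>f\<in>F. \<Sum>t\<in>T'. of_bool (R f t))" by (rule sum.swap)
  also have "\<dots> \<le> (\<Sum>f\<in>F. a * real (card T'))" using deg by (intro sum_mono) auto
  finally have m: "(\<Sum>t\<in>T'. m t) \<le> b * real (card T')" by (simp add: b_def mult.commute mult.left_commute)
  have ln2: "ln (2::real) \<le> 1" using ln_2_less_1 by simp
  have "real (card T') \<le> (\<Sum>t\<in>T'. 1 + (b - m t))"
    using m by (simp add: sum.distrib sum_subtractf mult.commute)
  also have "\<dots> \<le> (\<Sum>t\<in>T'. exp (b - m t))"
    by (intro sum_mono) (simp add: exp_ge_add_one_self)
  also have "\<dots> = exp b * (\<Sum>t\<in>T'. exp (- m t))"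
    by (simp add: sum_distrib_left exp_diff exp_minus field_simps)
  also have "\<dots> \<le> exp b * (\<Sum>t\<in>T'. wt R F t)"
  proof (intro mult_left_mono sum_mono)
    fix t
    have "exp (- m t) \<le> exp (- (m t * ln 2))"
      using ln2 mult_left_mono[OF ln2, of "m t"] by (simp add: m_def)
    also have "\<dots> = wt R F t"
      by (simp add: wt_def m_def exp_minus exp_of_nat_mult power_one_over inverse_eq_divide)
    finally show "exp (- m t) \<le> wt R F t" .
  qed simp
  finally show ?thesis by (simp add: b_def exp_minus field_simps)
qed

text \<open>A weighted Kleitman--Winston argument: the vertices of \<open>Q\<close> hardly see \<open>T'\<close>, so each of them
  with large weighted degree into \<open>T\<close> lowers the weight of \<open>T\<close> much faster than that of \<open>T'\<close>.\<close>

lemma sparse_fingerprint: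
  assumes fin: "finite S" "finite T" and d: "dense_pair R c \<epsilon> S T" and c: "0 < c" "c \<le> 1"
    and e: "0 < \<epsilon>" "2 * \<epsilon> \<le> \<epsilon>'\<^sup>2" and e': "0 < \<epsilon>'" "\<epsilon>' < 1"
    and Q: "Q \<subseteq> S" and T': "T' \<subseteq> T" "T' \<noteq> {}" "\<epsilon>' * real (card T) \<le> real (card T')"
    and deg: "\<And>u. u \<in> Q \<Longrightarrow> (\<Sum>t\<in>T'. of_bool (R u t)) \<le> c / 8 * real (card T')"
  shows "\<exists>F\<subseteq>Q. c * real (card F) \<le> 8 * ln (1 / \<epsilon>') \<and> Q - F \<subseteq> low_deg R c S T F \<and>
           real (card (low_deg R c S T F)) \<le> \<epsilon> * real (card S)"
proof -
  have finQ: "finite Q" using Q fin finite_subset by blast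
  have finT': "finite T'" using T' fin finite_subset by blast
  \<comment> \<open>Sets whose choice has cost the total weight a factor 1 - c/4 per vertex. A
    largest one cannot be extended, which puts the remaining vertices of \<open>Q\<close> into its
    container.\<close>
  define good where "good F \<longleftrightarrow> F \<subseteq> Q \<and> (\<Sum>t\<in>T. wt R F t) \<le> (1 - c / 4) ^ card F * real (card T)" for F
  have g0: "good {}" unfolding good_def wt_def by simp
  have fing: "finite (Collect good)"
    by (rule finite_subset[of _ "Pow Q"]) (auto simp: good_def finQ)
  have "Max (card ` Collect good) \<in> card ` Collect good"
    using fing g0 by (intro Max_in) auto
  then obtain F where F: "good F" and FM: "card F = Max (card ` Collect good)" by auto
  have max: "card F' \<le> card F" if "good F'" for F'
    unfolding FM using that fing by (intro Max_ge) auto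
  have FQ: "F \<subseteq> Q" using F good_def by auto
  have finF: "finite F" using FQ finQ finite_subset by blast
  have wF: "(\<Sum>t\<in>T. wt R F t) \<le> (1 - c / 4) ^ card F * real (card T)" using F good_def by auto
  have t0: "0 < real (card T')" using T' finT' by (simp add: card_gt_0_iff)
  have tT: "0 < real (card T)" using T' t0 card_mono[OF fin(2) T'(1)] by simp
  have low: "real (card T') * exp (- (c / 8 * real (card F))) \<le> (\<Sum>t\<in>T'. wt R F t)"
    using FQ deg by (intro wt_sum_lower finT' finF) auto
  also have "\<dots> \<le> (\<Sum>t\<in>T. wt R F t)"
    using fin T' by (intro sum_mono2) (auto simp: wt_nonneg)
  finally have low: "real (card T') * exp (- (c / 8 * real (card F))) \<le> (\<Sum>t\<in>T. wt R F t)" .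
  have low': "\<epsilon>' * real (card T) * exp (- (c / 8 * real (card F))) \<le> (\<Sum>t\<in>T. wt R F t)"
    by (rule order_trans[OF mult_right_mono[OF T'(3)] low]) simp
  \<comment> \<open>The total weight decays at rate c/4 per chosen vertex, that of \<open>T'\<close>
    at rate at most c/8. As \<open>T'\<close> starts with an \<epsilon>' share of the total, the gap
    bounds \<open>card F\<close>.\<close>
  have "(1 - c / 4) ^ card F \<le> exp (- (c / 4)) ^ card F"
    using c exp_ge_add_one_self[of "- (c/4)"] by (intro power_mono) auto
  also have "\<dots> = exp (- (c / 4 * real (card F)))" by (simp add: exp_of_nat_mult[symmetric] mult.commute)
  finally have "\<epsilon>' * real (card T) * exp (- (c / 8 * real (card F))) \<le> exp (- (c / 4 * real (card F))) * real (card T)"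
    using low' wF mult_right_mono[of "(1 - c / 4) ^ card F" "exp (- (c / 4 * real (card F)))" "real (card T)"]
    by linarith
  then have "\<epsilon>' * exp (- (c / 8 * real (card F))) \<le> exp (- (c / 4 * real (card F)))"
    using tT by (simp add: mult.commute mult.left_commute)
  then have "\<epsilon>' \<le> exp (- (c / 4 * real (card F))) * exp (c / 8 * real (card F))"
    by (simp add: exp_minus field_simps)
  also have "\<dots> = exp (- (c / 8 * real (card F)))" by (simp add: exp_add[symmetric])
  finally have e1: "\<epsilon>' \<le> exp (- (c / 8 * real (card F)))" .
  have "ln \<epsilon>' \<le> - (c / 8 * real (card F))"
    using e1 e' by (metis exp_gt_zero ln_exp ln_le_cancel_iff)
  then have size: "c * real (card F) \<le> 8 * ln (1 / \<epsilon>')" using e' by (simp add: ln_div)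
  \<comment> \<open>One factor \<epsilon>' is the share of \<open>T'\<close>, the other bounds the
    decay: the origin of the hypothesis
    \<open>2 * \<epsilon> \<le> \<epsilon>'\<^sup>2\<close>.\<close>
  have "\<epsilon>' * (\<epsilon>' * real (card T)) \<le> exp (- (c / 8 * real (card F))) * (\<epsilon>' * real (card T))"
    using e1 e' by (intro mult_right_mono) auto
  then have "\<epsilon>'\<^sup>2 * real (card T) \<le> (\<Sum>t\<in>T. wt R F t)"
    using low' by (simp add: power2_eq_square mult.commute mult.left_commute)
  then have "2 * \<epsilon> * real (card T) \<le> (\<Sum>t\<in>T. wt R F t)"
    using mult_right_mono[OF e(2), of "real (card T)"] by simp
  then have Z: "real (card (low_deg R c S T F)) \<le> \<epsilon> * real (card S)"
    by (intro card_low_deg[OF fin d c(1) e(1)])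
  have "Q - F \<subseteq> low_deg R c S T F"
  proof
    fix u assume u: "u \<in> Q - F"
    have "\<not> good (insert u F)" using max[of "insert u F"] u finF by auto
    then have "(1 - c / 4) ^ Suc (card F) * real (card T) < (\<Sum>t\<in>T. wt R (insert u F) t)"
      using u FQ finF unfolding good_def by auto
    also have "\<dots> = (\<Sum>t\<in>T. wt R F t) - (\<Sum>t\<in>T. of_bool (R u t) * wt R F t) / 2"
      using u finF by (simp add: wt_insert sum_subtractf sum_divide_distrib)
    finally have 1: "(1 - c / 4) * ((1 - c / 4) ^ card F * real (card T)) <
        (\<Sum>t\<in>T. wt R F t) - (\<Sum>t\<in>T. of_bool (R u t) * wt R F t) / 2" by simp
    have "(1 - c / 4) * (\<Sum>t\<in>T. wt R F t) \<le> (1 - c / 4) * ((1 - c / 4) ^ card F * real (card T))"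
      using wF c by (intro mult_left_mono) auto
    with 1 have "(\<Sum>t\<in>T. of_bool (R u t) * wt R F t) < c / 2 * (\<Sum>t\<in>T. wt R F t)"
      by (simp add: algebra_simps)
    then show "u \<in> low_deg R c S T F" using u Q by (auto simp: low_deg_def)
  qed
  then show ?thesis using FQ size Z by blast
qed

text \<open>A sparse \<open>Q\<close> is certified by its fingerprint together with a large part of
  \<open>Q\<close> inside the small container of that fingerprint. Summed over all fingerprints, the
  first component costs at most exp(\<pi>|S|), whereas the large subsets of a container of size
  \<epsilon>|S| have total weight only exp(-(K+1)\<pi>|S|).\<close>

lemma container_family:
  assumes fin: "finite S" "finite T" and d: "dense_pair R c \<epsilon> S T" and c: "0 < c" "c \<le> 1"
    and e: "0 < \<epsilon>" "2 * \<epsilon> \<le> \<epsilon>'\<^sup>2" and e': "0 < \<epsilon>'" "\<epsilon>' < 1"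
    and \<rho>: "0 < \<rho>" "4 * (K + 2) / \<rho> \<le> ln (1 / \<epsilon>)" and \<pi>: "0 \<le> \<pi>"
    and big: "32 * ln (1 / \<epsilon>') / \<rho> \<le> c * \<pi> * real (card S)"
  shows "\<exists>\<W>\<subseteq>Pow S. (\<Sum>D\<in>\<W>. \<pi> ^ card D) \<le> exp (- K * \<pi> * real (card S)) \<and>
    (\<forall>Q T'. Q \<subseteq> S \<longrightarrow> T' \<subseteq> T \<longrightarrow> \<rho> * \<pi> * real (card S) \<le> real (card Q) \<longrightarrow>
       \<epsilon>' * real (card T) \<le> real (card T') \<longrightarrow>
       ec R Q T' < c / 16 * real (card Q) * real (card T') \<longrightarrow> (\<exists>D\<in>\<W>. D \<subseteq> Q))"
proof -
  \<comment> \<open>At least half of \<open>Q\<close>, that is 2 * q vertices, have few neighbours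
    in \<open>T'\<close>; the fingerprint uses at most q of them, so q are left inside the
    container.\<close>
  define q where "q = \<rho> * \<pi> * real (card S) / 4"
  define Z where "Z = low_deg R c S T"
  define A where "A = (SIGMA F:{F. F \<subseteq> S \<and> real (card (Z F)) \<le> \<epsilon> * real (card S)}.
      {Y. Y \<subseteq> Z F \<and> q \<le> real (card Y)})"
  define B where "B = {x\<in>A. fst x \<inter> snd x = {}}"
  define \<W> where "\<W> = (\<lambda>x. fst x \<union> snd x) ` B"
  have ZS: "Z F \<subseteq> S" for F unfolding Z_def low_deg_def by auto
  have finA: "finite A" unfolding A_def
    using fin ZS by (intro finite_SigmaI) (auto intro: finite_subset[of _ "Pow S"])
  then have finB: "finite B" unfolding B_def by simp
  have finZ: "finite (Z F)" for F using ZS fin finite_subset by blast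
  have le1: "\<epsilon>'\<^sup>2 \<le> 1" using e' by (simp add: power_le_one)
  have "\<W> \<subseteq> Pow S" unfolding \<W>_def B_def A_def using ZS by fastforce
  moreover have "(\<Sum>D\<in>\<W>. \<pi> ^ card D) \<le> exp (- K * \<pi> * real (card S))"
  proof -
    have "(\<Sum>D\<in>\<W>. \<pi> ^ card D) \<le> (\<Sum>x\<in>B. \<pi> ^ card (fst x \<union> snd x))"
      unfolding \<W>_def using \<pi> finB sum_image_le[of B "\<lambda>D. \<pi> ^ card D" "\<lambda>x. fst x \<union> snd x"] by (simp add: o_def)
    also have "\<dots> = (\<Sum>x\<in>B. \<pi> ^ card (fst x) * \<pi> ^ card (snd x))"
    proof (rule sum.cong[OF refl])
      fix x assume "x \<in> B"
      then have x: "fst x \<subseteq> S" "snd x \<subseteq> Z (fst x)" "fst x \<inter> snd x = {}"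
        by (auto simp: B_def A_def)
      then have "finite (fst x)" "finite (snd x)" 
        using finite_subset[OF x(1) fin(1)] finite_subset[OF x(2) finZ] by auto
      with x show "\<pi> ^ card (fst x \<union> snd x) = \<pi> ^ card (fst x) * \<pi> ^ card (snd x)"
        by (simp add: card_Un_disjoint power_add)
    qed
    also have "\<dots> \<le> (\<Sum>x\<in>A. \<pi> ^ card (fst x) * \<pi> ^ card (snd x))"
      using finA \<pi> by (intro sum_mono2) (auto simp: B_def)
    also have "\<dots> = (\<Sum>F\<in>{F. F \<subseteq> S \<and> real (card (Z F)) \<le> \<epsilon> * real (card S)}.
        \<Sum>Y\<in>{Y. Y \<subseteq> Z F \<and> q \<le> real (card Y)}. \<pi> ^ card F * \<pi> ^ card Y)"
      unfolding A_def using fin finZ by (subst sum.Sigma) (auto simp: case_prod_beta)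
    also have "\<dots> \<le> (\<Sum>F\<in>{F. F \<subseteq> S \<and> real (card (Z F)) \<le> \<epsilon> * real (card S)}.
        \<pi> ^ card F * exp (- (K + 1) * \<pi> * real (card S)))"
      unfolding sum_distrib_left[symmetric]
    proof (intro sum_mono mult_left_mono)
      \<comment> \<open>Tilting by 1/\<epsilon> raises the mean size in the container from at most
        \<epsilon>\<pi>|S| to at most \<pi>|S|, and gains q ln(1/\<epsilon>) \<ge>
        (K+2)\<pi>|S|.\<close>
      fix F assume F: "F \<in> {F. F \<subseteq> S \<and> real (card (Z F)) \<le> \<epsilon> * real (card S)}"
      have "(\<Sum>Y\<in>{Y. Y \<subseteq> Z F \<and> q \<le> real (card Y)}. \<pi> ^ card Y)
          \<le> exp ((1 / \<epsilon>) * \<pi> * real (card (Z F)) - q * ln (1 / \<epsilon>))"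
        using e le1 \<pi> finZ by (intro sum_large_subsets_le) auto
      also have "\<dots> \<le> exp (- (K + 1) * \<pi> * real (card S))"
      proof -
        have "(1 / \<epsilon>) * \<pi> * real (card (Z F)) \<le> (1 / \<epsilon>) * \<pi> * (\<epsilon> * real (card S))"
          using F e \<pi> by (intro mult_left_mono) auto
        moreover have "q * (4 * (K + 2) / \<rho>) \<le> q * ln (1 / \<epsilon>)"
          using \<rho> \<pi> by (intro mult_left_mono) (auto simp: q_def)
        moreover have "(1 / \<epsilon>) * \<pi> * (\<epsilon> * real (card S)) = \<pi> * real (card S)" using e by simp
        moreover have "q * (4 * (K + 2) / \<rho>) = (K + 2) * \<pi> * real (card S)" using \<rho> by (simp add: q_def)
        moreover have "(K + 2) * \<pi> * real (card S) = (K + 1) * \<pi> * real (card S) + \<pi> * real (card S)"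
          by (simp add: algebra_simps)
        moreover have "- (K + 1) * \<pi> * real (card S) = - ((K + 1) * \<pi> * real (card S))" by (simp add: algebra_simps)
        ultimately show ?thesis unfolding exp_le_cancel_iff by linarith
      qed
      finally show "(\<Sum>Y\<in>{Y. Y \<subseteq> Z F \<and> q \<le> real (card Y)}. \<pi> ^ card Y)
          \<le> exp (- (K + 1) * \<pi> * real (card S))" .
    qed (use \<pi> in auto)
    also have "\<dots> \<le> (\<Sum>F\<in>Pow S. \<pi> ^ card F * exp (- (K + 1) * \<pi> * real (card S)))"
      using fin \<pi> by (intro sum_mono2) auto
    also have "\<dots> = (1 + \<pi>) ^ card S * exp (- (K + 1) * \<pi> * real (card S))"
      by (simp add: sum_distrib_right[symmetric] sum_Pow_power fin)
    also have "\<dots> \<le> exp (\<pi> * real (card S)) * exp (- (K + 1) * \<pi> * real (card S))"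
      using \<pi> by (intro mult_right_mono one_plus_power_le_exp) auto
    also have "\<dots> = exp (- K * \<pi> * real (card S))" by (simp add: exp_add[symmetric] algebra_simps)
    finally show ?thesis .
  qed
  moreover have "\<exists>D\<in>\<W>. D \<subseteq> Q" if Q: "Q \<subseteq> S" "\<rho> * \<pi> * real (card S) \<le> real (card Q)"
    and T': "T' \<subseteq> T" "\<epsilon>' * real (card T) \<le> real (card T')"
    and sp: "ec R Q T' < c / 16 * real (card Q) * real (card T')" for Q T'
  proof -
    have finQ: "finite Q" using Q fin finite_subset by blast
    define Q1 where "Q1 = {u\<in>Q. (\<Sum>t\<in>T'. of_bool (R u t)) \<le> c / 8 * real (card T')}"
    have pos: "0 < c / 16 * real (card Q) * real (card T')"
      using sp ec_nonneg[of R Q T'] by linarith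
    then have Tne: "T' \<noteq> {}" by auto
    have Tpos: "0 < real (card T')" using pos by (cases "card T' = 0") auto
    have "(\<Sum>u\<in>Q - Q1. c / 8 * real (card T')) \<le> (\<Sum>u\<in>Q - Q1. \<Sum>t\<in>T'. of_bool (R u t))"
      by (intro sum_mono) (auto simp: Q1_def)
    then have "c / 8 * real (card T') * real (card (Q - Q1)) \<le> (\<Sum>u\<in>Q - Q1. \<Sum>t\<in>T'. of_bool (R u t))"
      by (simp add: mult.commute)
    also have "\<dots> \<le> ec R Q T'" unfolding ec_def
      using finQ by (intro sum_mono2 sum_nonneg) auto
    also note sp
    finally have "(c / 16 * real (card T')) * (2 * real (card (Q - Q1))) < (c / 16 * real (card T')) * real (card Q)"
      by (simp add: field_simps)
    then have "2 * real (card (Q - Q1)) < real (card Q)" using c Tpos by simp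
    moreover have "real (card Q) = real (card Q1) + real (card (Q - Q1))"
    proof -
      have "Q1 \<subseteq> Q" by (auto simp: Q1_def)
      then show ?thesis using card_mono[OF finQ, of Q1] finQ finite_subset[of Q1 Q]
        by (simp add: card_Diff_subset of_nat_diff)
    qed
    ultimately have Q1: "real (card Q) / 2 \<le> real (card Q1)" by linarith
    obtain F where F: "F \<subseteq> Q1" "c * real (card F) \<le> 8 * ln (1 / \<epsilon>')"
      "Q1 - F \<subseteq> Z F" "real (card (Z F)) \<le> \<epsilon> * real (card S)"
      using sparse_fingerprint[OF fin d c e e', of Q1 T'] T' Q Tne unfolding Z_def
      by (auto simp: Q1_def)
    have finF: "finite F" using F(1) finQ finite_subset[of F Q] by (auto simp: Q1_def)
    have "c * real (card F) \<le> \<rho> * (32 * ln (1 / \<epsilon>') / \<rho>) / 4" using F(2) \<rho> by simp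
    also have "\<dots> \<le> \<rho> * (c * \<pi> * real (card S)) / 4" using big \<rho> by (intro divide_right_mono mult_left_mono) auto
    also have "\<dots> = c * q" by (simp add: q_def)
    finally have Fq: "real (card F) \<le> q" using c by simp
    have "real (card (Q1 - F)) = real (card Q1) - real (card F)"
    proof -
      have "finite Q1" using finQ by (auto simp: Q1_def)
      then show ?thesis using card_mono[of Q1 F] F(1) finF by (simp add: card_Diff_subset of_nat_diff)
    qed
    then have "q \<le> real (card (Q1 - F))" using Q1 Q(2) Fq by (simp add: q_def)
    then have "(F, Q1 - F) \<in> B" using F Q unfolding A_def B_def by (auto simp: Q1_def)
    then have "F \<union> (Q1 - F) \<in> \<W>" unfolding \<W>_def by force
    then show ?thesis using F(1) by (intro bexI[of _ "F \<union> (Q1 - F)"]) (auto simp: Q1_def)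
  qed
  ultimately show ?thesis by (intro exI[of _ \<W>] conjI allI impI) simp_all
qed

section \<open>Random subsets and inheritance of density\<close>

text \<open>Serves two purposes: over the set of vertex pairs it is the edge set of the random
  graph, and over a vertex class it is the random sample by which that class is shrunk.\<close>

definition rsub :: "'a set \<Rightarrow> real \<Rightarrow> 'a set pmf" where
  "rsub A \<pi> = map_pmf (\<lambda>X. {a\<in>A. X a}) (Pi_pmf A False (\<lambda>_. bernoulli_pmf \<pi>))"

lemma gnp_eq_rsub: "gnp n p = map_pmf (\<lambda>E. \<lparr>verts = {..<n}, edges = E\<rparr>) (rsub (nsets {..<n} 2) p)"
  unfolding gnp_def rsub_def by (simp add: pmf.map_comp o_def)

lemma set_pmf_rsub: "set_pmf (rsub A \<pi>) \<subseteq> Pow A"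
  unfolding rsub_def pmf.set_map by blast

lemma finite_set_pmf_rsub: "finite A \<Longrightarrow> finite (set_pmf (rsub A \<pi>))"
  using finite_subset[OF set_pmf_rsub] by (metis finite_Pow_iff)

lemma prob_rsub_superset:
  assumes "finite A" "D \<subseteq> A" "0 \<le> \<pi>" "\<pi> \<le> 1"
  shows "measure_pmf.prob (rsub A \<pi>) {X. D \<subseteq> X} = \<pi> ^ card D"
proof -
  have "measure_pmf.prob (rsub A \<pi>) {X. D \<subseteq> X}
      = measure_pmf.prob (Pi_pmf A False (\<lambda>_. bernoulli_pmf \<pi>)) (Pi A (\<lambda>a. if a \<in> D then {True} else UNIV))"
    unfolding rsub_def measure_map_pmf
    using assms(2) by (intro arg_cong[where f = "measure_pmf.prob _"]) (auto simp: Pi_iff split: if_splits)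
  also have "\<dots> = (\<Prod>a\<in>A. measure_pmf.prob (bernoulli_pmf \<pi>) (if a \<in> D then {True} else UNIV))"
    by (rule measure_Pi_pmf_Pi[OF assms(1)])
  also have "\<dots> = (\<Prod>a\<in>A. if a \<in> D then \<pi> else 1)"
    using assms by (intro prod.cong) (auto simp: measure_pmf_single)
  also have "\<dots> = (\<Prod>a\<in>D. \<pi>)"
    using assms by (simp add: prod.If_cases Int_absorb1)
  finally show ?thesis by simp
qed

lemma prob_rsub_family:
  assumes "finite A" "\<W> \<subseteq> Pow A" "0 \<le> \<pi>" "\<pi> \<le> 1"
  shows "measure_pmf.prob (rsub A \<pi>) {X. \<exists>D\<in>\<W>. D \<subseteq> X} \<le> (\<Sum>D\<in>\<W>. \<pi> ^ card D)"
proof -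
  have fin: "finite \<W>" using assms by (meson finite_Pow_iff finite_subset)
  have "measure_pmf.prob (rsub A \<pi>) {X. \<exists>D\<in>\<W>. D \<subseteq> X} = measure_pmf.prob (rsub A \<pi>) (\<Union>D\<in>\<W>. {X. D \<subseteq> X})"
    by (intro arg_cong[where f = "measure_pmf.prob _"]) auto
  also have "\<dots> \<le> (\<Sum>D\<in>\<W>. measure_pmf.prob (rsub A \<pi>) {X. D \<subseteq> X})"
    using fin by (intro measure_pmf.finite_measure_subadditive_finite) auto
  also have "\<dots> = (\<Sum>D\<in>\<W>. \<pi> ^ card D)"
    using assms by (intro sum.cong prob_rsub_superset) auto
  finally show ?thesis .
qed

lemma expectation_rsub_superset:
  assumes "finite A" "D \<subseteq> A" "0 \<le> \<pi>" "\<pi> \<le> 1"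
  shows "measure_pmf.expectation (rsub A \<pi>) (\<lambda>X. of_bool (D \<subseteq> X)) = \<pi> ^ card D"
proof -
  have "(\<lambda>X. of_bool (D \<subseteq> X) :: real) = indicator {X. D \<subseteq> X}" by (auto simp: indicator_def)
  then show ?thesis using prob_rsub_superset[OF assms] by simp
qed

lemma integrable_rsub: "finite A \<Longrightarrow> integrable (measure_pmf (rsub A \<pi>)) (f :: _ \<Rightarrow> real)"
  by (rule integrable_measure_pmf_finite[OF finite_set_pmf_rsub])

lemma expectation_rsub_mono:
  assumes "finite A" "\<And>X. X \<subseteq> A \<Longrightarrow> f X \<le> (g X :: real)"
  shows "measure_pmf.expectation (rsub A \<pi>) f \<le> measure_pmf.expectation (rsub A \<pi>) g"
  using assms set_pmf_rsub[of A \<pi>]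
  by (intro integral_mono_AE integrable_rsub AE_pmfI) auto

lemma expectation_rsub_card:
  assumes "finite A" "B \<subseteq> A" "0 \<le> \<pi>" "\<pi> \<le> 1"
  shows "measure_pmf.expectation (rsub A \<pi>) (\<lambda>X. \<Sum>b\<in>B. w b * of_bool (b \<in> X)) = \<pi> * (\<Sum>b\<in>B. w b :: real)"
proof -
  have "measure_pmf.expectation (rsub A \<pi>) (\<lambda>X. \<Sum>b\<in>B. w b * of_bool (b \<in> X))
     = (\<Sum>b\<in>B. measure_pmf.expectation (rsub A \<pi>) (\<lambda>X. w b * of_bool ({b} \<subseteq> X)))"
    using assms by (subst Bochner_Integration.integral_sum) (auto intro: integrable_rsub)
  also have "\<dots> = (\<Sum>b\<in>B. w b * \<pi>)"
  proof (rule sum.cong[OF refl])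
    fix b assume "b \<in> B"
    then have "measure_pmf.expectation (rsub A \<pi>) (\<lambda>X. of_bool ({b} \<subseteq> X)) = \<pi>"
      using expectation_rsub_superset[OF assms(1) _ assms(3,4), of "{b}"] assms(2) by auto
    then show "measure_pmf.expectation (rsub A \<pi>) (\<lambda>X. w b * of_bool ({b} \<subseteq> X)) = w b * \<pi>"
      by (simp del: insert_subset)
  qed
  finally show ?thesis by (simp add: sum_distrib_left mult.commute)
qed

lemma expectation_rsub_square:
  assumes "finite A" "B \<subseteq> A" "0 \<le> \<pi>" "\<pi> \<le> 1"
  shows "measure_pmf.expectation (rsub A \<pi>) (\<lambda>X. (real (card (X \<inter> B)) - \<pi> * real (card B))\<^sup>2) \<le> \<pi> * real (card B)"
proof -
  define m where "m = \<pi> * real (card B)"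
  have finB: "finite B" using assms finite_subset by blast
  have card_eq: "real (card (X \<inter> B)) = (\<Sum>b\<in>B. of_bool (b \<in> X))" for X
    using finB by (simp add: Int_commute)
  have E1: "measure_pmf.expectation (rsub A \<pi>) (\<lambda>X. real (card (X \<inter> B))) = m"
    using expectation_rsub_card[OF assms, of "\<lambda>_. 1"] unfolding card_eq by (simp add: m_def)
  have "measure_pmf.expectation (rsub A \<pi>) (\<lambda>X. (real (card (X \<inter> B)))\<^sup>2)
    = measure_pmf.expectation (rsub A \<pi>) (\<lambda>X. \<Sum>a\<in>B. \<Sum>b\<in>B. of_bool ({a, b} \<subseteq> X))"
    unfolding card_eq power2_eq_square sum_product by (intro arg_cong[where f = "measure_pmf.expectation _"] ext sum.cong) auto
  also have "\<dots> = (\<Sum>a\<in>B. \<Sum>b\<in>B. measure_pmf.expectation (rsub A \<pi>) (\<lambda>X. of_bool ({a, b} \<subseteq> X)))"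
    using assms by (simp add: Bochner_Integration.integral_sum integrable_rsub del: insert_subset)
  also have "\<dots> = (\<Sum>a\<in>B. \<Sum>b\<in>B. \<pi> ^ card {a, b})"
    using assms by (intro sum.cong expectation_rsub_superset) auto
  also have "\<dots> \<le> (\<Sum>a\<in>B. \<Sum>b\<in>B. \<pi>\<^sup>2 + (if a = b then \<pi> else 0))"
    using assms by (intro sum_mono) (auto simp: power2_eq_square)
  also have "\<dots> = m\<^sup>2 + m"
    using finB by (simp add: sum.distrib m_def power2_eq_square algebra_simps)
  finally have E2: "measure_pmf.expectation (rsub A \<pi>) (\<lambda>X. (real (card (X \<inter> B)))\<^sup>2) \<le> m\<^sup>2 + m" .
  have "measure_pmf.expectation (rsub A \<pi>) (\<lambda>X. (real (card (X \<inter> B)) - m)\<^sup>2)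
     = measure_pmf.expectation (rsub A \<pi>) (\<lambda>X. (real (card (X \<inter> B)))\<^sup>2 - 2 * m * real (card (X \<inter> B)) + m\<^sup>2)"
    by (simp add: power2_eq_square algebra_simps)
  also have "\<dots> = measure_pmf.expectation (rsub A \<pi>) (\<lambda>X. (real (card (X \<inter> B)))\<^sup>2) - 2 * m * m + m\<^sup>2"
    using assms(1) by (simp add: Bochner_Integration.integral_add Bochner_Integration.integral_diff integrable_rsub E1)
  also have "\<dots> \<le> m" using E2 by (simp add: power2_eq_square)
  finally show ?thesis by (simp add: m_def)
qed

lemma exists_below_expectation:
  assumes "finite A" "measure_pmf.expectation (rsub A \<pi>) f < (1::real)"
  shows "\<exists>X\<subseteq>A. f X < 1"
proof (rule ccontr)
  assume "\<not> ?thesis"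
  then have "measure_pmf.expectation (rsub A \<pi>) (\<lambda>_. 1) \<le> measure_pmf.expectation (rsub A \<pi>) f"
    by (intro expectation_rsub_mono[OF assms(1)]) (auto simp: not_less)
  then show False using assms(2) by simp
qed

text \<open>The power (1+\<delta>)^|X \<inter> B| is expanded over the subsets of
  \<open>X \<inter> B\<close>, so only probabilities of containing a given set enter. Thanks to the
  additive slack \<tau> the bound is uniform in \<open>B\<close>, small sets included.\<close>

lemma prob_rsub_upper_tail:
  assumes "finite A" "B \<subseteq> A" "0 \<le> \<pi>" "\<pi> \<le> 1" "0 < \<delta>" "0 \<le> \<tau>"
  shows "measure_pmf.prob (rsub A \<pi>) {X. (1 + \<delta>) * \<pi> * real (card B) + \<tau> \<le> real (card (X \<inter> B))}
    \<le> exp (- \<tau> * ln (1 + \<delta>))"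
proof -
  define k where "k = (1 + \<delta>) * \<pi> * real (card B) + \<tau>"
  have finB: "finite B" using assms finite_subset by blast
  have ln_ge: "\<delta> \<le> (1 + \<delta>) * ln (1 + \<delta>)"
  proof -
    have "- ln (1 + \<delta>) \<le> 1 / (1 + \<delta>) - 1"
      using assms ln_le_minus_one[of "1 / (1 + \<delta>)"] by (simp add: ln_div)
    then have "(1 + \<delta>) * (- ln (1 + \<delta>)) \<le> (1 + \<delta>) * (1 / (1 + \<delta>) - 1)"
      using assms by (intro mult_left_mono) auto
    also have "\<dots> = - \<delta>" using assms by (simp add: right_diff_distrib)
    finally show ?thesis by simp
  qed
  have "measure_pmf.prob (rsub A \<pi>) {X. k \<le> real (card (X \<inter> B))}
     = measure_pmf.expectation (rsub A \<pi>) (\<lambda>X. of_bool (k \<le> real (card (X \<inter> B))))"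
  proof -
    have "(\<lambda>X. of_bool (k \<le> real (card (X \<inter> B))) :: real) = indicator {X. k \<le> real (card (X \<inter> B))}"
      by (auto simp: indicator_def)
    then show ?thesis by simp
  qed
  also have "\<dots> \<le> measure_pmf.expectation (rsub A \<pi>) (\<lambda>X. \<Sum>D\<in>Pow B. exp (- k * ln (1 + \<delta>)) * \<delta> ^ card D * of_bool (D \<subseteq> X))"
  proof (rule expectation_rsub_mono[OF assms(1)])
    fix X assume "X \<subseteq> A"
    have "(\<Sum>D\<in>Pow B. \<delta> ^ card D * of_bool (D \<subseteq> X)) = (\<Sum>D\<in>Pow (X \<inter> B). \<delta> ^ card D)"
      using finB by (intro sum.mono_neutral_cong_right) auto
    also have "\<dots> = (1 + \<delta>) ^ card (X \<inter> B)" using finB by (intro sum_Pow_power) auto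
    also have "\<dots> = exp (real (card (X \<inter> B)) * ln (1 + \<delta>))" using assms by (simp add: exp_of_nat_mult)
    finally have eq: "(\<Sum>D\<in>Pow B. exp (- k * ln (1 + \<delta>)) * \<delta> ^ card D * of_bool (D \<subseteq> X))
        = exp (- k * ln (1 + \<delta>)) * exp (real (card (X \<inter> B)) * ln (1 + \<delta>))"
      by (simp add: sum_distrib_left[symmetric] mult.assoc)
    show "of_bool (k \<le> real (card (X \<inter> B))) \<le> (\<Sum>D\<in>Pow B. exp (- k * ln (1 + \<delta>)) * \<delta> ^ card D * of_bool (D \<subseteq> X))"
      unfolding eq exp_add[symmetric]
      using assms mult_right_mono[of k "real (card (X \<inter> B))" "ln (1 + \<delta>)"] by auto
  qed
  also have "\<dots> = (\<Sum>D\<in>Pow B. exp (- k * ln (1 + \<delta>)) * \<delta> ^ card D * measure_pmf.expectation (rsub A \<pi>) (\<lambda>X. of_bool (D \<subseteq> X)))"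
    using assms(1) by (subst Bochner_Integration.integral_sum) (auto intro: integrable_rsub)
  also have "\<dots> = (\<Sum>D\<in>Pow B. exp (- k * ln (1 + \<delta>)) * (\<delta> * \<pi>) ^ card D)"
    using assms by (intro sum.cong) (auto simp: expectation_rsub_superset power_mult_distrib)
  also have "\<dots> = exp (- k * ln (1 + \<delta>)) * (1 + \<delta> * \<pi>) ^ card B"
    by (simp add: sum_distrib_left[symmetric] sum_Pow_power finB)
  also have "\<dots> \<le> exp (- k * ln (1 + \<delta>)) * exp (\<delta> * \<pi> * real (card B))"
    using assms by (intro mult_left_mono one_plus_power_le_exp) auto
  also have "\<dots> = exp (\<delta> * (\<pi> * real (card B)) - k * ln (1 + \<delta>))" by (simp add: exp_add[symmetric] mult.assoc)
  also have "\<dots> \<le> exp (- \<tau> * ln (1 + \<delta>))"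
    using mult_right_mono[OF ln_ge, of "\<pi> * real (card B)"] assms by (simp add: k_def algebra_simps)
  finally show ?thesis by (simp add: k_def)
qed

lemma ec_restrict: 
  assumes "finite B"
  shows "ec R Q (B \<inter> T0) = (\<Sum>b\<in>B. (\<Sum>a\<in>Q. of_bool (R a b)) * of_bool (b \<in> T0))"
proof -
  have "ec R Q (B \<inter> T0) = (\<Sum>b\<in>B \<inter> T0. \<Sum>a\<in>Q. of_bool (R a b))"
    unfolding ec_def by (rule sum.swap)
  also have "\<dots> = (\<Sum>b\<in>B. (\<Sum>a\<in>Q. of_bool (R a b)) * of_bool (b \<in> T0))"
    using assms by (intro sum.mono_neutral_cong_left) auto
  finally show ?thesis .
qed

text \<open>Restricting to a random subset of \<open>T\<close> of size about \<open>\<pi> |T|\<close> makes the first moment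
  computation affordable: the number of choices for the pair has to be beaten by the container bound.\<close>

lemma dense_pair_sampling:
  fixes Qs :: "'v \<Rightarrow> 'a set" and Rs :: "'v \<Rightarrow> 'b set"
  assumes fin: "finite S" "finite T" "finite X" "X \<noteq> {}" and d: "dense_pair R c \<epsilon> S T" and c: "0 < c" "c \<le> 1"
    and e: "0 < \<epsilon>" "2 * \<epsilon> \<le> \<epsilon>1\<^sup>2" and e1: "0 < \<epsilon>1" "\<epsilon>1 < 1" "40 / \<epsilon>1 \<le> ln (1 / \<epsilon>)"
    and \<pi>: "0 < \<pi>" "\<pi> \<le> 1" and big: "64 * ln (1 / \<epsilon>1) / \<epsilon>1 \<le> c * \<pi> * real (card T)"
    and m: "64 \<le> \<pi> * real (card T)"
    and Rs: "\<And>v. v \<in> X \<Longrightarrow> Rs v \<subseteq> T" "\<And>v. v \<in> X \<Longrightarrow> 128 \<le> \<pi> * real (card (Rs v))"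
  shows "\<exists>T0\<subseteq>T. \<pi> * real (card T) / 2 \<le> real (card T0) \<and> real (card T0) \<le> 2 * \<pi> * real (card T) \<and>
    dense_pair R (c / 16) \<epsilon>1 S T0 \<and> (\<exists>X0\<subseteq>X. real (card X) / 2 \<le> real (card X0) \<and>
      (\<forall>v\<in>X0. \<pi> * real (card (Rs v)) / 2 \<le> real (card (Rs v \<inter> T0)) \<and>
        ec R (Qs v) (Rs v \<inter> T0) \<le> 8 * \<pi> * ec R (Qs v) (Rs v)))"
proof -
  define m where "m = \<pi> * real (card T)"
  \<comment> \<open>Containers with the roles of \<open>S\<close> and \<open>T\<close> exchanged.
    The sample may have only \<pi>|T|/2 elements, hence \<rho> = \<epsilon>1/2; with K = 3 the
    condition \<open>4 * (K + 2) / \<rho>\<close> becomes 40/\<epsilon>1.\<close>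
  obtain \<W> where \<W>: "\<W> \<subseteq> Pow T" "(\<Sum>D\<in>\<W>. \<pi> ^ card D) \<le> exp (- 3 * \<pi> * real (card T))"
    and \<W>3: "\<And>Q T'. Q \<subseteq> T \<Longrightarrow> T' \<subseteq> S \<Longrightarrow> (\<epsilon>1 / 2) * \<pi> * real (card T) \<le> real (card Q) \<Longrightarrow>
       \<epsilon>1 * real (card S) \<le> real (card T') \<Longrightarrow>
       ec (\<lambda>b a. R a b) Q T' < c / 16 * real (card Q) * real (card T') \<Longrightarrow> \<exists>D\<in>\<W>. D \<subseteq> Q"
    using container_family[OF fin(2,1) dense_pair_swap_imp[OF d] c e e1(1,2), of "\<epsilon>1 / 2" 3 \<pi>] e1 \<pi> big
    by auto
  have finW: "finite \<W>" using \<W>(1) fin by (meson finite_Pow_iff finite_subset)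
  define a where "a X = 4 / m\<^sup>2 * (real (card (X \<inter> T)) - m)\<^sup>2" for X
  define b where "b X = (\<Sum>D\<in>\<W>. of_bool (D \<subseteq> X) :: real)" for X
  define t1 where "t1 v Y = 4 / (\<pi> * real (card (Rs v)))\<^sup>2 * (real (card (Y \<inter> Rs v)) - \<pi> * real (card (Rs v)))\<^sup>2" for v Y
  define t2 where "t2 v Y = 1 / (8 * \<pi> * ec R (Qs v) (Rs v)) * ec R (Qs v) (Rs v \<inter> Y)" for v Y
  \<comment> \<open>All requirements in one random variable of mean below 1. Its summands are
    nonnegative, so a sample with value below 1 meets them all: \<open>a\<close> controls the size,
    \<open>b\<close> excludes the containers, and the factor 2 / card X lets fewer than half of the
    vertices violate \<open>t1\<close> or \<open>t2\<close>.\<close>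
  define f where "f Y = a Y + (b Y + 2 / real (card X) * (\<Sum>v\<in>X. t1 v Y + t2 v Y))" for Y
  let ?E = "measure_pmf.expectation (rsub T \<pi>)"
  have Xpos: "0 < real (card X)" using fin by (simp add: card_gt_0_iff)
  have Ea: "?E a \<le> 1 / 16"
  proof -
    have "?E a = 4 / m\<^sup>2 * ?E (\<lambda>X. (real (card (X \<inter> T)) - m)\<^sup>2)" unfolding a_def by simp
    also have "\<dots> \<le> 4 / m\<^sup>2 * m"
      unfolding m_def using fin \<pi> by (intro mult_left_mono expectation_rsub_square) auto
    also have "\<dots> = 4 / m" by (simp add: power2_eq_square)
    also have "\<dots> \<le> 1 / 16" using m by (simp add: m_def field_simps)
    finally show ?thesis .
  qed
  have Eb: "?E b \<le> 1 / 4"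
  proof -
    have "?E b = (\<Sum>D\<in>\<W>. \<pi> ^ card D)"
      unfolding b_def using \<W>(1) fin \<pi>
      by (subst Bochner_Integration.integral_sum) (auto intro!: sum.cong expectation_rsub_superset integrable_rsub)
    also note \<W>(2)
    also have "exp (- 3 * \<pi> * real (card T)) \<le> exp (- 192)" using m by simp
    also have "\<dots> \<le> 1 / (1 + 192 :: real)"
      using exp_ge_add_one_self[of 192] by (simp add: exp_minus field_simps)
    finally show ?thesis by simp
  qed
  have Et1: "?E (t1 v) \<le> 1 / 32" if "v \<in> X" for v
  proof -
    define mv where "mv = \<pi> * real (card (Rs v))"
    have "?E (t1 v) = 4 / mv\<^sup>2 * ?E (\<lambda>Y. (real (card (Y \<inter> Rs v)) - mv)\<^sup>2)" unfolding t1_def mv_def by simp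
    also have "\<dots> \<le> 4 / mv\<^sup>2 * mv"
      unfolding mv_def using fin \<pi> Rs that by (intro mult_left_mono expectation_rsub_square) auto
    also have "\<dots> = 4 / mv" by (simp add: power2_eq_square)
    also have "\<dots> \<le> 1 / 32" using Rs(2)[OF that] by (simp add: mv_def field_simps)
    finally show ?thesis .
  qed
  have Et2: "?E (t2 v) \<le> 1 / 8" if "v \<in> X" for v
  proof -
    have finR: "finite (Rs v)" using Rs(1)[OF that] fin finite_subset by blast
    have "?E (\<lambda>Y. ec R (Qs v) (Rs v \<inter> Y)) = \<pi> * (\<Sum>b\<in>Rs v. \<Sum>a\<in>Qs v. of_bool (R a b))"
      unfolding ec_restrict[OF finR] using fin Rs(1)[OF that] \<pi> by (intro expectation_rsub_card) auto
    also have "(\<Sum>b\<in>Rs v. \<Sum>a\<in>Qs v. of_bool (R a b)) = ec R (Qs v) (Rs v)"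
      unfolding ec_def by (rule sum.swap)
    finally have "?E (t2 v) = 1 / (8 * \<pi> * ec R (Qs v) (Rs v)) * (\<pi> * ec R (Qs v) (Rs v))"
      unfolding t2_def by simp
    also have "\<dots> \<le> 1 / 8" using \<pi> by (simp add: divide_simps)
    finally show ?thesis .
  qed
  have "?E f = ?E a + (?E b + 2 / real (card X) * (\<Sum>v\<in>X. ?E (t1 v) + ?E (t2 v)))"
    unfolding f_def using fin
    by (simp add: Bochner_Integration.integral_add Bochner_Integration.integral_sum integrable_rsub)
  also have "\<dots> \<le> 1 / 16 + (1 / 4 + 2 / real (card X) * (\<Sum>v\<in>X. 1 / 32 + 1 / 8))"
    using Ea Eb Et1 Et2 by (intro add_mono mult_left_mono sum_mono) auto
  also have "\<dots> < 1" using Xpos by simp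
  finally obtain T0 where T0: "T0 \<subseteq> T" "f T0 < 1"
    using exists_below_expectation[OF fin(2)] by blast
  have nn: "0 \<le> a T0" "0 \<le> b T0" "\<And>v. 0 \<le> t1 v T0" "\<And>v. 0 \<le> t2 v T0"
    unfolding a_def b_def t1_def t2_def using \<pi> ec_nonneg by (auto intro!: sum_nonneg mult_nonneg_nonneg divide_nonneg_nonneg)
  have snn: "0 \<le> 2 / real (card X) * (\<Sum>v\<in>X. t1 v T0 + t2 v T0)"
    using nn by (intro mult_nonneg_nonneg sum_nonneg add_nonneg_nonneg) auto
  have sq: "\<bar>x - y\<bar> \<le> y / 2" if "4 / y\<^sup>2 * (x - y)\<^sup>2 < 1" "0 < y" for x y :: real
  proof -
    have "4 * (x - y)\<^sup>2 \<le> y\<^sup>2" using that by (simp add: field_simps)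
    then have "(2 * (x - y))\<^sup>2 \<le> y\<^sup>2" unfolding power_mult_distrib by simp
    then have "\<bar>2 * (x - y)\<bar> \<le> \<bar>y\<bar>" by (rule abs_le_square_iff[THEN iffD2])
    then have "2 * \<bar>x - y\<bar> \<le> \<bar>y\<bar>" unfolding abs_mult by simp
    then show ?thesis using that(2) by simp
  qed
  have mpos: "0 < m" using m by (simp add: m_def)
  have TT: "T0 \<inter> T = T0" using T0 by auto
  have "a T0 < 1" using T0(2) nn snn unfolding f_def by linarith
  then have card0: "\<bar>real (card T0) - m\<bar> \<le> m / 2" unfolding a_def TT by (rule sq[OF _ mpos])
  have lo: "m / 2 \<le> real (card T0)" and hi: "real (card T0) \<le> 2 * m"
    using card0 mpos unfolding abs_le_iff by linarith+
  have "b T0 < 1" using T0(2) nn snn unfolding f_def by linarith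
  have noD: "\<not> D \<subseteq> T0" if "D \<in> \<W>" for D
  proof
    assume "D \<subseteq> T0"
    then have "1 \<le> b T0"
      unfolding b_def using member_le_sum[OF that, of "\<lambda>D. of_bool (D \<subseteq> T0) :: real"] finW by auto
    with \<open>b T0 < 1\<close> show False by simp
  qed
  have dense: "dense_pair R (c / 16) \<epsilon>1 S T0"
    unfolding dense_pair_def
  proof (intro allI impI)
    fix S' T' assume *: "S' \<subseteq> S" "T' \<subseteq> T0" "\<epsilon>1 * real (card S) \<le> real (card S')" "\<epsilon>1 * real (card T0) \<le> real (card T')"
    show "c / 16 * real (card S') * real (card T') \<le> ec R S' T'"
    proof (rule ccontr)
      assume "\<not> ?thesis"
      then have lt: "ec (\<lambda>b a. R a b) T' S' < c / 16 * real (card T') * real (card S')"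
        unfolding ec_swap[of R S' T'] by (simp add: mult_ac)
      have "\<epsilon>1 * (m / 2) \<le> \<epsilon>1 * real (card T0)" using lo e1 by (intro mult_left_mono) auto
      then have "(\<epsilon>1 / 2) * \<pi> * real (card T) \<le> real (card T')" using *(4) by (simp add: m_def)
      then obtain D where "D \<in> \<W>" "D \<subseteq> T'" using \<W>3[of T' S'] * T0(1) lt by blast
      then show False using noD *(2) by blast
    qed
  qed
  define X0 where "X0 = {v\<in>X. t1 v T0 + t2 v T0 < 1}"
  have "2 / real (card X) * (\<Sum>v\<in>X. t1 v T0 + t2 v T0) < 1" using T0(2) nn unfolding f_def by linarith
  then have "(\<Sum>v\<in>X. t1 v T0 + t2 v T0) < real (card X) / 2" using Xpos by (simp add: field_simps)
  moreover have "real (card (X - X0)) \<le> (\<Sum>v\<in>X. t1 v T0 + t2 v T0)"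
  proof -
    have "real (card (X - X0)) = (\<Sum>v\<in>X - X0. 1)" by simp
    also have "\<dots> \<le> (\<Sum>v\<in>X - X0. t1 v T0 + t2 v T0)" by (intro sum_mono) (auto simp: X0_def)
    also have "\<dots> \<le> (\<Sum>v\<in>X. t1 v T0 + t2 v T0)"
      using fin nn by (intro sum_mono2 add_nonneg_nonneg) auto
    finally show ?thesis .
  qed
  moreover have "real (card X) = real (card X0) + real (card (X - X0))"
  proof -
    have "X0 \<subseteq> X" by (auto simp: X0_def)
    then show ?thesis using card_mono[OF fin(3), of X0] fin finite_subset[of X0 X]
      by (simp add: card_Diff_subset of_nat_diff)
  qed
  ultimately have X0: "real (card X) / 2 \<le> real (card X0)" by linarith
  have X0prop: "\<pi> * real (card (Rs v)) / 2 \<le> real (card (Rs v \<inter> T0)) \<and>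
        ec R (Qs v) (Rs v \<inter> T0) \<le> 8 * \<pi> * ec R (Qs v) (Rs v)" if "v \<in> X0" for v
  proof
    have v: "v \<in> X" "t1 v T0 + t2 v T0 < 1" using that by (auto simp: X0_def)
    have "t1 v T0 < 1" using v nn(4)[of v] by linarith
    then have "\<bar>real (card (T0 \<inter> Rs v)) - \<pi> * real (card (Rs v))\<bar> \<le> \<pi> * real (card (Rs v)) / 2"
      unfolding t1_def by (rule sq) (use Rs(2)[OF v(1)] in linarith)
    then have "\<pi> * real (card (Rs v)) - \<pi> * real (card (Rs v)) / 2 \<le> real (card (T0 \<inter> Rs v))" by linarith
    then show "\<pi> * real (card (Rs v)) / 2 \<le> real (card (Rs v \<inter> T0))" by (simp add: Int_commute)
    have t2: "t2 v T0 < 1" using v nn(3)[of v] by linarith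
    have finR: "finite (Rs v)" using Rs(1)[OF v(1)] fin finite_subset by blast
    show "ec R (Qs v) (Rs v \<inter> T0) \<le> 8 * \<pi> * ec R (Qs v) (Rs v)"
    proof (cases "ec R (Qs v) (Rs v) = 0")
      case True
      have "finite (Qs v) \<or> ec R (Qs v) (Rs v \<inter> T0) = 0" by (cases "finite (Qs v)") (auto simp: ec_def)
      then have "ec R (Qs v) (Rs v \<inter> T0) \<le> ec R (Qs v) (Rs v)"
        using ec_mono[of "Qs v" "Rs v" "Qs v" "Rs v \<inter> T0" R] finR ec_nonneg[of R "Qs v" "Rs v"] by auto
      then show ?thesis using True by simp
    next
      case False
      then have "0 < 8 * \<pi> * ec R (Qs v) (Rs v)" using ec_nonneg[of R "Qs v" "Rs v"] \<pi> by simp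
      then show ?thesis using t2 unfolding t2_def by (simp add: divide_simps split: if_splits)
    qed
  qed
  show ?thesis
  proof (intro exI[of _ T0] conjI exI[of _ X0] ballI)
    show "dense_pair R (c / 16) \<epsilon>1 S T0" by (fact dense)
    show "X0 \<subseteq> X" by (auto simp: X0_def)
  qed (use T0 lo hi X0 X0prop m_def in auto)
qed

section \<open>First moment bounds over the edges of the random graph\<close>

definition adj :: "'a set set \<Rightarrow> 'a \<Rightarrow> 'a \<Rightarrow> bool" where
  "adj E u v \<longleftrightarrow> {u, v} \<in> E"

lemma adj_sym: "adj E u v \<longleftrightarrow> adj E v u"
  by (simp add: adj_def insert_commute)

text \<open>The containers at the vertices of \<open>X\<close> depend on the bipartite graph
  \<open>P\<close> between \<open>S\<close> and \<open>T\<close>. In place of conditioning, all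
  \<open>P\<close> are summed with weight \<open>p ^ card P\<close>, at a total cost of
  exp(p|S||T|). The vertex pairs used by \<open>P\<close> and by the different vertices of
  \<open>X\<close> are disjoint, so the weights multiply. Since \<open>P\<close> need only be
  contained in the random graph, subgraphs are covered as well.\<close>

lemma first_moment:
  fixes V :: "'a set"
  assumes V: "finite V" and sub: "S \<subseteq> V" "T \<subseteq> V" "X \<subseteq> V"
    and disj: "S \<inter> T = {}" "S \<inter> X = {}" "T \<inter> X = {}" and p: "0 \<le> p" "p \<le> 1" and w: "0 \<le> w"
    and \<P>: "\<P> \<subseteq> Pow (S \<times> T)"
    and \<W>: "\<And>P. P \<in> \<P> \<Longrightarrow> \<W> P \<subseteq> Pow (S \<union> T)" "\<And>P. P \<in> \<P> \<Longrightarrow> (\<Sum>D\<in>\<W> P. p ^ card D) \<le> w"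
  shows "measure_pmf.prob (rsub (nsets V 2) p)
      {E. \<exists>P\<in>\<P>. (\<forall>(a, b)\<in>P. {a, b} \<in> E) \<and> (\<forall>v\<in>X. \<exists>D\<in>\<W> P. \<forall>u\<in>D. {v, u} \<in> E)}
    \<le> exp (p * real (card S) * real (card T)) * w ^ card X"
proof -
  define e where "e = (\<lambda>x :: 'a \<times> 'a. {fst x, snd x})"
  define I where "I = (SIGMA P:\<P>. X \<rightarrow>\<^sub>E \<W> P)"
  define J where "J x = fst x \<union> Sigma X (snd x)" for x :: "('a \<times> 'a) set \<times> ('a \<Rightarrow> 'a set)"
  define \<E> where "\<E> = (\<lambda>x. e ` J x) ` I"
  have fin: "finite S" "finite T" "finite X" using sub by (auto intro: finite_subset[OF _ V])
  have fP: "finite \<P>" using fin \<P> by (meson finite_Pow_iff finite_SigmaI finite_subset)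
  have fW: "finite (\<W> P)" if "P \<in> \<P>" for P
    using fin \<W>(1)[OF that] by (meson finite_Pow_iff finite_UnI finite_subset)
  have finI: "finite I" unfolding I_def using fP fW fin by (intro finite_SigmaI finite_PiE) auto
  have JU: "J x \<subseteq> S \<times> T \<union> X \<times> (S \<union> T)" if "x \<in> I" for x
    using that \<P> \<W>(1) unfolding I_def J_def by (fastforce simp: PiE_iff)
  have inj: "inj_on e (S \<times> T \<union> X \<times> (S \<union> T))"
    using disj unfolding inj_on_def e_def by (auto simp: doubleton_eq_iff)
  have E2: "e ` (S \<times> T \<union> X \<times> (S \<union> T)) \<subseteq> nsets V 2"
    using disj sub unfolding e_def nsets_def by (auto simp: card_insert_if)
  have \<E>sub: "\<E> \<subseteq> Pow (nsets V 2)" using JU E2 unfolding \<E>_def by blast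
  have "measure_pmf.prob (rsub (nsets V 2) p)
      {E. \<exists>P\<in>\<P>. (\<forall>(a, b)\<in>P. {a, b} \<in> E) \<and> (\<forall>v\<in>X. \<exists>D\<in>\<W> P. \<forall>u\<in>D. {v, u} \<in> E)}
    \<le> measure_pmf.prob (rsub (nsets V 2) p) {E. \<exists>D\<in>\<E>. D \<subseteq> E}"
  proof (intro measure_pmf.finite_measure_mono subsetI)
    fix E assume "E \<in> {E. \<exists>P\<in>\<P>. (\<forall>(a, b)\<in>P. {a, b} \<in> E) \<and> (\<forall>v\<in>X. \<exists>D\<in>\<W> P. \<forall>u\<in>D. {v, u} \<in> E)}"
    then obtain P where P: "P \<in> \<P>" "\<forall>(a, b)\<in>P. {a, b} \<in> E" "\<forall>v\<in>X. \<exists>D\<in>\<W> P. \<forall>u\<in>D. {v, u} \<in> E" by auto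
    from P(3) obtain D where D: "\<And>v. v \<in> X \<Longrightarrow> D v \<in> \<W> P \<and> (\<forall>u\<in>D v. {v, u} \<in> E)" by metis
    define x where "x = (P, restrict D X)"
    have "x \<in> I" using P(1) D by (auto simp: x_def I_def)
    moreover have "e ` J x \<subseteq> E" using P(2) D by (auto simp: x_def J_def e_def)
    ultimately show "E \<in> {E. \<exists>D\<in>\<E>. D \<subseteq> E}" unfolding \<E>_def by blast
  qed simp
  also have "\<dots> \<le> (\<Sum>D\<in>\<E>. p ^ card D)"
    using V p \<E>sub by (intro prob_rsub_family) (auto simp: finite_imp_finite_nsets)
  also have "\<dots> \<le> (\<Sum>x\<in>I. p ^ card (e ` J x))"
    unfolding \<E>_def using p finI sum_image_le[of I "\<lambda>D. p ^ card D" "\<lambda>x. e ` J x"] by (simp add: o_def)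
  also have "\<dots> = (\<Sum>x\<in>I. p ^ card (fst x) * (\<Prod>v\<in>X. p ^ card (snd x v)))"
  proof (rule sum.cong[OF refl])
    fix x assume x: "x \<in> I"
    have "card (e ` J x) = card (J x)"
      using inj_on_subset[OF inj JU[OF x]] by (rule card_image)
    also have "\<dots> = card (fst x) + card (Sigma X (snd x))"
    proof -
      have "fst x \<in> \<P>" using x by (auto simp: I_def)
      then have f1: "fst x \<subseteq> S \<times> T" using \<P> by blast
      have f2: "Sigma X (snd x) \<subseteq> X \<times> (S \<union> T)" using x \<W>(1) by (fastforce simp: I_def PiE_iff)
      have "finite (fst x)" "finite (Sigma X (snd x))"
        using f1 f2 fin by (meson finite_SigmaI finite_UnI finite_subset)+
      moreover have "fst x \<inter> Sigma X (snd x) = {}" using f1 f2 disj by auto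
      ultimately show ?thesis unfolding J_def by (rule card_Un_disjoint)
    qed
    also have "card (Sigma X (snd x)) = (\<Sum>v\<in>X. card (snd x v))"
    proof -
      have "snd x v \<subseteq> S \<union> T" if "v \<in> X" for v using x \<W>(1) that by (fastforce simp: I_def PiE_iff)
      then have "\<forall>v\<in>X. finite (snd x v)" using fin by (meson finite_UnI finite_subset)
      then show ?thesis using fin by simp
    qed
    finally show "p ^ card (e ` J x) = p ^ card (fst x) * (\<Prod>v\<in>X. p ^ card (snd x v))"
      by (simp add: power_add power_sum)
  qed
  also have "\<dots> = (\<Sum>P\<in>\<P>. \<Sum>D\<in>X \<rightarrow>\<^sub>E \<W> P. p ^ card P * (\<Prod>v\<in>X. p ^ card (D v)))"
    unfolding I_def using fP fW fin by (subst sum.Sigma) (auto simp: case_prod_beta finite_PiE)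
  also have "\<dots> = (\<Sum>P\<in>\<P>. p ^ card P * (\<Sum>D\<in>\<W> P. p ^ card D) ^ card X)"
  proof (rule sum.cong[OF refl])
    fix P assume P: "P \<in> \<P>"
    have "(\<Sum>D\<in>X \<rightarrow>\<^sub>E \<W> P. \<Prod>v\<in>X. p ^ card (D v)) = (\<Prod>v\<in>X. \<Sum>D\<in>\<W> P. p ^ card D)"
      using fin fW[OF P] by (intro prod_sum_PiE[symmetric]) auto
    then show "(\<Sum>D\<in>X \<rightarrow>\<^sub>E \<W> P. p ^ card P * (\<Prod>v\<in>X. p ^ card (D v))) = p ^ card P * (\<Sum>D\<in>\<W> P. p ^ card D) ^ card X"
      by (simp add: sum_distrib_left[symmetric])
  qed
  also have "\<dots> \<le> (\<Sum>P\<in>\<P>. p ^ card P * w ^ card X)"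
    using \<W>(2) p by (intro sum_mono mult_left_mono power_mono sum_nonneg) auto
  also have "\<dots> \<le> (\<Sum>P\<in>Pow (S \<times> T). p ^ card P * w ^ card X)"
    using \<P> fin p w by (intro sum_mono2) auto
  also have "\<dots> = (1 + p) ^ card (S \<times> T) * w ^ card X"
    using fin by (simp add: sum_distrib_right[symmetric] sum_Pow_power)
  also have "\<dots> \<le> exp (p * real (card (S \<times> T))) * w ^ card X"
    using p w by (intro mult_right_mono one_plus_power_le_exp) auto
  finally show ?thesis using fin by (simp add: card_cartesian_product mult.assoc)
qed

text \<open>With a factor 1/n^2 for each vertex, the sum over all subsets of an n-set is (1 +
  1/n^2)^n \<le> exp(1/n). Requiring X to be nonempty replaces one such factor by exp(1/n) - 1,
  which tends to 0.\<close>

lemma union_bound_triples: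
  fixes V :: "'a set"
  assumes V: "finite V" "V \<noteq> {}" and \<C>: "\<And>X S T. (X, S, T) \<in> \<C> \<Longrightarrow> X \<subseteq> V \<and> S \<subseteq> V \<and> T \<subseteq> V \<and> X \<noteq> {}"
    and pr: "\<And>X S T. (X, S, T) \<in> \<C> \<Longrightarrow> measure_pmf.prob M (A X S T) \<le> (1 / (real (card V))\<^sup>2) ^ (card X + card S + card T)"
  shows "measure_pmf.prob M {E. \<exists>X S T. (X, S, T) \<in> \<C> \<and> E \<in> A X S T} \<le> exp (3 / real (card V)) - 1"
proof -
  define n where "n = real (card V)"
  define \<theta> where "\<theta> = 1 / n\<^sup>2"
  have n: "0 < n" using V by (simp add: n_def card_gt_0_iff)
  have th: "0 \<le> \<theta>" by (simp add: \<theta>_def)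
  have sub: "\<C> \<subseteq> (Pow V - {{}}) \<times> Pow V \<times> Pow V"
  proof
    fix t assume "t \<in> \<C>"
    then show "t \<in> (Pow V - {{}}) \<times> Pow V \<times> Pow V" using \<C> by (cases t) blast
  qed
  have finC: "finite \<C>" by (rule finite_subset[OF sub]) (use V in auto)
  have le: "(\<Sum>Y\<in>Pow V. \<theta> ^ card Y) \<le> exp (1 / n)"
  proof -
    have "(\<Sum>Y\<in>Pow V. \<theta> ^ card Y) = (1 + \<theta>) ^ card V" by (rule sum_Pow_power[OF V(1)])
    also have "\<dots> \<le> exp (\<theta> * n)" unfolding n_def by (rule one_plus_power_le_exp[OF th])
    also have "\<theta> * n = 1 / n" using n by (simp add: \<theta>_def power2_eq_square)
    finally show ?thesis .
  qed
  have le1: "(\<Sum>Y\<in>Pow V - {{}}. \<theta> ^ card Y) \<le> exp (1 / n) - 1"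
    using le V by (simp add: sum_diff)
  have "measure_pmf.prob M {E. \<exists>X S T. (X, S, T) \<in> \<C> \<and> E \<in> A X S T}
    = measure_pmf.prob M (\<Union>t\<in>\<C>. A (fst t) (fst (snd t)) (snd (snd t)))"
    by (intro arg_cong[where f = "measure_pmf.prob _"]) force
  also have "\<dots> \<le> (\<Sum>t\<in>\<C>. measure_pmf.prob M (A (fst t) (fst (snd t)) (snd (snd t))))"
    using finC by (intro measure_pmf.finite_measure_subadditive_finite) auto
  also have "\<dots> \<le> (\<Sum>t\<in>\<C>. \<theta> ^ card (fst t) * (\<theta> ^ card (fst (snd t)) * \<theta> ^ card (snd (snd t))))"
    using pr by (intro sum_mono) (auto simp: \<theta>_def n_def power_add mult.assoc)
  also have "\<dots> \<le> (\<Sum>t\<in>(Pow V - {{}}) \<times> Pow V \<times> Pow V. \<theta> ^ card (fst t) * (\<theta> ^ card (fst (snd t)) * \<theta> ^ card (snd (snd t))))"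
    using sub V th by (intro sum_mono2) auto
  also have "\<dots> = (\<Sum>X\<in>Pow V - {{}}. \<theta> ^ card X) * ((\<Sum>Y\<in>Pow V. \<theta> ^ card Y) * (\<Sum>Y\<in>Pow V. \<theta> ^ card Y))"
    by (simp add: sum_product sum.cartesian_product case_prod_beta)
  also have "\<dots> \<le> (exp (1 / n) - 1) * (exp (1 / n) * exp (1 / n))"
    using le le1 th n by (intro mult_mono sum_nonneg mult_nonneg_nonneg) auto
  also have "\<dots> = exp (3 / n) - exp (2 / n)" by (simp add: algebra_simps exp_add[symmetric])
  also have "\<dots> \<le> exp (3 / n) - 1" using n by simp
  finally show ?thesis by (simp add: n_def)
qed

lemma dense_pair_cong:
  assumes "\<And>a b. a \<in> A \<Longrightarrow> b \<in> B \<Longrightarrow> R a b \<longleftrightarrow> R' a b"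
  shows "dense_pair R c \<epsilon> A B \<longleftrightarrow> dense_pair R' c \<epsilon> A B"
proof -
  have "ec R A' B' = ec R' A' B'" if "A' \<subseteq> A" "B' \<subseteq> B" for A' B'
    unfolding ec_def using assms that by (intro sum.cong) auto
  then show ?thesis unfolding dense_pair_def by auto
qed

text \<open>Two rounds. If \<open>Q\<close> contains no certificate of being sparse towards a large
  subset of \<open>T\<close>, then (Q, T) is itself a dense pair, and containers inside
  \<open>T\<close> exist for this \<open>Q\<close>. A certificate of the second kind contains all of
  \<open>Q\<close>, which costs exp(\<pi>|S|) in the sum; the bound is therefore useful for classes
  of comparable size.\<close>

lemma container_family_two_sided:
  fixes R :: "'a \<Rightarrow> 'a \<Rightarrow> bool"
  assumes fin: "finite S" "finite T" and disj: "S \<inter> T = {}" and d: "dense_pair R c \<epsilon> S T" and c: "0 < c" "c \<le> 1"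
    and e: "0 < \<epsilon>" "2 * \<epsilon> \<le> \<epsilon>3\<^sup>2" and e3: "0 < \<epsilon>3" "8 * \<epsilon>3 \<le> 1"
    and \<rho>: "0 < \<rho>" "4 * (K + 2) / (\<epsilon>3 * \<rho>) \<le> ln (1 / \<epsilon>)" "4 * (K + 2) / \<rho> \<le> ln (1 / \<epsilon>3)" and \<pi>: "0 \<le> \<pi>"
    and big: "32 * ln (1 / \<epsilon>3) / (\<epsilon>3 * \<rho>) \<le> c * \<pi> * real (card S)" "32 * ln 2 / \<rho> \<le> c / 16 * \<pi> * real (card T)"
  shows "\<exists>\<W>\<subseteq>Pow (S \<union> T). (\<Sum>D\<in>\<W>. \<pi> ^ card D) \<le> exp (- K * \<pi> * real (card S)) + exp (\<pi> * real (card S) - K * \<pi> * real (card T)) \<and>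
    (\<forall>Q T'. Q \<subseteq> S \<longrightarrow> T' \<subseteq> T \<longrightarrow> \<rho> * \<pi> * real (card S) \<le> real (card Q) \<longrightarrow>
       \<rho> * \<pi> * real (card T) \<le> real (card T') \<longrightarrow>
       ec R Q T' < c / 256 * real (card Q) * real (card T') \<longrightarrow> (\<exists>D\<in>\<W>. D \<subseteq> Q \<union> T'))"
proof -
  have e3': "\<epsilon>3 < 1" using e3 by simp
  have er: "0 < \<epsilon>3 * \<rho>" using e3 \<rho> by simp
  obtain \<W>1 where W1: "\<W>1 \<subseteq> Pow S" "(\<Sum>D\<in>\<W>1. \<pi> ^ card D) \<le> exp (- K * \<pi> * real (card S))"
    "\<forall>Q T'. Q \<subseteq> S \<longrightarrow> T' \<subseteq> T \<longrightarrow> (\<epsilon>3 * \<rho>) * \<pi> * real (card S) \<le> real (card Q) \<longrightarrow>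
       \<epsilon>3 * real (card T) \<le> real (card T') \<longrightarrow>
       ec R Q T' < c / 16 * real (card Q) * real (card T') \<longrightarrow> (\<exists>D\<in>\<W>1. D \<subseteq> Q)"
    using container_family[OF fin d c e e3(1) e3' er \<rho>(2) \<pi> big(1)] by blast
  define \<Q> where "\<Q> = {Q. Q \<subseteq> S \<and> dense_pair (\<lambda>b a. R a b) (c / 16) \<epsilon>3 T Q}"
  have "\<exists>\<W>. \<W> \<subseteq> Pow T \<and> (\<Sum>D\<in>\<W>. \<pi> ^ card D) \<le> exp (- K * \<pi> * real (card T)) \<and>
    (\<forall>T' Q'. T' \<subseteq> T \<longrightarrow> Q' \<subseteq> Q \<longrightarrow> \<rho> * \<pi> * real (card T) \<le> real (card T') \<longrightarrow>
       1 / 2 * real (card Q) \<le> real (card Q') \<longrightarrow>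
       ec (\<lambda>b a. R a b) T' Q' < c / 16 / 16 * real (card T') * real (card Q') \<longrightarrow> (\<exists>D\<in>\<W>. D \<subseteq> T'))" if "Q \<in> \<Q>" for Q
  proof -
    have Q: "finite Q" "dense_pair (\<lambda>b a. R a b) (c / 16) \<epsilon>3 T Q"
      using that fin by (auto simp: \<Q>_def intro: finite_subset)
    \<comment> \<open>In the second round \<open>Q\<close> is fixed and used as a whole, so the
      proportion 1/2 on its side suffices.\<close>
    show ?thesis
      using container_family[OF fin(2) Q, of "1 / 2" \<rho> K \<pi>] c e3 \<rho> \<pi> big by (simp add: power2_eq_square)
  qed
  then obtain W2 where W2: "\<And>Q. Q \<in> \<Q> \<Longrightarrow> W2 Q \<subseteq> Pow T" "\<And>Q. Q \<in> \<Q> \<Longrightarrow> (\<Sum>D\<in>W2 Q. \<pi> ^ card D) \<le> exp (- K * \<pi> * real (card T))"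
    "\<And>Q T' Q'. Q \<in> \<Q> \<Longrightarrow> T' \<subseteq> T \<Longrightarrow> Q' \<subseteq> Q \<Longrightarrow> \<rho> * \<pi> * real (card T) \<le> real (card T') \<Longrightarrow>
       1 / 2 * real (card Q) \<le> real (card Q') \<Longrightarrow>
       ec (\<lambda>b a. R a b) T' Q' < c / 16 / 16 * real (card T') * real (card Q') \<Longrightarrow> (\<exists>D\<in>W2 Q. D \<subseteq> T')"
    by metis
  define I where "I = Sigma \<Q> W2"
  define \<W>2 where "\<W>2 = (\<lambda>x. fst x \<union> snd x) ` I"
  have finQ: "finite \<Q>" by (rule finite_subset[of _ "Pow S"]) (use fin in \<open>auto simp: \<Q>_def\<close>)
  have finW2: "finite (W2 Q)" if "Q \<in> \<Q>" for Q
    using W2(1)[OF that] fin by (meson finite_Pow_iff finite_subset)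
  have finI: "finite I" unfolding I_def using finQ finW2 by blast
  have "finite \<W>1" using W1(1) fin by (meson finite_Pow_iff finite_subset)
  moreover have "finite \<W>2" unfolding \<W>2_def using finI by simp
  ultimately have "(\<Sum>D\<in>\<W>1 \<union> \<W>2. \<pi> ^ card D) \<le> (\<Sum>D\<in>\<W>1. \<pi> ^ card D) + (\<Sum>D\<in>\<W>2. \<pi> ^ card D)"
    using sum.union_inter[of \<W>1 \<W>2 "\<lambda>D. \<pi> ^ card D"] sum_nonneg[of "\<W>1 \<inter> \<W>2" "\<lambda>D. \<pi> ^ card D"] \<pi> by simp
  moreover have "(\<Sum>D\<in>\<W>2. \<pi> ^ card D) \<le> exp (\<pi> * real (card S) - K * \<pi> * real (card T))"
  proof -
    have "(\<Sum>D\<in>\<W>2. \<pi> ^ card D) \<le> (\<Sum>x\<in>I. \<pi> ^ card (fst x \<union> snd x))"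
      unfolding \<W>2_def using \<pi> finI sum_image_le[of I "\<lambda>D. \<pi> ^ card D" "\<lambda>x. fst x \<union> snd x"] by (simp add: o_def)
    also have "\<dots> = (\<Sum>x\<in>I. \<pi> ^ card (fst x) * \<pi> ^ card (snd x))"
    proof (rule sum.cong[OF refl])
      fix x assume "x \<in> I"
      then have "fst x \<in> \<Q>" "snd x \<in> W2 (fst x)" by (auto simp: I_def)
      then have x: "fst x \<subseteq> S" "snd x \<subseteq> T" using W2(1) by (auto simp: \<Q>_def)
      then have "finite (fst x)" "finite (snd x)" "fst x \<inter> snd x = {}"
        using fin disj by (auto intro: finite_subset)
      then show "\<pi> ^ card (fst x \<union> snd x) = \<pi> ^ card (fst x) * \<pi> ^ card (snd x)"
        by (simp add: card_Un_disjoint power_add)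
    qed
    also have "\<dots> = (\<Sum>Q\<in>\<Q>. \<pi> ^ card Q * (\<Sum>D\<in>W2 Q. \<pi> ^ card D))"
      unfolding I_def sum_distrib_left using finQ finW2 by (subst sum.Sigma) (auto simp: case_prod_beta)
    also have "\<dots> \<le> (\<Sum>Q\<in>\<Q>. \<pi> ^ card Q * exp (- K * \<pi> * real (card T)))"
      using W2(2) \<pi> by (intro sum_mono mult_left_mono) auto
    also have "\<dots> \<le> (\<Sum>Q\<in>Pow S. \<pi> ^ card Q * exp (- K * \<pi> * real (card T)))"
      using fin \<pi> by (intro sum_mono2) (auto simp: \<Q>_def)
    also have "\<dots> = (1 + \<pi>) ^ card S * exp (- K * \<pi> * real (card T))"
      by (simp add: sum_distrib_right[symmetric] sum_Pow_power fin)
    also have "\<dots> \<le> exp (\<pi> * real (card S)) * exp (- K * \<pi> * real (card T))"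
      using \<pi> by (intro mult_right_mono one_plus_power_le_exp) auto
    finally show ?thesis by (simp add: exp_add[symmetric])
  qed
  ultimately have sum: "(\<Sum>D\<in>\<W>1 \<union> \<W>2. \<pi> ^ card D) \<le> exp (- K * \<pi> * real (card S)) + exp (\<pi> * real (card S) - K * \<pi> * real (card T))"
    using W1(2) by linarith
  have main: "\<exists>D\<in>\<W>1 \<union> \<W>2. D \<subseteq> Q \<union> T'" if Q: "Q \<subseteq> S" "\<rho> * \<pi> * real (card S) \<le> real (card Q)"
    and T': "T' \<subseteq> T" "\<rho> * \<pi> * real (card T) \<le> real (card T')"
    and sp: "ec R Q T' < c / 256 * real (card Q) * real (card T')" for Q T'
  proof (cases "\<exists>D\<in>\<W>1. D \<subseteq> Q")
    case False
    have "dense_pair R (c / 16) \<epsilon>3 Q T"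
      unfolding dense_pair_def
    proof (intro allI impI)
      fix Q' T'' assume *: "Q' \<subseteq> Q" "T'' \<subseteq> T" "\<epsilon>3 * real (card Q) \<le> real (card Q')" "\<epsilon>3 * real (card T) \<le> real (card T'')"
      have "\<epsilon>3 * (\<rho> * \<pi> * real (card S)) \<le> \<epsilon>3 * real (card Q)" using Q(2) e3 by (intro mult_left_mono) auto
      then have "(\<epsilon>3 * \<rho>) * \<pi> * real (card S) \<le> real (card Q')" using *(3) by (simp add: mult.assoc)
      then show "c / 16 * real (card Q') * real (card T'') \<le> ec R Q' T''"
        using W1(3) * Q(1) False by (meson dual_order.trans not_less)
    qed
    then have "Q \<in> \<Q>" using Q(1) dense_pair_swap_imp unfolding \<Q>_def by auto
    moreover have "ec (\<lambda>b a. R a b) T' Q < c / 16 / 16 * real (card T') * real (card Q)"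
      using sp unfolding ec_swap[of R Q T'] by (simp add: mult_ac)
    ultimately have "\<exists>D\<in>W2 Q. D \<subseteq> T'" using T' by (intro W2(3)[of Q T' Q]) simp_all
    then obtain D where "D \<in> W2 Q" "D \<subseteq> T'" by blast
    then have "(Q, D) \<in> I" "Q \<union> D \<subseteq> Q \<union> T'" using \<open>Q \<in> \<Q>\<close> by (auto simp: I_def)
    then show ?thesis unfolding \<W>2_def by (intro bexI[of _ "Q \<union> D"]) (auto intro!: image_eqI[of _ _ "(Q, D)"])
  qed blast
  have "\<W>1 \<union> \<W>2 \<subseteq> Pow (S \<union> T)"
  proof
    fix D assume "D \<in> \<W>1 \<union> \<W>2"
    then consider "D \<in> \<W>1" | Q D' where "Q \<in> \<Q>" "D' \<in> W2 Q" "D = Q \<union> D'"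
      unfolding \<W>2_def I_def by auto
    then show "D \<in> Pow (S \<union> T)"
      using W1(1) W2(1) by cases (auto simp: \<Q>_def)
  qed
  with sum main show ?thesis by (intro exI[of _ "\<W>1 \<union> \<W>2"] conjI allI impI) simp_all
qed

section \<open>Inheritance of density to neighbourhoods with high probability\<close>

lemma exists_small_eps:
  fixes a b :: real
  assumes "0 < b"
  shows "\<exists>\<epsilon>>0. \<epsilon> < 1 \<and> 2 * \<epsilon> \<le> b \<and> a \<le> ln (1 / \<epsilon>)"
proof -
  define \<epsilon> where "\<epsilon> = min (1 / 2) (min (b / 2) (exp (- a)))"
  have pos: "0 < \<epsilon>" using assms by (simp add: \<epsilon>_def)
  have "ln \<epsilon> \<le> ln (exp (- a))" using pos by (intro ln_mono) (auto simp: \<epsilon>_def)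
  then have "a \<le> ln (1 / \<epsilon>)" using pos by (simp add: ln_div)
  moreover have "2 * \<epsilon> \<le> b" "\<epsilon> < 1" by (auto simp: \<epsilon>_def min_def)
  ultimately show ?thesis using pos by auto
qed

lemma ec_adj_swap: "ec (adj E) A B = ec (adj E) B A"
  using ec_swap[of "adj E" A B] by (simp add: adj_sym[of E])

lemma dense_adj_swap: "dense_pair (adj E) c \<epsilon> A B \<Longrightarrow> dense_pair (adj E) c \<epsilon> B A"
  using dense_pair_swap_imp[of "adj E" c \<epsilon> A B] by (simp add: adj_sym[of E])

text \<open>The loss of a factor \<open>2\<^bsup>24\<^esup>\<close> in the density is harmless, since density is inherited at most
  \<open>2\<Delta>\<close> times along an edge of \<open>H\<close>.\<close>

definition inherit_one :: "'a set set \<Rightarrow> 'a set \<Rightarrow> real \<Rightarrow> real \<Rightarrow> real \<Rightarrow> real \<Rightarrow> real \<Rightarrow> real \<Rightarrow> real \<Rightarrow> bool" where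
  "inherit_one E V p d \<epsilon> \<rho> \<epsilon>' M1 M2 \<longleftrightarrow> (\<forall>G S T X. G \<subseteq> E \<longrightarrow> S \<subseteq> V \<longrightarrow> T \<subseteq> V \<longrightarrow> X \<subseteq> V \<longrightarrow>
     S \<inter> T = {} \<longrightarrow> S \<inter> X = {} \<longrightarrow> T \<inter> X = {} \<longrightarrow> M2 \<le> real (card S) \<longrightarrow> M1 \<le> real (card T) \<longrightarrow>
     dense_pair (adj G) (d * p) \<epsilon> S T \<longrightarrow>
     (\<forall>v\<in>X. \<exists>Q T'. Q \<subseteq> S \<and> (\<forall>u\<in>Q. {v, u} \<in> G) \<and> T' \<subseteq> T \<and>
        \<rho> * p * real (card S) \<le> real (card Q) \<and> \<epsilon>' * real (card T) \<le> real (card T') \<and>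
        ec (adj G) Q T' < d * p / 2^24 * real (card Q) * real (card T')) \<longrightarrow> real (card X) < M1)"

text \<open>\<open>G\<close> is an arbitrary part of \<open>E\<close>, as the subgraph is chosen
  after the random graph. Witnesses are measured against p|S| and p|T| rather than against the
  neighbourhoods themselves, so no upper bound on degrees enters.\<close>

definition inherit_two :: "'a set set \<Rightarrow> 'a set \<Rightarrow> real \<Rightarrow> real \<Rightarrow> real \<Rightarrow> real \<Rightarrow> real \<Rightarrow> bool" where
  "inherit_two E V p d \<epsilon> \<rho> M2 \<longleftrightarrow> (\<forall>G S T X. G \<subseteq> E \<longrightarrow> S \<subseteq> V \<longrightarrow> T \<subseteq> V \<longrightarrow> X \<subseteq> V \<longrightarrow>
     S \<inter> T = {} \<longrightarrow> S \<inter> X = {} \<longrightarrow> T \<inter> X = {} \<longrightarrow> M2 \<le> real (card S) \<longrightarrow> M2 \<le> real (card T) \<longrightarrow>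
     dense_pair (adj G) (d * p) \<epsilon> S T \<longrightarrow>
     (\<forall>v\<in>X. \<exists>Q T'. Q \<subseteq> S \<and> (\<forall>u\<in>Q. {v, u} \<in> G) \<and> T' \<subseteq> T \<and> (\<forall>u\<in>T'. {v, u} \<in> G) \<and>
        \<rho> * p * real (card S) \<le> real (card Q) \<and> \<rho> * p * real (card T) \<le> real (card T') \<and>
        ec (adj G) Q T' < d * p / 2^24 * real (card Q) * real (card T')) \<longrightarrow> real (card X) < M2)"

lemma subset_of_ceiling_card:
  assumes "m \<le> real (card X)" "0 < m"
  obtains X1 where "X1 \<subseteq> X" "finite X1" "m \<le> real (card X1)" "real (card X1) \<le> m + 1"
proof -
  have "nat \<lceil>m\<rceil> \<le> card X" using assms by linarith
  then obtain X1 where X1: "X1 \<subseteq> X" "card X1 = nat \<lceil>m\<rceil>" "finite X1"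
    by (rule obtain_subset_with_card_n)
  have "m \<le> real (nat \<lceil>m\<rceil>)" "real (nat \<lceil>m\<rceil>) \<le> m + 1" using assms by linarith+
  with X1 show ?thesis by (intro that) auto
qed

text \<open>A sample may carry up to eight times the expected number of edges on a set of half the
  expected size; together this raises the density by at most a factor 16.\<close>

lemma sparse_sampled:
  fixes c q r r0 \<pi> x y :: real
  assumes "x < c * q * r" "y \<le> 8 * \<pi> * x" "\<pi> * r / 2 \<le> r0" "0 < \<pi>" "0 < c" "0 \<le> q"
  shows "y < 16 * c * q * r0"
proof -
  have "8 * \<pi> * x < 8 * \<pi> * (c * q * r)" using assms by (intro mult_strict_left_mono) auto
  also have "\<dots> = 16 * c * q * (\<pi> * r / 2)" by simp
  also have "\<dots> \<le> 16 * c * q * r0" using assms by (intro mult_left_mono) auto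
  finally show ?thesis using assms by linarith
qed

text \<open>\<open>X\<close> is trimmed and \<open>T\<close> sampled to about M = C ln n / p
  vertices, while \<open>S\<close> stays whole. With K = 8 the containers contribute exp(-8p|S||X|)
  \<le> exp(-4p|S|M), against at most exp(2p|S|M) for the bipartite graph; the surplus in the
  exponent pays for the choice of the three sets.\<close>

lemma inherit_one_prob:
  fixes d \<rho> \<epsilon>' :: real
  assumes d: "0 < d" "d \<le> 1" and \<rho>: "0 < \<rho>" and e': "0 < \<epsilon>'" "\<epsilon>' < 1"
  shows "\<exists>\<epsilon>>0. \<epsilon> < 1 \<and> (\<exists>C0\<ge>1. \<forall>C\<ge>C0. \<forall>(n::nat) p. 3 \<le> n \<longrightarrow> 0 < p \<longrightarrow> p \<le> 1 \<longrightarrow>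
    measure_pmf.prob (rsub (nsets {..<n} 2) p)
      {E. \<not> inherit_one E {..<n} p d \<epsilon> \<rho> \<epsilon>' (C * ln (real n) / p) (C * ln (real n) / p\<^sup>2)} \<le> exp (3 / real n) - 1)"
proof -
  \<comment> \<open>The sample has at most 2\<pi>|T| vertices, but keeps at least half of the
    expected \<pi>\<epsilon>'|T| vertices of a witness; hence a quarter of \<epsilon>'.\<close>
  define \<epsilon>2 where "\<epsilon>2 = \<epsilon>' / 4"
  have e2: "0 < \<epsilon>2" "\<epsilon>2 < 1" using e' by (auto simp: \<epsilon>2_def)
  obtain \<epsilon>1 where e1: "0 < \<epsilon>1" "\<epsilon>1 < 1" "2 * \<epsilon>1 \<le> \<epsilon>2\<^sup>2" "40 / \<rho> \<le> ln (1 / \<epsilon>1)"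
    using exists_small_eps[of "\<epsilon>2\<^sup>2"] e2 by (metis zero_less_power)
  obtain \<epsilon> where e: "0 < \<epsilon>" "\<epsilon> < 1" "2 * \<epsilon> \<le> \<epsilon>1\<^sup>2" "40 / \<epsilon>1 \<le> ln (1 / \<epsilon>)"
    using exists_small_eps[of "\<epsilon>1\<^sup>2"] e1 by (metis zero_less_power)
  define C0 where "C0 = Max {64, 64 * ln (1 / \<epsilon>1) / (\<epsilon>1 * d), 128 / \<epsilon>', 512 * ln (1 / \<epsilon>2) / (\<rho> * d)}"
  have C0: "64 \<le> C0" "64 * ln (1 / \<epsilon>1) / (\<epsilon>1 * d) \<le> C0" "128 / \<epsilon>' \<le> C0" "512 * ln (1 / \<epsilon>2) / (\<rho> * d) \<le> C0"
    unfolding C0_def by (intro Max_ge; simp)+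
  have main: "measure_pmf.prob (rsub (nsets {..<n} 2) p)
      {E. \<not> inherit_one E {..<n} p d \<epsilon> \<rho> \<epsilon>' (C * ln (real n) / p) (C * ln (real n) / p\<^sup>2)} \<le> exp (3 / real n) - 1"
    if C: "C0 \<le> C" and n: "3 \<le> n" and p: "0 < p" "p \<le> 1" for C p :: real and n :: nat
  proof -
    define L where "L = ln (real n)"
    define M where "M = C * L / p"
    define M2 where "M2 = C * L / p\<^sup>2"
    have L1: "1 \<le> L"
    proof -
      have "exp 1 \<le> real n" using exp_le n by linarith
      then show ?thesis unfolding L_def using n by (simp add: ln_ge_iff)
    qed
    have "C * 1 \<le> C * L" using C C0(1) L1 by (intro mult_left_mono) auto
    then have CL: "C \<le> C * L" "64 \<le> C * L" using C C0(1) by linarith+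
    have pM: "p * M = C * L" "p * (p * M2) = C * L" using p by (auto simp: M_def M2_def power2_eq_square)
    have "C * L / 1 \<le> C * L / p" using CL p by (intro divide_left_mono) auto
    then have M: "64 \<le> M" using CL by (simp add: M_def)
    define rel :: "(nat \<times> nat) set \<Rightarrow> nat \<Rightarrow> nat \<Rightarrow> bool" where "rel P a b \<longleftrightarrow> (a, b) \<in> P" for P a b
    define c1 where "c1 = d * p / 16"
    have c1: "0 < c1" "c1 \<le> 1" using d p mult_le_one[of d p] by (auto simp: c1_def)
    have dp1: "d * p \<le> 1" using d p by (simp add: mult_le_one)
    define ok where "ok S T P \<longleftrightarrow> finite S \<and> finite T \<and> M2 \<le> real (card S) \<and> P \<subseteq> S \<times> T \<and> dense_pair (rel P) c1 \<epsilon>1 S T" for S T P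
    \<comment> \<open>A family is fixed for every bipartite graph \<open>P\<close> in advance,
      because the first moment bound ranges over all \<open>P\<close> and not only over the one that
      occurs.\<close>
    have "\<exists>\<W>. ok S T P \<longrightarrow> \<W> \<subseteq> Pow S \<and> (\<Sum>D\<in>\<W>. p ^ card D) \<le> exp (- 8 * p * real (card S)) \<and>
      (\<forall>Q T'. Q \<subseteq> S \<longrightarrow> T' \<subseteq> T \<longrightarrow> \<rho> * p * real (card S) \<le> real (card Q) \<longrightarrow> \<epsilon>2 * real (card T) \<le> real (card T') \<longrightarrow>
        ec (rel P) Q T' < c1 / 16 * real (card Q) * real (card T') \<longrightarrow> (\<exists>D\<in>\<W>. D \<subseteq> Q))" for S T P
    proof (cases "ok S T P")
      case True
      have "512 * ln (1 / \<epsilon>2) / (\<rho> * d) \<le> p * (p * M2)" using C C0(4) CL(1) pM by linarith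
      also have "\<dots> \<le> p * (p * real (card S))" using True p by (intro mult_left_mono) (auto simp: ok_def)
      finally have "512 * ln (1 / \<epsilon>2) / (\<rho> * d) * d / 16 \<le> p * (p * real (card S)) * d / 16"
        using d by (intro divide_right_mono mult_right_mono) auto
      then have big: "32 * ln (1 / \<epsilon>2) / \<rho> \<le> c1 * p * real (card S)"
        using d by (simp add: c1_def mult_ac)
      have K: "4 * (8 + 2) / \<rho> \<le> ln (1 / \<epsilon>1)" using e1(4) by simp
      have True': "finite S" "finite T" "dense_pair (rel P) c1 \<epsilon>1 S T" using True by (auto simp: ok_def)
      show ?thesis
        using container_family[OF True' c1 e1(1,3) e2 \<rho> K _ big] p by auto
    qed blast
    then obtain W where W: "\<And>S T P. ok S T P \<Longrightarrow> W S T P \<subseteq> Pow S"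
      "\<And>S T P. ok S T P \<Longrightarrow> (\<Sum>D\<in>W S T P. p ^ card D) \<le> exp (- 8 * p * real (card S))"
      "\<And>S T P Q T'. ok S T P \<Longrightarrow> Q \<subseteq> S \<Longrightarrow> T' \<subseteq> T \<Longrightarrow> \<rho> * p * real (card S) \<le> real (card Q) \<Longrightarrow> \<epsilon>2 * real (card T) \<le> real (card T') \<Longrightarrow>
        ec (rel P) Q T' < c1 / 16 * real (card Q) * real (card T') \<Longrightarrow> (\<exists>D\<in>W S T P. D \<subseteq> Q)"
      by metis
    define A where "A X S T = {E. \<exists>P\<in>{P. ok S T P}. (\<forall>(a, b)\<in>P. {a, b} \<in> E) \<and> (\<forall>v\<in>X. \<exists>D\<in>W S T P. \<forall>u\<in>D. {v, u} \<in> E)}" for X S T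
    define \<C> where "\<C> = {(X, S, T). X \<subseteq> {..<n} \<and> S \<subseteq> {..<n} \<and> T \<subseteq> {..<n} \<and> X \<noteq> {} \<and> S \<inter> T = {} \<and> S \<inter> X = {} \<and> T \<inter> X = {} \<and>
      M / 2 \<le> real (card X) \<and> real (card X) \<le> 2 * M \<and> M2 \<le> real (card S) \<and> real (card T) \<le> 2 * M}"
    have "measure_pmf.prob (rsub (nsets {..<n} 2) p) {E. \<not> inherit_one E {..<n} p d \<epsilon> \<rho> \<epsilon>' M M2}
       \<le> measure_pmf.prob (rsub (nsets {..<n} 2) p) {E. \<exists>X S T. (X, S, T) \<in> \<C> \<and> E \<in> A X S T}"
    proof (intro measure_pmf.finite_measure_mono subsetI)
      fix E assume "E \<in> {E. \<not> inherit_one E {..<n} p d \<epsilon> \<rho> \<epsilon>' M M2}"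
      then obtain G S T X where G: "G \<subseteq> E" and sub: "S \<subseteq> {..<n}" "T \<subseteq> {..<n}" "X \<subseteq> {..<n}"
        and disj: "S \<inter> T = {}" "S \<inter> X = {}" "T \<inter> X = {}" and S2: "M2 \<le> real (card S)" and T1: "M \<le> real (card T)"
        and dense: "dense_pair (adj G) (d * p) \<epsilon> S T"
        and bad: "\<forall>v\<in>X. \<exists>Q T'. Q \<subseteq> S \<and> (\<forall>u\<in>Q. {v, u} \<in> G) \<and> T' \<subseteq> T \<and>
        \<rho> * p * real (card S) \<le> real (card Q) \<and> \<epsilon>' * real (card T) \<le> real (card T') \<and>
        ec (adj G) Q T' < d * p / 2^24 * real (card Q) * real (card T')" and X: "M \<le> real (card X)"
        unfolding inherit_one_def by (auto simp: not_less)
      have fin: "finite S" "finite T" using sub by (auto intro: finite_subset)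
      from bad obtain Q R where QR: "\<And>v. v \<in> X \<Longrightarrow> Q v \<subseteq> S \<and> (\<forall>u\<in>Q v. {v, u} \<in> G) \<and> R v \<subseteq> T \<and>
        \<rho> * p * real (card S) \<le> real (card (Q v)) \<and> \<epsilon>' * real (card T) \<le> real (card (R v)) \<and>
        ec (adj G) (Q v) (R v) < d * p / 2^24 * real (card (Q v)) * real (card (R v))"
        by metis
      obtain X1 where X1: "X1 \<subseteq> X" "finite X1" "M \<le> real (card X1)" "real (card X1) \<le> M + 1"
        using subset_of_ceiling_card[OF X] M by force
      have X1ne: "X1 \<noteq> {}" using X1 M by auto
      define \<pi> where "\<pi> = M / real (card T)"
      have T0: "0 < real (card T)" using T1 M by linarith
      have \<pi>: "0 < \<pi>" "\<pi> \<le> 1" using T1 M T0 by (auto simp: \<pi>_def)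
      have \<pi>T: "\<pi> * real (card T) = M" using T0 by (simp add: \<pi>_def)
      have "64 * ln (1 / \<epsilon>1) / (\<epsilon>1 * d) \<le> p * M" using C C0(2) CL(1) pM by linarith
      then have "64 * ln (1 / \<epsilon>1) / (\<epsilon>1 * d) * d \<le> p * M * d" using d by (intro mult_right_mono) auto
      then have big: "64 * ln (1 / \<epsilon>1) / \<epsilon>1 \<le> d * p * \<pi> * real (card T)"
        using d by (simp add: \<pi>T[symmetric] mult_ac)
      have Rbig: "128 \<le> \<pi> * real (card (R v))" if "v \<in> X1" for v
      proof -
        have "128 / \<epsilon>' \<le> M"
        proof -
          have "128 / \<epsilon>' \<le> p * M" using C C0(3) CL(1) pM by linarith
          also have "\<dots> \<le> M" using p M by (simp add: mult_left_le_one_le)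
          finally show ?thesis .
        qed
        then have "128 \<le> \<epsilon>' * (\<pi> * real (card T))" using e' by (simp add: \<pi>T field_simps)
        also have "\<dots> = \<pi> * (\<epsilon>' * real (card T))" by simp
        also have "\<dots> \<le> \<pi> * real (card (R v))" using QR[of v] X1(1) that \<pi> by (intro mult_left_mono) auto
        finally show ?thesis .
      qed
      obtain T0 X0 where T0: "T0 \<subseteq> T" "M / 2 \<le> real (card T0)" "real (card T0) \<le> 2 * M"
        "dense_pair (adj G) c1 \<epsilon>1 S T0" and X0: "X0 \<subseteq> X1" "real (card X1) / 2 \<le> real (card X0)"
        and X0': "\<And>v. v \<in> X0 \<Longrightarrow> \<pi> * real (card (R v)) / 2 \<le> real (card (R v \<inter> T0)) \<and>
          ec (adj G) (Q v) (R v \<inter> T0) \<le> 8 * \<pi> * ec (adj G) (Q v) (R v)"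
      proof -
        have RT: "R v \<subseteq> T" if "v \<in> X1" for v using QR X1(1) that by blast
        have dp0: "0 < d * p" using d p by simp
        have M': "64 \<le> \<pi> * real (card T)" using M \<pi>T by simp
        show thesis
          using dense_pair_sampling[where Qs = Q and Rs = R, OF fin X1(2) X1ne dense dp0 dp1 e(1,3) e1(1,2) e(4) \<pi> big M' RT Rbig]
            that unfolding c1_def mult.assoc[of 2 \<pi>] \<pi>T by blast
      qed
      \<comment> \<open>The part of \<open>G\<close>, not of \<open>E\<close>, between the two sets:
        density is known for \<open>G\<close>, while the event only requires the pairs in
        \<open>P\<close> to be edges of \<open>E\<close>.\<close>
      define P where "P = {(a, b) \<in> S \<times> T0. {a, b} \<in> G}"
      have relP: "rel P a b \<longleftrightarrow> adj G a b" if "a \<in> S" "b \<in> T0" for a b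
        using that by (auto simp: rel_def P_def adj_def)
      have "dense_pair (rel P) c1 \<epsilon>1 S T0" using dense_pair_cong[of S T0 "rel P" "adj G"] relP T0(4) by blast
      then have okP: "ok S T0 P" using S2 T0(1) fin by (auto simp: ok_def P_def intro: finite_subset)
      have "\<exists>D\<in>W S T0 P. \<forall>u\<in>D. {v, u} \<in> E" if v: "v \<in> X0" for v
      proof -
        have vX: "v \<in> X" using v X0 X1 by auto
        have eq: "ec (rel P) (Q v) (R v \<inter> T0) = ec (adj G) (Q v) (R v \<inter> T0)"
          unfolding ec_def using QR[OF vX] relP by (intro sum.cong) auto
        have "ec (adj G) (Q v) (R v \<inter> T0) < 16 * (d * p / 2^24) * real (card (Q v)) * real (card (R v \<inter> T0))"
          using QR[OF vX] X0'[OF v] \<pi> d p by (intro sparse_sampled[of "ec (adj G) (Q v) (R v)" _ _ "real (card (R v))" _ \<pi>]) auto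
        also have "\<dots> \<le> c1 / 16 * real (card (Q v)) * real (card (R v \<inter> T0))"
          using d p by (intro mult_right_mono) (auto simp: c1_def)
        finally have lt: "ec (rel P) (Q v) (R v \<inter> T0) < c1 / 16 * real (card (Q v)) * real (card (R v \<inter> T0))"
          unfolding eq .
        have "\<epsilon>2 * real (card T0) \<le> \<epsilon>' / 4 * (2 * (\<pi> * real (card T)))"
          using T0(3) e' unfolding \<pi>T \<epsilon>2_def by (intro mult_left_mono) auto
        also have "\<dots> = \<pi> * (\<epsilon>' * real (card T)) / 2" by simp
        also have "\<dots> \<le> \<pi> * real (card (R v)) / 2" using QR[OF vX] \<pi> by (intro divide_right_mono mult_left_mono) auto
        also have "\<dots> \<le> real (card (R v \<inter> T0))" using X0'[OF v] by simp
        finally obtain D where "D \<in> W S T0 P" "D \<subseteq> Q v"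
          using W(3)[OF okP, of "Q v" "R v \<inter> T0"] QR[OF vX] lt by auto
        then show ?thesis using QR[OF vX] G by (intro bexI[of _ D]) auto
      qed
      moreover have "\<forall>(a, b)\<in>P. {a, b} \<in> E" using G by (auto simp: P_def)
      ultimately have "E \<in> A X0 S T0" using okP unfolding A_def by auto
      moreover have "(X0, S, T0) \<in> \<C>"
      proof -
        have "card X0 \<le> card X1" using X0(1) X1(2) by (rule card_mono[rotated])
        then have "real (card X0) \<le> 2 * M" using X1(4) M by linarith
        moreover have "M / 2 \<le> real (card X0)" using X0(2) X1(3) by linarith
        moreover from this have "X0 \<noteq> {}" using M by auto
        moreover have "X0 \<subseteq> X" "T0 \<subseteq> T" using X0 X1 T0 by auto
        ultimately show ?thesis unfolding \<C>_def using sub disj T0(3) S2 by auto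
      qed
      ultimately show "E \<in> {E. \<exists>X S T. (X, S, T) \<in> \<C> \<and> E \<in> A X S T}" by blast
    qed simp
    also have "\<dots> \<le> exp (3 / real (card {..<n})) - 1"
    proof (rule union_bound_triples)
      fix X S T assume "(X, S, T) \<in> \<C>"
      then have sub: "X \<subseteq> {..<n}" "S \<subseteq> {..<n}" "T \<subseteq> {..<n}" and disj: "S \<inter> T = {}" "S \<inter> X = {}" "T \<inter> X = {}"
        and sz: "M / 2 \<le> real (card X)" "real (card X) \<le> 2 * M" "M2 \<le> real (card S)" "real (card T) \<le> 2 * M"
        by (auto simp: \<C>_def)
      define s t x where "s = real (card S)" "t = real (card T)" "x = real (card X)"
      note stx = s_t_x_def
      have "measure_pmf.prob (rsub (nsets {..<n} 2) p) (A X S T) \<le> exp (p * real (card S) * real (card T)) * exp (- 8 * p * real (card S)) ^ card X"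
        unfolding A_def using sub disj p W(2)
      proof (intro first_moment[where V = "{..<n}"])
        show "{P. ok S T P} \<subseteq> Pow (S \<times> T)" by (auto simp: ok_def)
        show "W S T P \<subseteq> Pow (S \<union> T)" if "P \<in> {P. ok S T P}" for P using W(1)[of S T P] that by blast
      qed auto
      also have "\<dots> = exp (p * s * t - 8 * p * s * x)"
        by (simp add: exp_of_nat_mult[symmetric] exp_add[symmetric] stx)
      also have "\<dots> \<le> exp (- 2 * L * (x + s + t))"
      proof -
        \<comment> \<open>With u = p|S|, the product u M equals C|S| ln n and, because |S| \<ge> M2,
          is also at least C M ln n. It therefore dominates 2 ln n times the sum of the three
          sizes.\<close>
        have s: "M2 \<le> s" "0 \<le> s" using sz by (auto simp: stx)
        define u where "u = p * s"
        have u: "0 \<le> u" using s p by (simp add: u_def)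
        have "u * t \<le> u * (2 * M)" using sz u by (intro mult_left_mono) (auto simp: stx)
        then have h1: "u * t \<le> 2 * (u * M)" by simp
        have "u * (M / 2) \<le> u * x" using sz u by (intro mult_left_mono) (auto simp: stx)
        then have h2: "u * M \<le> 2 * (u * x)" by simp
        have h3: "u * M = s * (C * L)" using pM(1) unfolding u_def by (metis mult.assoc mult.commute)
        have "C * L \<le> p * (p * s)" unfolding pM(2)[symmetric] using s p by (intro mult_left_mono) auto
        also have "\<dots> \<le> u" using p s by (simp add: u_def mult_left_le_one_le)
        finally have h4: "C * L * M \<le> u * M" using M by (intro mult_right_mono) auto
        have C64: "64 * L \<le> C * L" using C C0(1) L1 by (intro mult_right_mono) auto
        have h5: "64 * L * M \<le> C * L * M" using mult_right_mono[OF C64, of M] M by simp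
        have h6: "s * (64 * L) \<le> s * (C * L)" using mult_left_mono[OF C64 s(2)] .
        have h7: "L * x \<le> L * (2 * M)" "L * t \<le> L * (2 * M)"
          using sz L1 by (auto simp: stx)
        have h8: "0 \<le> L * M" "0 \<le> s * L" using L1 M s by auto
        have "u * t - 8 * (u * x) \<le> - 2 * (L * x) - 2 * (s * L) - 2 * (L * t)"
          using h1 h2 h3 h4 h5 h6 h7 h8 by linarith
        also have "\<dots> = - 2 * L * (x + s + t)" by (simp add: algebra_simps)
        finally show ?thesis by (simp add: u_def)
      qed
      also have "\<dots> = (1 / (real n)\<^sup>2) ^ (card X + card S + card T)"
      proof -
        have "exp (- L) = 1 / real n" using n by (simp add: L_def exp_minus inverse_eq_divide)
        moreover have "exp (- 2 * L) = exp (- L) * exp (- L)" unfolding exp_add[symmetric] by simp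
        ultimately have eq: "(1 / (real n)\<^sup>2) = exp (- 2 * L)" by (simp add: power2_eq_square)
        show ?thesis unfolding eq exp_of_nat_mult[symmetric] by (simp add: stx algebra_simps)
      qed
      finally show "measure_pmf.prob (rsub (nsets {..<n} 2) p) (A X S T) \<le> (1 / (real (card {..<n}))\<^sup>2) ^ (card X + card S + card T)" by simp
    qed (use n in \<open>auto simp: \<C>_def lessThan_empty_iff\<close>)
    finally show ?thesis by (simp add: M_def M2_def L_def)
  qed
  show ?thesis
    using e main C0(1) by (intro exI[of _ \<epsilon>] conjI exI[of _ C0]) auto
qed

text \<open>Two-sided containers call for classes of comparable size, so \<open>T\<close> and then
  \<open>S\<close> are sampled to about M = C ln n / p^2 vertices. Each vertex of \<open>X\<close>
  contributes exp(-40pM); with |X| \<ge> M/4 this is exp(-10pM^2), against at most exp(4pM^2) for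
  the bipartite graph.\<close>

lemma inherit_two_prob:
  fixes d \<rho> :: real
  assumes d: "0 < d" "d \<le> 1" and \<rho>: "0 < \<rho>"
  shows "\<exists>\<epsilon>>0. \<epsilon> < 1 \<and> (\<exists>C0\<ge>1. \<forall>C\<ge>C0. \<forall>(n::nat) p. 3 \<le> n \<longrightarrow> 0 < p \<longrightarrow> p \<le> 1 \<longrightarrow>
    measure_pmf.prob (rsub (nsets {..<n} 2) p)
      {E. \<not> inherit_two E {..<n} p d \<epsilon> \<rho> (C * ln (real n) / p\<^sup>2)} \<le> exp (3 / real n) - 1)"
proof -
  define \<rho>4 where "\<rho>4 = \<rho> / 4"
  have \<rho>4: "0 < \<rho>4" using \<rho> by (auto simp: \<rho>4_def)
  \<comment> \<open>Chosen backwards: \<epsilon>3 serves inside the two-sided containers,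
    \<epsilon>2 after the sampling of \<open>S\<close>, \<epsilon>1 after that of \<open>T\<close>.
    The number 408 is 4 * (100 + 2), for K = 100.\<close>
  obtain \<epsilon>3 where e3: "0 < \<epsilon>3" "\<epsilon>3 < 1" "2 * \<epsilon>3 \<le> 1 / 4" "408 / \<rho>4 \<le> ln (1 / \<epsilon>3)"
    using exists_small_eps[of "1 / 4"] by (metis zero_less_divide_1_iff zero_less_numeral)
  obtain \<epsilon>2 where e2: "0 < \<epsilon>2" "\<epsilon>2 < 1" "2 * \<epsilon>2 \<le> \<epsilon>3\<^sup>2" "408 / (\<epsilon>3 * \<rho>4) \<le> ln (1 / \<epsilon>2)"
    using exists_small_eps[of "\<epsilon>3\<^sup>2"] e3 by (metis zero_less_power)
  obtain \<epsilon>1 where e1: "0 < \<epsilon>1" "\<epsilon>1 < 1" "2 * \<epsilon>1 \<le> \<epsilon>2\<^sup>2" "40 / \<epsilon>2 \<le> ln (1 / \<epsilon>1)"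
    using exists_small_eps[of "\<epsilon>2\<^sup>2"] e2 by (metis zero_less_power)
  obtain \<epsilon> where e: "0 < \<epsilon>" "\<epsilon> < 1" "2 * \<epsilon> \<le> \<epsilon>1\<^sup>2" "40 / \<epsilon>1 \<le> ln (1 / \<epsilon>)"
    using exists_small_eps[of "\<epsilon>1\<^sup>2"] e1 by (metis zero_less_power)
  define C0 where "C0 = Max {64, 64 * ln (1 / \<epsilon>1) / (\<epsilon>1 * d), 128 / \<rho>, 1024 * ln (1 / \<epsilon>2) / (\<epsilon>2 * d),
    16384 * ln (1 / \<epsilon>3) / (\<epsilon>3 * \<rho>4 * d), 262144 * ln 2 / (\<rho>4 * d)}"
  have C0: "64 \<le> C0" "64 * ln (1 / \<epsilon>1) / (\<epsilon>1 * d) \<le> C0" "128 / \<rho> \<le> C0" "1024 * ln (1 / \<epsilon>2) / (\<epsilon>2 * d) \<le> C0"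
    "16384 * ln (1 / \<epsilon>3) / (\<epsilon>3 * \<rho>4 * d) \<le> C0" "262144 * ln 2 / (\<rho>4 * d) \<le> C0"
    unfolding C0_def by (intro Max_ge; simp)+
  have main: "measure_pmf.prob (rsub (nsets {..<n} 2) p)
      {E. \<not> inherit_two E {..<n} p d \<epsilon> \<rho> (C * ln (real n) / p\<^sup>2)} \<le> exp (3 / real n) - 1"
    if C: "C0 \<le> C" and n: "3 \<le> n" and p: "0 < p" "p \<le> 1" for C p :: real and n :: nat
  proof -
    define L where "L = ln (real n)"
    define M where "M = C * L / p\<^sup>2"
    have L1: "1 \<le> L"
    proof -
      have "exp 1 \<le> real n" using exp_le n by linarith
      then show ?thesis unfolding L_def using n by (simp add: ln_ge_iff)
    qed
    have "C * 1 \<le> C * L" using C C0(1) L1 by (intro mult_left_mono) auto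
    then have CL: "C \<le> C * L" "64 \<le> C * L" using C C0(1) by linarith+
    have ppM: "p * (p * M) = C * L" using p by (auto simp: M_def power2_eq_square)
    have pM: "C * L \<le> p * M"
    proof -
      have "0 \<le> p * M" using ppM CL p by (simp add: M_def)
      then have "p * (p * M) \<le> 1 * (p * M)" using p by (intro mult_right_mono) auto
      then show ?thesis using ppM by simp
    qed
    have M: "64 \<le> M"
    proof -
      have "0 \<le> M" using CL by (simp add: M_def)
      then have "p * M \<le> 1 * M" using p by (intro mult_right_mono) auto
      then show ?thesis using pM CL by simp
    qed
    define rel :: "(nat \<times> nat) set \<Rightarrow> nat \<Rightarrow> nat \<Rightarrow> bool" where "rel P a b \<longleftrightarrow> (a, b) \<in> P" for P a b
    define c1 where "c1 = d * p / 16"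
    define c2 where "c2 = d * p / 256"
    have dp: "0 < d * p" "d * p \<le> 1" using d p by (auto simp: mult_le_one)
    have c1: "0 < c1" "c1 \<le> 1" and c2: "0 < c2" "c2 \<le> 1" using dp by (auto simp: c1_def c2_def)
    define ok where "ok S T P \<longleftrightarrow> finite S \<and> finite T \<and> S \<inter> T = {} \<and> M / 2 \<le> real (card S) \<and> M / 2 \<le> real (card T) \<and>
      real (card S) \<le> 2 * M \<and> P \<subseteq> S \<times> T \<and> dense_pair (rel P) c2 \<epsilon>2 S T" for S T P
    have "\<exists>\<W>. ok S T P \<longrightarrow> \<W> \<subseteq> Pow (S \<union> T) \<and> (\<Sum>D\<in>\<W>. p ^ card D) \<le> exp (- 40 * p * M) \<and>
      (\<forall>Q T'. Q \<subseteq> S \<longrightarrow> T' \<subseteq> T \<longrightarrow> \<rho>4 * p * real (card S) \<le> real (card Q) \<longrightarrow> \<rho>4 * p * real (card T) \<le> real (card T') \<longrightarrow>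
        ec (rel P) Q T' < c2 / 256 * real (card Q) * real (card T') \<longrightarrow> (\<exists>D\<in>\<W>. D \<subseteq> Q \<union> T'))" for S T P
    proof (cases "ok S T P")
      case True
      then have ok: "finite S" "finite T" "S \<inter> T = {}" "dense_pair (rel P) c2 \<epsilon>2 S T"
        and sz: "M / 2 \<le> real (card S)" "M / 2 \<le> real (card T)" "real (card S) \<le> 2 * M" by (auto simp: ok_def)
      have ps: "C0 / 2 * d / 256 \<le> c2 * p * y" if "M / 2 \<le> y" for y
      proof -
        have "C0 / 2 \<le> p * (p * M) / 2" using C CL(1) ppM by linarith
        also have "\<dots> = p * (p * (M / 2))" by simp
        also have "\<dots> \<le> p * (p * y)" using that p by (intro mult_left_mono) auto
        finally have "C0 / 2 * (d / 256) \<le> p * (p * y) * (d / 256)" using d by (intro mult_right_mono) auto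
        then show ?thesis by (simp add: c2_def mult_ac)
      qed
      have er: "0 < \<epsilon>3 * \<rho>4" using e3 \<rho>4 by simp
      have "16384 * ln (1 / \<epsilon>3) / (\<epsilon>3 * \<rho>4 * d) * (d / 512) \<le> C0 * (d / 512)" using C0(5) d by (intro mult_right_mono) auto
      then have "32 * ln (1 / \<epsilon>3) / (\<epsilon>3 * \<rho>4) \<le> C0 / 2 * d / 256" using d er by simp
      then have big1: "32 * ln (1 / \<epsilon>3) / (\<epsilon>3 * \<rho>4) \<le> c2 * p * real (card S)" using ps[OF sz(1)] by linarith
      have "262144 * ln 2 / (\<rho>4 * d) * (d / 8192) \<le> C0 * (d / 8192)" using C0(6) d by (intro mult_right_mono) auto
      then have "32 * ln 2 / \<rho>4 \<le> (C0 / 2 * d / 256) / 16" using d \<rho>4 by simp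
      then have big2: "32 * ln 2 / \<rho>4 \<le> c2 / 16 * p * real (card T)" using ps[OF sz(2)] by simp
      have K: "4 * (100 + 2) / (\<epsilon>3 * \<rho>4) \<le> ln (1 / \<epsilon>2)" "4 * (100 + 2) / \<rho>4 \<le> ln (1 / \<epsilon>3)" using e2(4) e3(4) by auto
      have e38: "8 * \<epsilon>3 \<le> 1" using e3 by simp
      have p0: "0 \<le> p" using p by simp
      obtain \<W> where W: "\<W> \<subseteq> Pow (S \<union> T)" 
        "(\<Sum>D\<in>\<W>. p ^ card D) \<le> exp (- 100 * p * real (card S)) + exp (p * real (card S) - 100 * p * real (card T))"
        "\<forall>Q T'. Q \<subseteq> S \<longrightarrow> T' \<subseteq> T \<longrightarrow> \<rho>4 * p * real (card S) \<le> real (card Q) \<longrightarrow> \<rho>4 * p * real (card T) \<le> real (card T') \<longrightarrow>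
        ec (rel P) Q T' < c2 / 256 * real (card Q) * real (card T') \<longrightarrow> (\<exists>D\<in>\<W>. D \<subseteq> Q \<union> T')"
        using container_family_two_sided[OF ok c2 e2(1,3) e3(1) e38 \<rho>4 K p0 big1 big2] by blast
      have "exp (- 100 * p * real (card S)) \<le> exp (- 48 * (p * M))"
      proof -
        have "p * (M / 2) \<le> p * real (card S)" using sz p by (intro mult_left_mono) auto
        moreover have "0 \<le> p * M" using p M by simp
        ultimately show ?thesis unfolding exp_le_cancel_iff mult.assoc by linarith
      qed
      moreover have "exp (p * real (card S) - 100 * p * real (card T)) \<le> exp (- 48 * (p * M))"
      proof -
        have "p * (M / 2) \<le> p * real (card T)" "p * real (card S) \<le> p * (2 * M)" using sz p by (auto intro: mult_left_mono)
        then show ?thesis unfolding exp_le_cancel_iff mult.assoc by linarith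
      qed
      moreover have "exp (- 48 * (p * M)) + exp (- 48 * (p * M)) \<le> exp (- 40 * (p * M))"
      proof -
        have "2 \<le> exp (8 * (p * M))"
          using exp_ge_add_one_self[of "8 * (p * M)"] pM CL by linarith
        then have "2 * exp (- 48 * (p * M)) \<le> exp (8 * (p * M)) * exp (- 48 * (p * M))" by (intro mult_right_mono) auto
        also have "\<dots> = exp (- 40 * (p * M))" by (simp add: exp_add[symmetric])
        finally show ?thesis by simp
      qed
      ultimately have "(\<Sum>D\<in>\<W>. p ^ card D) \<le> exp (- 40 * p * M)" using W(2) unfolding mult.assoc by linarith
      with W(1,3) show ?thesis by blast
    qed blast
    then obtain W where W: "\<And>S T P. ok S T P \<Longrightarrow> W S T P \<subseteq> Pow (S \<union> T)"
      "\<And>S T P. ok S T P \<Longrightarrow> (\<Sum>D\<in>W S T P. p ^ card D) \<le> exp (- 40 * p * M)"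
      "\<And>S T P Q T'. ok S T P \<Longrightarrow> Q \<subseteq> S \<Longrightarrow> T' \<subseteq> T \<Longrightarrow> \<rho>4 * p * real (card S) \<le> real (card Q) \<Longrightarrow> \<rho>4 * p * real (card T) \<le> real (card T') \<Longrightarrow>
        ec (rel P) Q T' < c2 / 256 * real (card Q) * real (card T') \<Longrightarrow> (\<exists>D\<in>W S T P. D \<subseteq> Q \<union> T')"
      by metis
    define A where "A X S T = {E. \<exists>P\<in>{P. ok S T P}. (\<forall>(a, b)\<in>P. {a, b} \<in> E) \<and> (\<forall>v\<in>X. \<exists>D\<in>W S T P. \<forall>u\<in>D. {v, u} \<in> E)}" for X S T
    define \<C> where "\<C> = {(X, S, T). X \<subseteq> {..<n} \<and> S \<subseteq> {..<n} \<and> T \<subseteq> {..<n} \<and> X \<noteq> {} \<and> S \<inter> T = {} \<and> S \<inter> X = {} \<and> T \<inter> X = {} \<and>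
      M / 4 \<le> real (card X) \<and> real (card X) \<le> 2 * M \<and> real (card S) \<le> 2 * M \<and> real (card T) \<le> 2 * M}"
    have "measure_pmf.prob (rsub (nsets {..<n} 2) p) {E. \<not> inherit_two E {..<n} p d \<epsilon> \<rho> M}
       \<le> measure_pmf.prob (rsub (nsets {..<n} 2) p) {E. \<exists>X S T. (X, S, T) \<in> \<C> \<and> E \<in> A X S T}"
    proof (intro measure_pmf.finite_measure_mono subsetI)
      fix E assume "E \<in> {E. \<not> inherit_two E {..<n} p d \<epsilon> \<rho> M}"
      then obtain G S T X where G: "G \<subseteq> E" and sub: "S \<subseteq> {..<n}" "T \<subseteq> {..<n}" "X \<subseteq> {..<n}"
        and disj: "S \<inter> T = {}" "S \<inter> X = {}" "T \<inter> X = {}" and S2: "M \<le> real (card S)" and T1: "M \<le> real (card T)"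
        and dense: "dense_pair (adj G) (d * p) \<epsilon> S T"
        and bad: "\<forall>v\<in>X. \<exists>Q T'. Q \<subseteq> S \<and> (\<forall>u\<in>Q. {v, u} \<in> G) \<and> T' \<subseteq> T \<and> (\<forall>u\<in>T'. {v, u} \<in> G) \<and>
        \<rho> * p * real (card S) \<le> real (card Q) \<and> \<rho> * p * real (card T) \<le> real (card T') \<and>
        ec (adj G) Q T' < d * p / 2^24 * real (card Q) * real (card T')" and X: "M \<le> real (card X)"
        unfolding inherit_two_def by (auto simp: not_less)
      have fin: "finite S" "finite T" using sub by (auto intro: finite_subset)
      from bad obtain Q R where QR: "\<And>v. v \<in> X \<Longrightarrow> Q v \<subseteq> S \<and> (\<forall>u\<in>Q v. {v, u} \<in> G) \<and> R v \<subseteq> T \<and> (\<forall>u\<in>R v. {v, u} \<in> G) \<and>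
        \<rho> * p * real (card S) \<le> real (card (Q v)) \<and> \<rho> * p * real (card T) \<le> real (card (R v)) \<and>
        ec (adj G) (Q v) (R v) < d * p / 2^24 * real (card (Q v)) * real (card (R v))"
        by metis
      obtain X1 where X1: "X1 \<subseteq> X" "finite X1" "M \<le> real (card X1)" "real (card X1) \<le> M + 1"
        using subset_of_ceiling_card[OF X] M by force
      have X1ne: "X1 \<noteq> {}" using X1 M by auto
      have r128: "128 \<le> \<rho> * (p * M)"
      proof -
        have "128 / \<rho> \<le> p * M" using C C0(3) CL(1) pM by linarith
        then show ?thesis using \<rho> by (simp add: field_simps)
      qed
      define \<pi> where "\<pi> = M / real (card T)"
      have T0: "0 < real (card T)" using T1 M by linarith
      have \<pi>: "0 < \<pi>" "\<pi> \<le> 1" using T1 M T0 by (auto simp: \<pi>_def)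
      have \<pi>T: "\<pi> * real (card T) = M" using T0 by (simp add: \<pi>_def)
      have "64 * ln (1 / \<epsilon>1) / (\<epsilon>1 * d) \<le> p * M" using C C0(2) CL(1) pM by linarith
      then have "64 * ln (1 / \<epsilon>1) / (\<epsilon>1 * d) * d \<le> p * M * d" using d by (intro mult_right_mono) auto
      then have big: "64 * ln (1 / \<epsilon>1) / \<epsilon>1 \<le> d * p * \<pi> * real (card T)"
        using d by (simp add: \<pi>T[symmetric] mult_ac)
      have Rbig: "\<rho> * (p * M) \<le> \<pi> * real (card (R v))" if "v \<in> X" for v
      proof -
        have "\<rho> * (p * M) = \<pi> * (\<rho> * p * real (card T))" by (simp add: \<pi>T[symmetric] mult_ac)
        also have "\<dots> \<le> \<pi> * real (card (R v))" using QR[of v] that \<pi> by (intro mult_left_mono) auto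
        finally show ?thesis .
      qed
      obtain T0 X2 where T0: "T0 \<subseteq> T" "M / 2 \<le> real (card T0)" "real (card T0) \<le> 2 * M"
        "dense_pair (adj G) c1 \<epsilon>1 S T0" and X2: "X2 \<subseteq> X1" "real (card X1) / 2 \<le> real (card X2)"
        and X2': "\<And>v. v \<in> X2 \<Longrightarrow> \<pi> * real (card (R v)) / 2 \<le> real (card (R v \<inter> T0)) \<and>
          ec (adj G) (Q v) (R v \<inter> T0) \<le> 8 * \<pi> * ec (adj G) (Q v) (R v)"
      proof -
        have RT: "R v \<subseteq> T" if "v \<in> X1" for v using QR X1(1) that by blast
        have R128: "128 \<le> \<pi> * real (card (R v))" if "v \<in> X1" for v using Rbig[of v] X1(1) that r128 by force
        have M': "64 \<le> \<pi> * real (card T)" using M \<pi>T by simp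
        show thesis
          using dense_pair_sampling[where Qs = Q and Rs = R, OF fin X1(2) X1ne dense dp e(1,3) e1(1,2) e(4) \<pi> big M' RT R128]
            that unfolding c1_def mult.assoc[of 2 \<pi>] \<pi>T by blast
      qed
      define R' where "R' v = R v \<inter> T0" for v
      have finT0: "finite T0" using T0(1) fin finite_subset by blast
      have X2ne: "finite X2" "X2 \<noteq> {}" using X2 X1 M finite_subset by auto
      have sp1: "ec (adj G) (R' v) (Q v) < 16 * (d * p / 2^24) * real (card (R' v)) * real (card (Q v))" if v: "v \<in> X2" for v
      proof -
        have vX: "v \<in> X" using v X2 X1 by auto
        have "ec (adj G) (Q v) (R v \<inter> T0) < 16 * (d * p / 2^24) * real (card (Q v)) * real (card (R v \<inter> T0))"
          using QR[OF vX] X2'[OF v] \<pi> dp by (intro sparse_sampled[of "ec (adj G) (Q v) (R v)" _ _ "real (card (R v))" _ \<pi>]) auto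
        then show ?thesis unfolding R'_def ec_adj_swap[of G "Q v"] by (simp add: mult_ac)
      qed
      define \<sigma> where "\<sigma> = M / real (card S)"
      have S0: "0 < real (card S)" using S2 M by linarith
      have \<sigma>: "0 < \<sigma>" "\<sigma> \<le> 1" using S2 M S0 by (auto simp: \<sigma>_def)
      have \<sigma>S: "\<sigma> * real (card S) = M" using S0 by (simp add: \<sigma>_def)
      have "1024 * ln (1 / \<epsilon>2) / (\<epsilon>2 * d) \<le> p * M" using C C0(4) CL(1) pM by linarith
      then have "1024 * ln (1 / \<epsilon>2) / (\<epsilon>2 * d) * (d / 16) \<le> p * M * (d / 16)" using d by (intro mult_right_mono) auto
      then have big2: "64 * ln (1 / \<epsilon>2) / \<epsilon>2 \<le> c1 * \<sigma> * real (card S)"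
        using d by (simp add: \<sigma>S[symmetric] c1_def mult_ac)
      have Qbig: "\<rho> * (p * M) \<le> \<sigma> * real (card (Q v))" if "v \<in> X" for v
      proof -
        have "\<rho> * (p * M) = \<sigma> * (\<rho> * p * real (card S))" by (simp add: \<sigma>S[symmetric] mult_ac)
        also have "\<dots> \<le> \<sigma> * real (card (Q v))" using QR[of v] that \<sigma> by (intro mult_left_mono) auto
        finally show ?thesis .
      qed
      obtain S0 X0 where S0: "S0 \<subseteq> S" "M / 2 \<le> real (card S0)" "real (card S0) \<le> 2 * M"
        "dense_pair (adj G) c2 \<epsilon>2 T0 S0" and X0: "X0 \<subseteq> X2" "real (card X2) / 2 \<le> real (card X0)"
        and X0': "\<And>v. v \<in> X0 \<Longrightarrow> \<sigma> * real (card (Q v)) / 2 \<le> real (card (Q v \<inter> S0)) \<and>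
          ec (adj G) (R' v) (Q v \<inter> S0) \<le> 8 * \<sigma> * ec (adj G) (R' v) (Q v)"
      proof -
        have QS: "Q v \<subseteq> S" if "v \<in> X2" for v using QR X1(1) X2(1) that by blast
        have Q128: "128 \<le> \<sigma> * real (card (Q v))" if "v \<in> X2" for v using Qbig[of v] X1(1) X2(1) that r128 by force
        have M': "64 \<le> \<sigma> * real (card S)" using M \<sigma>S by simp
        have c12: "c1 / 16 = c2" by (simp add: c1_def c2_def)
        show thesis
          using dense_pair_sampling[where Qs = R' and Rs = Q, OF finT0 fin(1) X2ne dense_adj_swap[OF T0(4)] c1 e1(1,3) e2(1,2) e1(4) \<sigma> big2 M' QS Q128]
            that unfolding c12 mult.assoc[of 2 \<sigma>] \<sigma>S by blast
      qed
      have finS0: "finite S0" using S0(1) fin finite_subset by blast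
      define P where "P = {(a, b) \<in> S0 \<times> T0. {a, b} \<in> G}"
      have relP: "rel P a b \<longleftrightarrow> adj G a b" if "a \<in> S0" "b \<in> T0" for a b
        using that by (auto simp: rel_def P_def adj_def)
      have "dense_pair (rel P) c2 \<epsilon>2 S0 T0"
        using dense_pair_cong[of S0 T0 "rel P" "adj G"] relP dense_adj_swap[OF S0(4)] by blast
      moreover have "S0 \<inter> T0 = {}" using S0(1) T0(1) disj by auto
      ultimately have okP: "ok S0 T0 P" using S0(2,3) T0(2) finS0 finT0 by (auto simp: ok_def P_def)
      have "\<exists>D\<in>W S0 T0 P. \<forall>u\<in>D. {v, u} \<in> E" if v: "v \<in> X0" for v
      proof -
        have vX: "v \<in> X" "v \<in> X2" using v X0 X1 X2 by auto
        have eq: "ec (rel P) (Q v \<inter> S0) (R' v) = ec (adj G) (Q v \<inter> S0) (R' v)"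
          unfolding ec_def using relP by (intro sum.cong) (auto simp: R'_def)
        have "ec (adj G) (R' v) (Q v \<inter> S0) < 16 * (16 * (d * p / 2^24)) * real (card (R' v)) * real (card (Q v \<inter> S0))"
          by (rule sparse_sampled[OF sp1[OF vX(2)] conjunct2[OF X0'[OF v]] conjunct1[OF X0'[OF v]] \<sigma>(1)]) (use dp in auto)
        \<comment> \<open>Here 2^24 is used up exactly: 16 for the density lost in each of two
          samplings, 256 in the two-sided containers, and 16 for the surplus of edges in each
          sampling.\<close>
        also have "16 * (16 * (d * p / 2^24)) = c2 / 256" by (simp add: c2_def)
        finally have lt: "ec (rel P) (Q v \<inter> S0) (R' v) < c2 / 256 * real (card (Q v \<inter> S0)) * real (card (R' v))"
          unfolding eq ec_adj_swap[of G "Q v \<inter> S0"] by (simp add: mult_ac)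
        have sz: "\<rho>4 * p * y \<le> \<rho> * (p * M) / 2" if "y \<le> 2 * M" for y
        proof -
          have "\<rho>4 * p * y \<le> \<rho>4 * p * (2 * M)" using that \<rho>4 p by (intro mult_left_mono) auto
          then show ?thesis by (simp add: \<rho>4_def mult_ac)
        qed
        have s1: "\<rho>4 * p * real (card S0) \<le> real (card (Q v \<inter> S0))"
          using sz[OF S0(3)] Qbig[OF vX(1)] X0'[OF v] by linarith
        have s2: "\<rho>4 * p * real (card T0) \<le> real (card (R' v))"
          using sz[OF T0(3)] Rbig[OF vX(1)] X2'[OF vX(2)] unfolding R'_def by linarith
        obtain D where "D \<in> W S0 T0 P" "D \<subseteq> (Q v \<inter> S0) \<union> R' v"
          using W(3)[OF okP _ _ s1 s2 lt] unfolding R'_def by auto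
        moreover have "{v, u} \<in> E" if "u \<in> D" for u
        proof -
          have "u \<in> Q v \<or> u \<in> R v" using that \<open>D \<subseteq> (Q v \<inter> S0) \<union> R' v\<close> by (auto simp: R'_def)
          then show ?thesis using QR[OF vX(1)] G by blast
        qed
        ultimately show ?thesis by blast
      qed
      moreover have "\<forall>(a, b)\<in>P. {a, b} \<in> E" using G by (auto simp: P_def)
      ultimately have "E \<in> A X0 S0 T0" using okP unfolding A_def by auto
      moreover have "(X0, S0, T0) \<in> \<C>"
      proof -
        have "X0 \<subseteq> X1" using X0 X2 by auto
        then have "card X0 \<le> card X1" using X1(2) card_mono by blast
        then have "real (card X0) \<le> 2 * M" using X1(4) M by linarith
        moreover have "M / 4 \<le> real (card X0)" using X0(2) X2(2) X1(3) by linarith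
        moreover from this have "X0 \<noteq> {}" using M by auto
        moreover have "X0 \<subseteq> X" "T0 \<subseteq> T" using X0 X1 X2 T0 by auto
        ultimately show ?thesis unfolding \<C>_def using sub disj T0(3) S0(1,3) by auto
      qed
      ultimately show "E \<in> {E. \<exists>X S T. (X, S, T) \<in> \<C> \<and> E \<in> A X S T}" by blast
    qed simp
    also have "\<dots> \<le> exp (3 / real (card {..<n})) - 1"
    proof (rule union_bound_triples)
      fix X S T assume "(X, S, T) \<in> \<C>"
      then have sub: "X \<subseteq> {..<n}" "S \<subseteq> {..<n}" "T \<subseteq> {..<n}" and disj: "S \<inter> T = {}" "S \<inter> X = {}" "T \<inter> X = {}"
        and sz: "M / 4 \<le> real (card X)" "real (card X) \<le> 2 * M" "real (card S) \<le> 2 * M" "real (card T) \<le> 2 * M"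
        by (auto simp: \<C>_def)
      define s t x where "s = real (card S)" "t = real (card T)" "x = real (card X)"
      note stx = s_t_x_def
      have "measure_pmf.prob (rsub (nsets {..<n} 2) p) (A X S T) \<le> exp (p * real (card S) * real (card T)) * exp (- 40 * p * M) ^ card X"
        unfolding A_def using sub disj p W(2)
      proof (intro first_moment[where V = "{..<n}"])
        show "{P. ok S T P} \<subseteq> Pow (S \<times> T)" by (auto simp: ok_def)
        show "W S T P \<subseteq> Pow (S \<union> T)" if "P \<in> {P. ok S T P}" for P using W(1)[of S T P] that by blast
      qed auto
      also have "\<dots> = exp (p * s * t - 40 * p * M * x)"
        by (simp add: exp_of_nat_mult[symmetric] exp_add[symmetric] stx)
      also have "\<dots> \<le> exp (- 2 * L * (x + s + t))"
      proof -
        have s: "0 \<le> s" "s \<le> 2 * M" "0 \<le> t" "t \<le> 2 * M" "x \<le> 2 * M" using sz by (auto simp: stx)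
        define u where "u = p * M"
        have u: "0 \<le> u" using M p by (simp add: u_def)
        have "p * s * t \<le> p * (2 * M) * (2 * M)" using s p M by (intro mult_mono) auto
        then have h1: "p * s * t \<le> 4 * (u * M)" by (simp add: u_def)
        have "u * (M / 4) \<le> u * x" using sz u by (intro mult_left_mono) (auto simp: stx)
        then have h2: "u * M \<le> 4 * (u * x)" by simp
        have "64 * L \<le> C * L" using C C0(1) L1 by (intro mult_right_mono) auto
        then have "64 * L \<le> u" using pM by (simp add: u_def)
        from mult_right_mono[OF this, of M] have h4: "64 * (L * M) \<le> u * M" using M by simp
        have h7: "L * x \<le> L * (2 * M)" "L * t \<le> L * (2 * M)" "L * s \<le> L * (2 * M)"
          using s L1 by auto
        have h8: "0 \<le> L * M" using L1 M by auto
        have "p * s * t - 40 * (u * x) \<le> - 2 * (L * x) - 2 * (L * s) - 2 * (L * t)"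
          using h1 h2 h4 h7 h8 by linarith
        also have "\<dots> = - 2 * L * (x + s + t)" by (simp add: algebra_simps)
        finally show ?thesis by (simp add: u_def mult.assoc)
      qed
      also have "\<dots> = (1 / (real n)\<^sup>2) ^ (card X + card S + card T)"
      proof -
        have "exp (- L) = 1 / real n" using n by (simp add: L_def exp_minus inverse_eq_divide)
        moreover have "exp (- 2 * L) = exp (- L) * exp (- L)" unfolding exp_add[symmetric] by simp
        ultimately have eq: "(1 / (real n)\<^sup>2) = exp (- 2 * L)" by (simp add: power2_eq_square)
        show ?thesis unfolding eq exp_of_nat_mult[symmetric] by (simp add: stx algebra_simps)
      qed
      finally show "measure_pmf.prob (rsub (nsets {..<n} 2) p) (A X S T) \<le> (1 / (real (card {..<n}))\<^sup>2) ^ (card X + card S + card T)" by simp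
    qed (use n in \<open>auto simp: \<C>_def lessThan_empty_iff\<close>)
    finally show ?thesis by (simp add: M_def L_def)
  qed
  show ?thesis
    using e main C0(1) by (intro exI[of _ \<epsilon>] conjI exI[of _ C0]) auto
qed

section \<open>Upper regularity and a Hall-type property of the random graph\<close>

text \<open>The additive error makes the condition meaningful for sets of linear size only, and it
  is applied to clusters, unions of clusters and the whole vertex set. The sets may overlap; an edge
  inside the overlap is counted twice.\<close>

definition upper_regular :: "nat set set \<Rightarrow> nat \<Rightarrow> real \<Rightarrow> real \<Rightarrow> bool" where
  "upper_regular E n p \<delta> \<longleftrightarrow> (\<forall>A B. A \<subseteq> {..<n} \<longrightarrow> B \<subseteq> {..<n} \<longrightarrow>
     ec (adj E) A B \<le> (1 + \<delta>) * p * real (card A) * real (card B) + 2 * \<delta> * p * (real n)\<^sup>2)"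

text \<open>Ordered pairs are split by orientation, so that each half corresponds to a set of
  potential edges to which the upper tail bound applies. There are 4^n pairs of sets, and the
  additive slack makes each half fail with probability at most exp(-3n).\<close>

lemma upper_regular_prob:
  assumes \<delta>: "0 < \<delta>" and p: "0 \<le> p" "p \<le> 1" and big: "3 \<le> \<delta> * ln (1 + \<delta>) * p * real n"
  shows "measure_pmf.prob (rsub (nsets {..<n} 2) p) {E. \<not> upper_regular E n p \<delta>} \<le> 2 * exp (- real n)"
proof -
  define \<tau> where "\<tau> = \<delta> * p * (real n)\<^sup>2"
  define F1 where "F1 A B = (\<lambda>x. {fst x, snd x}) ` {x\<in>A \<times> B. fst x < snd x}" for A B :: "nat set"
  define F2 where "F2 A B = (\<lambda>x. {fst x, snd x}) ` {x\<in>A \<times> B. snd x < fst x}" for A B :: "nat set"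
  define bad where "bad F = {E. (1 + \<delta>) * p * real (card F) + \<tau> \<le> real (card (E \<inter> F))}" for F :: "nat set set"
  define M where "M = rsub (nsets {..<n} 2) p"
  let ?PP = "Pow {..<n} \<times> Pow {..<n}"
  have inj1: "inj_on (\<lambda>x. {fst x, snd x}) {x\<in>A \<times> B. fst x < snd x}" for A B :: "nat set"
    by (auto simp: inj_on_def doubleton_eq_iff)
  have inj2: "inj_on (\<lambda>x. {fst x, snd x}) {x\<in>A \<times> B. snd x < fst x}" for A B :: "nat set"
    by (auto simp: inj_on_def doubleton_eq_iff)
  have Fsub: "F1 A B \<subseteq> nsets {..<n} 2" "F2 A B \<subseteq> nsets {..<n} 2" if "A \<subseteq> {..<n}" "B \<subseteq> {..<n}" for A B
    using that by (auto simp: F1_def F2_def nsets_def card_insert_if)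
  have "{E. \<not> upper_regular E n p \<delta>} \<subseteq> (\<Union>x\<in>?PP. bad (F1 (fst x) (snd x)) \<union> bad (F2 (fst x) (snd x))) \<union> (- Pow (nsets {..<n} 2))"
  proof
    fix E assume "E \<in> {E. \<not> upper_regular E n p \<delta>}"
    then obtain A B where AB: "A \<subseteq> {..<n}" "B \<subseteq> {..<n}"
      "(1 + \<delta>) * p * real (card A) * real (card B) + 2 * \<tau> < ec (adj E) A B"
      unfolding upper_regular_def \<tau>_def by (auto simp: not_le mult.assoc)
    have fin: "finite A" "finite B" using AB by (auto intro: finite_subset)
    show "E \<in> (\<Union>x\<in>?PP. bad (F1 (fst x) (snd x)) \<union> bad (F2 (fst x) (snd x))) \<union> (- Pow (nsets {..<n} 2))"
    proof (cases "E \<subseteq> nsets {..<n} 2")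
      case True
      define P1 where "P1 = {x\<in>A \<times> B. fst x < snd x}"
      define P2 where "P2 = {x\<in>A \<times> B. snd x < fst x}"
      define P where "P = {x\<in>A \<times> B. {fst x, snd x} \<in> E}"
      have finP: "finite P1" "finite P2" "finite P" using fin by (auto simp: P1_def P2_def P_def)
      have no_loop: "{a, a} \<notin> E" for a using True by (auto simp: nsets_def)
      have "ec (adj E) A B = (\<Sum>x\<in>A \<times> B. of_bool ({fst x, snd x} \<in> E))"
        unfolding ec_def adj_def by (simp add: sum.cartesian_product case_prod_beta)
      also have "\<dots> = real (card P)" using fin by (simp add: P_def Int_def conj_commute flip: sum.inter_filter)
      also have "P = (P \<inter> P1) \<union> (P \<inter> P2)"
      proof -
        have "x \<in> P1 \<or> x \<in> P2" if "x \<in> P" for x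
        proof -
          have "fst x \<noteq> snd x" using that no_loop[of "snd x"] by (auto simp: P_def)
          then show ?thesis using that by (auto simp: P_def P1_def P2_def)
        qed
        then show ?thesis by auto
      qed
      finally have "ec (adj E) A B \<le> real (card (P \<inter> P1)) + real (card (P \<inter> P2))"
        using card_Un_le[of "P \<inter> P1" "P \<inter> P2"] by linarith
      moreover have "card (P \<inter> P1) \<le> card (E \<inter> F1 A B)"
      proof (rule card_inj_on_le)
        show "inj_on (\<lambda>x. {fst x, snd x}) (P \<inter> P1)" using inj1[of A B] by (rule inj_on_subset) (auto simp: P1_def)
        show "(\<lambda>x. {fst x, snd x}) ` (P \<inter> P1) \<subseteq> E \<inter> F1 A B" by (auto simp: P_def P1_def F1_def)
        show "finite (E \<inter> F1 A B)" unfolding F1_def using finP(1) by (auto simp: P1_def)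
      qed
      moreover have "card (P \<inter> P2) \<le> card (E \<inter> F2 A B)"
      proof (rule card_inj_on_le)
        show "inj_on (\<lambda>x. {fst x, snd x}) (P \<inter> P2)" using inj2[of A B] by (rule inj_on_subset) (auto simp: P2_def)
        show "(\<lambda>x. {fst x, snd x}) ` (P \<inter> P2) \<subseteq> E \<inter> F2 A B" by (auto simp: P_def P2_def F2_def)
        show "finite (E \<inter> F2 A B)" unfolding F2_def using finP(2) by (auto simp: P2_def)
      qed
      moreover have "card (F1 A B) + card (F2 A B) \<le> card A * card B"
      proof -
        have "card (F1 A B) + card (F2 A B) = card P1 + card P2"
          unfolding F1_def F2_def P1_def P2_def using inj1 inj2 by (simp add: card_image)
        also have "\<dots> = card (P1 \<union> P2)" using finP by (intro card_Un_disjoint[symmetric]) (auto simp: P1_def P2_def)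
        also have "\<dots> \<le> card (A \<times> B)" using fin by (intro card_mono) (auto simp: P1_def P2_def)
        finally show ?thesis by (simp add: card_cartesian_product)
      qed
      then have "real (card (F1 A B)) + real (card (F2 A B)) \<le> real (card A) * real (card B)"
        by (metis of_nat_add of_nat_le_iff of_nat_mult)
      then have "(1 + \<delta>) * p * (real (card (F1 A B)) + real (card (F2 A B))) \<le> (1 + \<delta>) * p * (real (card A) * real (card B))"
        using \<delta> p by (intro mult_left_mono) auto
      ultimately have "E \<in> bad (F1 A B) \<or> E \<in> bad (F2 A B)"
        using AB(3) unfolding bad_def by (auto simp: algebra_simps)
      then show ?thesis using AB by force
    qed auto
  qed
  then have "measure_pmf.prob M {E. \<not> upper_regular E n p \<delta>}
     \<le> measure_pmf.prob M ((\<Union>x\<in>?PP. bad (F1 (fst x) (snd x)) \<union> bad (F2 (fst x) (snd x))) \<union> (- Pow (nsets {..<n} 2)))"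
    by (intro measure_pmf.finite_measure_mono) auto
  also have "\<dots> \<le> measure_pmf.prob M (\<Union>x\<in>?PP. bad (F1 (fst x) (snd x)) \<union> bad (F2 (fst x) (snd x))) + measure_pmf.prob M (- Pow (nsets {..<n} 2))"
    by (rule measure_Un_le) auto
  also have "measure_pmf.prob M (- Pow (nsets {..<n} 2)) = 0"
    using set_pmf_rsub[of "nsets {..<n} 2" p] by (auto simp: measure_pmf_zero_iff M_def)
  also have "measure_pmf.prob M (\<Union>x\<in>?PP. bad (F1 (fst x) (snd x)) \<union> bad (F2 (fst x) (snd x)))
     \<le> (\<Sum>x\<in>?PP. measure_pmf.prob M (bad (F1 (fst x) (snd x)) \<union> bad (F2 (fst x) (snd x))))"
    by (intro measure_pmf.finite_measure_subadditive_finite) auto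
  also have "\<dots> \<le> (\<Sum>x\<in>?PP. 2 * exp (- \<tau> * ln (1 + \<delta>)))"
  proof (rule sum_mono)
    fix x assume x: "x \<in> ?PP"
    have 1: "measure_pmf.prob M (bad F) \<le> exp (- \<tau> * ln (1 + \<delta>))" if "F \<subseteq> nsets {..<n} 2" for F
      unfolding bad_def M_def using that \<delta> p
      by (intro prob_rsub_upper_tail) (auto simp: \<tau>_def finite_imp_finite_nsets)
    have "measure_pmf.prob M (bad (F1 (fst x) (snd x)) \<union> bad (F2 (fst x) (snd x)))
       \<le> measure_pmf.prob M (bad (F1 (fst x) (snd x))) + measure_pmf.prob M (bad (F2 (fst x) (snd x)))"
      by (rule measure_Un_le) auto
    then show "measure_pmf.prob M (bad (F1 (fst x) (snd x)) \<union> bad (F2 (fst x) (snd x))) \<le> 2 * exp (- \<tau> * ln (1 + \<delta>))"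
      using 1[OF Fsub(1)[of "fst x" "snd x"]] 1[OF Fsub(2)[of "fst x" "snd x"]] x by auto
  qed
  also have "\<dots> = 2 ^ n * 2 ^ n * (2 * exp (- \<tau> * ln (1 + \<delta>)))"
    by (simp add: card_cartesian_product card_Pow)
  also have "\<dots> \<le> exp (real n) * exp (real n) * (2 * exp (- \<tau> * ln (1 + \<delta>)))"
  proof -
    have "(2::real) ^ n \<le> exp 1 ^ n" using exp_ge_add_one_self[of 1] by (intro power_mono) auto
    then have "(2::real) ^ n \<le> exp (real n)" by (simp add: exp_of_nat_mult[symmetric])
    then show ?thesis by (intro mult_right_mono mult_mono) auto
  qed
  also have "\<dots> = 2 * exp (2 * real n - \<tau> * ln (1 + \<delta>))" by (simp add: exp_add[symmetric])
  also have "\<dots> \<le> 2 * exp (- real n)"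
  proof -
    have "3 * real n \<le> \<delta> * ln (1 + \<delta>) * p * real n * real n" using big by (intro mult_right_mono) auto
    also have "\<dots> = \<tau> * ln (1 + \<delta>)" by (simp add: \<tau>_def power2_eq_square)
    finally show ?thesis by simp
  qed
  finally show ?thesis by (simp add: M_def)
qed

text \<open>Shaped after a failure of Hall's condition: \<open>\<T>\<close> stands for the images of
  the embedded neighbours of the vertices in a violating set, and \<open>W\<close> for the union of
  their candidate sets.\<close>

definition hall_property :: "nat set set \<Rightarrow> nat \<Rightarrow> real \<Rightarrow> nat \<Rightarrow> real \<Rightarrow> bool" where
  "hall_property E n p \<Delta> c \<longleftrightarrow> (\<forall>\<T> W. (\<forall>\<tau>\<in>\<T>. \<tau> \<subseteq> {..<n} \<and> \<tau> \<noteq> {} \<and> card \<tau> \<le> \<Delta>) \<longrightarrow>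
     disjoint \<T> \<longrightarrow> W \<subseteq> {..<n} \<longrightarrow> W \<inter> \<Union>\<T> = {} \<longrightarrow> card W < card \<T> \<longrightarrow> real (card W) \<le> c / exp 2 * real n \<longrightarrow>
     (\<exists>\<tau>\<in>\<T>. real (card {w\<in>W. \<forall>v\<in>\<tau>. {v, w} \<in> E}) < c * p ^ card \<tau> * real n))"

lemma card_small_subsets:
  assumes "finite V"
  shows "card {\<tau>. \<tau> \<subseteq> V \<and> \<tau> \<noteq> {} \<and> card \<tau> \<le> \<Delta>} \<le> card V ^ \<Delta>"
proof -
  have "{\<tau>. \<tau> \<subseteq> V \<and> \<tau> \<noteq> {} \<and> card \<tau> \<le> \<Delta>} \<subseteq> (\<lambda>f. f ` {..<\<Delta>}) ` ({..<\<Delta>} \<rightarrow>\<^sub>E V)"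
  proof
    fix \<tau> assume "\<tau> \<in> {\<tau>. \<tau> \<subseteq> V \<and> \<tau> \<noteq> {} \<and> card \<tau> \<le> \<Delta>}"
    then have t: "\<tau> \<subseteq> V" "\<tau> \<noteq> {}" "card \<tau> \<le> \<Delta>" by auto
    then have ft: "finite \<tau>" using assms finite_subset by blast
    obtain h where h: "bij_betw h {0..<card \<tau>} \<tau>" using ex_bij_betw_nat_finite[OF ft] by blast
    obtain a where a: "a \<in> \<tau>" using t by auto
    define f where "f = (\<lambda>i\<in>{..<\<Delta>}. if i < card \<tau> then h i else a)"
    have him: "h ` {0..<card \<tau>} = \<tau>" using h by (simp add: bij_betw_def)
    have "f ` {..<\<Delta>} = \<tau>"
    proof
      show "f ` {..<\<Delta>} \<subseteq> \<tau>" using him a by (auto simp: f_def)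
      show "\<tau> \<subseteq> f ` {..<\<Delta>}"
      proof
        fix x assume "x \<in> \<tau>"
        then have "x \<in> h ` {0..<card \<tau>}" using him by simp
        then obtain i where i: "i < card \<tau>" "x = h i" by auto
        then have "f i = x" "i < \<Delta>" using t by (auto simp: f_def)
        then show "x \<in> f ` {..<\<Delta>}" by auto
      qed
    qed
    moreover have "h i \<in> \<tau>" if "i < card \<tau>" for i
    proof -
      have "h i \<in> h ` {0..<card \<tau>}" using that by auto
      then show ?thesis using him by simp
    qed
    then have "f \<in> {..<\<Delta>} \<rightarrow>\<^sub>E V" using a t(1) by (auto simp: f_def)
    ultimately show "\<tau> \<in> (\<lambda>f. f ` {..<\<Delta>}) ` ({..<\<Delta>} \<rightarrow>\<^sub>E V)" by blast
  qed
  then have "card {\<tau>. \<tau> \<subseteq> V \<and> \<tau> \<noteq> {} \<and> card \<tau> \<le> \<Delta>} \<le> card ((\<lambda>f. f ` {..<\<Delta>}) ` ({..<\<Delta>} \<rightarrow>\<^sub>E V))"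
    using assms by (intro card_mono finite_imageI finite_PiE) auto
  also have "\<dots> \<le> card ({..<\<Delta>} \<rightarrow>\<^sub>E V)" using assms by (intro card_image_le finite_PiE) auto
  also have "\<dots> = card V ^ \<Delta>" by (simp add: card_PiE)
  finally show ?thesis .
qed

text \<open>Disjointness makes all relevant vertex pairs distinct. As |W| \<le> cn/e^2, tilting by
  e^2 bounds the weight of many common neighbours by n^(-(\<Delta>+2)) per tuple. Of these
  exponents, \<Delta> pay for choosing the tuple, one for an element of \<open>W\<close>, which is
  smaller than the family, and one remains.\<close>

lemma hall_property_prob:
  assumes c: "0 < c" and p: "0 \<le> p" "p \<le> 1" and n: "2 \<le> n" and big: "(real \<Delta> + 2) * ln (real n) \<le> c * p ^ \<Delta> * real n"
  shows "measure_pmf.prob (rsub (nsets {..<n} 2) p) {E. \<not> hall_property E n p \<Delta> c} \<le> (exp (1 / real n) - 1) * exp 1"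
proof -
  define V where "V = {..<n}"
  define M where "M = rsub (nsets V 2) p"
  define h where "h \<tau> = c * p ^ card \<tau> * real n" for \<tau> :: "nat set"
  define J0 where "J0 = {\<tau>. \<tau> \<subseteq> V \<and> \<tau> \<noteq> {} \<and> card \<tau> \<le> \<Delta>}"
  define \<C> where "\<C> = {(\<T>, W). \<T> \<subseteq> J0 \<and> disjoint \<T> \<and> W \<subseteq> V \<and> W \<inter> \<Union>\<T> = {} \<and> card W < card \<T> \<and> real (card W) \<le> c / exp 2 * real n}"
  define A where "A \<T> W = {E. \<forall>\<tau>\<in>\<T>. \<exists>Y\<subseteq>W. h \<tau> \<le> real (card Y) \<and> (\<forall>v\<in>\<tau>. \<forall>w\<in>Y. {v, w} \<in> E)}" for \<T> W
  define L where "L = ln (real n)"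
  have L: "0 < L" using n by (simp add: L_def)
  have finV: "finite V" "card V = n" by (auto simp: V_def)
  have finJ: "finite J0" unfolding J0_def using finV by auto
  have subC: "\<C> \<subseteq> (Pow J0 - {{}}) \<times> Pow V"
  proof
    fix t assume "t \<in> \<C>"
    then show "t \<in> (Pow J0 - {{}}) \<times> Pow V" by (cases t) (auto simp: \<C>_def)
  qed
  have finC: "finite \<C>" by (rule finite_subset[OF subC]) (use finJ finV in auto)
  have key: "measure_pmf.prob M (A \<T> W) \<le> (1 / real n) ^ ((\<Delta> + 1) * card \<T> + card W)" if TW: "(\<T>, W) \<in> \<C>" for \<T> W
  proof -
    have T: "\<T> \<subseteq> J0" "disjoint \<T>" "W \<subseteq> V" "W \<inter> \<Union>\<T> = {}" "card W < card \<T>" "real (card W) \<le> c / exp 2 * real n"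
      using TW by (auto simp: \<C>_def)
    have finT: "finite \<T>" using T(1) finJ finite_subset by blast
    have finW: "finite W" using T(3) finV finite_subset by blast
    define Ys where "Ys \<tau> = {Y. Y \<subseteq> W \<and> h \<tau> \<le> real (card Y)}" for \<tau>
    have finYs: "finite (Ys \<tau>)" for \<tau> unfolding Ys_def using finW by auto
    define I where "I = Pi\<^sub>E \<T> Ys"
    have finI: "finite I" unfolding I_def using finT finYs by (intro finite_PiE) auto
    define e where "e x = {fst x, snd x}" for x :: "nat \<times> nat"
    define J where "J f = (\<Union>\<tau>\<in>\<T>. \<tau> \<times> f \<tau>)" for f :: "nat set \<Rightarrow> nat set"
    define \<E> where "\<E> = (\<lambda>f. e ` J f) ` I"
    have fY: "f \<tau> \<subseteq> W" if "f \<in> I" "\<tau> \<in> \<T>" for f \<tau> using that by (auto simp: I_def Ys_def PiE_iff)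
    have JU: "J f \<subseteq> \<Union>\<T> \<times> W" if "f \<in> I" for f using fY[OF that] unfolding J_def by blast
    have inj: "inj_on e (\<Union>\<T> \<times> W)" using T(4) unfolding inj_on_def e_def by (auto simp: doubleton_eq_iff)
    have E2: "e ` (\<Union>\<T> \<times> W) \<subseteq> nsets V 2"
    proof
      fix z assume "z \<in> e ` (\<Union>\<T> \<times> W)"
      then obtain v w \<tau> where z: "z = {v, w}" "v \<in> \<tau>" "\<tau> \<in> \<T>" "w \<in> W" by (auto simp: e_def)
      have "v \<in> V" "w \<in> V" "v \<noteq> w" using z T by (auto simp: J0_def)
      then show "z \<in> nsets V 2" using z by (auto simp: nsets_def card_insert_if)
    qed
    have \<E>sub: "\<E> \<subseteq> Pow (nsets V 2)" using JU E2 unfolding \<E>_def by blast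
    have "measure_pmf.prob M (A \<T> W) \<le> measure_pmf.prob M {E. \<exists>D\<in>\<E>. D \<subseteq> E}"
    proof (intro measure_pmf.finite_measure_mono subsetI)
      fix E assume "E \<in> A \<T> W"
      then have "\<forall>\<tau>\<in>\<T>. \<exists>Y. Y \<in> Ys \<tau> \<and> (\<forall>v\<in>\<tau>. \<forall>w\<in>Y. {v, w} \<in> E)" unfolding A_def Ys_def by blast
      then obtain f where f: "\<And>\<tau>. \<tau> \<in> \<T> \<Longrightarrow> f \<tau> \<in> Ys \<tau> \<and> (\<forall>v\<in>\<tau>. \<forall>w\<in>f \<tau>. {v, w} \<in> E)" by metis
      have "restrict f \<T> \<in> I" using f by (auto simp: I_def)
      moreover have "e ` J (restrict f \<T>) \<subseteq> E" using f by (auto simp: J_def e_def)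
      ultimately show "E \<in> {E. \<exists>D\<in>\<E>. D \<subseteq> E}" unfolding \<E>_def by blast
    qed simp
    also have "\<dots> \<le> (\<Sum>D\<in>\<E>. p ^ card D)"
      unfolding M_def using finV p \<E>sub by (intro prob_rsub_family) (auto simp: finite_imp_finite_nsets)
    also have "\<dots> \<le> (\<Sum>f\<in>I. p ^ card (e ` J f))"
      unfolding \<E>_def using p finI sum_image_le[of I "\<lambda>D. p ^ card D" "\<lambda>x. e ` J x"] by (simp add: o_def)
    also have "\<dots> = (\<Sum>f\<in>I. \<Prod>\<tau>\<in>\<T>. (p ^ card \<tau>) ^ card (f \<tau>))"
    proof (rule sum.cong[OF refl])
      fix f assume f: "f \<in> I"
      have "card (e ` J f) = card (J f)" using inj_on_subset[OF inj JU[OF f]] by (rule card_image)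
      also have "\<dots> = (\<Sum>\<tau>\<in>\<T>. card (\<tau> \<times> f \<tau>))"
        unfolding J_def
      proof (rule card_UN_disjoint[OF finT])
        show "\<forall>\<tau>\<in>\<T>. finite (\<tau> \<times> f \<tau>)"
        proof (intro ballI finite_cartesian_product)
          fix \<tau> assume "\<tau> \<in> \<T>"
          then show "finite \<tau>" "finite (f \<tau>)"
            using fY[OF f] finite_subset[OF _ finW] finite_subset[OF _ finV(1)] T(1) by (auto simp: J0_def)
        qed
        show "\<forall>i\<in>\<T>. \<forall>j\<in>\<T>. i \<noteq> j \<longrightarrow> i \<times> f i \<inter> j \<times> f j = {}"
          using T(2) by (auto simp: disjoint_def)
      qed
      finally have "card (e ` J f) = (\<Sum>\<tau>\<in>\<T>. card \<tau> * card (f \<tau>))" by (simp add: card_cartesian_product)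
      then show "p ^ card (e ` J f) = (\<Prod>\<tau>\<in>\<T>. (p ^ card \<tau>) ^ card (f \<tau>))"
        by (simp add: power_sum power_mult)
    qed
    also have "\<dots> = (\<Prod>\<tau>\<in>\<T>. \<Sum>Y\<in>Ys \<tau>. (p ^ card \<tau>) ^ card Y)"
      unfolding I_def using finT finYs by (intro prod_sum_PiE[symmetric]) auto
    also have "\<dots> \<le> (\<Prod>\<tau>\<in>\<T>. exp (- ((real \<Delta> + 2) * L)))"
    proof (rule prod_mono, intro conjI)
      fix \<tau> assume t: "\<tau> \<in> \<T>"
      show "0 \<le> (\<Sum>Y\<in>Ys \<tau>. (p ^ card \<tau>) ^ card Y)" using p by (intro sum_nonneg) auto
      have "(\<Sum>Y\<in>Ys \<tau>. (p ^ card \<tau>) ^ card Y) \<le> exp (exp 2 * p ^ card \<tau> * real (card W) - h \<tau> * ln (exp 2))"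
        unfolding Ys_def using finW p by (intro sum_large_subsets_le) auto
      also have "\<dots> \<le> exp (- ((real \<Delta> + 2) * L))"
      proof -
        have "exp 2 * p ^ card \<tau> * real (card W) \<le> exp 2 * p ^ card \<tau> * (c / exp 2 * real n)"
          using T(6) p by (intro mult_left_mono) auto
        also have "\<dots> = h \<tau>" by (simp add: h_def)
        finally have 1: "exp 2 * p ^ card \<tau> * real (card W) \<le> h \<tau>" .
        have "card \<tau> \<le> \<Delta>" using t T(1) by (auto simp: J0_def)
        then have "p ^ \<Delta> \<le> p ^ card \<tau>" using p by (intro power_decreasing) auto
        then have "c * p ^ \<Delta> * real n \<le> h \<tau>" unfolding h_def using c by (intro mult_right_mono mult_left_mono) auto
        then have "(real \<Delta> + 2) * L \<le> h \<tau>" using big unfolding L_def by linarith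
        then show ?thesis using 1 unfolding exp_le_cancel_iff ln_exp by linarith
      qed
      finally show "(\<Sum>Y\<in>Ys \<tau>. (p ^ card \<tau>) ^ card Y) \<le> exp (- ((real \<Delta> + 2) * L))" .
    qed
    also have "\<dots> = exp (- (real ((\<Delta> + 2) * card \<T>) * L))"
      by (simp add: exp_of_nat_mult[symmetric] algebra_simps)
    also have "\<dots> \<le> exp (- (real ((\<Delta> + 1) * card \<T> + card W) * L))"
    proof -
      have "(\<Delta> + 1) * card \<T> + card W \<le> (\<Delta> + 2) * card \<T>" using T(5) by simp
      then have "real ((\<Delta> + 1) * card \<T> + card W) * L \<le> real ((\<Delta> + 2) * card \<T>) * L" 
        using L by (intro mult_right_mono of_nat_mono) auto
      then show ?thesis unfolding exp_le_cancel_iff by linarith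
    qed
    also have "\<dots> = (1 / real n) ^ ((\<Delta> + 1) * card \<T> + card W)"
    proof -
      have "1 / real n = exp (- L)" using n by (simp add: L_def exp_minus inverse_eq_divide)
      moreover have "exp (- (real N * L)) = exp (- L) ^ N" for N
        using exp_of_nat_mult[of N "- L"] by simp
      ultimately show ?thesis by (simp only:)
    qed
    finally show ?thesis .
  qed
  have "measure_pmf.prob M {E. \<not> hall_property E n p \<Delta> c} \<le> measure_pmf.prob M (\<Union>t\<in>\<C>. A (fst t) (snd t))"
  proof (intro measure_pmf.finite_measure_mono subsetI)
    fix E assume "E \<in> {E. \<not> hall_property E n p \<Delta> c}"
    then obtain \<T> W where *: "\<forall>\<tau>\<in>\<T>. \<tau> \<subseteq> {..<n} \<and> \<tau> \<noteq> {} \<and> card \<tau> \<le> \<Delta>" "disjoint \<T>" "W \<subseteq> {..<n}" "W \<inter> \<Union>\<T> = {}"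
      "card W < card \<T>" "real (card W) \<le> c / exp 2 * real n" 
      "\<forall>\<tau>\<in>\<T>. c * p ^ card \<tau> * real n \<le> real (card {w\<in>W. \<forall>v\<in>\<tau>. {v, w} \<in> E})"
      unfolding hall_property_def by (auto simp: not_less)
    have "(\<T>, W) \<in> \<C>" using * by (auto simp: \<C>_def J0_def V_def)
    moreover have "E \<in> A \<T> W"
      unfolding A_def
    proof (intro CollectI ballI)
      fix \<tau> assume "\<tau> \<in> \<T>"
      then show "\<exists>Y\<subseteq>W. h \<tau> \<le> real (card Y) \<and> (\<forall>v\<in>\<tau>. \<forall>w\<in>Y. {v, w} \<in> E)"
        using *(7) by (intro exI[of _ "{w\<in>W. \<forall>v\<in>\<tau>. {v, w} \<in> E}"]) (auto simp: h_def)
    qed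
    ultimately show "E \<in> (\<Union>t\<in>\<C>. A (fst t) (snd t))" by force
  qed simp
  also have "\<dots> \<le> (\<Sum>t\<in>\<C>. measure_pmf.prob M (A (fst t) (snd t)))"
    using finC by (intro measure_pmf.finite_measure_subadditive_finite) auto
  also have "\<dots> \<le> (\<Sum>t\<in>\<C>. ((1 / real n) ^ (\<Delta> + 1)) ^ card (fst t) * (1 / real n) ^ card (snd t))"
  proof (rule sum_mono)
    fix t assume "t \<in> \<C>"
    then have "measure_pmf.prob M (A (fst t) (snd t)) \<le> (1 / real n) ^ ((\<Delta> + 1) * card (fst t) + card (snd t))"
      using key[of "fst t" "snd t"] by simp
    also have "\<dots> = ((1 / real n) ^ (\<Delta> + 1)) ^ card (fst t) * (1 / real n) ^ card (snd t)"
      by (subst power_add, subst power_mult) (rule refl)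
    finally show "measure_pmf.prob M (A (fst t) (snd t)) \<le> ((1 / real n) ^ (\<Delta> + 1)) ^ card (fst t) * (1 / real n) ^ card (snd t)" .
  qed
  also have "\<dots> \<le> (\<Sum>t\<in>(Pow J0 - {{}}) \<times> Pow V. ((1 / real n) ^ (\<Delta> + 1)) ^ card (fst t) * (1 / real n) ^ card (snd t))"
    using subC finJ finV by (intro sum_mono2) auto
  also have "\<dots> = (\<Sum>\<T>\<in>Pow J0 - {{}}. ((1 / real n) ^ (\<Delta> + 1)) ^ card \<T>) * (\<Sum>W\<in>Pow V. (1 / real n) ^ card W)"
    by (simp add: sum_product sum.cartesian_product case_prod_beta)
  also have "\<dots> \<le> (exp (1 / real n) - 1) * exp 1"
  proof (rule mult_mono)
    have "(\<Sum>W\<in>Pow V. (1 / real n) ^ card W) = (1 + 1 / real n) ^ card V" by (rule sum_Pow_power[OF finV(1)])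
    also have "\<dots> \<le> exp (1 / real n * real (card V))" by (rule one_plus_power_le_exp) simp
    also have "\<dots> = exp 1" using n finV by simp
    finally show "(\<Sum>W\<in>Pow V. (1 / real n) ^ card W) \<le> exp 1" .
    have "(\<Sum>\<T>\<in>Pow J0. ((1 / real n) ^ (\<Delta> + 1)) ^ card \<T>) = (1 + (1 / real n) ^ (\<Delta> + 1)) ^ card J0"
      by (rule sum_Pow_power[OF finJ])
    also have "\<dots> \<le> exp ((1 / real n) ^ (\<Delta> + 1) * real (card J0))" by (rule one_plus_power_le_exp) simp
    also have "\<dots> \<le> exp (1 / real n)"
    proof -
      have "real (card J0) \<le> real n ^ \<Delta>"
        using card_small_subsets[OF finV(1), of \<Delta>] finV(2) unfolding J0_def by (metis of_nat_le_iff of_nat_power)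
      then have "(1 / real n) ^ (\<Delta> + 1) * real (card J0) \<le> (1 / real n) ^ (\<Delta> + 1) * real n ^ \<Delta>" by (intro mult_left_mono) auto
      also have "\<dots> = 1 / real n" using n by (simp add: power_one_over field_simps)
      finally show ?thesis by simp
    qed
    finally show "(\<Sum>\<T>\<in>Pow J0 - {{}}. ((1 / real n) ^ (\<Delta> + 1)) ^ card \<T>) \<le> exp (1 / real n) - 1"
      using finJ by (simp add: sum_diff)
  qed (auto intro!: sum_nonneg)
  finally show ?thesis by (simp add: M_def V_def)
qed

section \<open>Sparse regularity by counting missing edges\<close>

lemma sum_Un_nonneg_le:
  fixes h :: "'a \<Rightarrow> real"
  assumes "finite A" "finite B" "\<And>x. 0 \<le> h x"
  shows "sum h (A \<union> B) \<le> sum h A + sum h B"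
  using sum.union_inter[OF assms(1,2), of h] sum_nonneg[of "A \<inter> B" h] assms(3) by simp

text \<open>Only lower bounds on densities matter, so the energy is the total number of edges missing to
  density \<open>c\<close>. It is at most \<open>c n\<^sup>2\<close>, grows under refinement, and needs no upper regularity.\<close>

definition defect :: "('a \<Rightarrow> 'a \<Rightarrow> bool) \<Rightarrow> real \<Rightarrow> 'a set \<Rightarrow> 'a set \<Rightarrow> real" where
  "defect R c A B = max 0 (c * real (card A) * real (card B) - ec R A B)"

text \<open>A partition is a labelling by natural numbers. Empty cells are allowed, so the number of
  labels can be raised freely.\<close>

definition cell :: "'a set \<Rightarrow> ('a \<Rightarrow> nat) \<Rightarrow> nat \<Rightarrow> 'a set" where
  "cell V f i = {v\<in>V. f v = i}"

text \<open>Pairs with fewer edges than density \<open>c\<close> do not count as irregular; they are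
  given up as non-neighbours later. An irregular pair has enough edges overall, but some large
  subpair misses even density c/2.\<close>

definition irregular :: "('a \<Rightarrow> 'a \<Rightarrow> bool) \<Rightarrow> real \<Rightarrow> real \<Rightarrow> 'a set \<Rightarrow> 'a set \<Rightarrow> bool" where
  "irregular R c \<epsilon> A B \<longleftrightarrow> c * real (card A) * real (card B) \<le> ec R A B \<and> \<not> dense_pair R (c / 2) \<epsilon> A B"

lemma sum_cells:
  assumes "finite V" "finite I" "A = {v\<in>V. f v \<in> I}"
  shows "(\<Sum>v\<in>A. h v) = (\<Sum>i\<in>I. \<Sum>v\<in>cell V f i. h v)"
proof -
  have "(\<Sum>i\<in>I. sum h {v\<in>A. f v = i}) = sum h A"
    using assms by (intro sum.group) auto
  moreover have "{v\<in>A. f v = i} = cell V f i" if "i \<in> I" for i using assms that by (auto simp: cell_def)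
  ultimately show ?thesis by simp
qed

lemma card_cells:
  assumes "finite V" "finite I" "A = {v\<in>V. f v \<in> I}"
  shows "real (card A) = (\<Sum>i\<in>I. real (card (cell V f i)))"
  using sum_cells[OF assms, of "\<lambda>_. 1 :: real"] by simp

lemma defect_nonneg: "0 \<le> defect R c A B" by (simp add: defect_def)

text \<open>The signed deficit is additive over cells, and taking positive parts can only increase
  it.\<close>

lemma defect_refine:
  assumes "finite V" "finite I" "finite J" and A: "A = {v\<in>V. f v \<in> I}" and B: "B = {v\<in>V. f v \<in> J}"
  shows "c * real (card A) * real (card B) - ec R A B \<le> (\<Sum>i\<in>I. \<Sum>j\<in>J. defect R c (cell V f i) (cell V f j))"
proof -
  have "ec R A B = (\<Sum>i\<in>I. \<Sum>v\<in>cell V f i. \<Sum>j\<in>J. \<Sum>w\<in>cell V f j. of_bool (R v w))"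
    unfolding ec_def sum_cells[OF assms(1,2) A] sum_cells[OF assms(1,3) B] ..
  also have "\<dots> = (\<Sum>i\<in>I. \<Sum>j\<in>J. ec R (cell V f i) (cell V f j))"
    unfolding ec_def by (intro sum.cong refl sum.swap)
  finally have e: "ec R A B = (\<Sum>i\<in>I. \<Sum>j\<in>J. ec R (cell V f i) (cell V f j))" .
  have "c * real (card A) * real (card B) = (\<Sum>i\<in>I. \<Sum>j\<in>J. c * real (card (cell V f i)) * real (card (cell V f j)))"
  proof -
    have "(\<Sum>i\<in>I. \<Sum>j\<in>J. c * real (card (cell V f i)) * real (card (cell V f j)))
        = (\<Sum>i\<in>I. c * real (card (cell V f i)) * real (card B))"
      unfolding card_cells[OF assms(1,3) B] by (simp add: sum_distrib_left)
    also have "\<dots> = c * real (card A) * real (card B)"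
      unfolding card_cells[OF assms(1,2) A] by (simp add: sum_distrib_right[symmetric] sum_distrib_left[symmetric])
    finally show ?thesis ..
  qed
  then have "c * real (card A) * real (card B) - ec R A B
      = (\<Sum>i\<in>I. \<Sum>j\<in>J. c * real (card (cell V f i)) * real (card (cell V f j)) - ec R (cell V f i) (cell V f j))"
    unfolding e by (simp add: sum_subtractf)
  also have "\<dots> \<le> (\<Sum>i\<in>I. \<Sum>j\<in>J. defect R c (cell V f i) (cell V f j))"
    by (intro sum_mono) (simp add: defect_def)
  finally show ?thesis .
qed

definition energy :: "('a \<Rightarrow> 'a \<Rightarrow> bool) \<Rightarrow> real \<Rightarrow> 'a set \<Rightarrow> nat \<Rightarrow> ('a \<Rightarrow> nat) \<Rightarrow> real" where
  "energy R c V k f = (\<Sum>i<k. \<Sum>j<k. defect R c (cell V f i) (cell V f j))"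

definition irregular_mass :: "('a \<Rightarrow> 'a \<Rightarrow> bool) \<Rightarrow> real \<Rightarrow> real \<Rightarrow> 'a set \<Rightarrow> nat \<Rightarrow> ('a \<Rightarrow> nat) \<Rightarrow> real" where
  "irregular_mass R c \<epsilon> V k f = (\<Sum>i<k. \<Sum>j<k. of_bool (irregular R c \<epsilon> (cell V f i) (cell V f j)) *
     (real (card (cell V f i)) * real (card (cell V f j))))"

lemma energy_le:
  assumes "finite V" "f ` V \<subseteq> {..<k}" "0 \<le> c"
  shows "energy R c V k f \<le> c * (real (card V))\<^sup>2"
proof -
  have "V = {v\<in>V. f v \<in> {..<k}}" using assms by auto
  then have V: "real (card V) = (\<Sum>i<k. real (card (cell V f i)))"
    by (rule card_cells[OF assms(1) finite_lessThan])
  have "energy R c V k f \<le> (\<Sum>i<k. \<Sum>j<k. c * (real (card (cell V f i)) * real (card (cell V f j))))"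
    unfolding energy_def defect_def using assms ec_nonneg by (intro sum_mono) (auto simp: mult.assoc)
  also have "\<dots> = c * (real (card V))\<^sup>2"
    unfolding V power2_eq_square sum_product by (simp add: sum_distrib_left)
  finally show ?thesis .
qed

text \<open>An irregular pair has defect 0. On its witness the deficit below density
  \<open>c\<close> is at least half of the expected count, so a refinement that separates the
  witness gains at least (c/2)\<epsilon>^2|A||B|.\<close>

lemma energy_increment:
  fixes R :: "'a \<Rightarrow> 'a \<Rightarrow> bool"
  assumes V: "finite V" and f: "f ` V \<subseteq> {..<k}" and c: "0 \<le> c" and e: "0 \<le> \<epsilon>"
  shows "\<exists>g. g ` V \<subseteq> {..<k * 2 ^ (k * k) * 2 ^ (k * k)} \<and>
    energy R c V k f + c / 2 * \<epsilon>\<^sup>2 * irregular_mass R c \<epsilon> V k f \<le> energy R c V (k * 2 ^ (k * k) * 2 ^ (k * k)) g"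
proof -
  define l where "l = k * 2 ^ (k * k) * 2 ^ (k * k)"
  define irr where "irr i j \<longleftrightarrow> irregular R c \<epsilon> (cell V f i) (cell V f j)" for i j
  have "\<exists>A' B'. irr i j \<longrightarrow> A' \<subseteq> cell V f i \<and> B' \<subseteq> cell V f j \<and> \<epsilon> * real (card (cell V f i)) \<le> real (card A') \<and>
     \<epsilon> * real (card (cell V f j)) \<le> real (card B') \<and> ec R A' B' < c / 2 * real (card A') * real (card B')" for i j
    unfolding irr_def irregular_def dense_pair_def by (auto simp: not_le)
  then obtain A' B' where AB: "\<And>i j. irr i j \<Longrightarrow> A' i j \<subseteq> cell V f i \<and> B' i j \<subseteq> cell V f j \<and>
     \<epsilon> * real (card (cell V f i)) \<le> real (card (A' i j)) \<and>
     \<epsilon> * real (card (cell V f j)) \<le> real (card (B' i j)) \<and> ec R (A' i j) (B' i j) < c / 2 * real (card (A' i j)) * real (card (B' i j))"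
    by metis
  define U where "U = {..<k} \<times> {..<k}"
  \<comment> \<open>The new label records the old cell and the membership in the witnesses of all k
    * k pairs, on the first and on the second side: hence the factor 2^(k * k) twice.\<close>
  define h where "h v = (f v, {x\<in>U. v \<in> A' (fst x) (snd x)}, {x\<in>U. v \<in> B' (fst x) (snd x)})" for v
  have hV: "h ` V \<subseteq> {..<k} \<times> Pow U \<times> Pow U" using f by (auto simp: h_def)
  have "card (h ` V) \<le> card ({..<k} \<times> Pow U \<times> Pow U)" using hV by (intro card_mono) (auto simp: U_def)
  also have "\<dots> = card {..<l}" by (simp add: card_cartesian_product card_Pow U_def l_def)
  finally obtain idx where idx: "inj_on idx (h ` V)" "idx ` (h ` V) \<subseteq> {..<l}"
    using card_le_inj[of "h ` V" "{..<l}"] V by auto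
  define g where "g v = idx (h v)" for v
  have gV: "g ` V \<subseteq> {..<l}" using idx by (auto simp: g_def)
  have gh: "g u = g v \<longleftrightarrow> h u = h v" if "u \<in> V" "v \<in> V" for u v
    using idx(1) that by (auto simp: g_def inj_on_def)
  define I where "I A = g ` A" for A
  have sat: "A = {v\<in>V. g v \<in> I A}" if "A \<subseteq> V" "\<And>u v. u \<in> A \<Longrightarrow> v \<in> V \<Longrightarrow> h u = h v \<Longrightarrow> v \<in> A" for A
  proof
    show "A \<subseteq> {v\<in>V. g v \<in> I A}" using that(1) by (auto simp: I_def)
    show "{v\<in>V. g v \<in> I A} \<subseteq> A"
    proof
      fix v assume "v \<in> {v\<in>V. g v \<in> I A}"
      then obtain u where u: "u \<in> A" "v \<in> V" "g v = g u" by (auto simp: I_def)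
      then have "h u = h v" using gh[of u v] that(1) by auto
      then show "v \<in> A" using that(2)[of u v] u by blast
    qed
  qed
  have satc: "cell V f i = {v\<in>V. g v \<in> I (cell V f i)}" for i
    by (rule sat) (auto simp: cell_def h_def)
  have satA: "A' i j = {v\<in>V. g v \<in> I (A' i j)}" if "irr i j" "i < k" "j < k" for i j
  proof (rule sat)
    show "A' i j \<subseteq> V" using AB[OF that(1)] by (auto simp: cell_def)
    fix u v assume *: "u \<in> A' i j" "v \<in> V" "h u = h v"
    have eq: "{x\<in>U. u \<in> A' (fst x) (snd x)} = {x\<in>U. v \<in> A' (fst x) (snd x)}"
      using *(3) by (simp add: h_def)
    have "(i, j) \<in> {x\<in>U. u \<in> A' (fst x) (snd x)}" using * that by (auto simp: U_def)
    then have "(i, j) \<in> {x\<in>U. v \<in> A' (fst x) (snd x)}" by (simp only: eq)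
    then show "v \<in> A' i j" by simp
  qed
  have satB: "B' i j = {v\<in>V. g v \<in> I (B' i j)}" if "irr i j" "i < k" "j < k" for i j
  proof (rule sat)
    show "B' i j \<subseteq> V" using AB[OF that(1)] by (auto simp: cell_def)
    fix u v assume *: "u \<in> B' i j" "v \<in> V" "h u = h v"
    have eq: "{x\<in>U. u \<in> B' (fst x) (snd x)} = {x\<in>U. v \<in> B' (fst x) (snd x)}"
      using *(3) by (simp add: h_def)
    have "(i, j) \<in> {x\<in>U. u \<in> B' (fst x) (snd x)}" using * that by (auto simp: U_def)
    then have "(i, j) \<in> {x\<in>U. v \<in> B' (fst x) (snd x)}" by (simp only: eq)
    then show "v \<in> B' i j" by simp
  qed
  have finI: "finite (I A)" if "A \<subseteq> V" for A using that V finite_subset unfolding I_def by blast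
  have cellV: "cell V f i \<subseteq> V" for i by (auto simp: cell_def)
  define d where "d a b = defect R c (cell V g a) (cell V g b)" for a b
  have d0: "0 \<le> d a b" for a b by (simp add: d_def defect_nonneg)
  have local: "defect R c (cell V f i) (cell V f j) + c / 2 * \<epsilon>\<^sup>2 * (of_bool (irr i j) * (real (card (cell V f i)) * real (card (cell V f j))))
     \<le> (\<Sum>a\<in>I (cell V f i). \<Sum>b\<in>I (cell V f j). d a b)" if ij: "i < k" "j < k" for i j
  proof (cases "irr i j")
    case True
    note ab = AB[OF True]
    have subAB: "A' i j \<subseteq> cell V f i" "B' i j \<subseteq> cell V f j" "A' i j \<subseteq> V" "B' i j \<subseteq> V" using ab cellV by auto
    have d_zero: "defect R c (cell V f i) (cell V f j) = 0" using True unfolding irr_def irregular_def defect_def by simp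
    have "c / 2 * \<epsilon>\<^sup>2 * (real (card (cell V f i)) * real (card (cell V f j)))
        = c / 2 * ((\<epsilon> * real (card (cell V f i))) * (\<epsilon> * real (card (cell V f j))))" by (simp add: power2_eq_square)
    also have "\<dots> \<le> c / 2 * (real (card (A' i j)) * real (card (B' i j)))"
      using ab c e by (intro mult_left_mono mult_mono) auto
    also have "\<dots> \<le> c * real (card (A' i j)) * real (card (B' i j)) - ec R (A' i j) (B' i j)"
      using ab by (simp add: mult.assoc)
    also have "\<dots> \<le> (\<Sum>a\<in>I (A' i j). \<Sum>b\<in>I (B' i j). d a b)"
      unfolding d_def using subAB by (intro defect_refine[OF V finI finI satA[OF True ij] satB[OF True ij]])
    also have "\<dots> \<le> (\<Sum>a\<in>I (A' i j). \<Sum>b\<in>I (cell V f j). d a b)"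
      using subAB d0 finI[OF cellV] by (intro sum_mono sum_mono2) (auto simp: I_def)
    also have "\<dots> \<le> (\<Sum>a\<in>I (cell V f i). \<Sum>b\<in>I (cell V f j). d a b)"
      using subAB d0 finI[OF cellV] by (intro sum_mono2 sum_nonneg) (auto simp: I_def)
    finally show ?thesis using True d_zero by simp
  next
    case False
    have "c * real (card (cell V f i)) * real (card (cell V f j)) - ec R (cell V f i) (cell V f j) \<le> (\<Sum>a\<in>I (cell V f i). \<Sum>b\<in>I (cell V f j). d a b)"
      unfolding d_def by (rule defect_refine[OF V finI[OF cellV] finI[OF cellV] satc satc])
    moreover have "0 \<le> (\<Sum>a\<in>I (cell V f i). \<Sum>b\<in>I (cell V f j). d a b)" using d0 by (intro sum_nonneg) auto
    ultimately show ?thesis using False by (simp add: defect_def)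
  qed
  have disjI: "I (cell V f i) \<inter> I (cell V f j) = {}" if "i \<noteq> j" for i j
  proof (rule ccontr)
    assume "I (cell V f i) \<inter> I (cell V f j) \<noteq> {}"
    then obtain u v where uv: "u \<in> cell V f i" "v \<in> cell V f j" "g u = g v" by (auto simp: I_def)
    then have "h u = h v" using gh[of u v] by (auto simp: cell_def)
    then show False using uv that by (auto simp: h_def cell_def)
  qed
  have UI: "(\<Union>i<k. I (cell V f i)) \<subseteq> {..<l}" using gV cellV unfolding I_def by blast
  have sumI: "(\<Sum>i<k. \<Sum>a\<in>I (cell V f i). F a) = (\<Sum>a\<in>(\<Union>i<k. I (cell V f i)). F a)" for F :: "nat \<Rightarrow> real"
    using disjI finI[OF cellV] by (intro sum.UNION_disjoint[symmetric]) auto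
  have "energy R c V k f + c / 2 * \<epsilon>\<^sup>2 * irregular_mass R c \<epsilon> V k f
     = (\<Sum>i<k. \<Sum>j<k. defect R c (cell V f i) (cell V f j) + c / 2 * \<epsilon>\<^sup>2 * (of_bool (irr i j) * (real (card (cell V f i)) * real (card (cell V f j)))))"
    unfolding energy_def irregular_mass_def irr_def by (simp only: sum.distrib sum_distrib_left)
  also have "\<dots> \<le> (\<Sum>i<k. \<Sum>j<k. \<Sum>a\<in>I (cell V f i). \<Sum>b\<in>I (cell V f j). d a b)"
    using local by (intro sum_mono) auto
  also have "\<dots> = (\<Sum>i<k. \<Sum>a\<in>I (cell V f i). \<Sum>j<k. \<Sum>b\<in>I (cell V f j). d a b)"
    by (intro sum.cong refl sum.swap)
  also have "\<dots> = (\<Sum>a\<in>(\<Union>i<k. I (cell V f i)). \<Sum>b\<in>(\<Union>i<k. I (cell V f i)). d a b)"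
    unfolding sumI ..
  also have "\<dots> \<le> (\<Sum>a\<in>(\<Union>i<k. I (cell V f i)). \<Sum>b<l. d a b)"
    using UI d0 by (intro sum_mono sum_mono2) auto
  also have "\<dots> \<le> (\<Sum>a<l. \<Sum>b<l. d a b)"
    using UI d0 by (intro sum_mono2 sum_nonneg) auto
  also have "\<dots> = energy R c V l g" by (simp add: energy_def d_def)
  finally show ?thesis using gV unfolding l_def by blast
qed

primrec tower :: "nat \<Rightarrow> nat" where
  "tower 0 = 1"
| "tower (Suc s) = tower s * 2 ^ (tower s * tower s) * 2 ^ (tower s * tower s)"

text \<open>The energy is at most c n^2 and rises by (c/2)\<epsilon>^2\<epsilon>'n^2 per round while
  the irregular mass exceeds \<epsilon>'n^2. Both quantities scale with \<open>c\<close> and n^2, so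
  the number of rounds, and with it \<open>K\<close>, depends on neither.\<close>

lemma regularity:
  fixes \<epsilon> \<epsilon>' :: real
  assumes e: "0 < \<epsilon>" "0 < \<epsilon>'"
  shows "\<exists>K\<ge>1. \<forall>(V :: 'a set) R c. finite V \<longrightarrow> V \<noteq> {} \<longrightarrow> 0 < c \<longrightarrow>
    (\<exists>f. f ` V \<subseteq> {..<K} \<and> irregular_mass R c \<epsilon> V K f \<le> \<epsilon>' * (real (card V))\<^sup>2)"
proof -
  obtain s0 :: nat where s0: "2 / (\<epsilon>\<^sup>2 * \<epsilon>') < real s0" using reals_Archimedean2 by blast
  define K where "K = Max (tower ` {..s0})"
  have mono: "\<exists>f. f ` V \<subseteq> {..<K} \<and> irregular_mass R c \<epsilon> V K f \<le> \<epsilon>' * (real (card V))\<^sup>2"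
    if V: "finite V" "V \<noteq> {}" and c: "0 < c" for V :: "'a set" and R c
  proof -
    have step: "(\<exists>s\<le>t. \<exists>f. f ` V \<subseteq> {..<tower s} \<and> irregular_mass R c \<epsilon> V (tower s) f \<le> \<epsilon>' * (real (card V))\<^sup>2) \<or>
        (\<exists>f. f ` V \<subseteq> {..<tower t} \<and> real t * (c / 2 * \<epsilon>\<^sup>2 * (\<epsilon>' * (real (card V))\<^sup>2)) \<le> energy R c V (tower t) f)" for t
    proof (induction t)
      case 0
      have "(\<lambda>_. 0) ` V \<subseteq> {..<tower 0}" by auto
      moreover have "0 \<le> energy R c V (tower 0) (\<lambda>_. 0)" unfolding energy_def by (intro sum_nonneg defect_nonneg)
      ultimately show ?case by auto
    next
      case (Suc t)
      show ?case
      proof (cases "\<exists>s\<le>t. \<exists>f. f ` V \<subseteq> {..<tower s} \<and> irregular_mass R c \<epsilon> V (tower s) f \<le> \<epsilon>' * (real (card V))\<^sup>2")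
        case True
        then show ?thesis using le_Suc_eq by blast
      next
        case False
        then obtain f where f: "f ` V \<subseteq> {..<tower t}" "real t * (c / 2 * \<epsilon>\<^sup>2 * (\<epsilon>' * (real (card V))\<^sup>2)) \<le> energy R c V (tower t) f"
          using Suc by blast
        have irr: "\<epsilon>' * (real (card V))\<^sup>2 \<le> irregular_mass R c \<epsilon> V (tower t) f" 
        proof -
          have "\<not> irregular_mass R c \<epsilon> V (tower t) f \<le> \<epsilon>' * (real (card V))\<^sup>2" using False f(1) by blast
          then show ?thesis by linarith
        qed
        obtain g where g: "g ` V \<subseteq> {..<tower (Suc t)}"
          "energy R c V (tower t) f + c / 2 * \<epsilon>\<^sup>2 * irregular_mass R c \<epsilon> V (tower t) f \<le> energy R c V (tower (Suc t)) g"
          using energy_increment[OF V(1) f(1), of c \<epsilon> R] c e by auto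
        have "c / 2 * \<epsilon>\<^sup>2 * (\<epsilon>' * (real (card V))\<^sup>2) \<le> c / 2 * \<epsilon>\<^sup>2 * irregular_mass R c \<epsilon> V (tower t) f"
          using irr c by (intro mult_left_mono) auto
        then have "real (Suc t) * (c / 2 * \<epsilon>\<^sup>2 * (\<epsilon>' * (real (card V))\<^sup>2)) \<le> energy R c V (tower (Suc t)) g"
          using f(2) g(2) by (simp add: algebra_simps)
        then show ?thesis using g(1) by blast
      qed
    qed
    have nopos: "0 < c * (real (card V))\<^sup>2" using V c by (simp add: card_gt_0_iff)
    have "\<not> (\<exists>f. f ` V \<subseteq> {..<tower s0} \<and> real s0 * (c / 2 * \<epsilon>\<^sup>2 * (\<epsilon>' * (real (card V))\<^sup>2)) \<le> energy R c V (tower s0) f)"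
    proof
      assume "\<exists>f. f ` V \<subseteq> {..<tower s0} \<and> real s0 * (c / 2 * \<epsilon>\<^sup>2 * (\<epsilon>' * (real (card V))\<^sup>2)) \<le> energy R c V (tower s0) f"
      then obtain f where f: "f ` V \<subseteq> {..<tower s0}" "real s0 * (c / 2 * \<epsilon>\<^sup>2 * (\<epsilon>' * (real (card V))\<^sup>2)) \<le> energy R c V (tower s0) f" by blast
      have "2 < real s0 * (\<epsilon>\<^sup>2 * \<epsilon>')" using s0 e by (simp add: field_simps)
      then have "1 * (c * (real (card V))\<^sup>2) < (real s0 * (\<epsilon>\<^sup>2 * \<epsilon>') / 2) * (c * (real (card V))\<^sup>2)"
        using nopos by (intro mult_strict_right_mono) auto
      also have "\<dots> = real s0 * (c / 2 * \<epsilon>\<^sup>2 * (\<epsilon>' * (real (card V))\<^sup>2))" by simp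
      also have "\<dots> \<le> c * (real (card V))\<^sup>2" using f(2) energy_le[OF V(1) f(1), of c R] c by linarith
      finally show False by simp
    qed
    then obtain s f where sf: "s \<le> s0" "f ` V \<subseteq> {..<tower s}" "irregular_mass R c \<epsilon> V (tower s) f \<le> \<epsilon>' * (real (card V))\<^sup>2"
      using step[of s0] by blast
    have sK: "tower s \<le> K" unfolding K_def using sf(1) by (intro Max_ge) auto
    have empty: "cell V f i = {}" if "tower s \<le> i" for i using that sf(2) by (force simp: cell_def)
    have "irregular_mass R c \<epsilon> V K f = irregular_mass R c \<epsilon> V (tower s) f"
    proof -
      have "irregular_mass R c \<epsilon> V K f = (\<Sum>i<tower s. \<Sum>j<K. of_bool (irregular R c \<epsilon> (cell V f i) (cell V f j)) *
         (real (card (cell V f i)) * real (card (cell V f j))))"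
        unfolding irregular_mass_def using sK empty by (intro sum.mono_neutral_right) auto
      also have "\<dots> = irregular_mass R c \<epsilon> V (tower s) f"
        unfolding irregular_mass_def using sK empty by (intro sum.cong refl sum.mono_neutral_right) auto
      finally show ?thesis .
    qed
    then show ?thesis using sf sK by (intro exI[of _ f]) auto
  qed
  have "tower 0 \<le> K" unfolding K_def by (intro Max_ge finite_imageI imageI) auto
  then have "1 \<le> K" by simp
  then show ?thesis using mono by (intro exI[of _ K]) auto
qed

text \<open>Cells that are small or have many irregular partners are dropped. From a remaining cell
  at most Dpn edges per vertex, on average, lead to cells of density below \<open>D\<close>. By the
  minimum degree the others lead to the union \<open>U\<close> of the other cells, and upper
  regularity forces \<open>U\<close> to have nearly \<tau>n vertices, which bounds what lies
  outside.\<close>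

lemma cluster_structure:
  fixes \<epsilon> \<eta> :: real
  assumes e: "0 < \<epsilon>" "0 < \<eta>"
  shows "\<exists>K\<ge>1. \<forall>n p \<delta> D \<tau> E G. 1 \<le> n \<longrightarrow> 0 < p \<longrightarrow> 0 \<le> \<delta> \<longrightarrow> 0 < D \<longrightarrow> upper_regular E n p \<delta> \<longrightarrow> G \<subseteq> E \<longrightarrow>
    (\<forall>v<n. \<tau> * p * real n \<le> real (card {u\<in>{..<n}. {v, u} \<in> G})) \<longrightarrow>
    (\<exists>f I. I \<subseteq> {..<K} \<and> (\<forall>i\<in>I. \<eta> / real K * real n \<le> real (card (cell {..<n} f i))) \<and>
      (1 - 2 * \<eta>) * real n \<le> (\<Sum>i\<in>I. real (card (cell {..<n} f i))) \<and>
      (\<forall>i\<in>I. (\<Sum>j\<in>{j\<in>I. \<not> dense_pair (adj G) (D / 2 * p) \<epsilon> (cell {..<n} f i) (cell {..<n} f j)}. real (card (cell {..<n} f j)))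
         \<le> (1 - \<tau> + D + \<delta> + 2 * \<delta> * real K / \<eta> + \<eta>) * real n))"
proof -
  \<comment> \<open>With total irregular mass \<eta>^2 n^2, at most \<eta>n vertices lie in cells
    whose irregular partners have more than \<eta>n vertices.\<close>
  obtain K where K: "1 \<le> K" and reg: "\<And>(V :: nat set) R c. finite V \<Longrightarrow> V \<noteq> {} \<Longrightarrow> 0 < c \<Longrightarrow>
    (\<exists>f. f ` V \<subseteq> {..<K} \<and> irregular_mass R c \<epsilon> V K f \<le> \<eta>\<^sup>2 * (real (card V))\<^sup>2)"
  proof -
    have "0 < \<eta>\<^sup>2" using e by simp
    from regularity[where 'a = nat, OF e(1) this] show thesis by (elim exE conjE) (rule that; blast)
  qed
  show ?thesis
  proof (intro exI[of _ K] conjI allI impI K)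
    fix n :: nat and p \<delta> D \<tau> :: real and E G
    assume n: "1 \<le> n" and p: "0 < p" and \<delta>: "0 \<le> \<delta>" and D: "0 < D" and up: "upper_regular E n p \<delta>" and GE: "G \<subseteq> E"
      and deg: "\<forall>v<n. \<tau> * p * real n \<le> real (card {u\<in>{..<n}. {v, u} \<in> G})"
    define V where "V = {..<n}"
    have V: "finite V" "V \<noteq> {}" "card V = n" using n by (auto simp: V_def lessThan_empty_iff)
    define N where "N = real n"
    have N: "0 < N" using n by (simp add: N_def)
    obtain f where f: "f ` V \<subseteq> {..<K}" "irregular_mass (adj G) (D * p) \<epsilon> V K f \<le> \<eta>\<^sup>2 * N\<^sup>2"
      using reg[OF V(1,2), of "D * p" "adj G"] D p V(3) by (auto simp: N_def)
    define m where "m i = real (card (cell V f i))" for i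
    have m0: "0 \<le> m i" for i by (simp add: m_def)
    define irr where "irr i j \<longleftrightarrow> irregular (adj G) (D * p) \<epsilon> (cell V f i) (cell V f j)" for i j
    define idg where "idg i = (\<Sum>j<K. of_bool (irr i j) * m j)" for i
    have idg0: "0 \<le> idg i" for i unfolding idg_def using m0 by (intro sum_nonneg) auto
    define I where "I = {i\<in>{..<K}. \<eta> / real K * N \<le> m i \<and> idg i \<le> \<eta> * N}"
    have VK: "V = {v\<in>V. f v \<in> {..<K}}" using f by auto
    have sumV: "N = (\<Sum>i<K. m i)" using card_cells[OF V(1) finite_lessThan VK] V(3) by (simp add: N_def m_def)
    have c1: "(\<Sum>i\<in>{i\<in>{..<K}. m i < \<eta> / real K * N}. m i) \<le> \<eta> * N"
    proof -
      have "(\<Sum>i\<in>{i\<in>{..<K}. m i < \<eta> / real K * N}. m i) \<le> (\<Sum>i\<in>{i\<in>{..<K}. m i < \<eta> / real K * N}. \<eta> / real K * N)"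
        by (intro sum_mono) auto
      also have "\<dots> \<le> (\<Sum>i<K. \<eta> / real K * N)" using e N by (intro sum_mono2) auto
      also have "\<dots> = \<eta> * N" using K by simp
      finally show ?thesis .
    qed
    have c2: "(\<Sum>i\<in>{i\<in>{..<K}. \<eta> * N < idg i}. m i) \<le> \<eta> * N"
    proof -
      have "(\<Sum>i\<in>{i\<in>{..<K}. \<eta> * N < idg i}. m i) * (\<eta> * N) = (\<Sum>i\<in>{i\<in>{..<K}. \<eta> * N < idg i}. m i * (\<eta> * N))"
        by (simp add: sum_distrib_right)
      also have "\<dots> \<le> (\<Sum>i\<in>{i\<in>{..<K}. \<eta> * N < idg i}. m i * idg i)"
        using m0 by (intro sum_mono mult_left_mono) auto
      also have "\<dots> \<le> (\<Sum>i<K. m i * idg i)" using m0 idg0 by (intro sum_mono2) auto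
      also have "\<dots> = irregular_mass (adj G) (D * p) \<epsilon> V K f"
        unfolding irregular_mass_def idg_def irr_def m_def sum_distrib_left by (intro sum.cong refl) auto
      also have "\<dots> \<le> (\<eta> * N) * (\<eta> * N)" using f(2) by (simp add: power2_eq_square mult_ac)
      finally show ?thesis using e N by simp
    qed
    have IK: "I \<subseteq> {..<K}" by (auto simp: I_def)
    have cover: "(1 - 2 * \<eta>) * N \<le> (\<Sum>i\<in>I. m i)"
    proof -
      have "{..<K} = I \<union> ({i\<in>{..<K}. m i < \<eta> / real K * N} \<union> {i\<in>{..<K}. \<eta> * N < idg i})" by (auto simp: I_def)
      then have "N = (\<Sum>i\<in>I \<union> ({i\<in>{..<K}. m i < \<eta> / real K * N} \<union> {i\<in>{..<K}. \<eta> * N < idg i}). m i)" using sumV by simp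
      also have "\<dots> \<le> (\<Sum>i\<in>I. m i) + (\<Sum>i\<in>{i\<in>{..<K}. m i < \<eta> / real K * N} \<union> {i\<in>{..<K}. \<eta> * N < idg i}. m i)"
        using m0 IK by (intro sum_Un_nonneg_le) (auto intro: finite_subset)
      also have "(\<Sum>i\<in>{i\<in>{..<K}. m i < \<eta> / real K * N} \<union> {i\<in>{..<K}. \<eta> * N < idg i}. m i)
         \<le> (\<Sum>i\<in>{i\<in>{..<K}. m i < \<eta> / real K * N}. m i) + (\<Sum>i\<in>{i\<in>{..<K}. \<eta> * N < idg i}. m i)"
        using m0 by (intro sum_Un_nonneg_le) auto
      finally show ?thesis using c1 c2 by (simp add: algebra_simps)
    qed
    have nonnbr: "(\<Sum>j\<in>{j\<in>I. \<not> dense_pair (adj G) (D / 2 * p) \<epsilon> (cell V f i) (cell V f j)}. m j)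
         \<le> (1 - \<tau> + D + \<delta> + 2 * \<delta> * real K / \<eta> + \<eta>) * N" if i: "i \<in> I" for i
    proof -
      have mi: "\<eta> / real K * N \<le> m i" "idg i \<le> \<eta> * N" using i by (auto simp: I_def)
      have mpos: "0 < m i" using mi(1) e K N by (smt (verit) divide_pos_pos mult_pos_pos of_nat_0_less_iff One_nat_def Suc_le_lessD)
      define J where "J = {j\<in>{..<K}. ec (adj G) (cell V f i) (cell V f j) < D * p * m i * m j}"
      \<comment> \<open>Upper regularity is applied once to the union; cell by cell its additive
        error would be paid for every cell.\<close>
      define U where "U = {v\<in>V. f v \<in> {..<K} - J}"
      have cV: "cell V f i \<subseteq> V" by (auto simp: cell_def)
      have mJ: "(\<Sum>j\<in>J. m j) + real (card U) = N"
      proof -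
        have "real (card U) = (\<Sum>j\<in>{..<K} - J. m j)" unfolding m_def by (rule card_cells[OF V(1) _ U_def]) simp
        moreover have "(\<Sum>j<K. m j) = (\<Sum>j\<in>{..<K} - J. m j) + (\<Sum>j\<in>J. m j)" by (rule sum.subset_diff) (auto simp: J_def)
        ultimately show ?thesis using sumV by simp
      qed
      have mJ0: "0 \<le> (\<Sum>j\<in>J. m j)" using m0 by (intro sum_nonneg) auto
      have "m i * (\<tau> * p * N) \<le> (\<Sum>v\<in>cell V f i. real (card {u\<in>V. {v, u} \<in> G}))"
        using sum_mono[of "cell V f i" "\<lambda>_. \<tau> * p * N" "\<lambda>v. real (card {u\<in>V. {v, u} \<in> G})"] deg
        by (auto simp: m_def cell_def V_def N_def)
      also have "\<dots> = ec (adj G) (cell V f i) V"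
        unfolding ec_def using ec_deg[OF V(1), of "adj G"] by (simp add: adj_def)
      also have "\<dots> = (\<Sum>v\<in>cell V f i. \<Sum>j<K. \<Sum>u\<in>cell V f j. of_bool (adj G v u))"
        unfolding ec_def sum_cells[OF V(1) finite_lessThan VK] ..
      also have "\<dots> = (\<Sum>j<K. ec (adj G) (cell V f i) (cell V f j))" unfolding ec_def by (rule sum.swap)
      also have "\<dots> = (\<Sum>j\<in>{..<K} - J. ec (adj G) (cell V f i) (cell V f j)) + (\<Sum>j\<in>J. ec (adj G) (cell V f i) (cell V f j))"
        by (rule sum.subset_diff) (auto simp: J_def)
      also have "(\<Sum>j\<in>{..<K} - J. ec (adj G) (cell V f i) (cell V f j)) = ec (adj G) (cell V f i) U"
      proof -
        have "ec (adj G) (cell V f i) U = (\<Sum>v\<in>cell V f i. \<Sum>j\<in>{..<K} - J. \<Sum>u\<in>cell V f j. of_bool (adj G v u))"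
          unfolding ec_def by (subst sum_cells[OF V(1) _ U_def]) auto
        also have "\<dots> = (\<Sum>j\<in>{..<K} - J. ec (adj G) (cell V f i) (cell V f j))" unfolding ec_def by (rule sum.swap)
        finally show ?thesis ..
      qed
      also have "ec (adj G) (cell V f i) U \<le> ec (adj E) (cell V f i) U"
        unfolding ec_def adj_def using GE by (intro sum_mono) auto
      also have "\<dots> \<le> (1 + \<delta>) * p * m i * real (card U) + 2 * \<delta> * p * N\<^sup>2"
      proof -
        have "cell V f i \<subseteq> {..<n}" "U \<subseteq> {..<n}" using cV by (auto simp: V_def U_def)
        then show ?thesis using up unfolding upper_regular_def m_def N_def by blast
      qed
      also have "(\<Sum>j\<in>J. ec (adj G) (cell V f i) (cell V f j)) \<le> (\<Sum>j\<in>J. D * p * m i * m j)"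
        by (intro sum_mono) (auto simp: J_def)
      also have "\<dots> = D * p * m i * (\<Sum>j\<in>J. m j)" by (simp add: sum_distrib_left)
      also have "\<dots> \<le> D * p * m i * N" using mJ D p m0 by (intro mult_left_mono) auto
      finally have "m i * (\<tau> * p * N) \<le> (1 + \<delta>) * p * m i * real (card U) + 2 * \<delta> * p * N\<^sup>2 + D * p * m i * N" by simp
      also have "2 * \<delta> * p * N\<^sup>2 \<le> 2 * \<delta> * p * N * (m i * (real K / \<eta>))"
      proof -
        have "N \<le> m i * (real K / \<eta>)" using mi(1) e K by (simp add: field_simps)
        then have "2 * \<delta> * p * N * N \<le> 2 * \<delta> * p * N * (m i * (real K / \<eta>))" using \<delta> p N by (intro mult_left_mono) auto
        then show ?thesis by (simp add: power2_eq_square)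
      qed
      finally have "(p * m i) * (\<tau> * N) \<le> (p * m i) * ((1 + \<delta>) * real (card U) + 2 * \<delta> * (real K / \<eta>) * N + D * N)"
        by (simp add: algebra_simps)
      then have "\<tau> * N \<le> (1 + \<delta>) * real (card U) + 2 * \<delta> * (real K / \<eta>) * N + D * N"
        using p mpos by simp
      moreover have "\<delta> * real (card U) \<le> \<delta> * N" using mJ mJ0 \<delta> by (intro mult_left_mono) auto
      ultimately have JN: "(\<Sum>j\<in>J. m j) \<le> (1 - \<tau> + D + \<delta> + 2 * \<delta> * real K / \<eta>) * N"
        using mJ by (simp add: algebra_simps)
      have "(\<Sum>j\<in>{j\<in>I. \<not> dense_pair (adj G) (D / 2 * p) \<epsilon> (cell V f i) (cell V f j)}. m j) \<le> (\<Sum>j\<in>J \<union> {j\<in>{..<K}. irr i j}. m j)"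
        using m0 unfolding I_def J_def irr_def irregular_def m_def
        by (intro sum_mono2) (auto simp: not_less)
      also have "\<dots> \<le> (\<Sum>j\<in>J. m j) + (\<Sum>j\<in>{j\<in>{..<K}. irr i j}. m j)"
        using m0 by (intro sum_Un_nonneg_le) (auto simp: J_def)
      also have "(\<Sum>j\<in>{j\<in>{..<K}. irr i j}. m j) = idg i"
        unfolding idg_def by (intro sum.mono_neutral_cong_left) auto
      finally show ?thesis using JN mi(2) by (simp add: algebra_simps)
    qed
    show "\<exists>f I. I \<subseteq> {..<K} \<and> (\<forall>i\<in>I. \<eta> / real K * real n \<le> real (card (cell {..<n} f i))) \<and>
      (1 - 2 * \<eta>) * real n \<le> (\<Sum>i\<in>I. real (card (cell {..<n} f i))) \<and>
      (\<forall>i\<in>I. (\<Sum>j\<in>{j\<in>I. \<not> dense_pair (adj G) (D / 2 * p) \<epsilon> (cell {..<n} f i) (cell {..<n} f j)}. real (card (cell {..<n} f j)))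
         \<le> (1 - \<tau> + D + \<delta> + 2 * \<delta> * real K / \<eta> + \<eta>) * real n)"
      using IK cover nonnbr unfolding m_def N_def V_def
      by (intro exI[of _ f] exI[of _ I]) (auto simp: I_def m_def N_def V_def)
  qed
qed

section \<open>Walks between cliques and balanced assignments\<close>

lemma sum_UN_nonneg_le:
  fixes h :: "'a \<Rightarrow> real"
  assumes "finite S" "\<And>i. i \<in> S \<Longrightarrow> finite (B i)" "\<And>i x. i \<in> S \<Longrightarrow> x \<in> B i \<Longrightarrow> 0 \<le> h x"
  shows "sum h (\<Union>i\<in>S. B i) \<le> (\<Sum>i\<in>S. sum h (B i))"
  using assms
proof (induction S rule: finite_induct)
  case (insert x F)
  have fx: "finite (B x)" "finite (\<Union>i\<in>F. B i)" using insert by auto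
  have "0 \<le> sum h (B x \<inter> (\<Union>i\<in>F. B i))" using insert by (intro sum_nonneg) auto
  moreover have "sum h (\<Union>i\<in>F. B i) \<le> (\<Sum>i\<in>F. sum h (B i))"
    by (rule insert.IH) (use insert.prems in auto)
  ultimately show ?case using sum.union_inter[OF fx, of h] insert.hyps by simp
qed simp

text \<open>The cluster graph: \<open>\<mu>\<close> is the size of a cluster, \<open>A\<close> holds
  for dense pairs, and \<open>r\<close> will be the chromatic number of \<open>H\<close>. The
  hypothesis \<open>nonnbr\<close> is what the minimum degree provides: each cluster misses less
  than a 1/r share of the total weight.\<close>

locale weighted_relation =
  fixes I :: "'i set" and \<mu> :: "'i \<Rightarrow> real" and A :: "'i \<Rightarrow> 'i \<Rightarrow> bool" and r :: nat
  assumes finI: "finite I" and \<mu>pos: "\<And>i. i \<in> I \<Longrightarrow> 0 < \<mu> i" and r: "1 \<le> r"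
    and sym: "\<And>i j. A i j \<Longrightarrow> A j i"
    and nonnbr: "\<And>i. i \<in> I \<Longrightarrow> real r * (\<Sum>j\<in>{j\<in>I. \<not> A i j}. \<mu> j) < (\<Sum>i\<in>I. \<mu> i)"
begin

definition W :: real where "W = (\<Sum>i\<in>I. \<mu> i)"

lemma nonnbr_set:
  assumes "S \<subseteq> I"
  shows "real r * (\<Sum>j\<in>{j\<in>I. \<exists>i\<in>S. \<not> A i j}. \<mu> j) \<le> real (card S) * W"
proof -
  have finS: "finite S" using assms finI finite_subset by blast
  have "(\<Sum>j\<in>{j\<in>I. \<exists>i\<in>S. \<not> A i j}. \<mu> j) = (\<Sum>j\<in>(\<Union>i\<in>S. {j\<in>I. \<not> A i j}). \<mu> j)"
    by (intro sum.cong) auto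
  also have "\<dots> \<le> (\<Sum>i\<in>S. \<Sum>j\<in>{j\<in>I. \<not> A i j}. \<mu> j)"
    using finS finI \<mu>pos by (intro sum_UN_nonneg_le) (auto intro: less_imp_le)
  finally have "real r * (\<Sum>j\<in>{j\<in>I. \<exists>i\<in>S. \<not> A i j}. \<mu> j) \<le> real r * (\<Sum>i\<in>S. \<Sum>j\<in>{j\<in>I. \<not> A i j}. \<mu> j)"
    by (intro mult_left_mono) auto
  also have "\<dots> = (\<Sum>i\<in>S. real r * (\<Sum>j\<in>{j\<in>I. \<not> A i j}. \<mu> j))" by (simp add: sum_distrib_left)
  also have "\<dots> \<le> (\<Sum>i\<in>S. W)" using nonnbr assms unfolding W_def by (intro sum_mono less_imp_le) auto
  finally show ?thesis by simp
qed

text \<open>At most r sets of non-neighbours, each of weight less than W/r, cannot cover all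
  clusters.\<close>

lemma common_nbr:
  assumes "S \<subseteq> I" "card S \<le> r" "I \<noteq> {}"
  shows "\<exists>j\<in>I. \<forall>i\<in>S. A i j"
proof (rule ccontr)
  assume neg: "\<not> ?thesis"
  then obtain i0 where i0: "i0 \<in> S" using assms by blast
  have finS: "finite S" using assms finI finite_subset by blast
  have Wpos: "0 < W" unfolding W_def using assms \<mu>pos finI by (intro sum_pos) auto
  have "{j\<in>I. \<exists>i\<in>S. \<not> A i j} = I" using neg by auto
  then have "real r * W = real r * (\<Sum>j\<in>{j\<in>I. \<exists>i\<in>S. \<not> A i j}. \<mu> j)" by (simp add: W_def)
  also have "\<dots> = real r * (\<Sum>j\<in>(\<Union>i\<in>S. {j\<in>I. \<not> A i j}). \<mu> j)"
    by (intro arg_cong[where f = "\<lambda>x. real r * x"] sum.cong) auto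
  also have "\<dots> \<le> real r * (\<Sum>i\<in>S. \<Sum>j\<in>{j\<in>I. \<not> A i j}. \<mu> j)"
  proof (intro mult_left_mono)
    show "(\<Sum>j\<in>(\<Union>i\<in>S. {j\<in>I. \<not> A i j}). \<mu> j) \<le> (\<Sum>i\<in>S. \<Sum>j\<in>{j\<in>I. \<not> A i j}. \<mu> j)"
      using finS finI \<mu>pos by (intro sum_UN_nonneg_le) (auto intro: less_imp_le)
  qed auto
  also have "\<dots> = (\<Sum>i\<in>S. real r * (\<Sum>j\<in>{j\<in>I. \<not> A i j}. \<mu> j))" by (simp add: sum_distrib_left)
  also have "\<dots> < (\<Sum>i\<in>S. W)" using nonnbr assms i0 finS unfolding W_def by (intro sum_strict_mono) auto
  also have "\<dots> \<le> real r * W" using assms Wpos by (simp add: mult_right_mono)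
  finally show False by simp
qed

text \<open>A clique is an ordered \<open>r\<close>-tuple, padded with \<open>undefined\<close> so that tuples agreeing below \<open>r\<close> are
  equal. Pairs \<open>A i i\<close> may hold, so its entries need not be distinct.\<close>

definition clique :: "(nat \<Rightarrow> 'i) \<Rightarrow> bool" where
  "clique K \<longleftrightarrow> (\<forall>j<r. K j \<in> I) \<and> (\<forall>j<r. \<forall>l<r. j \<noteq> l \<longrightarrow> A (K j) (K l)) \<and> (\<forall>j\<ge>r. K j = undefined)"

text \<open>What edges between consecutive blocks require when colour j goes to \<open>K j\<close>
  in one block and colour l to \<open>K' l\<close> in the next; no edge joins equal colours, hence j
  \<noteq> l.\<close>

definition compat :: "(nat \<Rightarrow> 'i) \<Rightarrow> (nat \<Rightarrow> 'i) \<Rightarrow> bool" where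
  "compat K K' \<longleftrightarrow> (\<forall>j<r. \<forall>l<r. j \<noteq> l \<longrightarrow> A (K j) (K' l))"

definition reach :: "nat \<Rightarrow> (nat \<Rightarrow> 'i) \<Rightarrow> (nat \<Rightarrow> 'i) \<Rightarrow> bool" where
  "reach t K K' \<longleftrightarrow> (\<exists>w. w 0 = K \<and> w t = K' \<and> (\<forall>s\<le>t. clique (w s)) \<and> (\<forall>s<t. compat (w s) (w (Suc s))))"

lemma compat_refl: "clique K \<Longrightarrow> compat K K"
  by (auto simp: clique_def compat_def)

lemma reach_refl: "clique K \<Longrightarrow> reach 0 K K"
  unfolding reach_def by (intro exI[of _ "\<lambda>_. K"]) auto

lemma reach_step: "clique K \<Longrightarrow> clique K' \<Longrightarrow> compat K K' \<Longrightarrow> reach 1 K K'"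
  unfolding reach_def by (intro exI[of _ "\<lambda>s. if s = 0 then K else K'"]) auto

lemma reach_trans:
  assumes "reach s K1 K2" "reach t K2 K3"
  shows "reach (s + t) K1 K3"
proof -
  obtain w where w: "w 0 = K1" "w s = K2" "\<forall>i\<le>s. clique (w i)" "\<forall>i<s. compat (w i) (w (Suc i))"
    using assms(1) unfolding reach_def by auto
  obtain w' where w': "w' 0 = K2" "w' t = K3" "\<forall>i\<le>t. clique (w' i)" "\<forall>i<t. compat (w' i) (w' (Suc i))"
    using assms(2) unfolding reach_def by auto
  define z where "z i = (if i \<le> s then w i else w' (i - s))" for i
  have zs: "z i = w' (i - s)" if "s \<le> i" for i using that w w' by (auto simp: z_def)
  have "clique (z i)" if "i \<le> s + t" for i using w(3) w'(3) that by (auto simp: z_def)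
  moreover have "compat (z i) (z (Suc i))" if "i < s + t" for i
  proof (cases "i < s")
    case True then show ?thesis using w(4) by (auto simp: z_def)
  next
    case False
    then have "z i = w' (i - s)" "z (Suc i) = w' (Suc (i - s))" using zs[of i] zs[of "Suc i"] by (auto simp: Suc_diff_le)
    then show ?thesis using w'(4) that False by auto
  qed
  moreover have "z 0 = K1" "z (s + t) = K3" using w w' zs[of "s + t"] by (auto simp: z_def)
  ultimately show ?thesis unfolding reach_def by blast
qed

text \<open>The last entry must be related to m - 1 earlier ones and to \<open>Z\<close>, at most r
  clusters in all, and these have a common neighbour.\<close>

lemma extend_clique:
  assumes ne: "I \<noteq> {}" and Z: "finite Z" "Z \<subseteq> I" "m + card Z \<le> r + 1"
  shows "\<exists>x. (\<forall>j<m. x j \<in> I \<and> (\<forall>z\<in>Z. A (x j) z)) \<and> (\<forall>j<m. \<forall>l<m. j \<noteq> l \<longrightarrow> A (x j) (x l))"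
  using Z(3)
proof (induction m)
  case (Suc m)
  then obtain x where x: "\<forall>j<m. x j \<in> I \<and> (\<forall>z\<in>Z. A (x j) z)" "\<forall>j<m. \<forall>l<m. j \<noteq> l \<longrightarrow> A (x j) (x l)" by auto
  have "card (x ` {..<m} \<union> Z) \<le> card (x ` {..<m}) + card Z" by (rule card_Un_le)
  also have "\<dots> \<le> m + card Z" using card_image_le[of "{..<m}" x] by simp
  finally have "card (x ` {..<m} \<union> Z) \<le> r" using Suc by simp
  moreover have "x ` {..<m} \<union> Z \<subseteq> I" using x Z by auto
  ultimately obtain y where y: "y \<in> I" "\<forall>i\<in>x ` {..<m} \<union> Z. A i y" using common_nbr ne by blast
  have yA: "\<forall>j<m. A (x j) y \<and> A y (x j)" "\<forall>z\<in>Z. A y z" using y sym by auto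
  show ?case
  proof (intro exI[of _ "x(m := y)"] conjI allI impI)
    fix j assume "j < Suc m"
    then have "j < m \<or> j = m" by auto
    then show "(x(m := y)) j \<in> I" "\<forall>z\<in>Z. A ((x(m := y)) j) z" using x(1) y(1) yA(2) by auto
    fix l assume "l < Suc m" "j \<noteq> l"
    then show "A ((x(m := y)) j) ((x(m := y)) l)"
      using \<open>j < m \<or> j = m\<close> x(2) yA(1) by (cases "j = m"; cases "l = m") auto
  qed
qed auto

text \<open>To change entry m, the lower entries are replaced by clusters related to both
  \<open>K m\<close> and \<open>K' m\<close> and to the r - m - 1 later entries. Together with the m
  new clusters these number r + 1, just what \<open>extend_clique\<close> admits. Replacing the
  lower entries before and after is the induction hypothesis, so lengths follow 2(2^m - 1) + 1 =
  2^(m+1) - 1.\<close>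

lemma reach_agreeing_clique:
  assumes ne: "I \<noteq> {}" and "m \<le> r" "clique K" "clique K'" "\<forall>j\<ge>m. K j = K' j"
  shows "reach (2 ^ m - 1) K K'"
  using assms(2-5)
proof (induction m arbitrary: K K')
  case 0
  then have "K = K'" by auto
  then show ?case using reach_refl 0 by auto
next
  case (Suc m)
  define Z where "Z = insert (K m) (insert (K' m) (K ` {Suc m..<r}))"
  have mr: "m < r" using Suc by simp
  have "card Z \<le> Suc (Suc (card (K ` {Suc m..<r})))" by (auto simp: Z_def card_insert_if)
  also have "\<dots> \<le> Suc (Suc (r - Suc m))" using card_image_le[of "{Suc m..<r}" K] by simp
  finally have mZ: "m + card Z \<le> r + 1" using mr by simp
  have ZI: "Z \<subseteq> I" "finite Z" using Suc.prems mr by (auto simp: Z_def clique_def)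
  obtain x where x: "\<forall>j<m. x j \<in> I \<and> (\<forall>z\<in>Z. A (x j) z)" "\<forall>j<m. \<forall>l<m. j \<noteq> l \<longrightarrow> A (x j) (x l)"
    using extend_clique[OF ne ZI(2,1) mZ] by (elim exE conjE)
  define X1 where "X1 j = (if j < m then x j else K j)" for j
  define X2 where "X2 j = (if j < m then x j else K' j)" for j
  have Kj: "K j = K' j" if "Suc m \<le> j" for j using Suc.prems that by auto
  have xA: "A (x j) (K l)" "A (x j) (K' l)" "A (K l) (x j)" "A (K' l) (x j)" if "j < m" "m \<le> l" "l < r" for j l
  proof -
    have "K l \<in> Z \<and> K' l \<in> Z"
    proof (cases "l = m")
      case False
      then have "K l \<in> K ` {Suc m..<r}" "K' l = K l" using that Kj[of l] imageI[of l "{Suc m..<r}" K] by auto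
      then show ?thesis by (simp add: Z_def)
    qed (simp add: Z_def)
    then have "A (x j) (K l)" "A (x j) (K' l)" using x(1) that by blast+
    with sym show "A (x j) (K l)" "A (x j) (K' l)" "A (K l) (x j)" "A (K' l) (x j)" by blast+
  qed
  have mix: "clique (\<lambda>j. if j < m then x j else L j)"
    if L: "clique L" and cross: "\<And>j l. j < m \<Longrightarrow> m \<le> l \<Longrightarrow> l < r \<Longrightarrow> A (x j) (L l) \<and> A (L l) (x j)" for L
    unfolding clique_def
  proof (intro conjI allI impI)
    fix j l assume jl: "j < r" "l < r" "j \<noteq> l"
    have LA: "A (L j) (L l)" using L jl by (simp add: clique_def)
    show "A (if j < m then x j else L j) (if l < m then x l else L l)"
      using cross[of j l] cross[of l j] x(2) jl LA by (cases "j < m"; cases "l < m") simp_all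
  next
    fix j assume "j < r"
    then show "(if j < m then x j else L j) \<in> I" using L x(1) by (simp add: clique_def)
  next
    fix j assume "r \<le> j"
    then show "(if j < m then x j else L j) = undefined" using L mr by (simp add: clique_def)
  qed
  have c1: "clique X1" unfolding X1_def by (rule mix[OF Suc.prems(2)]) (simp add: xA)
  have c2: "clique X2" unfolding X2_def by (rule mix[OF Suc.prems(3)]) (simp add: xA)
  have KA: "A (K j) (K l)" "A (K' j) (K' l)" if "j < r" "l < r" "j \<noteq> l" for j l
    using that Suc.prems by (auto simp: clique_def)
  have c12: "compat X1 X2"
    unfolding compat_def
  proof (intro allI impI)
    fix j l assume jl: "j < r" "l < r" "j \<noteq> l"
    consider "j < m" "l < m" | "j < m" "m \<le> l" | "m \<le> j" "l < m" | "m \<le> j" "m \<le> l" by linarith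
    then show "A (X1 j) (X2 l)"
    proof cases
      case 4
      \<comment> \<open>Of two distinct indices from m on, one exceeds m, where both cliques
        agree.\<close>
      then have "Suc m \<le> j \<or> Suc m \<le> l" using jl by linarith
      then show ?thesis using 4 KA[OF jl] Kj[of j] Kj[of l] by (auto simp: X1_def X2_def)
    next
      case 1 then show ?thesis using x(2) jl by (simp add: X1_def X2_def)
    next
      case 2 then show ?thesis using xA jl by (simp add: X1_def X2_def)
    next
      case 3 then show ?thesis using xA jl by (simp add: X1_def X2_def)
    qed
  qed
  have 1: "reach (2 ^ m - 1) K X1" 
    by (rule Suc.IH[OF _ Suc.prems(2) c1]) (use mr in \<open>simp_all add: X1_def\<close>)
  have 2: "reach (2 ^ m - 1) X2 K'" 
    by (rule Suc.IH[OF _ c2 Suc.prems(3)]) (use mr in \<open>simp_all add: X2_def\<close>)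
  have "reach ((2 ^ m - 1 + 1) + (2 ^ m - 1)) K K'"
    using reach_trans[OF reach_trans[OF 1 reach_step[OF c1 c2 c12]] 2] .
  moreover have "((2 ^ m - 1 + 1) + (2 ^ m - 1)) = (2 ^ Suc m - 1 :: nat)" using one_le_power[of "2::nat" m] by simp
  ultimately show ?case by simp
qed

lemma reach_any_clique:
  assumes "I \<noteq> {}" "clique K" "clique K'"
  shows "reach (2 ^ r - 1) K K'"
  using reach_agreeing_clique[OF assms(1) _ assms(2,3), of r] assms(2,3) by (auto simp: clique_def)

section \<open>Greedy choice of cliques with balanced loads\<close>

lemma greedy_sequence:
  assumes ne: "I \<noteq> {}" and "m \<le> r"
  shows "\<exists>v. \<forall>j<m. v j \<in> I \<and> (\<forall>l<j. A (v l) (v j)) \<and> (\<forall>i\<in>I. (\<forall>l<j. A (v l) i) \<longrightarrow> ld (v j) \<le> (ld i :: real))"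
  using assms(2)
proof (induction m)
  case (Suc m)
  then obtain v where v: "\<forall>j<m. v j \<in> I \<and> (\<forall>l<j. A (v l) (v j)) \<and> (\<forall>i\<in>I. (\<forall>l<j. A (v l) i) \<longrightarrow> ld (v j) \<le> ld i)" by auto
  define C where "C = {i\<in>I. \<forall>l<m. A (v l) i}"
  have "card (v ` {..<m}) \<le> r" using card_image_le[of "{..<m}" v] Suc by simp
  moreover have "v ` {..<m} \<subseteq> I" using v by auto
  ultimately have "C \<noteq> {}" using common_nbr[of "v ` {..<m}"] ne by (auto simp: C_def)
  moreover have "finite C" using finI by (auto simp: C_def)
  ultimately obtain x where x: "x \<in> C" "\<forall>i\<in>C. ld x \<le> ld i"
    by (metis arg_min_if_finite(1) arg_min_least)
  show ?case
  proof (intro exI[of _ "v(m := x)"] allI impI)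
    fix j assume j: "j < Suc m"
    show "(v(m := x)) j \<in> I \<and> (\<forall>l<j. A ((v(m := x)) l) ((v(m := x)) j)) \<and>
      (\<forall>i\<in>I. (\<forall>l<j. A ((v(m := x)) l) i) \<longrightarrow> ld ((v(m := x)) j) \<le> ld i)"
    proof (cases "j = m")
      case True
      have "(v(m := x)) l = v l" if "l < m" for l using that by simp
      then show ?thesis using x unfolding True C_def by auto
    next
      case False
      then have "j < m" using j by simp
      moreover have "(v(m := x)) l = v l" if "l \<le> j" for l using that \<open>j < m\<close> by simp
      ultimately show ?thesis using v by auto
    qed
  qed
qed auto

text \<open>The loads q_0 \<le> q_1 \<le> ... of the greedy choices increase. A cluster of load
  below q_j is no common neighbour of the first j choices, so such clusters weigh at most jW/r;
  summing over levels bounds the sum of the q_j by r times the weighted mean load. Unequal class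
  sizes \<open>a\<close> are dealt with by a cyclic shift of the colours, since the average over all
  r shifts is fair.\<close>

lemma greedy_clique:
  assumes ne: "I \<noteq> {}" and ld: "\<And>i. i \<in> I \<Longrightarrow> 0 \<le> ld i" and a: "\<And>j. j < r \<Longrightarrow> 0 \<le> a j"
  shows "\<exists>K. clique K \<and> W * (\<Sum>j<r. a j * ld (K j)) \<le> (\<Sum>j<r. a j) * (\<Sum>i\<in>I. \<mu> i * ld i)"
proof -
  obtain v where v: "\<And>j. j < r \<Longrightarrow> v j \<in> I" "\<And>j l. j < r \<Longrightarrow> l < j \<Longrightarrow> A (v l) (v j)"
    "\<And>j i. j < r \<Longrightarrow> i \<in> I \<Longrightarrow> (\<forall>l<j. A (v l) i) \<Longrightarrow> ld (v j) \<le> ld i"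
    using greedy_sequence[OF ne order_refl, of ld] by blast
  define q where "q j = ld (v j)" for j
  \<comment> \<open>Increments of q, for summation by parts: clusters of load at least q_j weigh at
    least W(r - j)/r.\<close>
  define d where "d j = (if j = 0 then q 0 else q j - q (j - 1))" for j
  have q0: "0 \<le> q j" if "j < r" for j using that v ld by (simp add: q_def)
  have qmono: "q (j - 1) \<le> q j" if "j < r" for j
    unfolding q_def using that v by (intro v(3)) auto
  have d0: "0 \<le> d j" if "j < r" for j using qmono[OF that] q0[OF that] by (auto simp: d_def)
  have dsum: "(\<Sum>j<Suc m. d j) = q m" for m by (induction m) (auto simp: d_def)
  have abel: "(\<Sum>j<m. d j * real (m - j)) = (\<Sum>j<m. q j)" for m
  proof (induction m)
    case (Suc m)
    have "(\<Sum>j<Suc m. d j * real (Suc m - j)) = (\<Sum>j<Suc m. d j * real (m - j) + d j)"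
      by (intro sum.cong) (auto simp: Suc_diff_le algebra_simps)
    also have "\<dots> = (\<Sum>j<m. d j * real (m - j)) + q m" using dsum[of m] by (simp add: sum.distrib)
    finally show ?case using Suc by simp
  qed auto
  \<comment> \<open>As q increases, the increments at levels up to x telescope to the last such
    level. The second conjunct is what carries the induction through a step with q m \<le>
    x.\<close>
  have layer: "(\<Sum>j<m. d j * of_bool (q j \<le> x)) \<le> x \<and> (m > 0 \<longrightarrow> (\<Sum>j<m. d j * of_bool (q j \<le> x)) \<le> q (m - 1))"
    if "m \<le> r" "0 \<le> x" for m x
    using that(1)
  proof (induction m)
    case (Suc m)
    then have IH: "(\<Sum>j<m. d j * of_bool (q j \<le> x)) \<le> x" "m > 0 \<longrightarrow> (\<Sum>j<m. d j * of_bool (q j \<le> x)) \<le> q (m - 1)" by auto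
    show ?case
    proof (cases "q m \<le> x")
      case True
      then show ?thesis using IH by (cases "m = 0") (auto simp: d_def)
    next
      case False
      then show ?thesis using IH qmono[of m] q0[of m] Suc.prems by (cases "m = 0") auto
    qed
  qed (use that in auto)
  have big: "W * real (r - j) \<le> real r * (\<Sum>i\<in>I. \<mu> i * of_bool (q j \<le> ld i))" if j: "j < r" for j
  proof -
    have sub: "{i\<in>I. \<not> q j \<le> ld i} \<subseteq> {i\<in>I. \<exists>x\<in>v ` {..<j}. \<not> A x i}"
      using v(3)[OF j] by (auto simp: q_def)
    have "real r * (\<Sum>i\<in>{i\<in>I. \<not> q j \<le> ld i}. \<mu> i) \<le> real r * (\<Sum>i\<in>{i\<in>I. \<exists>x\<in>v ` {..<j}. \<not> A x i}. \<mu> i)"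
      using sub finI \<mu>pos by (intro mult_left_mono sum_mono2) (auto intro: less_imp_le)
    also have "\<dots> \<le> real (card (v ` {..<j})) * W" using v(1) j by (intro nonnbr_set) auto
    also have "\<dots> \<le> real j * W"
    proof -
      have "card (v ` {..<j}) \<le> j" using card_image_le[of "{..<j}" v] by simp
      moreover have "0 \<le> W" unfolding W_def using \<mu>pos by (intro sum_nonneg) (auto intro: less_imp_le)
      ultimately show ?thesis by (intro mult_right_mono) auto
    qed
    finally have 1: "real r * (\<Sum>i\<in>{i\<in>I. \<not> q j \<le> ld i}. \<mu> i) \<le> real j * W" .
    have "W = (\<Sum>i\<in>I. \<mu> i * of_bool (q j \<le> ld i)) + (\<Sum>i\<in>I. \<mu> i * of_bool (\<not> q j \<le> ld i))"
      unfolding W_def sum.distrib[symmetric] by (intro sum.cong) auto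
    also have "(\<Sum>i\<in>I. \<mu> i * of_bool (\<not> q j \<le> ld i)) = (\<Sum>i\<in>{i\<in>I. \<not> q j \<le> ld i}. \<mu> i)"
      using finI by (intro sum.mono_neutral_cong_right) auto
    finally have "real r * W = real r * (\<Sum>i\<in>I. \<mu> i * of_bool (q j \<le> ld i)) + real r * (\<Sum>i\<in>{i\<in>I. \<not> q j \<le> ld i}. \<mu> i)"
      by (simp add: distrib_left)
    then show ?thesis using 1 j by (simp add: of_nat_diff algebra_simps)
  qed
  have main: "W * (\<Sum>j<r. q j) \<le> real r * (\<Sum>i\<in>I. \<mu> i * ld i)"
  proof -
    have "W * (\<Sum>j<r. q j) = (\<Sum>j<r. d j * (W * real (r - j)))"
      unfolding abel[symmetric] by (simp add: sum_distrib_left mult_ac)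
    also have "\<dots> \<le> (\<Sum>j<r. d j * (real r * (\<Sum>i\<in>I. \<mu> i * of_bool (q j \<le> ld i))))"
      using big d0 by (intro sum_mono mult_left_mono) auto
    also have "\<dots> = (\<Sum>j<r. \<Sum>i\<in>I. real r * (\<mu> i * (d j * of_bool (q j \<le> ld i))))"
      by (simp only: sum_distrib_left mult_ac)
    also have "\<dots> = (\<Sum>i\<in>I. \<Sum>j<r. real r * (\<mu> i * (d j * of_bool (q j \<le> ld i))))" by (rule sum.swap)
    also have "\<dots> = (\<Sum>i\<in>I. real r * (\<mu> i * (\<Sum>j<r. d j * of_bool (q j \<le> ld i))))"
      by (simp only: sum_distrib_left)
    also have "\<dots> \<le> (\<Sum>i\<in>I. real r * (\<mu> i * ld i))"
      using layer[OF order_refl] ld \<mu>pos by (intro sum_mono mult_left_mono) (auto intro: less_imp_le)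
    finally show ?thesis by (simp add: sum_distrib_left)
  qed
  \<comment> \<open>Rotation by h. For fixed j it is a bijection in h, so averaging over h replaces
    the load met by each colour with the mean of q.\<close>
  define s where "s h j = (if j + h < r then j + h else j + h - r)" for h j :: nat
  have sbij: "bij_betw (\<lambda>h. s h j) {..<r} {..<r}" if "j < r" for j
  proof -
    have "inj_on (\<lambda>h. s h j) {..<r}" by (auto simp: inj_on_def s_def split: if_splits)
    moreover have "(\<lambda>h. s h j) ` {..<r} \<subseteq> {..<r}" using that by (auto simp: s_def)
    ultimately show ?thesis unfolding bij_betw_def by (metis endo_inj_surj finite_lessThan)
  qed
  have "(\<Sum>h<r. \<Sum>j<r. a j * q (s h j)) = (\<Sum>j<r. \<Sum>h<r. a j * q (s h j))" by (rule sum.swap)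
  also have "\<dots> = (\<Sum>j<r. a j * (\<Sum>h<r. q (s h j)))" by (simp add: sum_distrib_left)
  also have "\<dots> = (\<Sum>j<r. a j * (\<Sum>h<r. q h))"
    using sum.reindex_bij_betw[OF sbij, of _ q] by (intro sum.cong) auto
  finally have avg: "(\<Sum>h<r. \<Sum>j<r. a j * q (s h j)) = (\<Sum>j<r. a j) * (\<Sum>j<r. q j)" by (simp add: sum_distrib_right)
  have "\<exists>h<r. real r * (\<Sum>j<r. a j * q (s h j)) \<le> (\<Sum>j<r. a j) * (\<Sum>j<r. q j)"
  proof (rule ccontr)
    assume "\<not> ?thesis"
    then have "(\<Sum>h<r. (\<Sum>j<r. a j) * (\<Sum>j<r. q j)) < (\<Sum>h<r. real r * (\<Sum>j<r. a j * q (s h j)))"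
      using r by (intro sum_strict_mono) (auto simp: not_le lessThan_empty_iff)
    then have "real r * ((\<Sum>j<r. a j) * (\<Sum>j<r. q j)) < real r * (\<Sum>h<r. \<Sum>j<r. a j * q (s h j))"
      by (simp add: sum_distrib_left)
    then show False using avg by simp
  qed
  then obtain h where h: "h < r" "real r * (\<Sum>j<r. a j * q (s h j)) \<le> (\<Sum>j<r. a j) * (\<Sum>j<r. q j)" by blast
  define K where "K j = (if j < r then v (s h j) else undefined)" for j
  have vA: "A (v j) (v l)" if "j < r" "l < r" "j \<noteq> l" for j l
    using v(2)[of j l] v(2)[of l j] sym that by (cases "j < l") auto
  have sr: "s h j < r" if "j < r" for j using that h by (auto simp: s_def)
  have sinj: "s h j \<noteq> s h l" if "j < r" "l < r" "j \<noteq> l" for j l using that h by (auto simp: s_def)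
  have "clique K" unfolding clique_def K_def using v(1) vA sr sinj by auto
  moreover have "W * (\<Sum>j<r. a j * ld (K j)) \<le> (\<Sum>j<r. a j) * (\<Sum>i\<in>I. \<mu> i * ld i)"
  proof -
    have W0: "0 \<le> W" unfolding W_def using \<mu>pos by (intro sum_nonneg) (auto intro: less_imp_le)
    have "(\<Sum>j<r. a j * ld (K j)) = (\<Sum>j<r. a j * q (s h j))" by (simp add: K_def q_def)
    then have "real r * (W * (\<Sum>j<r. a j * ld (K j))) = W * (real r * (\<Sum>j<r. a j * q (s h j)))" by simp
    also have "\<dots> \<le> W * ((\<Sum>j<r. a j) * (\<Sum>j<r. q j))" using h(2) W0 by (rule mult_left_mono)
    also have "\<dots> = (\<Sum>j<r. a j) * (W * (\<Sum>j<r. q j))" by simp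
    also have "\<dots> \<le> (\<Sum>j<r. a j) * (real r * (\<Sum>i\<in>I. \<mu> i * ld i))"
      using main a by (intro mult_left_mono sum_nonneg) auto
    finally have "real r * (W * (\<Sum>j<r. a j * ld (K j))) \<le> real r * ((\<Sum>j<r. a j) * (\<Sum>i\<in>I. \<mu> i * ld i))" by (simp add: mult_ac)
    then show ?thesis using r by simp
  qed
  ultimately show ?thesis by blast
qed

definition load :: "(nat \<Rightarrow> nat \<Rightarrow> 'i) \<Rightarrow> (nat \<Rightarrow> nat \<Rightarrow> real) \<Rightarrow> nat \<Rightarrow> 'i \<Rightarrow> real" where
  "load Ks a N i = (\<Sum>s<N. \<Sum>j<r. of_bool (Ks s j = i) * a s j)"

text \<open>The cliques are chosen one after the other so that the potential
  \<open>\<Sum>i. load(i)\<^sup>2 / \<mu> i\<close> grows hardly more than it would under a perfectly fair distribution.\<close>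

lemma balanced_cliques:
  assumes ne: "I \<noteq> {}" and a: "\<And>s j. 0 \<le> a s j" "\<And>s. (\<Sum>j<r. a s j) \<le> M"
    and \<nu>: "0 < \<nu>" "\<And>i. i \<in> I \<Longrightarrow> \<nu> \<le> \<mu> i"
  shows "\<exists>Ks. (\<forall>s. clique (Ks s)) \<and> (\<forall>i\<in>I. (load Ks a N i - \<mu> i * (\<Sum>s<N. \<Sum>j<r. a s j) / W)\<^sup>2 \<le> \<mu> i * (real N * M\<^sup>2 / \<nu>))"
proof -
  have Wpos: "0 < W" unfolding W_def using ne \<mu>pos finI by (intro sum_pos) auto
  have tot: "(\<Sum>i\<in>I. \<Sum>j<r. of_bool (K j = i) * b j) = (\<Sum>j<r. b j)" if "clique K" for K and b :: "nat \<Rightarrow> real"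
  proof -
    have "(\<Sum>i\<in>I. \<Sum>j<r. of_bool (K j = i) * b j) = (\<Sum>j<r. \<Sum>i\<in>I. of_bool (K j = i) * b j)" by (rule sum.swap)
    also have "\<dots> = (\<Sum>j<r. b j)"
    proof (rule sum.cong[OF refl])
      fix j assume "j \<in> {..<r}"
      then have "K j \<in> I" using that by (auto simp: clique_def)
      then have "(\<Sum>i\<in>I. of_bool (K j = i) * b j) = (\<Sum>i\<in>{K j}. of_bool (K j = i) * b j)"
        using finI by (intro sum.mono_neutral_right) auto
      then show "(\<Sum>i\<in>I. of_bool (K j = i) * b j) = b j" by simp
    qed
    finally show ?thesis .
  qed
  \<comment> \<open>By Cauchy-Schwarz the potential cannot fall below the square of the total load
    divided by W. The induction keeps it within N M^2/\<nu> of that minimum, and the excess is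
    exactly the weighted variance of the loads.\<close>
  have "\<exists>Ks. (\<forall>s. clique (Ks s)) \<and> (\<Sum>i\<in>I. (load Ks a N i)\<^sup>2 / \<mu> i) \<le> (\<Sum>s<N. \<Sum>j<r. a s j)\<^sup>2 / W + real N * M\<^sup>2 / \<nu>"
  proof (induction N)
    case 0
    obtain K where "clique K" using greedy_clique[where a = "\<lambda>_. 0" and ld = "\<lambda>_. 0", OF ne] by auto
    then show ?case by (intro exI[of _ "\<lambda>_. K"]) (auto simp: load_def)
  next
    case (Suc N)
    then obtain Ks where Ks: "\<forall>s. clique (Ks s)" "(\<Sum>i\<in>I. (load Ks a N i)\<^sup>2 / \<mu> i) \<le> (\<Sum>s<N. \<Sum>j<r. a s j)\<^sup>2 / W + real N * M\<^sup>2 / \<nu>" by blast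
    define T where "T = (\<Sum>s<N. \<Sum>j<r. a s j)"
    define ld where "ld i = load Ks a N i / \<mu> i" for i
    have l0: "0 \<le> load Ks a N i" for i unfolding load_def using a by (intro sum_nonneg) auto
    have ld0: "0 \<le> ld i" if "i \<in> I" for i using l0 \<mu>pos[OF that] by (simp add: ld_def)
    have mld: "\<mu> i * ld i = load Ks a N i" if "i \<in> I" for i using \<mu>pos[OF that] by (simp add: ld_def)
    have loadT: "(\<Sum>i\<in>I. load Ks a N i) = T"
    proof -
      have "(\<Sum>i\<in>I. load Ks a N i) = (\<Sum>s<N. \<Sum>i\<in>I. \<Sum>j<r. of_bool (Ks s j = i) * a s j)" unfolding load_def by (rule sum.swap)
      also have "\<dots> = T" unfolding T_def using tot Ks(1) by (intro sum.cong) auto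
      finally show ?thesis .
    qed
    obtain K where K: "clique K" "W * (\<Sum>j<r. a N j * ld (K j)) \<le> (\<Sum>j<r. a N j) * (\<Sum>i\<in>I. \<mu> i * ld i)"
      using greedy_clique[where a = "a N" and ld = ld, OF ne ld0] a by auto
    define B where "B = (\<Sum>j<r. a N j)"
    have B: "0 \<le> B" "B \<le> M" unfolding B_def using a by (auto intro: sum_nonneg)
    have K2: "W * (\<Sum>j<r. a N j * ld (K j)) \<le> B * T" using K(2) mld loadT by (simp add: B_def)
    define inc where "inc i = (\<Sum>j<r. of_bool (K j = i) * a N j)" for i
    have inc0: "0 \<le> inc i" for i unfolding inc_def using a by (intro sum_nonneg) auto
    have incB: "(\<Sum>i\<in>I. inc i) = B" unfolding inc_def B_def by (rule tot[OF K(1)])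
    define Ks' where "Ks' = Ks(N := K)"
    have "load Ks' a (Suc N) i = load Ks a N i + inc i" for i
      unfolding load_def inc_def Ks'_def by simp
    then have "(\<Sum>i\<in>I. (load Ks' a (Suc N) i)\<^sup>2 / \<mu> i) = (\<Sum>i\<in>I. (load Ks a N i)\<^sup>2 / \<mu> i + 2 * (ld i * inc i) + (inc i)\<^sup>2 / \<mu> i)"
      by (simp add: ld_def power2_sum add_divide_distrib mult_ac add_ac)
    also have "\<dots> = (\<Sum>i\<in>I. (load Ks a N i)\<^sup>2 / \<mu> i) + 2 * (\<Sum>i\<in>I. ld i * inc i) + (\<Sum>i\<in>I. (inc i)\<^sup>2 / \<mu> i)"
      by (simp add: sum.distrib sum_distrib_left)
    also have "(\<Sum>i\<in>I. ld i * inc i) = (\<Sum>j<r. a N j * ld (K j))"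
    proof -
      have "(\<Sum>i\<in>I. ld i * inc i) = (\<Sum>i\<in>I. \<Sum>j<r. of_bool (K j = i) * (a N j * ld (K j)))"
        unfolding inc_def sum_distrib_left by (intro sum.cong) auto
      also have "\<dots> = (\<Sum>j<r. a N j * ld (K j))" by (rule tot[OF K(1)])
      finally show ?thesis .
    qed
    also have "(\<Sum>i\<in>I. (inc i)\<^sup>2 / \<mu> i) \<le> M\<^sup>2 / \<nu>"
    proof -
      have "(\<Sum>i\<in>I. (inc i)\<^sup>2 / \<mu> i) \<le> (\<Sum>i\<in>I. inc i * B / \<nu>)"
      proof (rule sum_mono)
        fix i assume i: "i \<in> I"
        have "inc i \<le> B" unfolding incB[symmetric] using i finI inc0 by (intro member_le_sum) auto
        then have "(inc i)\<^sup>2 \<le> inc i * B" using inc0 by (simp add: power2_eq_square mult_left_mono)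
        then show "(inc i)\<^sup>2 / \<mu> i \<le> inc i * B / \<nu>" using \<nu> i \<mu>pos[OF i] inc0 B by (intro frac_le) auto
      qed
      also have "\<dots> = B * B / \<nu>" by (simp add: sum_divide_distrib[symmetric] sum_distrib_right[symmetric] incB)
      also have "\<dots> \<le> M\<^sup>2 / \<nu>" using B \<nu> unfolding power2_eq_square by (intro divide_right_mono mult_mono) auto
      finally show ?thesis .
    qed
    also have "(\<Sum>j<r. a N j * ld (K j)) \<le> B * T / W" using K2 Wpos by (simp add: field_simps)
    also note Ks(2)
    finally have "(\<Sum>i\<in>I. (load Ks' a (Suc N) i)\<^sup>2 / \<mu> i) \<le> (T\<^sup>2 / W + real N * M\<^sup>2 / \<nu>) + 2 * (B * T / W) + M\<^sup>2 / \<nu>"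
      by (simp add: T_def)
    also have "\<dots> \<le> (T + B)\<^sup>2 / W + real (Suc N) * M\<^sup>2 / \<nu>"
    proof -
      have "(T + B)\<^sup>2 / W = T\<^sup>2 / W + 2 * (B * T / W) + B\<^sup>2 / W" using Wpos by (simp add: power2_sum field_simps)
      moreover have "0 \<le> B\<^sup>2 / W" using Wpos by simp
      moreover have "real (Suc N) * M\<^sup>2 / \<nu> = real N * M\<^sup>2 / \<nu> + M\<^sup>2 / \<nu>" by (simp add: add_divide_distrib distrib_right)
      ultimately show ?thesis by linarith
    qed
    also have "T + B = (\<Sum>s<Suc N. \<Sum>j<r. a s j)" by (simp add: T_def B_def)
    finally show ?case using Ks(1) K(1) by (intro exI[of _ Ks']) (auto simp: Ks'_def)
  qed
  then obtain Ks where Ks: "\<forall>s. clique (Ks s)" "(\<Sum>i\<in>I. (load Ks a N i)\<^sup>2 / \<mu> i) \<le> (\<Sum>s<N. \<Sum>j<r. a s j)\<^sup>2 / W + real N * M\<^sup>2 / \<nu>" by blast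
  define T where "T = (\<Sum>s<N. \<Sum>j<r. a s j)"
  have loadT: "(\<Sum>i\<in>I. load Ks a N i) = T"
  proof -
    have "(\<Sum>i\<in>I. load Ks a N i) = (\<Sum>s<N. \<Sum>i\<in>I. \<Sum>j<r. of_bool (Ks s j = i) * a s j)" unfolding load_def by (rule sum.swap)
    also have "\<dots> = T" unfolding T_def using tot Ks(1) by (intro sum.cong) auto
    finally show ?thesis .
  qed
  define w where "w = T / W"
  have wT: "\<mu> i * T / W = \<mu> i * w" for i by (simp add: w_def)
  have "(\<Sum>i\<in>I. (load Ks a N i - \<mu> i * T / W)\<^sup>2 / \<mu> i)
     = (\<Sum>i\<in>I. (load Ks a N i)\<^sup>2 / \<mu> i - 2 * w * load Ks a N i + w\<^sup>2 * \<mu> i)"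
  proof (rule sum.cong[OF refl])
    fix i assume "i \<in> I"
    then have m: "\<mu> i \<noteq> 0" using \<mu>pos by force
    have "(load Ks a N i - \<mu> i * w)\<^sup>2 = (load Ks a N i)\<^sup>2 - 2 * w * load Ks a N i * \<mu> i + w\<^sup>2 * \<mu> i * \<mu> i"
      by (simp add: power2_eq_square algebra_simps)
    then show "(load Ks a N i - \<mu> i * T / W)\<^sup>2 / \<mu> i = (load Ks a N i)\<^sup>2 / \<mu> i - 2 * w * load Ks a N i + w\<^sup>2 * \<mu> i"
      using m unfolding wT by (simp add: add_divide_distrib diff_divide_distrib)
  qed
  also have "\<dots> = (\<Sum>i\<in>I. (load Ks a N i)\<^sup>2 / \<mu> i) - 2 * w * T + w\<^sup>2 * W"
    by (simp only: sum.distrib sum_subtractf sum_distrib_left[symmetric] loadT W_def)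
  also have "\<dots> = (\<Sum>i\<in>I. (load Ks a N i)\<^sup>2 / \<mu> i) - T\<^sup>2 / W" using Wpos by (simp add: w_def power2_eq_square)
  also have "\<dots> \<le> real N * M\<^sup>2 / \<nu>" using Ks(2) by (simp add: T_def)
  finally have var: "(\<Sum>i\<in>I. (load Ks a N i - \<mu> i * T / W)\<^sup>2 / \<mu> i) \<le> real N * M\<^sup>2 / \<nu>" .
  have "(load Ks a N i - \<mu> i * T / W)\<^sup>2 \<le> \<mu> i * (real N * M\<^sup>2 / \<nu>)" if i: "i \<in> I" for i
  proof -
    have "(load Ks a N i - \<mu> i * T / W)\<^sup>2 / \<mu> i \<le> (\<Sum>i\<in>I. (load Ks a N i - \<mu> i * T / W)\<^sup>2 / \<mu> i)"
      using i finI \<mu>pos by (intro member_le_sum) (auto intro!: divide_nonneg_pos)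
    then have "(load Ks a N i - \<mu> i * T / W)\<^sup>2 / \<mu> i \<le> real N * M\<^sup>2 / \<nu>" using var by linarith
    then show ?thesis using \<mu>pos[OF i] by (simp add: pos_divide_le_eq mult.commute)
  qed
  then show ?thesis using Ks(1) unfolding T_def by blast
qed

text \<open>Blocks are grouped into runs of length \<open>q\<close>. The first 2^r - 1 blocks of a
  run carry the walk from the previous clique to its own, and the schedule then stays constant,
  which is allowed because a clique is compatible with itself.\<close>

lemma clique_schedule:
  assumes ne: "I \<noteq> {}" and Ks: "\<And>s. clique (Ks s)" and q: "2 ^ r \<le> (q::nat)"
  shows "\<exists>cl. (\<forall>t. clique (cl t) \<and> compat (cl t) (cl (Suc t))) \<and> (\<forall>t. 2 ^ r \<le> t mod q \<longrightarrow> cl t = Ks (t div q))"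
proof -
  define L where "L = (2 ^ r - 1 :: nat)"
  have lpos: "L < q" "0 < q" using q one_le_power[of "2::nat" r] unfolding L_def by linarith+
  have "\<forall>s. \<exists>w. w 0 = Ks s \<and> w L = Ks (Suc s) \<and> (\<forall>i\<le>L. clique (w i)) \<and> (\<forall>i<L. compat (w i) (w (Suc i)))"
    using reach_any_clique[OF ne Ks Ks] unfolding reach_def L_def by blast
  then obtain w where w: "\<And>s. w s 0 = Ks s" "\<And>s. w s L = Ks (Suc s)" "\<And>s i. i \<le> L \<Longrightarrow> clique (w s i)"
    "\<And>s i. i < L \<Longrightarrow> compat (w s i) (w s (Suc i))"
    by metis
  \<comment> \<open>The first run has no predecessor and is constant throughout, so the truncated
    subtraction in \<open>t div q - 1\<close> never matters.\<close>
  define cl where "cl t = (if t div q = 0 then Ks 0 else if t mod q < L then w (t div q - 1) (t mod q) else Ks (t div q))" for t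
  have late: "cl t = Ks (t div q)" if "L \<le> t mod q" for t using that by (auto simp: cl_def)
  have early: "cl t = w (t div q - 1) (t mod q)" if "t mod q \<le> L" "t div q \<noteq> 0" for t
    using that w(2)[of "t div q - 1"] by (auto simp: cl_def le_less)
  have 1: "clique (cl t)" for t using Ks w(3) by (auto simp: cl_def)
  have 2: "compat (cl t) (cl (Suc t))" for t
  proof (cases "Suc (t mod q) = q")
    case True
    have "Suc t mod q = 0" "Suc t div q = Suc (t div q)" using True by (auto simp: mod_Suc div_Suc)
    moreover have "cl t = Ks (t div q)" using late[of t] True lpos by auto
    ultimately have "cl (Suc t) = cl t" using early[of "Suc t"] w(1) by simp
    then show ?thesis using compat_refl 1 by simp
  next
    case False
    then have eq: "Suc t mod q = Suc (t mod q)" "Suc t div q = t div q" by (auto simp: mod_Suc div_Suc)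
    consider "t div q = 0" | "t div q \<noteq> 0" "t mod q < L" | "t div q \<noteq> 0" "L \<le> t mod q" by linarith
    then show ?thesis
    proof cases
      case 1
      then have "cl t = Ks 0" "cl (Suc t) = Ks 0" using eq by (auto simp: cl_def)
      then show ?thesis using compat_refl Ks by simp
    next
      case 2
      then show ?thesis using early[of t] early[of "Suc t"] eq w(4) by simp
    next
      case 3
      then have "cl t = Ks (t div q)" "cl (Suc t) = Ks (t div q)" using late[of t] late[of "Suc t"] eq by auto
      then show ?thesis using compat_refl Ks by simp
    qed
  qed
  have "cl t = Ks (t div q)" if "2 ^ r \<le> t mod q" for t using late[of t] that unfolding L_def by simp
  then show ?thesis using 1 2 by blast
qed

end

section \<open>The embedding\<close>

text \<open>Halmos-Vaughan induction: split at a critical proper subset if there is one; otherwise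
  any choice for one element leaves Hall's condition intact.\<close>

lemma hall_matching:
  assumes "finite X" "\<And>x. x \<in> X \<Longrightarrow> finite (C x)" "\<And>Y. Y \<subseteq> X \<Longrightarrow> card Y \<le> card (\<Union>x\<in>Y. C x)"
  shows "\<exists>g. inj_on g X \<and> (\<forall>x\<in>X. g x \<in> C x)"
  using assms
proof (induction "card X" arbitrary: X C rule: less_induct)
  case less
  show ?case
  proof (cases "X = {}")
    case False
    then obtain x where x: "x \<in> X" by auto
    show ?thesis
    proof (cases "\<exists>Y\<subset>X. Y \<noteq> {} \<and> card (\<Union>x\<in>Y. C x) = card Y")
      case True
      then obtain Y where Y: "Y \<subset> X" "Y \<noteq> {}" "card (\<Union>x\<in>Y. C x) = card Y" by auto
      define Z where "Z = (\<Union>x\<in>Y. C x)"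
      have finY: "finite Y" using Y less.prems(1) finite_subset by blast
      have "card Y < card X" using Y less.prems(1) psubset_card_mono by blast
      moreover have "card Y' \<le> card (\<Union>x\<in>Y'. C x)" if "Y' \<subseteq> Y" for Y' using that Y less.prems(3) by auto
      ultimately obtain g1 where g1: "inj_on g1 Y" "\<And>x. x \<in> Y \<Longrightarrow> g1 x \<in> C x"
        using less.hyps[of Y C] finY Y(1) less.prems(2) by blast
      have "card (X - Y) < card X" using Y less.prems(1) by (intro psubset_card_mono) auto
      moreover have "card Y' \<le> card (\<Union>x\<in>Y'. C x - Z)" if Y': "Y' \<subseteq> X - Y" for Y'
      proof -
        have finY': "finite Y'" using Y' less.prems(1) finite_subset by blast
        have "card Y' + card Y = card (Y' \<union> Y)" using Y' finY' finY by (intro card_Un_disjoint[symmetric]) auto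
        also have "\<dots> \<le> card (\<Union>x\<in>Y' \<union> Y. C x)" using Y' Y by (intro less.prems(3)) auto
        also have "(\<Union>x\<in>Y' \<union> Y. C x) = (\<Union>x\<in>Y'. C x - Z) \<union> Z" by (auto simp: Z_def)
        also have "card \<dots> \<le> card (\<Union>x\<in>Y'. C x - Z) + card Z" by (rule card_Un_le)
        finally show ?thesis using Y(3) by (simp add: Z_def)
      qed
      ultimately obtain g2 where g2: "inj_on g2 (X - Y)" "\<And>x. x \<in> X - Y \<Longrightarrow> g2 x \<in> C x - Z"
        using less.hyps[of "X - Y" "\<lambda>x. C x - Z"] less.prems(1,2) by (metis (no_types, lifting) Diff_iff finite_Diff)
      define g where "g x = (if x \<in> Y then g1 x else g2 x)" for x
      have gZ: "g x \<in> Z \<longleftrightarrow> x \<in> Y" if "x \<in> X" for x using that g1(2) g2(2)[of x] by (auto simp: g_def Z_def)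
      have "inj_on g X"
      proof (rule inj_onI)
        fix a b assume ab: "a \<in> X" "b \<in> X" "g a = g b"
        then have "a \<in> Y \<longleftrightarrow> b \<in> Y" using gZ[of a] gZ[of b] by simp
        then show "a = b" using ab g1(1) g2(1) by (cases "a \<in> Y") (auto simp: g_def inj_on_def)
      qed
      moreover have "\<forall>x\<in>X. g x \<in> C x" using g1(2) g2(2) by (auto simp: g_def)
      ultimately show ?thesis by blast
    next
      case False
      have "card {x} \<le> card (\<Union>x\<in>{x}. C x)" using x by (intro less.prems(3)) auto
      then obtain v where v: "v \<in> C x" by fastforce
      have "card (X - {x}) < card X" using x less.prems(1) by (intro psubset_card_mono) auto
      moreover have "card Y \<le> card (\<Union>y\<in>Y. C y - {v})" if Y: "Y \<subseteq> X - {x}" for Y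
      proof (cases "Y = {}")
        case Yne: False
        have "card Y \<le> card (\<Union>x\<in>Y. C x)" using Y by (intro less.prems(3)) auto
        moreover have "card (\<Union>x\<in>Y. C x) \<noteq> card Y" using False Y Yne x by blast
        moreover have "(\<Union>y\<in>Y. C y - {v}) = (\<Union>x\<in>Y. C x) - {v}" by auto
        moreover have "card (\<Union>x\<in>Y. C x) - 1 \<le> card ((\<Union>x\<in>Y. C x) - {v})" by (metis card_Diff_singleton_if diff_le_self order_refl)
        ultimately show ?thesis by simp
      qed simp
      ultimately obtain g where g: "inj_on g (X - {x})" "\<And>y. y \<in> X - {x} \<Longrightarrow> g y \<in> C y - {v}"
        using less.hyps[of "X - {x}" "\<lambda>y. C y - {v}"] less.prems(1,2) by (metis (no_types, lifting) Diff_iff finite_Diff)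
      have "inj_on (g(x := v)) X"
      proof (rule inj_onI)
        fix a b assume ab: "a \<in> X" "b \<in> X" "(g(x := v)) a = (g(x := v)) b"
        show "a = b"
        proof (cases "a = x \<or> b = x")
          case True
          then show ?thesis using ab g(2)[of a] g(2)[of b] by (auto split: if_splits)
        next
          case False
          then show ?thesis using ab g(1) by (auto simp: inj_on_def)
        qed
      qed
      moreover have "\<forall>y\<in>X. (g(x := v)) y \<in> C y" using g(2) v by auto
      ultimately show ?thesis by blast
    qed
  qed auto
qed

text \<open>A vertex \<open>u\<close> of \<open>H\<close> lies in block \<open>b u\<close>, has colour \<open>\<kappa> u\<close> in a colouring of the cube of \<open>H\<close>, and
  is to be embedded into the part \<open>U (\<sigma> u) (\<kappa> u)\<close> reserved for its colour in its cluster \<open>Vc (\<sigma> u)\<close>.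
  The sequences \<open>d\<close> and \<open>\<epsilon>\<close> are indexed by the number of neighbours embedded so far.\<close>

locale embedding_setup =
  fixes E G :: "nat set set" and n :: nat and p :: real
    and VH :: "'h set" and hadj :: "'h \<Rightarrow> 'h \<Rightarrow> bool" and \<Delta> q :: nat
    and b \<kappa> :: "'h \<Rightarrow> nat" and \<sigma> :: "'h \<Rightarrow> 'i" and U :: "'i \<Rightarrow> nat \<Rightarrow> nat set" and Vc :: "'i \<Rightarrow> nat set"
    and d \<epsilon> :: "nat \<Rightarrow> real" and \<kappa>0 a0 \<zeta> c M1 M2 :: real
  assumes GE: "G \<subseteq> E" and p: "0 < p" "p \<le> 1" and finH: "finite VH" and \<Delta>: "1 \<le> \<Delta>"
    and hsym: "\<And>u v. hadj u v \<Longrightarrow> hadj v u" and hV: "\<And>u v. hadj u v \<Longrightarrow> u \<in> VH"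
    and hdeg: "\<And>u. u \<in> VH \<Longrightarrow> card {w. hadj u w} \<le> \<Delta>"
    and \<kappa>q: "\<And>u. u \<in> VH \<Longrightarrow> \<kappa> u < q"
    and bedge: "\<And>u v. hadj u v \<Longrightarrow> b u \<le> b v + 1"
    and \<kappa>1: "\<And>u v. hadj u v \<Longrightarrow> \<kappa> u \<noteq> \<kappa> v"
    and \<kappa>2: "\<And>u v w. hadj u v \<Longrightarrow> hadj v w \<Longrightarrow> u \<noteq> w \<Longrightarrow> \<kappa> u \<noteq> \<kappa> w"
    and \<kappa>3: "\<And>u v w x. hadj u v \<Longrightarrow> hadj v w \<Longrightarrow> hadj w x \<Longrightarrow> u \<noteq> x \<Longrightarrow> \<kappa> u \<noteq> \<kappa> x"
    and \<kappa>b: "\<And>u v. u \<in> VH \<Longrightarrow> v \<in> VH \<Longrightarrow> \<kappa> u = \<kappa> v \<Longrightarrow> b u < b v \<Longrightarrow> b u + 3 \<le> b v"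
    and UV: "\<And>i k. U i k \<subseteq> Vc i" and Vcn: "\<And>i. Vc i \<subseteq> {..<n}"
    and Udisj: "\<And>u w v. u \<in> VH \<Longrightarrow> w \<in> VH \<Longrightarrow> v \<in> U (\<sigma> u) (\<kappa> u) \<Longrightarrow> v \<in> U (\<sigma> w) (\<kappa> w) \<Longrightarrow> \<sigma> u = \<sigma> w \<and> \<kappa> u = \<kappa> w"
    and Usize: "\<And>u. u \<in> VH \<Longrightarrow> real (card {w\<in>VH. \<sigma> w = \<sigma> u \<and> \<kappa> w = \<kappa> u}) + \<zeta> * real (card (Vc (\<sigma> u))) \<le> real (card (U (\<sigma> u) (\<kappa> u)))"
    and a0: "0 < a0" "\<And>u. u \<in> VH \<Longrightarrow> a0 \<le> \<zeta> * real (card (Vc (\<sigma> u)))"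
    and dense0: "\<And>u v. hadj u v \<Longrightarrow> dense_pair (adj G) (d 0 * p) (\<epsilon> 0 * \<zeta>) (Vc (\<sigma> u)) (Vc (\<sigma> v))"
    and dS: "\<And>l. d (Suc l) = d l / 2^24" and d0: "d 0 \<le> 1" and \<kappa>0: "0 < \<kappa>0" "\<And>l. l \<le> 2 * \<Delta> \<Longrightarrow> \<kappa>0 \<le> d l"
    and \<epsilon>0: "\<And>l. l \<le> 2 * \<Delta> \<Longrightarrow> 0 < \<epsilon> l" and \<epsilon>S: "\<And>l. l < 2 * \<Delta> \<Longrightarrow> \<epsilon> l \<le> \<epsilon> (Suc l)" and \<epsilon>D: "\<epsilon> (2 * \<Delta>) * (4 * real \<Delta>) \<le> 1"
    and inh1: "\<And>l. l < 2 * \<Delta> \<Longrightarrow> inherit_one E {..<n} p (d l) (\<epsilon> l) (\<epsilon> (Suc l) * \<kappa>0) (\<epsilon> (Suc l)) M1 M2"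
    and inh2: "\<And>l. l < 2 * \<Delta> \<Longrightarrow> inherit_two E {..<n} p (d l) (\<epsilon> l) (\<epsilon> (Suc l) * \<kappa>0) M2"
    and M0: "0 \<le> M1" "0 \<le> M2"
    and S1: "\<And>j. j + 1 \<le> \<Delta> \<Longrightarrow> 8 * (real \<Delta>)\<^sup>2 * M1 \<le> a0 * (\<kappa>0 * p) ^ j"
    and S2: "\<And>j. j + 2 \<le> \<Delta> \<Longrightarrow> 8 * (real \<Delta>)\<^sup>2 * M2 \<le> a0 * (\<kappa>0 * p) ^ j"
    and hall: "hall_property E n p \<Delta> c" and cn: "c * real n \<le> a0 / 2 * \<kappa>0 ^ \<Delta>" 
    and layer: "\<And>t k. real (card {u\<in>VH. b u = t \<and> \<kappa> u = k}) \<le> a0 / 2" "\<And>t k. real (card {u\<in>VH. b u = t \<and> \<kappa> u = k}) \<le> c / exp 2 * real n"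
begin

text \<open>Lexicographic: block first, then colour. Vertices of equal time have the same colour, so
  they are independent and no two of them have a common neighbour.\<close>

definition time :: "'h \<Rightarrow> nat" where "time u = b u * q + \<kappa> u"

definition placed :: "nat \<Rightarrow> 'h set" where "placed t = {u\<in>VH. time u < t}"

definition nplaced :: "nat \<Rightarrow> 'h \<Rightarrow> nat" where "nplaced t u = card {w\<in>placed t. hadj u w}"

text \<open>Vertices sharing a part \<open>U i k\<close> lie in the same block or at least three blocks apart. Images are
  removed from the candidates only in the latter case: at that time no neighbour of \<open>u\<close> has been
  embedded, so the removal costs no regularity.\<close>

definition cand :: "nat \<Rightarrow> ('h \<Rightarrow> nat) \<Rightarrow> 'h \<Rightarrow> nat set" where
  "cand t f u = {v\<in>U (\<sigma> u) (\<kappa> u). (\<forall>w\<in>placed t. b w + 3 \<le> b u \<longrightarrow> f w \<noteq> v) \<and> (\<forall>w\<in>placed t. hadj u w \<longrightarrow> {v, f w} \<in> G)}"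

text \<open>Sizes and densities are tracked by the numbers of embedded neighbours alone, so the loss
  is bounded by \<Delta> steps per vertex and 2\<Delta> per edge, however many vertices have been
  embedded.\<close>

definition inv :: "nat \<Rightarrow> ('h \<Rightarrow> nat) \<Rightarrow> bool" where
  "inv t f \<longleftrightarrow> inj_on f (placed t) \<and> (\<forall>u\<in>placed t. f u \<in> U (\<sigma> u) (\<kappa> u)) \<and>
     (\<forall>u\<in>placed t. \<forall>w\<in>placed t. hadj u w \<longrightarrow> {f u, f w} \<in> G) \<and>
     (\<forall>u\<in>VH - placed t. a0 * (\<kappa>0 * p) ^ nplaced t u \<le> real (card (cand t f u))) \<and>
     (\<forall>u\<in>VH - placed t. \<forall>w\<in>VH - placed t. hadj u w \<longrightarrow>
        dense_pair (adj G) (d (nplaced t u + nplaced t w) * p) (\<epsilon> (nplaced t u + nplaced t w)) (cand t f u) (cand t f w))"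

lemma finite_placed: "finite (placed t)" unfolding placed_def using finH by simp
lemma placed_subset: "placed t \<subseteq> VH" unfolding placed_def by auto
lemma finite_U: "finite (U i k)" using UV Vcn finite_subset[of _ "{..<n}"] by (meson finite_lessThan finite_subset order_trans)
lemma cand_subset: "cand t f u \<subseteq> U (\<sigma> u) (\<kappa> u)" unfolding cand_def by auto
lemma cand_subset_lessThan: "cand t f u \<subseteq> {..<n}" using cand_subset UV Vcn by blast
lemma finite_cand: "finite (cand t f u)" by (rule finite_subset[OF cand_subset_lessThan]) simp
lemma finite_nbrs_H: "finite {w. hadj u w}" using hV hsym finH finite_subset[of "{w. hadj u w}" VH] by blast

lemma b_le: "w \<in> placed (Suc t) \<Longrightarrow> b w \<le> t div q"
proof -
  assume w: "w \<in> placed (Suc t)"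
  then have "b w * q + \<kappa> w \<le> t" "\<kappa> w < q" using \<kappa>q by (auto simp: placed_def time_def)
  then have "b w * q \<le> t" "0 < q" by auto
  then show "b w \<le> t div q" by (simp add: less_eq_div_iff_mult_less_eq)
qed

lemma time_eq: "w \<in> VH \<Longrightarrow> time w = t \<Longrightarrow> b w = t div q \<and> \<kappa> w = t mod q"
  using \<kappa>q[of w] by (auto simp: time_def)

lemma cand_disjoint:
  assumes "u \<in> VH" "w \<in> VH" "\<kappa> u \<noteq> \<kappa> w"
  shows "cand t f u \<inter> cand t f w = {}"
  using assms Udisj cand_subset by blast

text \<open>No neighbour restricts the candidates, so only images lying in the same part can be
  missing, at most one for each vertex assigned to that part; the reserve in \<open>Usize\<close> is
  left.\<close>

lemma fresh_large:
  assumes u: "u \<in> VH" and f: "inj_on f (placed t)" "\<forall>w\<in>placed t. f w \<in> U (\<sigma> w) (\<kappa> w)" and z: "nplaced t u = 0"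
  shows "\<zeta> * real (card (Vc (\<sigma> u))) \<le> real (card (cand t f u))"
proof -
  have none: "\<not> hadj u w" if "w \<in> placed t" for w
    using z that finite_placed[of t] unfolding nplaced_def by auto
  define R where "R = {w\<in>placed t. \<sigma> w = \<sigma> u \<and> \<kappa> w = \<kappa> u}"
  have "U (\<sigma> u) (\<kappa> u) - f ` R \<subseteq> cand t f u"
  proof
    fix v assume v: "v \<in> U (\<sigma> u) (\<kappa> u) - f ` R"
    have "f w \<noteq> v" if "w \<in> placed t" for w
    proof
      assume "f w = v"
      then have "\<sigma> w = \<sigma> u \<and> \<kappa> w = \<kappa> u" using Udisj[of w u v] f(2) that v u placed_subset by blast
      then have "w \<in> R" using that by (simp add: R_def)
      then show False using v \<open>f w = v\<close> by blast
    qed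
    then show "v \<in> cand t f u" using v none by (auto simp: cand_def)
  qed
  then have "card (U (\<sigma> u) (\<kappa> u) - f ` R) \<le> card (cand t f u)" using finite_cand card_mono by blast
  moreover have "card (U (\<sigma> u) (\<kappa> u)) - card (f ` R) \<le> card (U (\<sigma> u) (\<kappa> u) - f ` R)" by (rule diff_card_le_card_Diff) (use finite_placed R_def in simp)
  moreover have "card (f ` R) \<le> card {w\<in>VH. \<sigma> w = \<sigma> u \<and> \<kappa> w = \<kappa> u}"
  proof -
    have "card (f ` R) \<le> card R" by (rule card_image_le) (use finite_placed R_def in simp)
    also have "\<dots> \<le> card {w\<in>VH. \<sigma> w = \<sigma> u \<and> \<kappa> w = \<kappa> u}" using finH placed_subset by (intro card_mono) (auto simp: R_def)
    finally show ?thesis .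
  qed
  ultimately have "real (card (U (\<sigma> u) (\<kappa> u))) - real (card {w\<in>VH. \<sigma> w = \<sigma> u \<and> \<kappa> w = \<kappa> u}) \<le> real (card (cand t f u))" by linarith
  then show ?thesis using Usize[OF u] by linarith
qed

lemma inv_0: "inv 0 f"
proof -
  have e: "placed 0 = {}" by (auto simp: placed_def)
  have n0: "nplaced 0 u = 0" for u by (simp add: nplaced_def e)
  have big: "\<zeta> * real (card (Vc (\<sigma> u))) \<le> real (card (cand 0 f u))" if "u \<in> VH" for u
    using fresh_large[OF that, of f 0] by (simp add: e n0)
  have "dense_pair (adj G) (d 0 * p) (\<epsilon> 0) (cand 0 f u) (cand 0 f w)" if "hadj u w" for u w
  proof (rule dense_pair_subset[OF dense0[OF that]])
    show "cand 0 f u \<subseteq> Vc (\<sigma> u)" "cand 0 f w \<subseteq> Vc (\<sigma> w)" using cand_subset UV by blast+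
    show "\<zeta> * real (card (Vc (\<sigma> u))) \<le> real (card (cand 0 f u))" "\<zeta> * real (card (Vc (\<sigma> w))) \<le> real (card (cand 0 f w))"
      using big hV that hsym by blast+
  qed (use \<epsilon>0[of 0] in auto)
  moreover have "a0 \<le> real (card (cand 0 f u))" if "u \<in> VH" for u
    using order_trans[OF a0(2)[OF that] big[OF that]] .
  ultimately show ?thesis unfolding inv_def e n0 by simp
qed

section \<open>Exceptional candidates and the embedding of one layer\<close>

definition bad :: "nat \<Rightarrow> ('h \<Rightarrow> nat) \<Rightarrow> 'h \<Rightarrow> 'h \<Rightarrow> nat set" where
  "bad t f x y = {v\<in>cand t f x. real (card {u\<in>cand t f y. {v, u} \<in> G}) < \<kappa>0 * p * real (card (cand t f y))}"

text \<open>Choices for \<open>x\<close> that spoil the density between the restricted candidates of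
  \<open>y\<close> and the unrestricted ones of \<open>z\<close>. The degree condition is included
  because inheritance measures witnesses against p times the whole candidate set; choices violating
  it lie in \<open>bad\<close>.\<close>

definition bad1 :: "nat \<Rightarrow> ('h \<Rightarrow> nat) \<Rightarrow> 'h \<Rightarrow> 'h \<Rightarrow> 'h \<Rightarrow> nat set" where
  "bad1 t f x y z = {v\<in>cand t f x. \<kappa>0 * p * real (card (cand t f y)) \<le> real (card {u\<in>cand t f y. {v, u} \<in> G}) \<and>
     \<not> dense_pair (adj G) (d (Suc (nplaced t y + nplaced t z)) * p) (\<epsilon> (Suc (nplaced t y + nplaced t z)))
        {u\<in>cand t f y. {v, u} \<in> G} (cand t f z)}"

definition bad2 :: "nat \<Rightarrow> ('h \<Rightarrow> nat) \<Rightarrow> 'h \<Rightarrow> 'h \<Rightarrow> 'h \<Rightarrow> nat set" where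
  "bad2 t f x y z = {v\<in>cand t f x. \<kappa>0 * p * real (card (cand t f y)) \<le> real (card {u\<in>cand t f y. {v, u} \<in> G}) \<and>
     \<kappa>0 * p * real (card (cand t f z)) \<le> real (card {u\<in>cand t f z. {v, u} \<in> G}) \<and>
     \<not> dense_pair (adj G) (d (Suc (nplaced t y + nplaced t z)) * p) (\<epsilon> (Suc (nplaced t y + nplaced t z)))
        {u\<in>cand t f y. {v, u} \<in> G} {u\<in>cand t f z. {v, u} \<in> G}}"

text \<open>Neighbours still to come lower the number of embedded ones: one leaves at most \<Delta>
  - 1, two at most \<Delta> - 2. This saving makes candidate sets large enough for
  inheritance.\<close>

lemma nplaced_le:
  assumes "u \<in> VH" "Y \<subseteq> {w. hadj u w}" "Y \<inter> placed t = {}"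
  shows "nplaced t u + card Y \<le> \<Delta>"
proof -
  have "nplaced t u + card Y = card ({w\<in>placed t. hadj u w} \<union> Y)"
    unfolding nplaced_def using assms finite_placed finite_subset[OF assms(2) finite_nbrs_H] by (intro card_Un_disjoint[symmetric]) auto
  also have "\<dots> \<le> card {w. hadj u w}" using assms finite_nbrs_H by (intro card_mono) auto
  also have "\<dots> \<le> \<Delta>" by (rule hdeg[OF assms(1)])
  finally show ?thesis .
qed

lemma \<epsilon>_mono: "l \<le> m \<Longrightarrow> m \<le> 2 * \<Delta> \<Longrightarrow> \<epsilon> l \<le> \<epsilon> m"
proof (induction m)
  case (Suc m)
  then show ?case using \<epsilon>S[of m] by (cases "l = Suc m") auto
qed auto

context
  fixes t f
  assumes inv: "inv t f"
begin

lemma cand_size: "u \<in> VH - placed t \<Longrightarrow> a0 * (\<kappa>0 * p) ^ nplaced t u \<le> real (card (cand t f u))"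
  using inv unfolding inv_def by blast

lemma cand_dense: "u \<in> VH - placed t \<Longrightarrow> w \<in> VH - placed t \<Longrightarrow> hadj u w \<Longrightarrow>
   dense_pair (adj G) (d (nplaced t u + nplaced t w) * p) (\<epsilon> (nplaced t u + nplaced t w)) (cand t f u) (cand t f w)"
  using inv unfolding inv_def by blast

text \<open>The low-degree candidates together span too few edges to the candidates of
  \<open>y\<close>, which density excludes unless they are an \<epsilon>-small part. The factor
  4\<Delta> lets the sets for all neighbours of \<open>x\<close> fill at most a quarter.\<close>

lemma card_bad:
  assumes xy: "x \<in> VH - placed t" "y \<in> VH - placed t" "hadj x y"
  shows "real (card (bad t f x y)) * (4 * real \<Delta>) \<le> real (card (cand t f x))"
proof (cases "bad t f x y = {}")
  case False
  define l where "l = nplaced t x + nplaced t y"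
  have "nplaced t x + card {y} \<le> \<Delta>" "nplaced t y + card {x} \<le> \<Delta>"
    using xy hsym by (intro nplaced_le; auto)+
  then have l: "l \<le> 2 * \<Delta>" by (simp add: l_def)
  have fb: "finite (bad t f x y)" unfolding bad_def using finite_cand by simp
  have "\<not> \<epsilon> l * real (card (cand t f x)) \<le> real (card (bad t f x y))"
  proof
    assume big: "\<epsilon> l * real (card (cand t f x)) \<le> real (card (bad t f x y))"
    have "nplaced t y + card {x} \<le> \<Delta>" using xy hsym by (intro nplaced_le) auto
    have e1: "\<epsilon> l * real (card (cand t f y)) \<le> real (card (cand t f y))"
    proof -
      have "\<epsilon> l \<le> \<epsilon> (2 * \<Delta>)" using \<epsilon>_mono l by blast
      moreover have "\<epsilon> (2 * \<Delta>) * 1 \<le> \<epsilon> (2 * \<Delta>) * (4 * real \<Delta>)" using \<epsilon>0[of "2 * \<Delta>"] \<Delta> by (intro mult_left_mono) auto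
      ultimately have "\<epsilon> l \<le> 1" using \<epsilon>D by linarith
      then show ?thesis by (intro mult_left_le_one_le) (use \<epsilon>0[OF l] in auto)
    qed
    have "d l * p * real (card (bad t f x y)) * real (card (cand t f y)) \<le> ec (adj G) (bad t f x y) (cand t f y)"
      using cand_dense[OF xy] big e1 unfolding l_def by (intro dense_pairD) (auto simp: bad_def)
    also have "\<dots> = (\<Sum>v\<in>bad t f x y. real (card {u\<in>cand t f y. {v, u} \<in> G}))"
      unfolding ec_def using ec_deg[OF finite_cand, of "adj G"] by (simp add: adj_def)
    also have "\<dots> < (\<Sum>v\<in>bad t f x y. \<kappa>0 * p * real (card (cand t f y)))"
      using fb False by (intro sum_strict_mono) (auto simp: bad_def)
    also have "\<dots> = \<kappa>0 * (p * real (card (bad t f x y)) * real (card (cand t f y)))" by simp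
    also have "\<dots> \<le> d l * (p * real (card (bad t f x y)) * real (card (cand t f y)))"
      using \<kappa>0(2)[OF l] p by (intro mult_right_mono) auto
    finally show False by (simp add: mult.assoc)
  qed
  then have "real (card (bad t f x y)) \<le> \<epsilon> (2 * \<Delta>) * real (card (cand t f x))"
    using mult_right_mono[OF \<epsilon>_mono[OF l order_refl], of "real (card (cand t f x))"] by linarith
  then have "real (card (bad t f x y)) * (4 * real \<Delta>) \<le> \<epsilon> (2 * \<Delta>) * real (card (cand t f x)) * (4 * real \<Delta>)"
    by (intro mult_right_mono) auto
  also have "\<dots> = (\<epsilon> (2 * \<Delta>) * (4 * real \<Delta>)) * real (card (cand t f x))" by simp
  also have "\<dots> \<le> 1 * real (card (cand t f x))" by (rule mult_right_mono[OF \<epsilon>D]) simp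
  finally show ?thesis by simp
qed simp

lemma M1_le:
  assumes "u \<in> VH - placed t" "hadj u w" "w \<notin> placed t"
  shows "8 * (real \<Delta>)\<^sup>2 * M1 \<le> real (card (cand t f u))"
proof -
  have "nplaced t u + card {w} \<le> \<Delta>" using assms by (intro nplaced_le) auto
  then show ?thesis using S1[of "nplaced t u"] cand_size[OF assms(1)] by auto
qed

lemma M2_le:
  assumes "u \<in> VH - placed t" "hadj u w" "w \<notin> placed t" "hadj u z" "z \<notin> placed t" "w \<noteq> z"
  shows "8 * (real \<Delta>)\<^sup>2 * M2 \<le> real (card (cand t f u))"
proof -
  have "nplaced t u + card {w, z} \<le> \<Delta>" using assms by (intro nplaced_le) auto
  then show ?thesis using S2[of "nplaced t u"] cand_size[OF assms(1)] assms(6) by auto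
qed

lemma le_eight: "0 \<le> m \<Longrightarrow> 8 * (real \<Delta>)\<^sup>2 * m \<le> s \<Longrightarrow> m \<le> s"
proof -
  assume m: "0 \<le> m" "8 * (real \<Delta>)\<^sup>2 * m \<le> s"
  have "1 \<le> (real \<Delta>)\<^sup>2" using \<Delta> by simp
  then have "1 * m \<le> (8 * (real \<Delta>)\<^sup>2) * m" using m by (intro mult_right_mono) auto
  then show "m \<le> s" using m by linarith
qed

lemma edge_level:
  assumes "y \<in> VH - placed t" "z \<in> VH - placed t" "hadj y z"
  shows "Suc (Suc (nplaced t y + nplaced t z)) \<le> 2 * \<Delta>"
proof -
  have "nplaced t y + card {z} \<le> \<Delta>" using assms by (intro nplaced_le) auto
  moreover have "nplaced t z + card {y} \<le> \<Delta>" using assms hsym by (intro nplaced_le) auto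
  ultimately show ?thesis by simp
qed

text \<open>\<open>y\<close> has the two unembedded neighbours \<open>x\<close> and
  \<open>z\<close>, so its candidate set reaches size M2; \<open>z\<close> is only known to have
  \<open>y\<close>, so its candidate set reaches M1. This is why \<open>inherit_one\<close> asks for
  different sizes of its two classes.\<close>

lemma card_bad1:
  assumes xyz: "x \<in> VH - placed t" "y \<in> VH - placed t" "z \<in> VH - placed t" "hadj x y" "hadj y z" "x \<noteq> z"
  shows "real (card (bad1 t f x y z)) \<le> M1"
proof -
  define l where "l = nplaced t y + nplaced t z"
  have l: "l < 2 * \<Delta>" using edge_level[OF xyz(2,3,5)] by (simp add: l_def)
  have k: "\<kappa> x \<noteq> \<kappa> y" "\<kappa> y \<noteq> \<kappa> z" "\<kappa> x \<noteq> \<kappa> z" using \<kappa>1 \<kappa>2 xyz by auto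
  have inh: "inherit_one E {..<n} p (d l) (\<epsilon> l) (\<epsilon> (Suc l) * \<kappa>0) (\<epsilon> (Suc l)) M1 M2" by (rule inh1[OF l])
  have eS: "0 < \<epsilon> (Suc l)" using \<epsilon>0[of "Suc l"] l by simp
  have "real (card (bad1 t f x y z)) < M1"
  proof (rule inh[unfolded inherit_one_def, rule_format, OF GE])
    show "cand t f y \<subseteq> {..<n}" "cand t f z \<subseteq> {..<n}" by (rule cand_subset_lessThan)+
    show "bad1 t f x y z \<subseteq> {..<n}" using cand_subset_lessThan unfolding bad1_def by blast
    show "cand t f y \<inter> cand t f z = {}" using xyz k by (intro cand_disjoint) auto
    show "cand t f y \<inter> bad1 t f x y z = {}" using cand_disjoint[of x y t f] xyz k unfolding bad1_def by blast
    show "cand t f z \<inter> bad1 t f x y z = {}" using cand_disjoint[of x z t f] xyz k unfolding bad1_def by blast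
    show "M2 \<le> real (card (cand t f y))"
      by (rule le_eight[OF M0(2) M2_le[OF xyz(2) hsym[OF xyz(4)] _ xyz(5) _ xyz(6)]]) (use xyz in simp_all)
    show "M1 \<le> real (card (cand t f z))"
      by (rule le_eight[OF M0(1) M1_le[OF xyz(3) hsym[OF xyz(5)]]]) (use xyz in simp)
    show "dense_pair (adj G) (d l * p) (\<epsilon> l) (cand t f y) (cand t f z)" unfolding l_def by (rule cand_dense[OF xyz(2,3,5)])
    fix v assume v: "v \<in> bad1 t f x y z"
    define N where "N = {u\<in>cand t f y. {v, u} \<in> G}"
    have N: "\<kappa>0 * p * real (card (cand t f y)) \<le> real (card N)" "\<not> dense_pair (adj G) (d (Suc l) * p) (\<epsilon> (Suc l)) N (cand t f z)"
      using v unfolding bad1_def N_def l_def by auto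
    from N(2) obtain Q T where QT: "Q \<subseteq> N" "T \<subseteq> cand t f z" "\<epsilon> (Suc l) * real (card N) \<le> real (card Q)"
      "\<epsilon> (Suc l) * real (card (cand t f z)) \<le> real (card T)" "ec (adj G) Q T < d (Suc l) * p * real (card Q) * real (card T)"
      unfolding dense_pair_def by (auto simp: not_le)
    have "\<epsilon> (Suc l) * (\<kappa>0 * p * real (card (cand t f y))) \<le> \<epsilon> (Suc l) * real (card N)" using N(1) eS by (intro mult_left_mono) auto
    then have "\<epsilon> (Suc l) * \<kappa>0 * p * real (card (cand t f y)) \<le> real (card Q)" using QT(3) by (simp add: mult.assoc)
    then show "\<exists>Q T'. Q \<subseteq> cand t f y \<and> (\<forall>u\<in>Q. {v, u} \<in> G) \<and> T' \<subseteq> cand t f z \<and>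
       \<epsilon> (Suc l) * \<kappa>0 * p * real (card (cand t f y)) \<le> real (card Q) \<and> \<epsilon> (Suc l) * real (card (cand t f z)) \<le> real (card T') \<and>
       ec (adj G) Q T' < d l * p / 2 ^ 24 * real (card Q) * real (card T')"
      using QT by (intro exI[of _ Q] exI[of _ T]) (auto simp: N_def dS)
  qed
  then show ?thesis by simp
qed

text \<open>In a triangle each of \<open>y\<close> and \<open>z\<close> has two unembedded
  neighbours, so both candidate sets reach size M2, as a restriction on both sides demands.\<close>

lemma card_bad2:
  assumes xyz: "x \<in> VH - placed t" "y \<in> VH - placed t" "z \<in> VH - placed t" "hadj x y" "hadj y z" "hadj x z"
  shows "real (card (bad2 t f x y z)) \<le> M2"
proof -
  define l where "l = nplaced t y + nplaced t z"
  have l: "l < 2 * \<Delta>" using edge_level[OF xyz(2,3,5)] by (simp add: l_def)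
  have k: "\<kappa> x \<noteq> \<kappa> y" "\<kappa> y \<noteq> \<kappa> z" "\<kappa> x \<noteq> \<kappa> z" using \<kappa>1 xyz by auto
  have inh: "inherit_two E {..<n} p (d l) (\<epsilon> l) (\<epsilon> (Suc l) * \<kappa>0) M2" by (rule inh2[OF l])
  have eS: "0 < \<epsilon> (Suc l)" using \<epsilon>0[of "Suc l"] l by simp
  have "real (card (bad2 t f x y z)) < M2"
  proof (rule inh[unfolded inherit_two_def, rule_format, OF GE])
    show "cand t f y \<subseteq> {..<n}" "cand t f z \<subseteq> {..<n}" by (rule cand_subset_lessThan)+
    show "bad2 t f x y z \<subseteq> {..<n}" using cand_subset_lessThan unfolding bad2_def by blast
    show "cand t f y \<inter> cand t f z = {}" using xyz k by (intro cand_disjoint) auto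
    show "cand t f y \<inter> bad2 t f x y z = {}" using cand_disjoint[of x y t f] xyz k unfolding bad2_def by blast
    show "cand t f z \<inter> bad2 t f x y z = {}" using cand_disjoint[of x z t f] xyz k unfolding bad2_def by blast
    have ne: "x \<noteq> z" "x \<noteq> y" using k by auto
    show "M2 \<le> real (card (cand t f y))"
      by (rule le_eight[OF M0(2) M2_le[OF xyz(2) hsym[OF xyz(4)] _ xyz(5) _ ne(1)]]) (use xyz in simp_all)
    show "M2 \<le> real (card (cand t f z))"
      by (rule le_eight[OF M0(2) M2_le[OF xyz(3) hsym[OF xyz(6)] _ hsym[OF xyz(5)] _ ne(2)]]) (use xyz in simp_all)
    show "dense_pair (adj G) (d l * p) (\<epsilon> l) (cand t f y) (cand t f z)" unfolding l_def by (rule cand_dense[OF xyz(2,3,5)])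
    fix v assume v: "v \<in> bad2 t f x y z"
    define N where "N y = {u\<in>cand t f y. {v, u} \<in> G}" for y
    have N: "\<kappa>0 * p * real (card (cand t f y)) \<le> real (card (N y))" "\<kappa>0 * p * real (card (cand t f z)) \<le> real (card (N z))"
      "\<not> dense_pair (adj G) (d (Suc l) * p) (\<epsilon> (Suc l)) (N y) (N z)"
      using v unfolding bad2_def N_def l_def by auto
    from N(3) obtain Q T where QT: "Q \<subseteq> N y" "T \<subseteq> N z" "\<epsilon> (Suc l) * real (card (N y)) \<le> real (card Q)"
      "\<epsilon> (Suc l) * real (card (N z)) \<le> real (card T)" "ec (adj G) Q T < d (Suc l) * p * real (card Q) * real (card T)"
      unfolding dense_pair_def by (auto simp: not_le)
    have "\<epsilon> (Suc l) * (\<kappa>0 * p * real (card (cand t f y))) \<le> \<epsilon> (Suc l) * real (card (N y))" using N(1) eS by (intro mult_left_mono) auto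
    then have 1: "\<epsilon> (Suc l) * \<kappa>0 * p * real (card (cand t f y)) \<le> real (card Q)" using QT(3) by (simp add: mult.assoc)
    have "\<epsilon> (Suc l) * (\<kappa>0 * p * real (card (cand t f z))) \<le> \<epsilon> (Suc l) * real (card (N z))" using N(2) eS by (intro mult_left_mono) auto
    then have 2: "\<epsilon> (Suc l) * \<kappa>0 * p * real (card (cand t f z)) \<le> real (card T)" using QT(4) by (simp add: mult.assoc)
    show "\<exists>Q T'. Q \<subseteq> cand t f y \<and> (\<forall>u\<in>Q. {v, u} \<in> G) \<and> T' \<subseteq> cand t f z \<and> (\<forall>u\<in>T'. {v, u} \<in> G) \<and>
       \<epsilon> (Suc l) * \<kappa>0 * p * real (card (cand t f y)) \<le> real (card Q) \<and> \<epsilon> (Suc l) * \<kappa>0 * p * real (card (cand t f z)) \<le> real (card T') \<and>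
       ec (adj G) Q T' < d l * p / 2 ^ 24 * real (card Q) * real (card T')"
      using QT 1 2 by (intro exI[of _ Q] exI[of _ T]) (auto simp: N_def dS)
  qed
  then show ?thesis by simp
qed

definition pairs1 where "pairs1 x = {(y, z). y \<in> VH - placed t \<and> z \<in> VH - placed t \<and> hadj x y \<and> hadj y z \<and> x \<noteq> z}"
definition pairs2 where "pairs2 x = {(y, z). y \<in> VH - placed t \<and> z \<in> VH - placed t \<and> hadj x y \<and> hadj y z \<and> hadj x z}"
definition nbrs where "nbrs x = {y\<in>VH - placed t. hadj x y}"

definition good where
  "good x = cand t f x - ((\<Union>y\<in>nbrs x. bad t f x y) \<union> (\<Union>(y, z)\<in>pairs1 x. bad1 t f x y z) \<union> (\<Union>(y, z)\<in>pairs2 x. bad2 t f x y z))"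

text \<open>Low degrees cost a quarter. The at most \<Delta>^2 pairs in each of
  \<open>pairs1\<close> and \<open>pairs2\<close> cost an eighth, because the candidate set has at
  least 8\<Delta>^2 times the bound for a single pair.\<close>

lemma card_good:
  assumes x: "x \<in> VH - placed t"
  shows "real (card (cand t f x)) / 2 \<le> real (card (good x))"
proof -
  let ?s = "real (card (cand t f x))"
  have fin: "finite (nbrs x)" "finite (pairs1 x)" "finite (pairs2 x)"
  proof -
    have "pairs1 x \<subseteq> VH \<times> VH" "pairs2 x \<subseteq> VH \<times> VH" by (auto simp: pairs1_def pairs2_def)
    then show "finite (nbrs x)" "finite (pairs1 x)" "finite (pairs2 x)"
      using finH finite_subset[of _ "VH \<times> VH"] by (auto simp: nbrs_def)
  qed
  have cN: "card (nbrs x) \<le> \<Delta>"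
    using card_mono[OF finite_nbrs_H, of "nbrs x" x] hdeg[of x] x by (force simp: nbrs_def)
  have dd: "card (Sigma {w. hadj x w} (\<lambda>y. {w. hadj y w})) \<le> \<Delta> * \<Delta>"
  proof -
    have "card (Sigma {w. hadj x w} (\<lambda>y. {w. hadj y w})) = (\<Sum>y\<in>{w. hadj x w}. card {w. hadj y w})"
      using finite_nbrs_H by simp
    also have "\<dots> \<le> (\<Sum>y\<in>{w. hadj x w}. \<Delta>)" using hdeg hV hsym by (intro sum_mono) blast
    also have "\<dots> \<le> \<Delta> * \<Delta>" using hdeg[of x] x by simp
    finally show ?thesis .
  qed
  have fS: "finite (Sigma {w. hadj x w} (\<lambda>y. {w. hadj y w}))" using finite_nbrs_H by simp
  have c1: "card (pairs1 x) \<le> \<Delta> * \<Delta>" 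
    by (rule order_trans[OF card_mono[OF fS] dd]) (auto simp: pairs1_def)
  have c2: "card (pairs2 x) \<le> \<Delta> * \<Delta>" 
    by (rule order_trans[OF card_mono[OF fS] dd]) (auto simp: pairs2_def)
  have D0: "0 < real \<Delta>" using \<Delta> by simp
  have b0: "real (card (\<Union>y\<in>nbrs x. bad t f x y)) \<le> ?s / 4"
  proof -
    have "real (card (\<Union>y\<in>nbrs x. bad t f x y)) \<le> (\<Sum>y\<in>nbrs x. real (card (bad t f x y)))"
      using card_UN_le[OF fin(1), of "\<lambda>y. bad t f x y"] by (metis of_nat_le_iff of_nat_sum)
    also have "\<dots> \<le> (\<Sum>y\<in>nbrs x. ?s / (4 * real \<Delta>))"
      using card_bad[OF x] D0 by (intro sum_mono) (auto simp: nbrs_def pos_le_divide_eq)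
    also have "\<dots> = real (card (nbrs x)) * (?s / (4 * real \<Delta>))" by simp
    also have "\<dots> \<le> real \<Delta> * (?s / (4 * real \<Delta>))" using cN by (intro mult_right_mono) auto
    finally show ?thesis using D0 by simp
  qed
  have b1: "real (card (\<Union>(y, z)\<in>pairs1 x. bad1 t f x y z)) \<le> ?s / 8"
  proof (cases "pairs1 x = {}")
    case False
    then obtain y where y: "hadj x y" "y \<notin> placed t" by (auto simp: pairs1_def)
    have "real (card (\<Union>(y, z)\<in>pairs1 x. bad1 t f x y z)) \<le> (\<Sum>a\<in>pairs1 x. real (card (case a of (y, z) \<Rightarrow> bad1 t f x y z)))"
      using card_UN_le[OF fin(2), of "\<lambda>(y, z). bad1 t f x y z"] by (metis of_nat_le_iff of_nat_sum)
    also have "\<dots> \<le> (\<Sum>a\<in>pairs1 x. M1)" using card_bad1[OF x] by (intro sum_mono) (auto simp: pairs1_def)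
    also have "\<dots> = real (card (pairs1 x)) * M1" by simp
    also have "\<dots> \<le> (real \<Delta>)\<^sup>2 * M1"
    proof -
      have "real (card (pairs1 x)) \<le> (real \<Delta>)\<^sup>2" using c1 by (metis of_nat_le_iff of_nat_mult power2_eq_square)
      then show ?thesis using M0 by (intro mult_right_mono) auto
    qed
    also have "\<dots> \<le> ?s / 8" using M1_le[OF x y] by simp
    finally show ?thesis .
  qed simp
  have b2: "real (card (\<Union>(y, z)\<in>pairs2 x. bad2 t f x y z)) \<le> ?s / 8"
  proof (cases "pairs2 x = {}")
    case False
    then obtain y z where y: "hadj x y" "y \<notin> placed t" "hadj x z" "z \<notin> placed t" "hadj y z" by (auto simp: pairs2_def)
    have yz: "y \<noteq> z" using \<kappa>1[OF y(5)] by auto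
    have "real (card (\<Union>(y, z)\<in>pairs2 x. bad2 t f x y z)) \<le> (\<Sum>a\<in>pairs2 x. real (card (case a of (y, z) \<Rightarrow> bad2 t f x y z)))"
      using card_UN_le[OF fin(3), of "\<lambda>(y, z). bad2 t f x y z"] by (metis of_nat_le_iff of_nat_sum)
    also have "\<dots> \<le> (\<Sum>a\<in>pairs2 x. M2)" using card_bad2[OF x] by (intro sum_mono) (auto simp: pairs2_def)
    also have "\<dots> = real (card (pairs2 x)) * M2" by simp
    also have "\<dots> \<le> (real \<Delta>)\<^sup>2 * M2"
    proof -
      have "real (card (pairs2 x)) \<le> (real \<Delta>)\<^sup>2" using c2 by (metis of_nat_le_iff of_nat_mult power2_eq_square)
      then show ?thesis using M0 by (intro mult_right_mono) auto
    qed
    also have "\<dots> \<le> ?s / 8" using M2_le[OF x y(1-4) yz] by simp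
    finally show ?thesis .
  qed simp
  define B where "B = (\<Union>y\<in>nbrs x. bad t f x y) \<union> (\<Union>(y, z)\<in>pairs1 x. bad1 t f x y z) \<union> (\<Union>(y, z)\<in>pairs2 x. bad2 t f x y z)"
  have Bs: "B \<subseteq> cand t f x" unfolding B_def bad_def bad1_def bad2_def by auto
  have "real (card B) \<le> ?s / 2"
    using card_Un_le[of "(\<Union>y\<in>nbrs x. bad t f x y) \<union> (\<Union>(y, z)\<in>pairs1 x. bad1 t f x y z)" "(\<Union>(y, z)\<in>pairs2 x. bad2 t f x y z)"]
      card_Un_le[of "(\<Union>y\<in>nbrs x. bad t f x y)" "(\<Union>(y, z)\<in>pairs1 x. bad1 t f x y z)"] b0 b1 b2 unfolding B_def by linarith
  moreover have "card (good x) = card (cand t f x) - card B"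
    unfolding good_def B_def[symmetric] using Bs finite_cand finite_subset by (intro card_Diff_subset) blast+
  moreover have "card B \<le> card (cand t f x)" using Bs finite_cand card_mono by blast
  ultimately show ?thesis by (simp add: of_nat_diff)
qed

text \<open>In a violating set every vertex has an embedded neighbour, since half of a fresh
  candidate set is already as large as a layer. The sets of images of embedded neighbours are then
  nonempty, and disjoint because vertices of one colour have no common neighbour; so
  \<open>hall_property\<close> yields a vertex with fewer candidates than are known to
  exist.\<close>

lemma layer_matching:
  defines "X \<equiv> {u\<in>VH. time u = t}"
  shows "\<exists>g. inj_on g X \<and> (\<forall>x\<in>X. g x \<in> good x)"
proof (rule hall_matching)
  have XV: "X \<subseteq> VH - placed t" by (auto simp: X_def placed_def)
  show "finite X" using finH by (simp add: X_def)
  have XK: "\<kappa> x = t mod q" if "x \<in> X" for x using that time_eq[of x t] by (simp add: X_def)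
  have gc: "good x \<subseteq> cand t f x" for x by (auto simp: good_def)
  show "finite (good x)" for x by (rule finite_subset[OF gc finite_cand])
  have finj: "inj_on f (placed t)" and fU: "\<And>w. w \<in> placed t \<Longrightarrow> f w \<in> U (\<sigma> w) (\<kappa> w)" using inv unfolding inv_def by auto
  fix Y assume Y: "Y \<subseteq> X"
  define W where "W = (\<Union>x\<in>Y. good x)"
  have Wn: "W \<subseteq> {..<n}" unfolding W_def using gc cand_subset_lessThan by blast
  have finW: "finite W" using Wn finite_subset by blast
  have Ycard: "real (card Y) \<le> a0 / 2" "real (card Y) \<le> c / exp 2 * real n"
  proof -
    have "Y \<subseteq> {u\<in>VH. b u = t div q \<and> \<kappa> u = t mod q}" using Y time_eq by (auto simp: X_def)
    then have "card Y \<le> card {u\<in>VH. b u = t div q \<and> \<kappa> u = t mod q}" using finH by (intro card_mono) auto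
    then show "real (card Y) \<le> a0 / 2" "real (card Y) \<le> c / exp 2 * real n"
      using layer(1)[of "t div q" "t mod q"] layer(2)[of "t div q" "t mod q"] by linarith+
  qed
  have gsize: "a0 / 2 * (\<kappa>0 * p) ^ nplaced t x \<le> real (card (good x))" if "x \<in> Y" for x
  proof -
    have xV: "x \<in> VH - placed t" using that Y XV by blast
    show ?thesis using cand_size[OF xV] card_good[OF xV] by linarith
  qed
  have "card Y \<le> card W"
  proof (rule ccontr)
    assume "\<not> ?thesis"
    then have lt: "card W < card Y" by simp
    have pos: "0 < nplaced t x" if "x \<in> Y" for x
    proof (rule ccontr)
      assume "\<not> 0 < nplaced t x"
      then have "a0 / 2 \<le> real (card (good x))" using gsize[OF that] by simp
      also have "card (good x) \<le> card W" unfolding W_def using that finW[unfolded W_def] by (intro card_mono) auto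
      finally show False using Ycard(1) lt by linarith
    qed
    define \<tau> where "\<tau> x = f ` {w\<in>placed t. hadj x w}" for x
    have card\<tau>: "card (\<tau> x) = nplaced t x" for x
      unfolding \<tau>_def nplaced_def by (rule card_image) (rule inj_on_subset[OF finj], auto)
    have dis: "\<tau> x \<inter> \<tau> x' = {}" if "x \<in> Y" "x' \<in> Y" "x \<noteq> x'" for x x'
    proof (rule ccontr)
      assume "\<tau> x \<inter> \<tau> x' \<noteq> {}"
      then obtain w w' where w: "w \<in> placed t" "w' \<in> placed t" "hadj x w" "hadj x' w'" "f w = f w'" by (auto simp: \<tau>_def)
      then have "w = w'" using finj by (auto dest: inj_onD)
      then have "\<kappa> x \<noteq> \<kappa> x'" using \<kappa>2[OF w(3) hsym, of x'] w(4) that(3) by blast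
      moreover have "\<kappa> x = \<kappa> x'" using XK[OF subsetD[OF Y that(1)]] XK[OF subsetD[OF Y that(2)]] by simp
      ultimately show False by simp
    qed
    have ne: "\<tau> x \<noteq> {}" if "x \<in> Y" for x using pos[OF that] card\<tau>[of x] by force
    have inj\<tau>: "inj_on \<tau> Y"
    proof (rule inj_onI)
      fix x x' assume xx: "x \<in> Y" "x' \<in> Y" "\<tau> x = \<tau> x'"
      show "x = x'" using dis[OF xx(1,2)] ne[OF xx(1)] xx(3) by (cases "x = x'") auto
    qed
    have "\<exists>\<tau>'\<in>\<tau> ` Y. real (card {w\<in>W. \<forall>v\<in>\<tau>'. {v, w} \<in> E}) < c * p ^ card \<tau>' * real n"
    proof (rule hall[unfolded hall_property_def, rule_format])
      fix \<tau>' assume "\<tau>' \<in> \<tau> ` Y"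
      then obtain x where x: "x \<in> Y" "\<tau>' = \<tau> x" by auto
      have "f w \<in> {..<n}" if "w \<in> placed t" for w using fU[OF that] UV Vcn by blast
      then have "\<tau>' \<subseteq> {..<n}" using x by (auto simp: \<tau>_def)
      moreover have "nplaced t x + card ({}::'h set) \<le> \<Delta>" using x Y XV by (intro nplaced_le) auto
      then have "card \<tau>' \<le> \<Delta>" using card\<tau> x by simp
      ultimately show "\<tau>' \<subseteq> {..<n} \<and> \<tau>' \<noteq> {} \<and> card \<tau>' \<le> \<Delta>" using ne x by simp
    next
      show "disjoint (\<tau> ` Y)"
      proof (rule disjointI)
        fix a a' assume "a \<in> \<tau> ` Y" "a' \<in> \<tau> ` Y" "a \<noteq> a'"
        then show "a \<inter> a' = {}" using dis by blast
      qed
      show "W \<subseteq> {..<n}" by (rule Wn)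
      show "W \<inter> \<Union> (\<tau> ` Y) = {}"
      proof (rule ccontr)
        assume "W \<inter> \<Union> (\<tau> ` Y) \<noteq> {}"
        then obtain v x x' w where v: "v \<in> good x'" "x' \<in> Y" "x \<in> Y" "w \<in> placed t" "hadj x w" "v = f w"
          by (auto simp: W_def \<tau>_def)
        have "v \<in> U (\<sigma> x') (\<kappa> x')" using v(1) gc cand_subset by blast
        moreover have "v \<in> U (\<sigma> w) (\<kappa> w)" using fU[OF v(4)] v(6) by simp
        ultimately have "\<kappa> x' = \<kappa> w" using Udisj[of x' w v] v Y XV placed_subset by blast
        moreover have "\<kappa> x = \<kappa> x'" using XK[OF subsetD[OF Y v(3)]] XK[OF subsetD[OF Y v(2)]] by simp
        ultimately show False using \<kappa>1[OF v(5)] by simp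
      qed
      show "card W < card (\<tau> ` Y)" using lt card_image[OF inj\<tau>] by simp
      show "real (card W) \<le> c / exp 2 * real n" using Ycard(2) lt by linarith
    qed
    then obtain x where x: "x \<in> Y" "real (card {w\<in>W. \<forall>v\<in>\<tau> x. {v, w} \<in> E}) < c * p ^ nplaced t x * real n"
      using card\<tau> by auto
    have "good x \<subseteq> {w\<in>W. \<forall>v\<in>\<tau> x. {v, w} \<in> E}"
    proof
      fix w assume w: "w \<in> good x"
      have "{w, f u} \<in> G" if "u \<in> placed t" "hadj x u" for u using w gc that by (auto simp: cand_def)
      then have "{f u, w} \<in> E" if "u \<in> placed t" "hadj x u" for u using GE that by (metis insert_commute subsetD)
      then show "w \<in> {w\<in>W. \<forall>v\<in>\<tau> x. {v, w} \<in> E}" using w x(1) by (auto simp: W_def \<tau>_def)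
    qed
    then have "card (good x) \<le> card {w\<in>W. \<forall>v\<in>\<tau> x. {v, w} \<in> E}" using finW by (intro card_mono) auto
    then have "a0 / 2 * (\<kappa>0 * p) ^ nplaced t x < c * p ^ nplaced t x * real n" using gsize[OF x(1)] x(2) by linarith
    moreover have "c * p ^ nplaced t x * real n \<le> a0 / 2 * (\<kappa>0 * p) ^ nplaced t x"
    proof -
      have "nplaced t x + card ({}::'h set) \<le> \<Delta>" using x Y XV by (intro nplaced_le) auto
      moreover have "\<kappa>0 \<le> 1" using \<kappa>0(2)[of 0] d0 by simp
      ultimately have "\<kappa>0 ^ \<Delta> \<le> \<kappa>0 ^ nplaced t x" using \<kappa>0(1) by (intro power_decreasing) auto
      then have "a0 / 2 * \<kappa>0 ^ \<Delta> \<le> a0 / 2 * \<kappa>0 ^ nplaced t x" using a0(1) by (intro mult_left_mono) auto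
      then have "c * real n * p ^ nplaced t x \<le> a0 / 2 * \<kappa>0 ^ nplaced t x * p ^ nplaced t x"
        using cn p by (intro mult_right_mono) auto
      then show ?thesis by (simp add: power_mult_distrib mult_ac)
    qed
    ultimately show False by simp
  qed
  then show "card Y \<le> card (\<Union>x\<in>Y. good x)" by (simp add: W_def)
qed

text \<open>Colours separate vertices up to distance three. So a remaining vertex has at most one
  neighbour in the layer, and if both ends of an edge have one, it is the same vertex. Each edge
  thus undergoes a single restriction, on one side or on both, and these are what the exceptional
  sets control.\<close>

lemma inv_step: "\<exists>g. inv (Suc t) g"
proof -
  define X where "X = {u\<in>VH. time u = t}"
  obtain g0 where g0: "inj_on g0 X" "\<And>x. x \<in> X \<Longrightarrow> g0 x \<in> good x"
    using layer_matching unfolding X_def by blast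
  define g where "g u = (if u \<in> X then g0 u else f u)" for u
  have PS: "placed (Suc t) = placed t \<union> X" by (auto simp: placed_def X_def)
  have XP: "X \<inter> placed t = {}" by (auto simp: placed_def X_def)
  have XV: "X \<subseteq> VH - placed t" by (auto simp: placed_def X_def)
  have gX: "g x = g0 x" if "x \<in> X" for x using that by (simp add: g_def)
  have gP: "g w = f w" if "w \<in> placed t" for w using that XP by (auto simp: g_def)
  have g0c: "g0 x \<in> cand t f x" if "x \<in> X" for x using g0(2)[OF that] by (auto simp: good_def)
  have XX: "\<kappa> x = \<kappa> x'" "b x = b x'" if "x \<in> X" "x' \<in> X" for x x'
    using that time_eq[of x t] time_eq[of x' t] by (auto simp: X_def)
  have Xind: "\<not> hadj x x'" if "x \<in> X" "x' \<in> X" for x x' using XX[OF that] \<kappa>1 by blast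
  have finj: "inj_on f (placed t)" and fU: "\<And>w. w \<in> placed t \<Longrightarrow> f w \<in> U (\<sigma> w) (\<kappa> w)"
    and fE: "\<And>u w. u \<in> placed t \<Longrightarrow> w \<in> placed t \<Longrightarrow> hadj u w \<Longrightarrow> {f u, f w} \<in> G" using inv unfolding inv_def by auto
  have gU: "g u \<in> U (\<sigma> u) (\<kappa> u)" if "u \<in> placed (Suc t)" for u
    using that fU g0c cand_subset gX gP unfolding PS by fastforce
  have bX: "b x = t div q" if "x \<in> X" for x using time_eq[of x t] that by (auto simp: X_def)
  \<comment> \<open>A clash can only come from the same part, hence from the same colour and, being
    earlier, from at least three blocks back; such images have been removed from the
    candidates.\<close>
  have cross: "g0 x \<noteq> f w" if "x \<in> X" "w \<in> placed t" for x w
  proof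
    assume eq: "g0 x = f w"
    have "g0 x \<in> U (\<sigma> x) (\<kappa> x)" by (rule subsetD[OF cand_subset g0c[OF that(1)]])
    moreover have "g0 x \<in> U (\<sigma> w) (\<kappa> w)" using fU[OF that(2)] eq by simp
    moreover have "x \<in> VH" "w \<in> VH" using that XV placed_subset by auto
    ultimately have "\<kappa> x = \<kappa> w" using Udisj by blast
    have tw: "time w < time x" using that by (auto simp: placed_def X_def)
    have "b w < b x"
    proof (rule ccontr)
      assume "\<not> b w < b x"
      then have "b x * q \<le> b w * q" by simp
      then show False using tw \<open>\<kappa> x = \<kappa> w\<close> by (simp add: time_def)
    qed
    then have "b w + 3 \<le> b x" using \<kappa>b[of w x] \<open>\<kappa> x = \<kappa> w\<close> that XV placed_subset by auto
    then have "f w \<noteq> g0 x" using g0c[OF that(1)] that(2) by (auto simp: cand_def)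
    then show False using eq by simp
  qed
  have ginj: "inj_on g (placed (Suc t))"
  proof (rule inj_onI)
    fix u w assume uw: "u \<in> placed (Suc t)" "w \<in> placed (Suc t)" "g u = g w"
    consider "u \<in> placed t" "w \<in> placed t" | "u \<in> X" "w \<in> X" | "u \<in> X" "w \<in> placed t" | "u \<in> placed t" "w \<in> X"
      using uw unfolding PS by blast
    then show "u = w"
    proof cases
      case 1 then show ?thesis using uw(3) gP finj by (auto dest: inj_onD)
    next
      case 2 then show ?thesis using uw(3) gX g0(1) by (auto dest: inj_onD)
    next
      case 3 then show ?thesis using uw(3) gX gP cross by auto
    next
      case 4 then show ?thesis using uw(3) gX gP cross[of w u] by auto
    qed
  qed
  have gXP: "{g0 x, f w} \<in> G" if "x \<in> X" "w \<in> placed t" "hadj x w" for x w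
    using g0c[OF that(1)] that by (auto simp: cand_def)
  have gE: "{g u, g w} \<in> G" if "u \<in> placed (Suc t)" "w \<in> placed (Suc t)" "hadj u w" for u w
  proof -
    have "u \<in> placed t \<union> X" "w \<in> placed t \<union> X" using that(1,2) PS by auto
    then consider "u \<in> placed t" "w \<in> placed t" | "u \<in> X" "w \<in> X" | "u \<in> X" "w \<in> placed t" | "u \<in> placed t" "w \<in> X"
      by blast
    then show ?thesis
    proof cases
      case 1 then show ?thesis using gP fE that(3) by simp
    next
      case 2 then show ?thesis using Xind that(3) by blast
    next
      case 3 then show ?thesis using gX gP gXP that(3) by simp
    next
      case 4 then show ?thesis using gX gP gXP[OF _ _ hsym[OF that(3)]] by (simp add: insert_commute)
    qed
  qed
  have notS: "u \<in> VH - placed t \<and> u \<notin> X" if "u \<in> VH - placed (Suc t)" for u using that PS by auto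
  have uniq: "x = x'" if "x \<in> X" "x' \<in> X" "hadj x u" "hadj x' u" for x x' u
    using \<kappa>2[OF that(3) hsym[OF that(4)]] XX(1)[OF that(1,2)] by blast
  have uniq3: "x = x'" if "x \<in> X" "x' \<in> X" "hadj x u" "hadj u w" "hadj x' w" for x x' u w
    using \<kappa>3[OF that(3,4) hsym[OF that(5)]] XX(1)[OF that(1,2)] by blast
  have np: "nplaced (Suc t) u = nplaced t u + card {x\<in>X. hadj u x}" for u
  proof -
    have "{w\<in>placed (Suc t). hadj u w} = {w\<in>placed t. hadj u w} \<union> {x\<in>X. hadj u x}" unfolding PS by auto
    moreover have "finite X" using finH by (simp add: X_def)
    moreover have "card ({w\<in>placed t. hadj u w} \<union> {x\<in>X. hadj u x}) = card {w\<in>placed t. hadj u w} + card {x\<in>X. hadj u x}"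
      by (rule card_Un_disjoint) (use finite_placed \<open>finite X\<close> XP in auto)
    ultimately show ?thesis unfolding nplaced_def by simp
  qed
  have np0: "nplaced (Suc t) u = nplaced t u" if "\<And>x. x \<in> X \<Longrightarrow> \<not> hadj x u" for u
  proof -
    have e: "{x\<in>X. hadj u x} = {}" using that hsym by blast
    show ?thesis unfolding np e by simp
  qed
  have np1: "nplaced (Suc t) u = Suc (nplaced t u)" if "x \<in> X" "hadj x u" for u x
  proof -
    have e: "{x\<in>X. hadj u x} = {x}" using that hsym uniq by blast
    show ?thesis unfolding np e by simp
  qed
  \<comment> \<open>A vertex with an embedded neighbour is at most one block ahead of the present
    one, and its own neighbours at most two. No image of the present layer is removed from their
    candidates, which therefore change through adjacency alone.\<close>
  have early: "b u \<le> t div q + 1" if "0 < nplaced (Suc t) u" for u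
  proof -
    have "{w\<in>placed (Suc t). hadj u w} \<noteq> {}" using that unfolding nplaced_def by force
    then obtain w where "w \<in> placed (Suc t)" "hadj u w" by auto
    then show ?thesis using b_le[of w t] bedge[of u w] by simp
  qed
  have cs0: "cand (Suc t) g u = cand t f u" if "b u \<le> t div q + 2" "\<And>x. x \<in> X \<Longrightarrow> \<not> hadj x u" for u
  proof -
    have "\<not> hadj u x" if "x \<in> X" for x using \<open>\<And>x. x \<in> X \<Longrightarrow> \<not> hadj x u\<close> hsym that by blast
    moreover have "\<not> b x + 3 \<le> b u" if "x \<in> X" for x using bX[OF that] \<open>b u \<le> t div q + 2\<close> by simp
    ultimately show ?thesis unfolding cand_def PS using gP by (auto simp: ball_Un)
  qed
  have cs1: "cand (Suc t) g u = {v\<in>cand t f u. {g0 x, v} \<in> G}" if "b u \<le> t div q + 2" "x \<in> X" "hadj x u" for u x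
  proof -
    have "hadj u x' \<longleftrightarrow> x' = x" if "x' \<in> X" for x' using \<open>x \<in> X\<close> \<open>hadj x u\<close> uniq[of x x' u] hsym that by blast
    moreover have "\<not> b x + 3 \<le> b u" if "x \<in> X" for x using bX[OF that] \<open>b u \<le> t div q + 2\<close> by simp
    ultimately show ?thesis unfolding cand_def PS using gP gX \<open>x \<in> X\<close> by (auto simp: ball_Un insert_commute)
  qed
  have fresh: "\<zeta> * real (card (Vc (\<sigma> u))) \<le> real (card (cand (Suc t) g u))" if "u \<in> VH" "nplaced (Suc t) u = 0" for u
    using fresh_large[OF that(1) ginj _ that(2)] gU by blast
  have deg: "\<kappa>0 * p * real (card (cand t f u)) \<le> real (card {v\<in>cand t f u. {g0 x, v} \<in> G})"
    if u: "u \<in> VH - placed t" and x: "x \<in> X" "hadj x u" for u x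
  proof -
    have "u \<in> nbrs x" using u x by (auto simp: nbrs_def)
    then have "g0 x \<notin> bad t f x u" using g0(2)[OF x(1)] by (auto simp: good_def)
    then show ?thesis using g0c[OF x(1)] by (auto simp: bad_def not_less)
  qed
  have size: "a0 * (\<kappa>0 * p) ^ nplaced (Suc t) u \<le> real (card (cand (Suc t) g u))" if u: "u \<in> VH - placed (Suc t)" for u
  proof (cases "nplaced (Suc t) u = 0")
    case True
    have uV: "u \<in> VH" using u by blast
    show ?thesis using order_trans[OF a0(2)[OF uV] fresh[OF uV True]] True by simp
  next
    case False
    then have bu: "b u \<le> t div q + 2" using early[of u] by simp
    have ut: "u \<in> VH - placed t" using notS[OF u] by blast
    show ?thesis
    proof (cases "\<exists>x\<in>X. hadj x u")
      case True
      then obtain x where x: "x \<in> X" "hadj x u" by blast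
      have "a0 * (\<kappa>0 * p) ^ nplaced (Suc t) u = \<kappa>0 * p * (a0 * (\<kappa>0 * p) ^ nplaced t u)" unfolding np1[OF x] by simp
      also have "\<dots> \<le> \<kappa>0 * p * real (card (cand t f u))" using cand_size[OF ut] \<kappa>0 p by (intro mult_left_mono) auto
      also have "\<dots> \<le> real (card (cand (Suc t) g u))" unfolding cs1[OF bu x] by (rule deg[OF ut x])
      finally show ?thesis .
    next
      case False
      then show ?thesis using cs0[OF bu] np0[of u] cand_size[OF ut] by simp
    qed
  qed
  have dense: "dense_pair (adj G) (d (nplaced (Suc t) u + nplaced (Suc t) w) * p) (\<epsilon> (nplaced (Suc t) u + nplaced (Suc t) w))
      (cand (Suc t) g u) (cand (Suc t) g w)" if u: "u \<in> VH - placed (Suc t)" and w: "w \<in> VH - placed (Suc t)" and uw: "hadj u w" for u w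
  proof (cases "nplaced (Suc t) u + nplaced (Suc t) w = 0")
    \<comment> \<open>Removal of used vertices may shrink these candidate sets. As no neighbour is
      embedded at either end, density is read off afresh from the clusters.\<close>
    case True
    then have n0: "nplaced (Suc t) u = 0" "nplaced (Suc t) w = 0" by auto
    have uV: "u \<in> VH" "w \<in> VH" using u w by auto
    have "dense_pair (adj G) (d 0 * p) (\<epsilon> 0) (cand (Suc t) g u) (cand (Suc t) g w)"
    proof (rule dense_pair_subset[OF dense0[OF uw]])
      show "cand (Suc t) g u \<subseteq> Vc (\<sigma> u)" "cand (Suc t) g w \<subseteq> Vc (\<sigma> w)" using cand_subset UV by blast+
      show "\<zeta> * real (card (Vc (\<sigma> u))) \<le> real (card (cand (Suc t) g u))" by (rule fresh[OF uV(1) n0(1)])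
      show "\<zeta> * real (card (Vc (\<sigma> w))) \<le> real (card (cand (Suc t) g w))" by (rule fresh[OF uV(2) n0(2)])
      show "0 \<le> \<epsilon> 0" using \<epsilon>0[of 0] by simp
    qed simp
    then show ?thesis using n0 by simp
  next
    case False
    have "b u \<le> t div q + 2 \<and> b w \<le> t div q + 2"
      using False early[of u] early[of w] bedge[OF uw] bedge[OF hsym[OF uw]] by (cases "nplaced (Suc t) u = 0") auto
    then have bu: "b u \<le> t div q + 2" and bw: "b w \<le> t div q + 2" by auto
    have ut: "u \<in> VH - placed t" and wt: "w \<in> VH - placed t" using notS[OF u] notS[OF w] by auto
    have uX: "u \<notin> X" "w \<notin> X" using notS[OF u] notS[OF w] by auto
    define l where "l = nplaced t u + nplaced t w"
    have l: "Suc (Suc l) \<le> 2 * \<Delta>" using edge_level[OF ut wt uw] by (simp add: l_def)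
    have one: "dense_pair (adj G) (d (Suc (nplaced t y + nplaced t z)) * p) (\<epsilon> (Suc (nplaced t y + nplaced t z))) {v\<in>cand t f y. {g0 x, v} \<in> G} (cand t f z)"
      if y: "y \<in> VH - placed t" and z: "z \<in> VH - placed t" "z \<notin> X" and yz: "hadj y z" and x: "x \<in> X" "hadj x y" for x y z
    proof -
      have "x \<noteq> z" using x z by auto
      then have "(y, z) \<in> pairs1 x" using y z yz x by (auto simp: pairs1_def)
      then have "g0 x \<notin> bad1 t f x y z" using g0(2)[OF x(1)] by (auto simp: good_def)
      then show ?thesis using g0c[OF x(1)] deg[OF y x] by (auto simp: bad1_def)
    qed
    consider "\<And>x. x \<in> X \<Longrightarrow> \<not> hadj x u \<and> \<not> hadj x w" | x where "x \<in> X" "hadj x u" "hadj x w"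
      | x where "x \<in> X" "hadj x u" "\<not> hadj x w" | x where "x \<in> X" "\<not> hadj x u" "hadj x w" by blast
    then show ?thesis
    proof cases
      case 1
      then show ?thesis using cs0[OF bu] cs0[OF bw] np0[of u] np0[of w] cand_dense[OF ut wt uw] by simp
    next
      case (2 x)
      have "(u, w) \<in> pairs2 x" using ut wt uw 2 by (auto simp: pairs2_def)
      then have "g0 x \<notin> bad2 t f x u w" using g0(2)[OF 2(1)] by (auto simp: good_def)
      then have "dense_pair (adj G) (d (Suc l) * p) (\<epsilon> (Suc l)) {v\<in>cand t f u. {g0 x, v} \<in> G} {v\<in>cand t f w. {g0 x, v} \<in> G}"
        using g0c[OF 2(1)] deg[OF ut 2(1,2)] deg[OF wt 2(1,3)] by (auto simp: bad2_def l_def)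
      \<comment> \<open>A common neighbour raises the index by two at the cost of one application of
        inheritance; the level reached is weakened to the one required.\<close>
      then have "dense_pair (adj G) (d (Suc (Suc l)) * p) (\<epsilon> (Suc (Suc l))) {v\<in>cand t f u. {g0 x, v} \<in> G} {v\<in>cand t f w. {g0 x, v} \<in> G}"
      proof (rule dense_pair_mono)
        have "0 \<le> d (Suc l)" using \<kappa>0(2)[of "Suc l"] \<kappa>0(1) l by simp
        then show "d (Suc (Suc l)) * p \<le> d (Suc l) * p" unfolding dS[of "Suc l"] using p by (intro mult_right_mono) auto
        show "\<epsilon> (Suc l) \<le> \<epsilon> (Suc (Suc l))" using \<epsilon>S[of "Suc l"] l by simp
      qed
      moreover have "nplaced (Suc t) u + nplaced (Suc t) w = Suc (Suc l)"
        unfolding np1[OF 2(1,2)] np1[OF 2(1,3)] l_def by simp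
      ultimately show ?thesis unfolding cs1[OF bu 2(1,2)] cs1[OF bw 2(1,3)] by simp
    next
      case (3 x)
      have nw: "\<not> hadj x' w" if "x' \<in> X" for x' using uniq3[OF 3(1) that 3(2) uw] 3(3) by blast
      have w0: "nplaced (Suc t) w = nplaced t w" "cand (Suc t) g w = cand t f w"
        by (rule np0 cs0[OF bw], erule nw)+
      have "nplaced (Suc t) u + nplaced (Suc t) w = Suc (nplaced t u + nplaced t w)" unfolding np1[OF 3(1,2)] w0 by simp
      then show ?thesis unfolding cs1[OF bu 3(1,2)] w0(2) using one[OF ut wt uX(2) uw 3(1,2)] by simp
    next
      case (4 x)
      have nu: "\<not> hadj x' u" if "x' \<in> X" for x' using uniq3[OF 4(1) that 4(3) hsym[OF uw]] 4(2) by blast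
      have u0: "nplaced (Suc t) u = nplaced t u" "cand (Suc t) g u = cand t f u"
        by (rule np0 cs0[OF bu], erule nu)+
      have "nplaced (Suc t) u + nplaced (Suc t) w = Suc (nplaced t w + nplaced t u)" unfolding np1[OF 4(1,3)] u0 by simp
      then show ?thesis unfolding cs1[OF bw 4(1,3)] u0(2)
        using dense_adj_swap[OF one[OF wt ut uX(1) hsym[OF uw] 4(1,3)]] by simp
    qed
  qed
  have "inv (Suc t) g" unfolding inv_def using ginj gU gE size dense by blast
  then show ?thesis by blast
qed

end

lemma embedding_exists: "\<exists>f. inj_on f VH \<and> (\<forall>u\<in>VH. f u \<in> {..<n}) \<and> (\<forall>u w. hadj u w \<longrightarrow> {f u, f w} \<in> G)"
proof -
  have ex: "\<exists>f. inv t f" for t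
  proof (induction t)
    case 0 then show ?case using inv_0 by blast
  next
    case (Suc t) then show ?case using inv_step by blast
  qed
  define N where "N = Suc (Max (insert 0 (time ` VH)))"
  have "time u < N" if "u \<in> VH" for u
    unfolding N_def less_Suc_eq_le using that finH by (intro Max_ge) auto
  then have PV: "placed N = VH" by (auto simp: placed_def)
  obtain f where f: "inv N f" using ex by blast
  have "f u \<in> {..<n}" if "u \<in> VH" for u using f UV Vcn that unfolding inv_def PV by blast
  moreover have "{f u, f w} \<in> G" if "hadj u w" for u w
    using f hV[OF that] hV[OF hsym[OF that]] that unfolding inv_def PV by blast
  ultimately show ?thesis using f unfolding inv_def PV by blast
qed

end

section \<open>Assembly\<close>

lemma greedy_colouring:
  assumes "finite V" and sym: "\<And>u v. near u v \<Longrightarrow> near v u"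
    and deg: "\<And>u. u \<in> V \<Longrightarrow> card {v\<in>V. v \<noteq> u \<and> near u v} \<le> k"
  shows "\<exists>col. (\<forall>u\<in>V. col u < Suc k) \<and> (\<forall>u\<in>V. \<forall>v\<in>V. u \<noteq> v \<longrightarrow> near u v \<longrightarrow> col u \<noteq> (col v :: nat))"
  using assms(1,3)
proof (induction V rule: finite_induct)
  case (insert x F)
  have deg: "card {v\<in>F. v \<noteq> u \<and> near u v} \<le> k" if "u \<in> F" for u
  proof -
    have "card {v\<in>F. v \<noteq> u \<and> near u v} \<le> card {v\<in>insert x F. v \<noteq> u \<and> near u v}"
      using insert.hyps(1) by (intro card_mono) auto
    then show ?thesis using insert.prems[of u] that by simp
  qed
  have "\<exists>col. (\<forall>u\<in>F. col u < Suc k) \<and> (\<forall>u\<in>F. \<forall>v\<in>F. u \<noteq> v \<longrightarrow> near u v \<longrightarrow> col u \<noteq> (col v :: nat))"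
    by (rule insert.IH) (erule deg)
  then obtain col where col: "\<forall>u\<in>F. col u < Suc k" "\<forall>u\<in>F. \<forall>v\<in>F. u \<noteq> v \<longrightarrow> near u v \<longrightarrow> col u \<noteq> (col v :: nat)"
    by (elim exE conjE)
  define N where "N = {v\<in>insert x F. v \<noteq> x \<and> near x v}"
  have finite_nbrs_H: "finite N" using insert.hyps(1) by (simp add: N_def)
  have "card (col ` N) \<le> k" using card_image_le[OF finite_nbrs_H, of col] insert.prems[of x] by (simp add: N_def)
  then have "\<not> {..<Suc k} \<subseteq> col ` N" using card_mono[of "col ` N" "{..<Suc k}"] finite_nbrs_H by auto
  then obtain c where c: "c < Suc k" "c \<notin> col ` N" by auto
  show ?case
  proof (intro exI[of _ "col(x := c)"] conjI ballI impI)
    fix u assume "u \<in> insert x F"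
    then show "(col(x := c)) u < Suc k" using c col by auto
    fix v assume uv: "v \<in> insert x F" "u \<noteq> v" "near u v"
    consider "u = x" "v \<in> F" | "u \<in> F" "v = x" | "u \<in> F" "v \<in> F" using uv \<open>u \<in> insert x F\<close> by auto
    then show "(col(x := c)) u \<noteq> (col(x := c)) v"
    proof cases
      case 1
      then have "v \<in> N" using uv by (auto simp: N_def)
      then show ?thesis using c 1 uv by auto
    next
      case 2
      then have "u \<in> N" using uv sym by (auto simp: N_def)
      then show ?thesis using c 2 uv by auto
    next
      case 3
      then show ?thesis using col uv insert.hyps(2) by auto
    qed
  qed
qed auto

lemma disjoint_subsets_of_sizes:
  fixes s :: "nat \<Rightarrow> nat" and q :: nat
  assumes "finite V" "(\<Sum>k<q. s k) \<le> card V"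
  shows "\<exists>U. (\<forall>k<q. U k \<subseteq> V \<and> card (U k) = s k) \<and> (\<forall>k<q. \<forall>l<q. k \<noteq> l \<longrightarrow> U k \<inter> U l = {})"
  using assms(2)
proof (induction q)
  case (Suc q)
  then obtain U where U: "\<forall>k<q. U k \<subseteq> V \<and> card (U k) = s k" "\<forall>k<q. \<forall>l<q. k \<noteq> l \<longrightarrow> U k \<inter> U l = {}" by auto
  define Z where "Z = (\<Union>k<q. U k)"
  have "card Z \<le> (\<Sum>k<q. card (U k))" unfolding Z_def by (rule card_UN_le) simp
  also have "\<dots> = (\<Sum>k<q. s k)" using U by simp
  finally have Z: "card Z \<le> (\<Sum>k<q. s k)" .
  have ZV: "Z \<subseteq> V" using U by (auto simp: Z_def)
  have "s q \<le> card (V - Z)" using Z ZV Suc.prems assms(1) finite_subset[OF ZV] by (simp add: card_Diff_subset)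
  then obtain Y where Y: "Y \<subseteq> V - Z" "card Y = s q" by (rule obtain_subset_with_card_n)
  have YU: "Y \<inter> U k = {}" if "k < q" for k using Y(1) that by (auto simp: Z_def)
  show ?case
  proof (intro exI[of _ "U(q := Y)"] conjI allI impI)
    fix k assume k: "k < Suc q"
    then show "(U(q := Y)) k \<subseteq> V" "card ((U(q := Y)) k) = s k" using U Y by (auto simp: less_Suc_eq)
    fix l assume l: "l < Suc q" "k \<noteq> l"
    consider "k = q" "l < q" | "k < q" "l = q" | "k < q" "l < q" using k l by linarith
    then show "(U(q := Y)) k \<inter> (U(q := Y)) l = {}"
      using U(2) YU l(2) by cases auto
  qed
qed auto

context weighted_relation
begin

text \<open>The three terms are the fair share, the deviation allowed by the quadratic potential,
  and all vertices in the first 2^r blocks of the runs, where a walk between cliques is under way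
  and the assignment is not controlled.\<close>

lemma balanced_assignment:
  assumes ne: "I \<noteq> {}" and VH: "finite VH" and hc: "\<And>u. u \<in> VH \<Longrightarrow> hc u < r"
    and B: "\<And>t. card {u\<in>VH. b u = t} \<le> B" and T: "\<And>u. u \<in> VH \<Longrightarrow> b u < T" and q: "2 ^ r \<le> (q::nat)"
    and \<nu>: "0 < \<nu>" "\<And>i. i \<in> I \<Longrightarrow> \<nu> \<le> \<mu> i"
  shows "\<exists>\<sigma>. (\<forall>u\<in>VH. \<sigma> u \<in> I) \<and>
    (\<forall>u\<in>VH. \<forall>v\<in>VH. hc u \<noteq> hc v \<longrightarrow> b u \<le> b v + 1 \<longrightarrow> b v \<le> b u + 1 \<longrightarrow> A (\<sigma> u) (\<sigma> v)) \<and>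
    (\<forall>i\<in>I. real (card {u\<in>VH. \<sigma> u = i}) \<le> \<mu> i * (real (card VH) / W)
       + sqrt (\<mu> i * (real (T div q + 1) * (real (q * B))\<^sup>2 / \<nu>)) + real ((T div q + 1) * (2 ^ r * B)))"
proof -
  define N where "N = T div q + 1"
  define a where "a s j = real (card {u\<in>VH. b u div q = s \<and> hc u = j})" for s j
  have q0: "0 < q" using q by (metis less_le_trans pos2 zero_less_power)
  have card_sum: "(\<Sum>j<r. a s j) = real (card {u\<in>VH. b u div q = s})" for s
  proof -
    have "card {u\<in>VH. b u div q = s} = card (\<Union>j<r. {u\<in>VH. b u div q = s \<and> hc u = j})"
      using hc by (intro arg_cong[where f = card]) auto
    also have "\<dots> = (\<Sum>j<r. card {u\<in>VH. b u div q = s \<and> hc u = j})"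
      using VH by (intro card_UN_disjoint) auto
    finally show ?thesis by (simp add: a_def)
  qed
  have aM: "(\<Sum>j<r. a s j) \<le> real (q * B)" for s
  proof -
    have "card {u\<in>VH. b u div q = s} \<le> card (\<Union>t<q. {u\<in>VH. b u = s * q + t})"
    proof (intro card_mono subsetI)
      show "finite (\<Union>t<q. {u\<in>VH. b u = s * q + t})" using VH by simp
      fix u assume "u \<in> {u\<in>VH. b u div q = s}"
      then show "u \<in> (\<Union>t<q. {u\<in>VH. b u = s * q + t})" using q0 by (auto intro!: bexI[of _ "b u mod q"])
    qed
    also have "\<dots> \<le> (\<Sum>t<q. card {u\<in>VH. b u = s * q + t})" by (rule card_UN_le) simp
    also have "\<dots> \<le> (\<Sum>t<q. B)" using B by (intro sum_mono) auto
    finally show ?thesis unfolding card_sum by (metis card_lessThan of_nat_le_iff sum_constant of_nat_id)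
  qed
  have divN: "b u div q < N" if "u \<in> VH" for u using T[OF that] unfolding N_def by (simp add: div_le_mono less_Suc_eq_le)
  have tot: "(\<Sum>s<N. \<Sum>j<r. a s j) = real (card VH)"
  proof -
    have "card VH = card (\<Union>s<N. {u\<in>VH. b u div q = s})" using divN by (intro arg_cong[where f = card]) auto
    also have "\<dots> = (\<Sum>s<N. card {u\<in>VH. b u div q = s})" using VH by (intro card_UN_disjoint) auto
    finally show ?thesis by (simp add: card_sum)
  qed
  have a0: "0 \<le> a s j" for s j by (simp add: a_def)
  obtain Ks where Ks: "\<And>s. clique (Ks s)" "\<And>i. i \<in> I \<Longrightarrow> (load Ks a N i - \<mu> i * real (card VH) / W)\<^sup>2 \<le> \<mu> i * (real N * (real (q * B))\<^sup>2 / \<nu>)"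
  proof -
    have "\<exists>Ks. (\<forall>s. clique (Ks s)) \<and> (\<forall>i\<in>I. (load Ks a N i - \<mu> i * (\<Sum>s<N. \<Sum>j<r. a s j) / W)\<^sup>2 \<le> \<mu> i * (real N * (real (q * B))\<^sup>2 / \<nu>))"
      by (rule balanced_cliques[OF ne a0 aM \<nu>(1)]) (erule \<nu>(2))
    then show thesis unfolding tot using that by blast
  qed
  obtain cl where cl: "\<And>t. clique (cl t)" "\<And>t. compat (cl t) (cl (Suc t))" "\<And>t. 2 ^ r \<le> t mod q \<Longrightarrow> cl t = Ks (t div q)"
    using clique_schedule[where Ks = Ks, OF ne Ks(1) q] by blast
  define \<sigma> where "\<sigma> u = cl (b u) (hc u)" for u
  have 1: "\<sigma> u \<in> I" if "u \<in> VH" for u using cl(1)[of "b u"] hc[OF that] by (simp add: \<sigma>_def clique_def)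
  have 2: "A (\<sigma> u) (\<sigma> v)" if uv: "u \<in> VH" "v \<in> VH" "hc u \<noteq> hc v" "b u \<le> b v + 1" "b v \<le> b u + 1" for u v
  proof -
    consider "b u = b v" | "b v = Suc (b u)" | "b u = Suc (b v)" using uv by linarith
    then show ?thesis
    proof cases
      case 1
      then show ?thesis using cl(1)[of "b u"] hc uv by (simp add: \<sigma>_def clique_def)
    next
      case 2
      then show ?thesis using cl(2)[of "b u"] hc uv by (simp add: \<sigma>_def compat_def)
    next
      case 3
      then have "A (\<sigma> v) (\<sigma> u)" using cl(2)[of "b v"] hc uv by (simp add: \<sigma>_def compat_def)
      then show ?thesis by (rule sym)
    qed
  qed
  have 3: "real (card {u\<in>VH. \<sigma> u = i}) \<le> \<mu> i * (real (card VH) / W)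
       + sqrt (\<mu> i * (real N * (real (q * B))\<^sup>2 / \<nu>)) + real (N * (2 ^ r * B))" if i: "i \<in> I" for i
  proof -
    define Y1 where "Y1 = {u\<in>VH. b u mod q < 2 ^ r}"
    define Y2 where "Y2 = {u\<in>VH. Ks (b u div q) (hc u) = i}"
    have "{u\<in>VH. \<sigma> u = i} \<subseteq> Y1 \<union> Y2"
    proof
      fix u assume u: "u \<in> {u\<in>VH. \<sigma> u = i}"
      show "u \<in> Y1 \<union> Y2"
      proof (cases "b u mod q < 2 ^ r")
        case True
        then show ?thesis using u by (simp add: Y1_def)
      next
        case False
        then have "cl (b u) = Ks (b u div q)" by (intro cl(3)) simp
        then show ?thesis using u by (simp add: Y2_def \<sigma>_def)
      qed
    qed
    then have "card {u\<in>VH. \<sigma> u = i} \<le> card (Y1 \<union> Y2)" using VH by (intro card_mono) (auto simp: Y1_def Y2_def)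
    also have "\<dots> \<le> card Y1 + card Y2" by (rule card_Un_le)
    finally have le: "real (card {u\<in>VH. \<sigma> u = i}) \<le> real (card Y1) + real (card Y2)" by linarith
    have "card Y1 \<le> card (\<Union>x\<in>{..<N} \<times> {..<2 ^ r}. {u\<in>VH. b u = fst x * q + snd x})"
    proof (intro card_mono subsetI)
      show "finite (\<Union>x\<in>{..<N} \<times> {..<2 ^ r}. {u\<in>VH. b u = fst x * q + snd x})" using VH by simp
      fix u assume "u \<in> Y1"
      then show "u \<in> (\<Union>x\<in>{..<N} \<times> {..<2 ^ r}. {u\<in>VH. b u = fst x * q + snd x})"
        using divN by (intro UN_I[of "(b u div q, b u mod q)"]) (auto simp: Y1_def)
    qed
    also have "\<dots> \<le> (\<Sum>x\<in>{..<N} \<times> {..<2 ^ r}. card {u\<in>VH. b u = fst x * q + snd x})" by (rule card_UN_le) simp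
    also have "\<dots> \<le> (\<Sum>x\<in>{..<N} \<times> {..<(2::nat) ^ r}. B)" using B by (intro sum_mono) auto
    also have "\<dots> = N * (2 ^ r * B)" by (simp add: card_cartesian_product)
    finally have Y1: "real (card Y1) \<le> real (N * (2 ^ r * B))" by (simp only: of_nat_le_iff)
    have "card Y2 = card (\<Union>x\<in>{..<N} \<times> {..<r}. {u\<in>VH. b u div q = fst x \<and> hc u = snd x \<and> Ks (fst x) (snd x) = i})"
      using divN hc by (intro arg_cong[where f = card]) (auto simp: Y2_def)
    also have "\<dots> = (\<Sum>x\<in>{..<N} \<times> {..<r}. card {u\<in>VH. b u div q = fst x \<and> hc u = snd x \<and> Ks (fst x) (snd x) = i})"
      using VH by (intro card_UN_disjoint) auto
    also have "real \<dots> = (\<Sum>x\<in>{..<N} \<times> {..<r}. of_bool (Ks (fst x) (snd x) = i) * a (fst x) (snd x))"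
      unfolding of_nat_sum by (intro sum.cong refl) (simp add: a_def)
    also have "\<dots> = load Ks a N i" unfolding load_def sum.cartesian_product by (simp add: case_prod_beta)
    finally have Y2: "real (card Y2) = load Ks a N i" .
    have "load Ks a N i - \<mu> i * real (card VH) / W \<le> sqrt (\<mu> i * (real N * (real (q * B))\<^sup>2 / \<nu>))"
      by (rule real_le_rsqrt[OF Ks(2)[OF i]])
    then show ?thesis using le Y1 Y2 by simp
  qed
  show ?thesis using 1 2 3 unfolding N_def by (intro exI[of _ \<sigma>]) blast
qed

end

section \<open>Chaining the inheritance statements\<close>

lemma inherit_one_mono:
  assumes "inherit_one E V p d \<epsilon> \<rho> \<epsilon>' M1 M2" "\<epsilon>0 \<le> \<epsilon>"
  shows "inherit_one E V p d \<epsilon>0 \<rho> \<epsilon>' M1 M2"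
proof (unfold inherit_one_def, intro allI impI, goal_cases)
  case (1 G S T X)
  have dn: "dense_pair (adj G) (d * p) \<epsilon> S T" by (rule dense_pair_mono[OF 1(10) order_refl assms(2)])
  note imp = assms(1)[unfolded inherit_one_def, THEN spec[of _ G], THEN spec[of _ S], THEN spec[of _ T], THEN spec[of _ X]]
  show ?case by (rule imp[THEN mp, OF 1(1), THEN mp, OF 1(2), THEN mp, OF 1(3), THEN mp, OF 1(4), THEN mp, OF 1(5), THEN mp, OF 1(6), THEN mp, OF 1(7), THEN mp, OF 1(8), THEN mp, OF 1(9), THEN mp, OF dn, THEN mp, OF 1(11)])
qed

lemma inherit_two_mono:
  assumes "inherit_two E V p d \<epsilon> \<rho> M2" "\<epsilon>0 \<le> \<epsilon>"
  shows "inherit_two E V p d \<epsilon>0 \<rho> M2"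
proof (unfold inherit_two_def, intro allI impI, goal_cases)
  case (1 G S T X)
  have dn: "dense_pair (adj G) (d * p) \<epsilon> S T" by (rule dense_pair_mono[OF 1(10) order_refl assms(2)])
  note imp = assms(1)[unfolded inherit_two_def, THEN spec[of _ G], THEN spec[of _ S], THEN spec[of _ T], THEN spec[of _ X]]
  show ?case by (rule imp[THEN mp, OF 1(1), THEN mp, OF 1(2), THEN mp, OF 1(3), THEN mp, OF 1(4), THEN mp, OF 1(5), THEN mp, OF 1(6), THEN mp, OF 1(7), THEN mp, OF 1(8), THEN mp, OF 1(9), THEN mp, OF dn, THEN mp, OF 1(11)])
qed

text \<open>The proportion \<open>\<epsilon>' * \<kappa>0\<close> arises because a witness is an
  \<epsilon>' part of a neighbourhood that itself contains at least a \<kappa>0 p part of the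
  candidates.\<close>

lemma inheritance_step:
  fixes d \<kappa>0 \<epsilon>' :: real
  assumes d: "0 < d" "d \<le> 1" and \<kappa>0: "0 < \<kappa>0" and e': "0 < \<epsilon>'" "\<epsilon>' < 1"
  shows "\<exists>\<epsilon>>0. \<epsilon> \<le> \<epsilon>' \<and> (\<exists>C0\<ge>1. \<forall>C\<ge>C0. \<forall>(n::nat) p. 3 \<le> n \<longrightarrow> 0 < p \<longrightarrow> p \<le> 1 \<longrightarrow>
    measure_pmf.prob (rsub (nsets {..<n} 2) p)
      {E. \<not> (inherit_one E {..<n} p d \<epsilon> (\<epsilon>' * \<kappa>0) \<epsilon>' (C * ln (real n) / p) (C * ln (real n) / p\<^sup>2) \<and>
             inherit_two E {..<n} p d \<epsilon> (\<epsilon>' * \<kappa>0) (C * ln (real n) / p\<^sup>2))} \<le> 2 * (exp (3 / real n) - 1))"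
proof -
  have \<rho>: "0 < \<epsilon>' * \<kappa>0" using e' \<kappa>0 by simp
  obtain \<epsilon>1 C1 where 1: "0 < \<epsilon>1" "1 \<le> C1" "\<And>C n p. C1 \<le> C \<Longrightarrow> 3 \<le> n \<Longrightarrow> 0 < p \<Longrightarrow> p \<le> 1 \<Longrightarrow>
    measure_pmf.prob (rsub (nsets {..<n} 2) p)
      {E. \<not> inherit_one E {..<n} p d \<epsilon>1 (\<epsilon>' * \<kappa>0) \<epsilon>' (C * ln (real n) / p) (C * ln (real n) / p\<^sup>2)} \<le> exp (3 / real n) - 1"
    using inherit_one_prob[OF d \<rho> e'] by blast
  obtain \<epsilon>2 C2 where 2: "0 < \<epsilon>2" "1 \<le> C2" "\<And>C n p. C2 \<le> C \<Longrightarrow> 3 \<le> n \<Longrightarrow> 0 < p \<Longrightarrow> p \<le> 1 \<Longrightarrow>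
    measure_pmf.prob (rsub (nsets {..<n} 2) p)
      {E. \<not> inherit_two E {..<n} p d \<epsilon>2 (\<epsilon>' * \<kappa>0) (C * ln (real n) / p\<^sup>2)} \<le> exp (3 / real n) - 1"
    using inherit_two_prob[OF d \<rho>] by blast
  define \<epsilon> where "\<epsilon> = min \<epsilon>' (min \<epsilon>1 \<epsilon>2)"
  have main: "measure_pmf.prob (rsub (nsets {..<n} 2) p)
      {E. \<not> (inherit_one E {..<n} p d \<epsilon> (\<epsilon>' * \<kappa>0) \<epsilon>' (C * ln (real n) / p) (C * ln (real n) / p\<^sup>2) \<and>
             inherit_two E {..<n} p d \<epsilon> (\<epsilon>' * \<kappa>0) (C * ln (real n) / p\<^sup>2))} \<le> 2 * (exp (3 / real n) - 1)"
    if C: "max C1 C2 \<le> C" and n: "3 \<le> n" and p: "0 < p" "p \<le> 1" for C p :: real and n :: nat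
  proof -
    let ?M = "rsub (nsets {..<n} 2) p"
    define A where "A = {E. \<not> inherit_one E {..<n} p d \<epsilon>1 (\<epsilon>' * \<kappa>0) \<epsilon>' (C * ln (real n) / p) (C * ln (real n) / p\<^sup>2)}"
    define B where "B = {E. \<not> inherit_two E {..<n} p d \<epsilon>2 (\<epsilon>' * \<kappa>0) (C * ln (real n) / p\<^sup>2)}"
    have "measure_pmf.prob ?M {E. \<not> (inherit_one E {..<n} p d \<epsilon> (\<epsilon>' * \<kappa>0) \<epsilon>' (C * ln (real n) / p) (C * ln (real n) / p\<^sup>2) \<and>
             inherit_two E {..<n} p d \<epsilon> (\<epsilon>' * \<kappa>0) (C * ln (real n) / p\<^sup>2))} \<le> measure_pmf.prob ?M (A \<union> B)"
    proof (intro measure_pmf.finite_measure_mono)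
      have le: "\<epsilon> \<le> \<epsilon>1" "\<epsilon> \<le> \<epsilon>2" by (auto simp: \<epsilon>_def)
      show "{E. \<not> (inherit_one E {..<n} p d \<epsilon> (\<epsilon>' * \<kappa>0) \<epsilon>' (C * ln (real n) / p) (C * ln (real n) / p\<^sup>2) \<and>
             inherit_two E {..<n} p d \<epsilon> (\<epsilon>' * \<kappa>0) (C * ln (real n) / p\<^sup>2))} \<subseteq> A \<union> B"
        unfolding A_def B_def using inherit_one_mono[OF _ le(1)] inherit_two_mono[OF _ le(2)] by blast
    qed simp
    also have "\<dots> \<le> measure_pmf.prob ?M A + measure_pmf.prob ?M B" by (rule measure_Un_le) auto
    also have "\<dots> \<le> (exp (3 / real n) - 1) + (exp (3 / real n) - 1)"
      unfolding A_def B_def using C n p by (intro add_mono 1(3) 2(3)) auto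
    also have "\<dots> = 2 * (exp (3 / real n) - 1)" by simp
    finally show ?thesis .
  qed
  show ?thesis
    using main 1(1,2) 2(1) e'(1) by (intro exI[of _ \<epsilon>] conjI exI[of _ "max C1 C2"]) (auto simp: \<epsilon>_def)
qed

text \<open>Each parameter is obtained from the next one, so the sequence is built downwards from
  its last term. One constant serves all levels because each level tolerates every larger
  constant.\<close>

lemma inheritance_chain:
  fixes d :: "nat \<Rightarrow> real" and \<kappa>0 \<epsilon>1 :: real and m :: nat
  assumes d: "\<And>l. 0 < d l" "\<And>l. d l \<le> 1" and \<kappa>0: "0 < \<kappa>0" and e1: "0 < \<epsilon>1" "\<epsilon>1 < 1"
  shows "\<exists>\<epsilon> C0. 1 \<le> C0 \<and> \<epsilon> m = \<epsilon>1 \<and> (\<forall>l\<le>m. 0 < \<epsilon> l) \<and> (\<forall>l<m. \<epsilon> l \<le> \<epsilon> (Suc l)) \<and>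
    (\<forall>(n::nat) p. \<forall>l<m. 3 \<le> n \<longrightarrow> 0 < p \<longrightarrow> p \<le> 1 \<longrightarrow> measure_pmf.prob (rsub (nsets {..<n} 2) p)
      {E. \<not> (inherit_one E {..<n} p (d l) (\<epsilon> l) (\<epsilon> (Suc l) * \<kappa>0) (\<epsilon> (Suc l)) (C0 * ln (real n) / p) (C0 * ln (real n) / p\<^sup>2) \<and>
             inherit_two E {..<n} p (d l) (\<epsilon> l) (\<epsilon> (Suc l) * \<kappa>0) (C0 * ln (real n) / p\<^sup>2))} \<le> 2 * (exp (3 / real n) - 1))"
proof -
  define good where "good l \<epsilon> \<epsilon>' C \<longleftrightarrow> (\<forall>(n::nat) p. 3 \<le> n \<longrightarrow> 0 < p \<longrightarrow> p \<le> 1 \<longrightarrow> measure_pmf.prob (rsub (nsets {..<n} 2) p)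
      {E. \<not> (inherit_one E {..<n} p (d l) \<epsilon> (\<epsilon>' * \<kappa>0) \<epsilon>' (C * ln (real n) / p) (C * ln (real n) / p\<^sup>2) \<and>
             inherit_two E {..<n} p (d l) \<epsilon> (\<epsilon>' * \<kappa>0) (C * ln (real n) / p\<^sup>2))} \<le> 2 * (exp (3 / real n) - 1))" for l \<epsilon> \<epsilon>' C
  have step: "\<exists>\<epsilon> C0. 0 < \<epsilon> \<and> \<epsilon> \<le> \<epsilon>' \<and> 1 \<le> C0 \<and> (\<forall>C\<ge>C0. good l \<epsilon> \<epsilon>' C)" if "0 < \<epsilon>'" "\<epsilon>' < 1" for l \<epsilon>'
    using inheritance_step[OF d \<kappa>0 that, of l] unfolding good_def by blast
  have "\<exists>\<epsilon> C0. 1 \<le> C0 \<and> \<epsilon> m = \<epsilon>1 \<and> (\<forall>l. m - k \<le> l \<and> l \<le> m \<longrightarrow> 0 < \<epsilon> l \<and> \<epsilon> l < 1) \<and>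
      (\<forall>l. m - k \<le> l \<and> l < m \<longrightarrow> \<epsilon> l \<le> \<epsilon> (Suc l) \<and> (\<forall>C\<ge>C0. good l (\<epsilon> l) (\<epsilon> (Suc l)) C))" if "k \<le> m" for k
    using that
  proof (induction k)
    case 0
    show ?case by (rule exI[of _ "\<lambda>_. \<epsilon>1"], rule exI[of _ 1]) (use e1 in auto)
  next
    case (Suc k)
    then obtain \<epsilon> C0 where IH: "1 \<le> C0" "\<epsilon> m = \<epsilon>1" "\<forall>l. m - k \<le> l \<and> l \<le> m \<longrightarrow> 0 < \<epsilon> l \<and> \<epsilon> l < 1"
      "\<forall>l. m - k \<le> l \<and> l < m \<longrightarrow> \<epsilon> l \<le> \<epsilon> (Suc l) \<and> (\<forall>C\<ge>C0. good l (\<epsilon> l) (\<epsilon> (Suc l)) C)" by auto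
    define j where "j = m - Suc k"
    have j: "Suc j = m - k" "j < m" using Suc.prems by (auto simp: j_def)
    have ej: "0 < \<epsilon> (Suc j)" "\<epsilon> (Suc j) < 1" using IH(3) j by auto
    obtain \<epsilon>' C' where e': "0 < \<epsilon>'" "\<epsilon>' \<le> \<epsilon> (Suc j)" "1 \<le> C'" "\<forall>C\<ge>C'. good j \<epsilon>' (\<epsilon> (Suc j)) C"
      using step[OF ej, of j] by blast
    show ?case
    proof (rule exI[of _ "\<epsilon>(j := \<epsilon>')"], rule exI[of _ "max C0 C'"], intro conjI allI impI)
      show "1 \<le> max C0 C'" using IH(1) by simp
      show "(\<epsilon>(j := \<epsilon>')) m = \<epsilon>1" using IH(2) j by simp
    next
      fix l assume l: "m - Suc k \<le> l \<and> l \<le> m"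
      show "0 < (\<epsilon>(j := \<epsilon>')) l" "(\<epsilon>(j := \<epsilon>')) l < 1"
        using l IH(3) e' ej j by (cases "l = j"; auto simp: j_def)+
    next
      fix l assume l: "m - Suc k \<le> l \<and> l < m"
      show "(\<epsilon>(j := \<epsilon>')) l \<le> (\<epsilon>(j := \<epsilon>')) (Suc l)"
        using l IH(4) e' j by (cases "l = j") (auto simp: j_def)
      fix C assume "max C0 C' \<le> C"
      then show "good l ((\<epsilon>(j := \<epsilon>')) l) ((\<epsilon>(j := \<epsilon>')) (Suc l)) C"
        using l IH(4) e' j by (cases "l = j") (auto simp: j_def)
    qed
  qed
  from this[OF order_refl] obtain \<epsilon> C0 where x: "1 \<le> C0" "\<epsilon> m = \<epsilon>1" "\<And>l. l \<le> m \<Longrightarrow> 0 < \<epsilon> l"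
    "\<And>l. l < m \<Longrightarrow> \<epsilon> l \<le> \<epsilon> (Suc l)" "\<And>l. l < m \<Longrightarrow> \<forall>C\<ge>C0. good l (\<epsilon> l) (\<epsilon> (Suc l)) C" by auto
  have "good l (\<epsilon> l) (\<epsilon> (Suc l)) C0" if "l < m" for l using x(5)[OF that] by simp
  then show ?thesis using x(1-4) unfolding good_def by (intro exI[of _ \<epsilon>] exI[of _ C0]) blast
qed

section \<open>The guest graph: colouring, labelling, loads and target sets\<close>

lemma simple_graph_edge:
  assumes "simple_graph H" "{u, v} \<in> edges H"
  shows "u \<in> verts H" "v \<in> verts H" "u \<noteq> v"
  using assms by (auto simp: simple_graph_def nsets_def card_insert_if)

text \<open>A \<open>LEAST\<close> is attained only if some value qualifies; as the vertices are
  natural numbers, the identity is a proper colouring.\<close>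

lemma exists_optimal_colouring:
  fixes H :: "nat ugraph"
  assumes H: "simple_graph H"
  shows "\<exists>c. proper_colouring H (chromatic_number H) c"
proof -
  have "proper_colouring H (Suc (Max (insert 0 (verts H)))) id"
    unfolding proper_colouring_def
  proof (intro conjI allI impI)
    show "id ` verts H \<subseteq> {..<Suc (Max (insert 0 (verts H)))}"
      using H by (auto simp: simple_graph_def less_Suc_eq_le)
    show "id u \<noteq> id v" if "{u, v} \<in> edges H" for u v using simple_graph_edge[OF H that] by simp
  qed
  then have "\<exists>k. \<exists>c. proper_colouring H k c" by blast
  then show ?thesis unfolding chromatic_number_def by (rule LeastI_ex)
qed

lemma exists_optimal_labelling:
  assumes H: "simple_graph H"
  shows "\<exists>l. bij_betw l (verts H) {1..card (verts H)} \<and>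
    (\<forall>u v. {u, v} \<in> edges H \<longrightarrow> \<bar>int (l u) - int (l v)\<bar> \<le> int (bandwidth H))"
proof -
  have fin: "finite (verts H)" using H by (simp add: simple_graph_def)
  obtain l where l: "bij_betw l (verts H) {1..card (verts H)}"
    using ex_bij_betw_nat_finite_1[OF fin] bij_betw_inv by blast
  have "\<bar>int (l u) - int (l v)\<bar> \<le> int (card (verts H))" if "{u, v} \<in> edges H" for u v
  proof -
    have "l u \<in> {1..card (verts H)}" "l v \<in> {1..card (verts H)}"
      using simple_graph_edge[OF H that] l by (auto dest: bij_betwE)
    then show ?thesis by auto
  qed
  then have "\<exists>b. \<exists>l. bij_betw l (verts H) {1..card (verts H)} \<and>
    (\<forall>u v. {u, v} \<in> edges H \<longrightarrow> \<bar>int (l u) - int (l v)\<bar> \<le> int b)" using l by blast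
  then show ?thesis unfolding bandwidth_def by (rule LeastI_ex)
qed

lemma degree_eq_card_nbrs:
  assumes G: "simple_graph G"
  shows "degree G v = card {u. {v, u} \<in> edges G}"
proof -
  have eq: "(\<lambda>u. {v, u}) ` {u. {v, u} \<in> edges G} = {e \<in> edges G. v \<in> e}"
  proof (intro equalityI subsetI)
    fix e assume e: "e \<in> {e \<in> edges G. v \<in> e}"
    then have "card e = 2" using G by (auto simp: simple_graph_def nsets_def)
    then obtain a b where "e = {a, b}" "a \<noteq> b" by (auto simp: card_2_iff)
    then have "e = {v, a} \<or> e = {v, b}" using e by auto
    then show "e \<in> (\<lambda>u. {v, u}) ` {u. {v, u} \<in> edges G}" using e by auto
  qed auto
  have "inj_on (\<lambda>u. {v, u}) {u. {v, u} \<in> edges G}" by (rule inj_onI) (auto simp only: doubleton_eq_iff)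
  from card_image[OF this] show ?thesis unfolding degree_def eq .
qed

text \<open>At most (1 - \<gamma>)n vertices spread over clusters covering (1 - \<gamma>/4)n fill a
  1 - \<gamma>/2 proportion of each; the deviation and the transitions take \<gamma>/16 each, which
  leaves 3\<gamma>/8.\<close>

lemma assignment_load_le:
  fixes \<gamma> \<eta> K \<xi> \<beta> n \<mu> W h \<nu> :: real and q B T R r :: nat
  assumes \<gamma>: "0 < \<gamma>" "\<gamma> < 1" and \<eta>: "0 < \<eta>" "\<eta> \<le> 1" and K: "1 \<le> K" and \<xi>: "\<xi> = \<gamma>\<^sup>2 * \<eta>^3 / (1000 * K^3)"
    and q: "2 ^ R * 32 * K / (\<gamma> * \<eta>) \<le> real q" and \<beta>: "\<beta> \<le> \<gamma> * \<eta> / (128 * K * 2 ^ R)" "2 * real q * \<beta> \<le> \<xi>"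
    and B: "0 < B" "real B \<le> 2 * \<beta> * n" and T: "real T \<le> n / real B + 1" and n: "0 < n"
    and \<mu>: "\<eta> / K * n \<le> \<mu>" "\<mu> \<le> n" and W: "(1 - \<gamma> / 4) * n \<le> W" and h: "0 \<le> h" "h \<le> (1 - \<gamma>) * n" and r: "r \<le> R"
    and \<nu>: "\<nu> = \<eta> / K * n"
  shows "\<mu> * (h / W) + sqrt (\<mu> * (real (T div q + 1) * (real (q * B))\<^sup>2 / \<nu>)) + real ((T div q + 1) * (2 ^ r * B)) \<le> (1 - 3 * \<gamma> / 8) * \<mu>"
proof -
  define y where "y = \<gamma> * \<eta> / K"
  have y: "0 < y" using \<gamma> \<eta> K by (simp add: y_def)
  have yn: "y * n \<le> \<gamma> * \<mu>" using \<mu>(1) \<gamma> mult_left_mono[OF \<mu>(1), of \<gamma>] by (simp add: y_def)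
  have qpos: "0 < real q"
  proof -
    have "0 < 2 ^ R * 32 * K / (\<gamma> * \<eta>)" using \<gamma> \<eta> K by simp
    then show ?thesis using q by linarith
  qed
  then have q1: "1 \<le> real q" by simp
  define x where "x = real (q * B)"
  have x0: "0 < x" using qpos B by (simp add: x_def)
  define N where "N = real (T div q + 1)"
  have N: "N \<le> n / x + 2"
  proof -
    have "real (T div q) \<le> real T / real q" by (rule of_nat_div_le_of_nat)
    also have "\<dots> \<le> (n / real B + 1) / real q" using T qpos by (intro divide_right_mono) auto
    also have "\<dots> = n / x + 1 / real q" using qpos B by (simp add: x_def add_divide_distrib mult.commute)
    also have "\<dots> \<le> n / x + 1" using q1 by simp
    finally show ?thesis by (simp add: N_def)
  qed
  have N0: "0 \<le> N" by (simp add: N_def)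
  have \<xi>0: "0 < \<xi>" "\<xi> \<le> 1"
  proof -
    show "0 < \<xi>" unfolding \<xi> using \<gamma> \<eta> K by simp
    have "\<gamma>\<^sup>2 * \<eta>^3 \<le> 1 * 1" using \<gamma> \<eta> by (intro mult_mono power_le_one) auto
    moreover have "1 \<le> 1000 * K^3" using one_le_power[OF K, of 3] by linarith
    ultimately show "\<xi> \<le> 1" unfolding \<xi> using K by (simp add: divide_le_eq_1)
  qed
  \<comment> \<open>\<open>x\<close> bounds the number of vertices in one run. Runs are long
    compared with the walks, yet this makes them short compared with the clusters, so that the
    deviation is small.\<close>
  have x\<xi>: "x \<le> \<xi> * n"
  proof -
    have "x \<le> real q * (2 * \<beta> * n)" using B qpos by (simp add: x_def)
    also have "\<dots> = (2 * real q * \<beta>) * n" by simp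
    also have "\<dots> \<le> \<xi> * n" using \<beta>(2) n by (intro mult_right_mono) auto
    finally show ?thesis .
  qed
  have t1: "\<mu> * (h / W) \<le> (1 - \<gamma> / 2) * \<mu>"
  proof -
    have "0 < (1 - \<gamma> / 4) * n" using n \<gamma> by (intro mult_pos_pos) auto
    then have W0: "0 < W" using W by linarith
    have "h \<le> (1 - \<gamma>) * n" by (rule h(2))
    also have "\<dots> \<le> ((1 - \<gamma> / 2) * (1 - \<gamma> / 4)) * n" using n \<gamma> by (intro mult_right_mono) (auto simp: algebra_simps)
    also have "\<dots> = (1 - \<gamma> / 2) * ((1 - \<gamma> / 4) * n)" by simp
    also have "\<dots> \<le> (1 - \<gamma> / 2) * W" using W \<gamma> by (intro mult_left_mono) auto
    finally have "h / W \<le> 1 - \<gamma> / 2" using W0 by (simp add: divide_le_eq)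
    moreover have "0 \<le> \<mu>"
    proof -
      have "0 < \<eta> / K * n" using \<eta> K n by simp
      then show ?thesis using \<mu>(1) by linarith
    qed
    ultimately have "\<mu> * (h / W) \<le> \<mu> * (1 - \<gamma> / 2)" by (intro mult_left_mono)
    then show ?thesis by (simp add: mult.commute)
  qed
  have t2: "sqrt (\<mu> * (N * x\<^sup>2 / \<nu>)) \<le> \<gamma> / 16 * \<mu>"
  proof (rule real_le_lsqrt)
    have "N * x\<^sup>2 \<le> (n / x + 2) * x\<^sup>2" using N by (intro mult_right_mono) auto
    also have "\<dots> = n * x + 2 * (x * x)" using x0 by (simp add: power2_eq_square distrib_right)
    also have "\<dots> \<le> n * (\<xi> * n) + 2 * ((1 * n) * (\<xi> * n))"
    proof -
      have "\<xi> * n \<le> 1 * n" using \<xi>0 n by (intro mult_right_mono) auto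
      then have "x \<le> 1 * n" using x\<xi> by linarith
      then have "x * x \<le> (1 * n) * (\<xi> * n)" using x\<xi> x0 n by (intro mult_mono) auto
      moreover have "n * x \<le> n * (\<xi> * n)" using x\<xi> n by (intro mult_left_mono) auto
      ultimately show ?thesis by linarith
    qed
    finally have Nx: "N * x\<^sup>2 \<le> 3 * \<xi> * n * n" by simp
    have \<nu>0: "0 < \<nu>" using \<nu> \<eta> K n by simp
    have \<mu>0: "0 \<le> \<mu>" using \<mu>(1) \<nu>0 \<nu> by linarith
    have "\<mu> * (N * x\<^sup>2 / \<nu>) \<le> n * (3 * \<xi> * n * n / \<nu>)"
    proof (rule mult_mono[OF \<mu>(2)])
      show "N * x\<^sup>2 / \<nu> \<le> 3 * \<xi> * n * n / \<nu>" using Nx \<nu>0 by (intro divide_right_mono) simp_all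
      show "0 \<le> n" "0 \<le> N * x\<^sup>2 / \<nu>" using n N0 \<nu>0 by simp_all
    qed
    also have "\<dots> = 3 * \<xi> * (K / \<eta>) * n * n" unfolding \<nu> using \<eta> K n by (simp add: field_simps)
    also have "3 * \<xi> * (K / \<eta>) = 3 / 1000 * (y * y)"
      unfolding \<xi> y_def using \<eta> K by (simp add: field_simps power2_eq_square power3_eq_cube)
    also have "3 / 1000 * (y * y) * n * n = 3 / 1000 * ((y * n) * (y * n))" by simp
    also have "\<dots> \<le> 1 / 256 * ((\<gamma> * \<mu>) * (\<gamma> * \<mu>))"
    proof -
      have "(y * n) * (y * n) \<le> (\<gamma> * \<mu>) * (\<gamma> * \<mu>)" by (rule mult_mono[OF yn yn]) (use y n \<gamma> \<mu>0 in simp_all)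
      moreover have "0 \<le> (y * n) * (y * n)" using y n by simp
      ultimately show ?thesis by linarith
    qed
    also have "\<dots> = (\<gamma> / 16 * \<mu>)\<^sup>2" by (simp add: power2_eq_square)
    finally show "\<mu> * (N * x\<^sup>2 / \<nu>) \<le> (\<gamma> / 16 * \<mu>)\<^sup>2" .
    show "0 \<le> \<gamma> / 16 * \<mu>" using \<gamma> \<mu>0 by simp
  qed
  have t3: "real ((T div q + 1) * (2 ^ r * B)) \<le> \<gamma> / 16 * \<mu>"
  proof -
    have "real ((T div q + 1) * (2 ^ r * B)) = N * (2 ^ r * real B)" by (simp only: N_def of_nat_mult of_nat_power of_nat_numeral)
    also have "\<dots> \<le> (n / x + 2) * (2 ^ R * real B)"
      using N N0 r by (intro mult_mono power_increasing) auto
    also have "\<dots> = 2 ^ R / real q * n + 2 * 2 ^ R * real B" using B qpos by (simp add: x_def distrib_right)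
    also have "\<dots> \<le> y / 32 * n + y / 32 * n"
    proof (rule add_mono)
      have "2 ^ R * 32 \<le> real q * y" using q \<gamma> \<eta> K by (simp add: y_def field_simps)
      then have "2 ^ R / real q \<le> y / 32" using qpos by (simp add: field_simps)
      then show "2 ^ R / real q * n \<le> y / 32 * n" using n by (intro mult_right_mono) auto
      have "\<beta> * (128 * 2 ^ R) \<le> y" using \<beta>(1) K by (simp add: y_def field_simps)
      then have "\<beta> * (128 * 2 ^ R) * n \<le> y * n" using n by (intro mult_right_mono) auto
      moreover have "2 * 2 ^ R * real B \<le> 2 * 2 ^ R * (2 * \<beta> * n)" using B by (intro mult_left_mono) auto
      moreover have "2 * 2 ^ R * (2 * \<beta> * n) = \<beta> * (128 * 2 ^ R) * n / 32" "y / 32 * n = y * n / 32" by simp_all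
      ultimately show "2 * 2 ^ R * real B \<le> y / 32 * n" by linarith
    qed
    also have "\<dots> = (y * n) / 16" by simp
    also have "\<dots> \<le> \<gamma> / 16 * \<mu>" using yn by simp
    finally show ?thesis .
  qed
  have "(1 - \<gamma> / 2) * \<mu> + \<gamma> / 16 * \<mu> + \<gamma> / 16 * \<mu> = (1 - 3 * \<gamma> / 8) * \<mu>" by (simp add: algebra_simps)
  then show ?thesis using t1 t2 t3 unfolding N_def x_def by linarith
qed

text \<open>\<open>near\<close> means distance at most three, expressed by closed neighbourhoods of
  at most \<Delta> + 1 vertices. Pairing a colouring of this relation with the block index modulo 3
  makes distinct blocks of equal colour differ by a multiple of three.\<close>

lemma separating_colouring:
  fixes hadj :: "'h \<Rightarrow> 'h \<Rightarrow> bool" and b :: "'h \<Rightarrow> nat"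
  assumes fin: "finite VH" and hsym: "\<And>u v. hadj u v \<Longrightarrow> hadj v u" and hV: "\<And>u v. hadj u v \<Longrightarrow> u \<in> VH"
    and irr: "\<And>u v. hadj u v \<Longrightarrow> u \<noteq> v" and deg: "\<And>u. u \<in> VH \<Longrightarrow> card {w. hadj u w} \<le> \<Delta>"
  obtains \<kappa> where "\<And>u. u \<in> VH \<Longrightarrow> \<kappa> u < 3 * Suc ((\<Delta> + 1) ^ 3)"
    "\<And>u v. hadj u v \<Longrightarrow> \<kappa> u \<noteq> \<kappa> v"
    "\<And>u v w. hadj u v \<Longrightarrow> hadj v w \<Longrightarrow> u \<noteq> w \<Longrightarrow> \<kappa> u \<noteq> \<kappa> w"
    "\<And>u v w x. hadj u v \<Longrightarrow> hadj v w \<Longrightarrow> hadj w x \<Longrightarrow> u \<noteq> x \<Longrightarrow> \<kappa> u \<noteq> \<kappa> x"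
    "\<And>u v. u \<in> VH \<Longrightarrow> v \<in> VH \<Longrightarrow> \<kappa> u = \<kappa> v \<Longrightarrow> b u < b v \<Longrightarrow> b u + 3 \<le> b v"
proof -
  define nb where "nb u = insert u {w. hadj u w}" for u
  define near where "near u v \<longleftrightarrow> (\<exists>x y. x \<in> nb u \<and> y \<in> nb x \<and> v \<in> nb y)" for u v
  have nb_self: "u \<in> nb u" for u by (simp add: nb_def)
  have nb_adj: "w \<in> nb u" if "hadj u w" for u w using that by (simp add: nb_def)
  have nb_sym: "v \<in> nb u" if "u \<in> nb v" for u v
  proof (cases "u = v")
    case True
    then show ?thesis by (simp add: nb_def)
  next
    case False
    then have "hadj v u" using that by (simp add: nb_def)
    from hsym[OF this] show ?thesis by (simp add: nb_def)
  qed
  have nbV: "nb u \<subseteq> VH" if "u \<in> VH" for u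
  proof
    fix w assume w: "w \<in> nb u"
    show "w \<in> VH"
    proof (cases "w = u")
      case False
      then have "hadj u w" using w by (simp add: nb_def)
      from hV[OF hsym[OF this]] show ?thesis .
    qed (use that in simp)
  qed
  have nbc: "card (nb u) \<le> \<Delta> + 1" if "u \<in> VH" for u
  proof -
    have "card (nb u) \<le> Suc (card {w. hadj u w})" unfolding nb_def by (rule card_insert_le_m1) simp_all
    then show ?thesis using deg[OF that] by simp
  qed
  have finnb: "finite (nb u)" if "u \<in> VH" for u using finite_subset[OF nbV[OF that] fin] .
  have near_card: "card {v\<in>VH. v \<noteq> u \<and> near u v} \<le> (\<Delta> + 1) ^ 3" if u: "u \<in> VH" for u
  proof -
    have one: "card (\<Union>y\<in>nb x. nb y) \<le> (\<Delta> + 1) * (\<Delta> + 1)" if x: "x \<in> VH" for x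
    proof -
      have "card (\<Union>y\<in>nb x. nb y) \<le> (\<Sum>y\<in>nb x. card (nb y))" by (rule card_UN_le[OF finnb[OF x]])
      also have "\<dots> \<le> (\<Sum>y\<in>nb x. \<Delta> + 1)" by (rule sum_mono) (rule nbc, use nbV[OF x] in blast)
      also have "\<dots> = card (nb x) * (\<Delta> + 1)" by (simp only: sum_constant of_nat_id)
      also have "\<dots> \<le> (\<Delta> + 1) * (\<Delta> + 1)" using nbc[OF x] by (rule mult_right_mono) simp
      finally show ?thesis .
    qed
    have finite_U: "finite (\<Union>x\<in>nb u. \<Union>y\<in>nb x. nb y)"
    proof (intro finite_UN_I finnb u)
      fix x assume x: "x \<in> nb u"
      then show xV: "x \<in> VH" using nbV[OF u] by blast
      fix y assume "y \<in> nb x"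
      then show "y \<in> VH" using nbV[OF xV] by blast
    qed
    have "card {v\<in>VH. v \<noteq> u \<and> near u v} \<le> card (\<Union>x\<in>nb u. \<Union>y\<in>nb x. nb y)"
      by (rule card_mono[OF finite_U]) (unfold near_def, blast)
    also have "\<dots> \<le> (\<Sum>x\<in>nb u. card (\<Union>y\<in>nb x. nb y))" by (rule card_UN_le[OF finnb[OF u]])
    also have "\<dots> \<le> (\<Sum>x\<in>nb u. (\<Delta> + 1) * (\<Delta> + 1))" by (rule sum_mono) (rule one, use nbV[OF u] in blast)
    also have "\<dots> = card (nb u) * ((\<Delta> + 1) * (\<Delta> + 1))" by simp
    also have "\<dots> \<le> (\<Delta> + 1) * ((\<Delta> + 1) * (\<Delta> + 1))" using nbc[OF u] by (rule mult_right_mono) simp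
    finally show ?thesis by (simp only: power3_eq_cube mult.assoc)
  qed
  have nearI: "near u v" if "x \<in> nb u" "y \<in> nb x" "v \<in> nb y" for u v x y using that unfolding near_def by blast
  have near_sym: "near v u" if nr: "near u v" for u v
  proof -
    obtain x y where xy: "x \<in> nb u" "y \<in> nb x" "v \<in> nb y" using nr unfolding near_def by blast
    show ?thesis by (rule nearI[OF nb_sym[OF xy(3)] nb_sym[OF xy(2)] nb_sym[OF xy(1)]])
  qed
  have "\<exists>col. (\<forall>u\<in>VH. col u < Suc ((\<Delta> + 1) ^ 3)) \<and> (\<forall>u\<in>VH. \<forall>v\<in>VH. u \<noteq> v \<longrightarrow> near u v \<longrightarrow> col u \<noteq> (col v :: nat))"
    by (rule greedy_colouring[OF fin]) (erule near_sym, erule near_card)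
  then obtain col where col: "\<forall>u\<in>VH. col u < Suc ((\<Delta> + 1) ^ 3)"
    "\<forall>u\<in>VH. \<forall>v\<in>VH. u \<noteq> v \<longrightarrow> near u v \<longrightarrow> col u \<noteq> (col v :: nat)" by (elim exE conjE)
  define \<kappa> where "\<kappa> u = 3 * col u + b u mod 3" for u
  have \<kappa>D: "col u = col v" "b u mod 3 = b v mod 3" if "\<kappa> u = \<kappa> v" for u v
    using that unfolding \<kappa>_def by presburger+
  have \<kappa>near: "\<kappa> u \<noteq> \<kappa> v" if "u \<in> VH" "v \<in> VH" "u \<noteq> v" "near u v" for u v
    using col(2) that \<kappa>D(1)[of u v] by blast
  show thesis
  proof (rule that[of \<kappa>])
    fix u assume "u \<in> VH"
    then have "col u < Suc ((\<Delta> + 1) ^ 3)" using col(1) by blast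
    then show "\<kappa> u < 3 * Suc ((\<Delta> + 1) ^ 3)" unfolding \<kappa>_def by presburger
  next
    fix u v assume uv: "hadj u v"
    have "near u v" by (rule nearI[OF nb_self nb_self nb_adj[OF uv]])
    then show "\<kappa> u \<noteq> \<kappa> v" by (intro \<kappa>near hV[OF uv] hV[OF hsym[OF uv]] irr[OF uv])
  next
    fix u v w assume uv: "hadj u v" "hadj v w" and ne: "u \<noteq> w"
    have "near u w" by (rule nearI[OF nb_self nb_adj[OF uv(1)] nb_adj[OF uv(2)]])
    then show "\<kappa> u \<noteq> \<kappa> w" by (intro \<kappa>near hV[OF uv(1)] hV[OF hsym[OF uv(2)]] ne)
  next
    fix u v w x assume uv: "hadj u v" "hadj v w" "hadj w x" and ne: "u \<noteq> x"
    have "near u x" by (rule nearI[OF nb_adj[OF uv(1)] nb_adj[OF uv(2)] nb_adj[OF uv(3)]])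
    then show "\<kappa> u \<noteq> \<kappa> x" by (intro \<kappa>near hV[OF uv(1)] hV[OF hsym[OF uv(3)]] ne)
  next
    fix u v assume "\<kappa> u = \<kappa> v" and lt: "b u < b v"
    then have "b u mod 3 = b v mod 3" using \<kappa>D(2) by blast
    then show "b u + 3 \<le> b v" using lt by presburger
  qed
qed

lemma block_card_le:
  assumes l: "inj_on l V" "l ` V \<subseteq> {1..m}" and fin: "finite V" and B: "0 < (B::nat)"
  shows "card {u\<in>V. (l u - 1) div B = t} \<le> B"
proof -
  have "l ` {u\<in>V. (l u - 1) div B = t} \<subseteq> {Suc (t * B)..<Suc (t * B) + B}"
  proof
    fix x assume "x \<in> l ` {u\<in>V. (l u - 1) div B = t}"
    then have x: "1 \<le> x" "(x - 1) div B = t" using l(2) by force+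
    have "t * B + (x - 1) mod B = x - 1" using div_mult_mod_eq[of "x - 1" B] unfolding x(2) .
    moreover have "(x - 1) mod B < B" using B by simp
    ultimately show "x \<in> {Suc (t * B)..<Suc (t * B) + B}" using x(1) unfolding atLeastLessThan_iff by linarith
  qed
  from card_mono[OF _ this] have "card (l ` {u\<in>V. (l u - 1) div B = t}) \<le> B" by simp
  moreover have "inj_on l {u\<in>V. (l u - 1) div B = t}" by (rule inj_on_subset[OF l(1)]) blast
  ultimately show ?thesis using card_image by fastforce
qed

lemma adjacent_blocks:
  fixes x y B :: nat
  assumes "0 < B" "\<bar>int x - int y\<bar> \<le> int B"
  shows "(x - 1) div B \<le> (y - 1) div B + 1"
proof -
  have "x - 1 \<le> (y - 1) + B" using assms(2) by linarith
  then have "(x - 1) div B \<le> ((y - 1) + B) div B" by (rule div_le_mono)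
  then show ?thesis using assms(1) by simp
qed

text \<open>Each part gets room for its vertices and a reserve \<zeta>|Vc i|; the extra
  \<open>q\<close> in the load hypothesis absorbs the rounding of the q reserves of a
  cluster.\<close>

lemma disjoint_target_sets:
  fixes Vc :: "'i \<Rightarrow> 'a set" and \<sigma> :: "'h \<Rightarrow> 'i" and \<kappa> :: "'h \<Rightarrow> nat" and \<zeta> :: real
  assumes finH: "finite VH" and finVc: "\<And>i. finite (Vc i)" and disj: "\<And>i j. i \<noteq> j \<Longrightarrow> Vc i \<inter> Vc j = {}"
    and \<kappa>q: "\<And>u. u \<in> VH \<Longrightarrow> \<kappa> u < q" and \<sigma>I: "\<And>u. u \<in> VH \<Longrightarrow> \<sigma> u \<in> I" and \<zeta>: "0 \<le> \<zeta>"
    and load: "\<And>i. i \<in> I \<Longrightarrow> real (card {u\<in>VH. \<sigma> u = i}) + real q * (\<zeta> * real (card (Vc i))) + real q \<le> real (card (Vc i))"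
  obtains U where "\<And>i k. U i k \<subseteq> Vc i"
    "\<And>u w v. u \<in> VH \<Longrightarrow> w \<in> VH \<Longrightarrow> v \<in> U (\<sigma> u) (\<kappa> u) \<Longrightarrow> v \<in> U (\<sigma> w) (\<kappa> w) \<Longrightarrow> \<sigma> u = \<sigma> w \<and> \<kappa> u = \<kappa> w"
    "\<And>u. u \<in> VH \<Longrightarrow> real (card {w\<in>VH. \<sigma> w = \<sigma> u \<and> \<kappa> w = \<kappa> u}) + \<zeta> * real (card (Vc (\<sigma> u))) \<le> real (card (U (\<sigma> u) (\<kappa> u)))"
proof -
  define s where "s i k = card {w\<in>VH. \<sigma> w = i \<and> \<kappa> w = k} + nat \<lceil>\<zeta> * real (card (Vc i))\<rceil>" for i k
  have ex: "\<exists>U. (\<forall>k<q. U k \<subseteq> Vc i \<and> card (U k) = s i k) \<and> (\<forall>k<q. \<forall>l<q. k \<noteq> l \<longrightarrow> U k \<inter> U l = {})" if i: "i \<in> I" for i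
  proof (rule disjoint_subsets_of_sizes[OF finVc])
    define z where "z = \<zeta> * real (card (Vc i))"
    have z: "0 \<le> z" using \<zeta> by (simp add: z_def)
    have "{u\<in>VH. \<sigma> u = i} = (\<Union>k<q. {w\<in>VH. \<sigma> w = i \<and> \<kappa> w = k})" using \<kappa>q by auto
    then have "card {u\<in>VH. \<sigma> u = i} = card (\<Union>k<q. {w\<in>VH. \<sigma> w = i \<and> \<kappa> w = k})" by simp
    also have "\<dots> = (\<Sum>k<q. card {w\<in>VH. \<sigma> w = i \<and> \<kappa> w = k})"
      using finH by (intro card_UN_disjoint) auto
    finally have "(\<Sum>k<q. s i k) = card {u\<in>VH. \<sigma> u = i} + q * nat \<lceil>z\<rceil>"
      by (simp add: s_def sum.distrib z_def)
    then have "real (\<Sum>k<q. s i k) = real (card {u\<in>VH. \<sigma> u = i}) + real q * real (nat \<lceil>z\<rceil>)" by simp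
    also have "real (nat \<lceil>z\<rceil>) \<le> z + 1" using z by linarith
    then have "real q * real (nat \<lceil>z\<rceil>) \<le> real q * (z + 1)" by (rule mult_left_mono) simp
    then have "real (card {u\<in>VH. \<sigma> u = i}) + real q * real (nat \<lceil>z\<rceil>) \<le> real (card {u\<in>VH. \<sigma> u = i}) + real q * z + real q"
      by (simp add: distrib_left)
    also have "\<dots> \<le> real (card (Vc i))" using load[OF i] unfolding z_def .
    finally show "(\<Sum>k<q. s i k) \<le> card (Vc i)" by (simp only: of_nat_le_iff)
  qed
  have "\<exists>U0. \<forall>i\<in>I. (\<forall>k<q. U0 i k \<subseteq> Vc i \<and> card (U0 i k) = s i k) \<and> (\<forall>k<q. \<forall>l<q. k \<noteq> l \<longrightarrow> U0 i k \<inter> U0 i l = {})"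
    by (intro bchoice ballI ex)
  then obtain U0 where "\<forall>i\<in>I. (\<forall>k<q. U0 i k \<subseteq> Vc i \<and> card (U0 i k) = s i k) \<and> (\<forall>k<q. \<forall>l<q. k \<noteq> l \<longrightarrow> U0 i k \<inter> U0 i l = {})"
    by (elim exE)
  note U0 = bspec[OF this]
  define U where "U i k = (if i \<in> I \<and> k < q then U0 i k else {})" for i k
  have Ueq: "U (\<sigma> u) (\<kappa> u) = U0 (\<sigma> u) (\<kappa> u)" if "u \<in> VH" for u using \<sigma>I[OF that] \<kappa>q[OF that] by (simp add: U_def)
  have sub: "U i k \<subseteq> Vc i" for i k using U0[of i] by (simp add: U_def)
  show thesis
  proof (rule that[of U])
    show "U i k \<subseteq> Vc i" for i k by (rule sub)
    show "\<sigma> u = \<sigma> w \<and> \<kappa> u = \<kappa> w" if H: "u \<in> VH" "w \<in> VH" "v \<in> U (\<sigma> u) (\<kappa> u)" "v \<in> U (\<sigma> w) (\<kappa> w)" for u w v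
    proof -
      have s: "\<sigma> u = \<sigma> w"
      proof (rule ccontr)
        assume "\<sigma> u \<noteq> \<sigma> w"
        from disj[OF this] show False using H(3,4) sub by blast
      qed
      have "\<kappa> u = \<kappa> w"
      proof (rule ccontr)
        assume ne: "\<kappa> u \<noteq> \<kappa> w"
        have "U0 (\<sigma> u) (\<kappa> u) \<inter> U0 (\<sigma> u) (\<kappa> w) = {}" using U0[OF \<sigma>I[OF H(1)]] \<kappa>q[OF H(1)] \<kappa>q[OF H(2)] ne by blast
        moreover have "v \<in> U0 (\<sigma> u) (\<kappa> u)" using H(3) unfolding Ueq[OF H(1)] .
        moreover have "v \<in> U0 (\<sigma> u) (\<kappa> w)" using H(4) unfolding Ueq[OF H(2)] s .
        ultimately show False by blast
      qed
      then show ?thesis using s by blast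
    qed
    show "real (card {w\<in>VH. \<sigma> w = \<sigma> u \<and> \<kappa> w = \<kappa> u}) + \<zeta> * real (card (Vc (\<sigma> u))) \<le> real (card (U (\<sigma> u) (\<kappa> u)))" if u: "u \<in> VH" for u
    proof -
      have "card (U (\<sigma> u) (\<kappa> u)) = s (\<sigma> u) (\<kappa> u)" unfolding Ueq[OF u] using U0[OF \<sigma>I[OF u]] \<kappa>q[OF u] by blast
      moreover have "\<zeta> * real (card (Vc (\<sigma> u))) \<le> real (nat \<lceil>\<zeta> * real (card (Vc (\<sigma> u)))\<rceil>)" by linarith
      ultimately show ?thesis by (simp add: s_def)
    qed
  qed
qed

text \<open>Upper regularity on the whole vertex set bounds the average degree by (1 + 3\<delta>)pn.
  Applied to the required minimum degree, this bounds the chromatic number of \<open>H\<close> in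
  terms of \<gamma>, so that \<beta> can be chosen before \<open>H\<close> is known.\<close>

lemma min_degree_factor_le:
  assumes up: "upper_regular E n p \<delta>" and GE: "G \<subseteq> E" and p: "0 < p" and n: "1 \<le> n"
    and deg: "\<And>v. v < n \<Longrightarrow> \<tau> * p * real n \<le> real (card {u\<in>{..<n}. {v, u} \<in> G})"
  shows "\<tau> \<le> 1 + 3 * \<delta>"
proof -
  have "\<tau> * (p * (real n)\<^sup>2) = (\<Sum>v<n. \<tau> * p * real n)" by (simp add: power2_eq_square)
  also have "\<dots> \<le> (\<Sum>v<n. real (card {u\<in>{..<n}. {v, u} \<in> E}))"
  proof (rule sum_mono)
    fix v assume "v \<in> {..<n}"
    then have "\<tau> * p * real n \<le> real (card {u\<in>{..<n}. {v, u} \<in> G})" using deg by simp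
    also have "card {u\<in>{..<n}. {v, u} \<in> G} \<le> card {u\<in>{..<n}. {v, u} \<in> E}"
      using GE by (intro card_mono) auto
    finally show "\<tau> * p * real n \<le> real (card {u\<in>{..<n}. {v, u} \<in> E})" by simp
  qed
  also have "\<dots> = ec (adj E) {..<n} {..<n}" 
    unfolding ec_def adj_def by (intro sum.cong refl ec_deg[OF finite_lessThan, of "\<lambda>a b. {a, b} \<in> E", symmetric])
  also have "\<dots> \<le> (1 + \<delta>) * p * real (card {..<n}) * real (card {..<n}) + 2 * \<delta> * p * (real n)\<^sup>2"
    using up unfolding upper_regular_def by blast
  also have "\<dots> = (1 + 3 * \<delta>) * (p * (real n)\<^sup>2)" by (simp add: power2_eq_square algebra_simps)
  finally show ?thesis using p n by (simp add: mult_le_cancel_right)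
qed

text \<open>The deterministic part: randomness enters only through upper regularity, the inheritance
  statements and the Hall property of \<open>E\<close>. The cluster structure is also assumed,
  because its bound K has to be fixed before \<beta>.\<close>

lemma embedding_of_bounded_bandwidth:
  fixes n \<Delta> R q K q' :: nat and \<gamma> \<eta> \<zeta> \<delta> c \<kappa>0 \<beta> p M1 M2 \<xi> :: real and d \<epsilon> :: "nat \<Rightarrow> real"
    and E :: "nat set set" and H G :: "nat ugraph"
  assumes \<gamma>: "0 < \<gamma>" "\<gamma> < 1" and \<Delta>: "1 \<le> \<Delta>" and R: "2 / \<gamma> \<le> real R"
    and q: "q = 3 * Suc ((\<Delta> + 1) ^ 3)" and \<zeta>: "\<zeta> = \<gamma> / (8 * real q)" and \<eta>: "\<eta> = \<gamma> / 8"
    and d: "\<And>l. d l = \<gamma> / 16 / 2 ^ (24 * l)" and \<kappa>0: "\<kappa>0 = d (2 * \<Delta>)"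
    and \<epsilon>0: "\<And>l. l \<le> 2 * \<Delta> \<Longrightarrow> 0 < \<epsilon> l" and \<epsilon>S: "\<And>l. l < 2 * \<Delta> \<Longrightarrow> \<epsilon> l \<le> \<epsilon> (Suc l)"
    and \<epsilon>D: "\<epsilon> (2 * \<Delta>) * (4 * real \<Delta>) \<le> 1"
    and K: "1 \<le> K"
    and str: "\<And>\<tau> G. G \<subseteq> E \<Longrightarrow> (\<forall>v<n. \<tau> * p * real n \<le> real (card {u\<in>{..<n}. {v, u} \<in> G})) \<Longrightarrow>
      \<exists>f I. I \<subseteq> {..<K} \<and> (\<forall>i\<in>I. \<eta> / real K * real n \<le> real (card (cell {..<n} f i))) \<and>
      (1 - 2 * \<eta>) * real n \<le> (\<Sum>i\<in>I. real (card (cell {..<n} f i))) \<and>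
      (\<forall>i\<in>I. (\<Sum>j\<in>{j\<in>I. \<not> dense_pair (adj G) (d 0 * p) (\<epsilon> 0 * \<zeta>) (cell {..<n} f i) (cell {..<n} f j)}. real (card (cell {..<n} f j)))
         \<le> (1 - \<tau> + 3 * \<gamma> / 8) * real n)"
    and \<delta>: "0 \<le> \<delta>" "3 * \<delta> \<le> \<gamma> / 2" and up: "upper_regular E n p \<delta>"
    and q': "2 ^ R * 32 * real K / (\<gamma> * \<eta>) \<le> real q'" and \<xi>: "\<xi> = \<gamma>\<^sup>2 * \<eta>^3 / (1000 * (real K)^3)"
    and \<beta>: "0 < \<beta>" "\<beta> \<le> \<gamma> * \<eta> / (128 * real K * 2 ^ R)" "2 * real q' * \<beta> \<le> \<xi>" "2 * \<beta> \<le> c / exp 2"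
    and c: "c = \<zeta> * (\<eta> / real K) / 2 * \<kappa>0 ^ \<Delta>"
    and n: "1 \<le> \<beta> * real n" "4 * real q \<le> \<gamma> * (\<eta> / real K * real n)"
    and p: "0 < p" "p \<le> 1" and M0: "0 \<le> M1" "0 \<le> M2"
    and M1: "8 * (real \<Delta>)\<^sup>2 * (M1 * p) \<le> \<zeta> * (\<eta> / real K * real n) * (\<kappa>0 * p) ^ \<Delta>"
    and M2: "8 * (real \<Delta>)\<^sup>2 * (M2 * p\<^sup>2) \<le> \<zeta> * (\<eta> / real K * real n) * (\<kappa>0 * p) ^ \<Delta>"
    and inh1: "\<And>l. l < 2 * \<Delta> \<Longrightarrow> inherit_one E {..<n} p (d l) (\<epsilon> l) (\<epsilon> (Suc l) * \<kappa>0) (\<epsilon> (Suc l)) M1 M2"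
    and inh2: "\<And>l. l < 2 * \<Delta> \<Longrightarrow> inherit_two E {..<n} p (d l) (\<epsilon> l) (\<epsilon> (Suc l) * \<kappa>0) M2"
    and hall: "hall_property E n p \<Delta> c"
    and H: "simple_graph H" "int (card (verts H)) = \<lfloor>(1 - \<gamma>) * real n\<rfloor>" "max_degree H \<le> \<Delta>" "real (bandwidth H) \<le> \<beta> * real n"
    and G: "subgraph G \<lparr>verts = {..<n}, edges = E\<rparr>" "card (verts G) = n"
    and mindeg: "((real (chromatic_number H) - 1) / real (chromatic_number H) + \<gamma>) * p * real n \<le> real (min_degree G)"
  shows "contains_copy G H"
proof (cases "verts H = {}")
  case True
  then have "edges H = {}" using H(1) by (auto simp: simple_graph_def nsets_def)
  then show ?thesis using True by (simp add: contains_copy_def)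
next
  case ne: False
  define VH where "VH = verts H"
  define hadj where "hadj u v \<longleftrightarrow> {u, v} \<in> edges H" for u v
  have finH: "finite VH" using H(1) by (simp add: VH_def simple_graph_def)
  have hV: "u \<in> VH" if "hadj u v" for u v using simple_graph_edge[OF H(1)] that by (simp add: hadj_def VH_def)
  have irr: "u \<noteq> v" if "hadj u v" for u v using simple_graph_edge[OF H(1)] that by (simp add: hadj_def)
  have hsym: "hadj v u" if "hadj u v" for u v using that by (simp add: hadj_def insert_commute)
  have hdeg: "card {w. hadj u w} \<le> \<Delta>" if "u \<in> VH" for u
  proof -
    have "degree H u \<le> max_degree H" unfolding max_degree_def using finH that by (intro Max_ge) (auto simp: VH_def)
    then show ?thesis using H(3) unfolding degree_eq_card_nbrs[OF H(1)] hadj_def by linarith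
  qed
  have n0: "0 < real n" using n(1) \<beta>(1) by (smt (verit) mult_nonneg_nonpos)
  have "0 < q" unfolding q by simp
  then have q0: "0 < real q" by (simp only: of_nat_0_less_iff)
  have \<zeta>0: "0 < \<zeta>" using \<gamma> q0 by (simp add: \<zeta>)
  have \<eta>0: "0 < \<eta>" "\<eta> \<le> 1" using \<gamma> by (auto simp: \<eta>)
  have K0: "1 \<le> real K" using K by simp
  have dpos: "0 < d l" for l using \<gamma> by (simp add: d)
  have dle: "d l \<le> d k" if "k \<le> l" for l k
    unfolding d using that \<gamma> by (intro divide_left_mono power_increasing) auto
  have d1: "d l \<le> 1" for l using dle[of 0 l] \<gamma> d[of 0] by simp
  have \<kappa>0': "0 < \<kappa>0" "\<kappa>0 \<le> 1" using dpos d1 by (auto simp: \<kappa>0)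
  define m where "m = \<eta> / real K * real n"
  have m0: "0 < m" using \<eta>0 K0 n0 by (simp add: m_def)
  define a0 where "a0 = \<zeta> * m"
  have a00: "0 < a0" using \<zeta>0 m0 by (simp add: a0_def)

  have SG: "simple_graph G" and GE: "edges G \<subseteq> E" and VG: "verts G = {..<n}"
  proof -
    show "simple_graph G" "edges G \<subseteq> E" using G(1) by (auto simp: subgraph_def)
    have "verts G \<subseteq> {..<n}" using G(1) by (simp add: subgraph_def)
    then show "verts G = {..<n}" using G(2) by (intro card_subset_eq) auto
  qed
  define r where "r = chromatic_number H"
  obtain hc where hc: "proper_colouring H r hc" using exists_optimal_colouring[OF H(1)] unfolding r_def by (elim exE)
  have hcr: "hc u < r" if "u \<in> VH" for u using hc that by (auto simp: proper_colouring_def VH_def)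
  have r1: "1 \<le> r" using ne hcr by (force simp: VH_def)
  define \<tau> where "\<tau> = (real r - 1) / real r + \<gamma>"
  have Gdeg: "\<tau> * p * real n \<le> real (card {u\<in>{..<n}. {v, u} \<in> edges G})" if v: "v < n" for v
  proof -
    have "min_degree G \<le> degree G v" unfolding min_degree_def VG using v by (intro Min_le) auto
    also have "degree G v = card {u. {v, u} \<in> edges G}" by (rule degree_eq_card_nbrs[OF SG])
    also have "{u. {v, u} \<in> edges G} = {u\<in>{..<n}. {v, u} \<in> edges G}"
      using simple_graph_edge(2)[OF SG] VG by blast
    finally show ?thesis using mindeg unfolding \<tau>_def r_def by linarith
  qed
  have Gdeg': "\<forall>v<n. \<tau> * p * real n \<le> real (card {u\<in>{..<n}. {v, u} \<in> edges G})" using Gdeg by blast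
  have rR: "r \<le> R"
  proof -
    have "\<tau> \<le> 1 + 3 * \<delta>" 
      by (rule min_degree_factor_le[OF up GE p(1)]) (use n0 in simp, erule Gdeg)
    moreover have "\<tau> = 1 - 1 / real r + \<gamma>" using r1 by (simp add: \<tau>_def diff_divide_distrib)
    ultimately have "\<gamma> / 2 \<le> 1 / real r" using \<delta> by linarith
    then have "real r \<le> 2 / \<gamma>" using \<gamma> r1 by (simp add: field_simps)
    then show ?thesis using R by linarith
  qed
  obtain f I where IK: "I \<subseteq> {..<K}" and big: "\<forall>i\<in>I. m \<le> real (card (cell {..<n} f i))"
    and tot: "(1 - 2 * \<eta>) * real n \<le> (\<Sum>i\<in>I. real (card (cell {..<n} f i)))"
    and nn: "\<forall>i\<in>I. (\<Sum>j\<in>{j\<in>I. \<not> dense_pair (adj (edges G)) (d 0 * p) (\<epsilon> 0 * \<zeta>) (cell {..<n} f i) (cell {..<n} f j)}. real (card (cell {..<n} f j)))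
         \<le> (1 - \<tau> + 3 * \<gamma> / 8) * real n"
    using str[OF GE Gdeg'] unfolding m_def by (elim exE conjE)
  define Vc where "Vc = cell {..<n} f"
  define \<mu> where "\<mu> i = real (card (Vc i))" for i
  define A where "A i j = dense_pair (adj (edges G)) (d 0 * p) (\<epsilon> 0 * \<zeta>) (Vc i) (Vc j)" for i j
  have finI: "finite I" using IK finite_subset by blast
  have \<mu>m: "m \<le> \<mu> i" if "i \<in> I" for i using big that by (simp add: \<mu>_def Vc_def)
  have Vcn: "Vc i \<subseteq> {..<n}" for i by (auto simp: Vc_def cell_def)
  have finVc: "finite (Vc i)" for i using finite_subset[OF Vcn] by simp
  have \<mu>n: "\<mu> i \<le> real n" for i using card_mono[OF _ Vcn[of i]] by (simp add: \<mu>_def)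
  have Wn: "(1 - \<gamma> / 4) * real n \<le> (\<Sum>i\<in>I. \<mu> i)" using tot by (simp add: \<mu>_def Vc_def \<eta>)
  have wr: "weighted_relation I \<mu> A r"
  proof
    show "finite I" by (rule finI)
    show "0 < \<mu> i" if "i \<in> I" for i using \<mu>m[OF that] m0 by linarith
    show "1 \<le> r" by (rule r1)
    show "A j i" if "A i j" for i j using dense_adj_swap that unfolding A_def .
    fix i assume i: "i \<in> I"
    have "(\<Sum>j\<in>{j\<in>I. \<not> A i j}. \<mu> j) \<le> (1 - \<tau> + 3 * \<gamma> / 8) * real n" using nn i unfolding A_def \<mu>_def Vc_def by blast
    then have "real r * (\<Sum>j\<in>{j\<in>I. \<not> A i j}. \<mu> j) \<le> real r * ((1 - \<tau> + 3 * \<gamma> / 8) * real n)" by (rule mult_left_mono) simp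
    also have "real r * ((1 - \<tau> + 3 * \<gamma> / 8) * real n) = (real r * (1 - \<tau> + 3 * \<gamma> / 8)) * real n" by simp
    \<comment> \<open>The surplus \<gamma> in the minimum degree pays for the losses in the cluster
      structure and for the vertices outside the clusters, whose total weight may be as small as (1
      - \<gamma>/4)n.\<close>
    also have "real r * (1 - \<tau> + 3 * \<gamma> / 8) = 1 - 5 / 8 * (\<gamma> * real r)" using r1 by (simp add: \<tau>_def field_simps)
    also have "(1 - 5 / 8 * (\<gamma> * real r)) * real n < (1 - \<gamma> / 4) * real n"
    proof (rule mult_strict_right_mono[OF _ n0])
      have "\<gamma> * 1 \<le> \<gamma> * real r" using r1 \<gamma> by (intro mult_left_mono) auto
      then show "1 - 5 / 8 * (\<gamma> * real r) < 1 - \<gamma> / 4" using \<gamma> by linarith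
    qed
    also have "\<dots> \<le> (\<Sum>i\<in>I. \<mu> i)" by (rule Wn)
    finally show "real r * (\<Sum>j\<in>{j\<in>I. \<not> A i j}. \<mu> j) < (\<Sum>i\<in>I. \<mu> i)" .
  qed
  have Ine: "I \<noteq> {}"
  proof
    assume "I = {}"
    then have "(1 - \<gamma> / 4) * real n \<le> 0" using Wn by simp
    moreover have "0 < (1 - \<gamma> / 4) * real n" using n0 \<gamma> by (intro mult_pos_pos) auto
    ultimately show False by linarith
  qed

  \<comment> \<open>Blocks are at least as long as the bandwidth, so an edge of \<open>H\<close>
    stays within a block or joins consecutive ones.\<close>
  define B where "B = nat \<lceil>\<beta> * real n\<rceil>"
  have Bge: "\<beta> * real n \<le> real B" unfolding B_def by linarith
  have B0: "0 < B" using Bge n(1) by (cases B) auto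
  have Ble: "real B \<le> 2 * \<beta> * real n"
  proof -
    have "real B \<le> \<beta> * real n + 1" unfolding B_def using n(1) by linarith
    then show ?thesis using n(1) by linarith
  qed
  obtain l where l: "bij_betw l VH {1..card VH}" "\<And>u v. {u, v} \<in> edges H \<Longrightarrow> \<bar>int (l u) - int (l v)\<bar> \<le> int (bandwidth H)"
    using exists_optimal_labelling[OF H(1)] unfolding VH_def by (elim exE conjE) blast
  define b where "b u = (l u - 1) div B" for u
  have bB: "card {u\<in>VH. b u = t} \<le> B" for t
    unfolding b_def using l(1) by (intro block_card_le[where m = "card VH"] finH B0) (auto simp: bij_betw_def)
  have bedge: "b u \<le> b v + 1" if "hadj u v" for u v
  proof -
    have "\<bar>int (l u) - int (l v)\<bar> \<le> int (bandwidth H)" using l(2) that unfolding hadj_def .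
    moreover have "bandwidth H \<le> B" using H(4) Bge by linarith
    ultimately show ?thesis unfolding b_def by (intro adjacent_blocks B0) linarith
  qed
  have cardVH: "real (card VH) \<le> (1 - \<gamma>) * real n"
    using H(2) unfolding VH_def by linarith
  define T where "T = card VH div B + 1"
  have bT: "b u < T" if "u \<in> VH" for u
  proof -
    have "l u \<in> {1..card VH}" using bij_betwE[OF l(1)] that by blast
    then have "l u - 1 \<le> card VH" unfolding atLeastAtMost_iff by linarith
    then show ?thesis unfolding b_def T_def by (simp add: div_le_mono less_Suc_eq_le)
  qed
  have Tn: "real T \<le> real n / real B + 1"
  proof -
    have "(1 - \<gamma>) * real n \<le> 1 * real n" using \<gamma> n0 by (intro mult_right_mono) auto
    then have "real (card VH) / real B \<le> real n / real B" using cardVH by (intro divide_right_mono) auto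
    moreover have "real (card VH div B) \<le> real (card VH) / real B" by (rule of_nat_div_le_of_nat)
    ultimately show ?thesis by (simp add: T_def)
  qed
  have q'r: "2 ^ r \<le> q'"
  proof -
    have "(2::real) ^ r \<le> 2 ^ R" using rR by (intro power_increasing) auto
    also have "\<dots> = 2 ^ R * 1" by simp
    also have "\<dots> \<le> 2 ^ R * (32 * real K / (\<gamma> * \<eta>))"
    proof (rule mult_left_mono)
      have "\<gamma> * \<eta> \<le> 1 * 1" using \<gamma> \<eta>0 by (intro mult_mono) auto
      moreover have "0 < \<gamma> * \<eta>" using \<gamma> \<eta>0 by simp
      ultimately show "1 \<le> 32 * real K / (\<gamma> * \<eta>)" using K0 by (simp add: le_divide_eq)
    qed simp
    also have "\<dots> \<le> real q'" using q' by simp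
    finally have "real (2 ^ r) \<le> real q'" by simp
    then show ?thesis by (simp only: of_nat_le_iff)
  qed
  have "\<exists>\<sigma>. (\<forall>u\<in>VH. \<sigma> u \<in> I) \<and>
    (\<forall>u\<in>VH. \<forall>v\<in>VH. hc u \<noteq> hc v \<longrightarrow> b u \<le> b v + 1 \<longrightarrow> b v \<le> b u + 1 \<longrightarrow> A (\<sigma> u) (\<sigma> v)) \<and>
    (\<forall>i\<in>I. real (card {u\<in>VH. \<sigma> u = i}) \<le> \<mu> i * (real (card VH) / weighted_relation.W I \<mu>)
       + sqrt (\<mu> i * (real (T div q' + 1) * (real (q' * B))\<^sup>2 / m)) + real ((T div q' + 1) * (2 ^ r * B)))"
    by (rule weighted_relation.balanced_assignment[OF wr Ine finH hcr bB bT q'r m0 \<mu>m])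
  then obtain \<sigma> where \<sigma>I: "\<forall>u\<in>VH. \<sigma> u \<in> I"
    and \<sigma>A: "\<forall>u\<in>VH. \<forall>v\<in>VH. hc u \<noteq> hc v \<longrightarrow> b u \<le> b v + 1 \<longrightarrow> b v \<le> b u + 1 \<longrightarrow> A (\<sigma> u) (\<sigma> v)"
    and \<sigma>l: "\<forall>i\<in>I. real (card {u\<in>VH. \<sigma> u = i}) \<le> \<mu> i * (real (card VH) / weighted_relation.W I \<mu>)
       + sqrt (\<mu> i * (real (T div q' + 1) * (real (q' * B))\<^sup>2 / m)) + real ((T div q' + 1) * (2 ^ r * B))"
    by (elim exE conjE)
  have load: "real (card {u\<in>VH. \<sigma> u = i}) \<le> (1 - 3 * \<gamma> / 8) * \<mu> i" if i: "i \<in> I" for i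
  proof -
    have "\<mu> i * (real (card VH) / weighted_relation.W I \<mu>)
       + sqrt (\<mu> i * (real (T div q' + 1) * (real (q' * B))\<^sup>2 / m)) + real ((T div q' + 1) * (2 ^ r * B)) \<le> (1 - 3 * \<gamma> / 8) * \<mu> i"
    proof (rule assignment_load_le[OF \<gamma> \<eta>0 K0 \<xi> q' \<beta>(2,3) B0 Ble Tn n0 _ \<mu>n _ _ cardVH rR m_def])
      show "\<eta> / real K * real n \<le> \<mu> i" using \<mu>m[OF i] unfolding m_def .
      show "(1 - \<gamma> / 4) * real n \<le> weighted_relation.W I \<mu>" using Wn unfolding weighted_relation.W_def[OF wr] .
    qed simp
    then show ?thesis using \<sigma>l i by fastforce
  qed
  obtain \<kappa> where \<kappa>: "\<And>u. u \<in> VH \<Longrightarrow> \<kappa> u < 3 * Suc ((\<Delta> + 1) ^ 3)"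
    "\<And>u v. hadj u v \<Longrightarrow> \<kappa> u \<noteq> \<kappa> v"
    "\<And>u v w. hadj u v \<Longrightarrow> hadj v w \<Longrightarrow> u \<noteq> w \<Longrightarrow> \<kappa> u \<noteq> \<kappa> w"
    "\<And>u v w x. hadj u v \<Longrightarrow> hadj v w \<Longrightarrow> hadj w x \<Longrightarrow> u \<noteq> x \<Longrightarrow> \<kappa> u \<noteq> \<kappa> x"
    "\<And>u v. u \<in> VH \<Longrightarrow> v \<in> VH \<Longrightarrow> \<kappa> u = \<kappa> v \<Longrightarrow> b u < b v \<Longrightarrow> b u + 3 \<le> b v"
    by (rule separating_colouring[of VH hadj \<Delta> b, OF finH hsym hV irr hdeg]) (assumption | (rule that; assumption))+
  have \<kappa>q: "\<kappa> u < q" if "u \<in> VH" for u using \<kappa>(1)[OF that] unfolding q .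
  have Vdisj: "Vc i \<inter> Vc j = {}" if "i \<noteq> j" for i j using that by (auto simp: Vc_def cell_def)
  have tl: "real (card {u\<in>VH. \<sigma> u = i}) + real q * (\<zeta> * real (card (Vc i))) + real q \<le> real (card (Vc i))" if i: "i \<in> I" for i
  proof -
    \<comment> \<open>Of the 3\<gamma>/8 left over in a cluster, \<gamma>/8 holds the q reserves and
      \<gamma>/4 their rounding.\<close>
    have "real q * (\<zeta> * \<mu> i) = \<gamma> / 8 * \<mu> i" using q0 by (simp add: \<zeta>)
    moreover have "real q \<le> \<gamma> / 4 * \<mu> i"
    proof -
      have "\<gamma> * m \<le> \<gamma> * \<mu> i" using \<mu>m[OF i] \<gamma> by (intro mult_left_mono) auto
      then show ?thesis using n(2) unfolding m_def by simp
    qed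
    moreover have "(1 - 3 * \<gamma> / 8) * \<mu> i + \<gamma> / 8 * \<mu> i + \<gamma> / 4 * \<mu> i = \<mu> i" by (simp add: algebra_simps)
    ultimately show ?thesis using load[OF i] unfolding \<mu>_def by linarith
  qed
  have \<sigma>I': "\<sigma> u \<in> I" if "u \<in> VH" for u using \<sigma>I that by blast
  obtain U where U: "\<And>i k. U i k \<subseteq> Vc i"
    "\<And>u w v. u \<in> VH \<Longrightarrow> w \<in> VH \<Longrightarrow> v \<in> U (\<sigma> u) (\<kappa> u) \<Longrightarrow> v \<in> U (\<sigma> w) (\<kappa> w) \<Longrightarrow> \<sigma> u = \<sigma> w \<and> \<kappa> u = \<kappa> w"
    "\<And>u. u \<in> VH \<Longrightarrow> real (card {w\<in>VH. \<sigma> w = \<sigma> u \<and> \<kappa> w = \<kappa> u}) + \<zeta> * real (card (Vc (\<sigma> u))) \<le> real (card (U (\<sigma> u) (\<kappa> u)))"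
    by (rule disjoint_target_sets[of VH Vc \<kappa> q \<sigma> I \<zeta>, OF finH finVc Vdisj \<kappa>q \<sigma>I' less_imp_le[OF \<zeta>0] tl]) (assumption | (rule that; assumption))+
  have a01: "a0 \<le> \<zeta> * real (card (Vc (\<sigma> u)))" if "u \<in> VH" for u
    unfolding a0_def using \<mu>m[OF \<sigma>I'[OF that]] \<zeta>0 by (intro mult_left_mono) (auto simp: \<mu>_def)
  have dense0: "dense_pair (adj (edges G)) (d 0 * p) (\<epsilon> 0 * \<zeta>) (Vc (\<sigma> u)) (Vc (\<sigma> v))" if uv: "hadj u v" for u v
  proof -
    have "hc u \<noteq> hc v" using hc uv by (simp add: proper_colouring_def hadj_def)
    then have "A (\<sigma> u) (\<sigma> v)" using \<sigma>A hV[OF uv] hV[OF hsym[OF uv]] bedge[OF uv] bedge[OF hsym[OF uv]] by blast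
    then show ?thesis unfolding A_def .
  qed
  have dS: "d (Suc l) = d l / 2 ^ 24" for l by (simp add: d power_add)
  have d0: "d 0 \<le> 1" by (rule d1)
  have \<kappa>d: "\<kappa>0 \<le> d l" if "l \<le> 2 * \<Delta>" for l unfolding \<kappa>0 by (rule dle[OF that])
  have kp: "0 < \<kappa>0 * p" "\<kappa>0 * p \<le> 1" using \<kappa>0' p by (auto intro: mult_le_one)
  have S1: "8 * (real \<Delta>)\<^sup>2 * M1 \<le> a0 * (\<kappa>0 * p) ^ j" if "j + 1 \<le> \<Delta>" for j
  proof -
    \<comment> \<open>For j < \<Delta> one factor p is to spare and turns the assumption on M1 * p
      into a bound on M1; for M2 and j + 2 \<le> \<Delta> there are two.\<close>
    have "(\<kappa>0 * p) ^ \<Delta> \<le> (\<kappa>0 * p) ^ (j + 1)" using that kp by (intro power_decreasing) auto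
    also have "\<dots> = (\<kappa>0 * p) ^ j * (\<kappa>0 * p)" by simp
    also have "\<dots> \<le> (\<kappa>0 * p) ^ j * (1 * p)" using kp \<kappa>0' p by (intro mult_left_mono mult_right_mono) auto
    finally have "a0 * (\<kappa>0 * p) ^ \<Delta> \<le> a0 * ((\<kappa>0 * p) ^ j * p)" using a00 by simp
    then have "(8 * (real \<Delta>)\<^sup>2 * M1) * p \<le> (a0 * (\<kappa>0 * p) ^ j) * p" using M1 unfolding a0_def m_def by (simp add: mult.assoc)
    then show ?thesis using p(1) by (rule mult_right_le_imp_le)
  qed
  have S2: "8 * (real \<Delta>)\<^sup>2 * M2 \<le> a0 * (\<kappa>0 * p) ^ j" if "j + 2 \<le> \<Delta>" for j
  proof -
    have p2: "0 < p\<^sup>2" using p by simp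
    have "(\<kappa>0 * p) ^ \<Delta> \<le> (\<kappa>0 * p) ^ (j + 2)" using that kp by (intro power_decreasing) auto
    also have "\<dots> = (\<kappa>0 * p) ^ j * (\<kappa>0 * p)\<^sup>2" by (simp only: power_add)
    also have "\<dots> \<le> (\<kappa>0 * p) ^ j * p\<^sup>2"
    proof (rule mult_left_mono)
      have "\<kappa>0 * p \<le> p" using \<kappa>0' p by (simp add: mult_le_cancel_right1)
      then show "(\<kappa>0 * p)\<^sup>2 \<le> p\<^sup>2" using kp by (intro power_mono) auto
    qed (use kp in simp)
    finally have "a0 * (\<kappa>0 * p) ^ \<Delta> \<le> a0 * ((\<kappa>0 * p) ^ j * p\<^sup>2)" using a00 by simp
    then have "(8 * (real \<Delta>)\<^sup>2 * M2) * p\<^sup>2 \<le> (a0 * (\<kappa>0 * p) ^ j) * p\<^sup>2" using M2 unfolding a0_def m_def by (simp add: mult.assoc)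
    then show ?thesis using p2 by (rule mult_right_le_imp_le)
  qed
  have cn: "c * real n \<le> a0 / 2 * \<kappa>0 ^ \<Delta>" unfolding c a0_def m_def by (simp add: mult_ac)
  have layer2: "real (card {u\<in>VH. b u = t \<and> \<kappa> u = k}) \<le> c / exp 2 * real n" for t k
  proof -
    have "card {u\<in>VH. b u = t \<and> \<kappa> u = k} \<le> card {u\<in>VH. b u = t}" using finH by (intro card_mono) auto
    also have "\<dots> \<le> B" by (rule bB)
    finally have "real (card {u\<in>VH. b u = t \<and> \<kappa> u = k}) \<le> real B" by simp
    also have "\<dots> \<le> 2 * \<beta> * real n" by (rule Ble)
    also have "\<dots> \<le> c / exp 2 * real n" using \<beta>(4) n0 by (intro mult_right_mono) auto
    finally show ?thesis .
  qed
  have layer1: "real (card {u\<in>VH. b u = t \<and> \<kappa> u = k}) \<le> a0 / 2" for t k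
  proof -
    have c0: "0 \<le> c" using \<beta>(1,4) by (smt (verit) divide_neg_pos exp_gt_zero)
    have "c / exp 2 \<le> c / 1" using c0 by (intro divide_left_mono) auto
    then have "c / exp 2 \<le> c" unfolding div_by_1 .
    then have "c / exp 2 * real n \<le> c * real n" by (rule mult_right_mono) simp
    also have "\<dots> \<le> a0 / 2 * \<kappa>0 ^ \<Delta>" by (rule cn)
    also have "\<dots> \<le> a0 / 2 * 1" using a00 \<kappa>0' by (intro mult_left_mono power_le_one) auto
    finally show ?thesis using layer2[of t k] by linarith
  qed
  have "embedding_setup E (edges G) n p VH hadj \<Delta> q b \<kappa> \<sigma> U Vc d \<epsilon> \<kappa>0 a0 \<zeta> c M1 M2"
    by (rule embedding_setup.intro; fact)
  from embedding_setup.embedding_exists[OF this]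
  obtain g where g: "inj_on g VH" "\<forall>u\<in>VH. g u \<in> {..<n}" "\<forall>u w. hadj u w \<longrightarrow> {g u, g w} \<in> edges G" by (elim exE conjE)
  show ?thesis unfolding contains_copy_def
  proof (intro exI[of _ g] conjI ballI)
    show "inj_on g (verts H)" using g(1) by (simp add: VH_def)
    show "g ` verts H \<subseteq> verts G" using g(2) unfolding VG VH_def by blast
    fix e assume e: "e \<in> edges H"
    then have "card e = 2" using H(1) by (auto simp: simple_graph_def nsets_def)
    then obtain x y where "e = {x, y}" by (auto simp: card_2_iff)
    then show "g ` e \<in> edges G" using g(3) e unfolding hadj_def by simp
  qed
qed

section \<open>Threshold, failure probability and conclusion\<close>

lemma threshold_power:
  fixes p C :: real and n \<Delta> :: nat
  assumes C: "1 \<le> C" and \<Delta>: "1 \<le> \<Delta>" and n: "3 \<le> n" and p: "C * (log 2 (real n) / real n) powr (1 / real \<Delta>) \<le> p"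
  shows "0 < p" "C * ln (real n) \<le> p ^ \<Delta> * real n"
proof -
  define x where "x = log 2 (real n) / real n"
  have ln0: "0 < ln (real n)" using n by simp
  have ln2: "0 < ln (2::real)" "ln (2::real) \<le> 1" using ln_le_minus_one[of "2::real"] by auto
  have log: "ln (real n) \<le> log 2 (real n)" using ln0 ln2 by (simp add: log_def le_divide_eq mult_left_le)
  have x0: "0 < x" unfolding x_def using log ln0 n by (intro divide_pos_pos) auto
  have y0: "0 < C * x powr (1 / real \<Delta>)" using C x0 by simp
  show "0 < p" using p y0 unfolding x_def by linarith
  \<comment> \<open>Base 2 only helps, as the logarithm to base 2 is at least the natural one, and C
    \<ge> 1 gives C \<le> C^\<Delta>.\<close>
  have "C * ln (real n) \<le> C ^ \<Delta> * log 2 (real n)"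
    using log ln0 C \<Delta> self_le_power[of C \<Delta>] by (intro mult_mono) auto
  also have "\<dots> = C ^ \<Delta> * x * real n" using n by (simp add: x_def)
  also have "x = (x powr (1 / real \<Delta>)) ^ \<Delta>" using x0 \<Delta> by (simp add: powr_powr flip: powr_realpow)
  also have "C ^ \<Delta> * (x powr (1 / real \<Delta>)) ^ \<Delta> = (C * x powr (1 / real \<Delta>)) ^ \<Delta>" by (simp only: power_mult_distrib)
  also have "\<dots> * real n \<le> p ^ \<Delta> * real n" using p y0 unfolding x_def by (intro mult_right_mono power_mono) auto
  finally show "C * ln (real n) \<le> p ^ \<Delta> * real n" .
qed

lemma prob_gnp_ge:
  assumes "\<And>E. good E \<Longrightarrow> P \<lparr>verts = {..<n}, edges = E\<rparr>"
    and "measure_pmf.prob (rsub (nsets {..<n} 2) p) {E. \<not> good E} \<le> e"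
  shows "1 - e \<le> measure_pmf.prob (gnp n p) {\<Gamma>. P \<Gamma>}"
proof -
  have "measure_pmf.prob (rsub (nsets {..<n} 2) p) {E. \<not> good E} = 1 - measure_pmf.prob (rsub (nsets {..<n} 2) p) {E. good E}"
    using measure_pmf.prob_compl[of "{E. good E}" "rsub (nsets {..<n} 2) p"] by (simp add: Compl_eq_Diff_UNIV[symmetric] Collect_neg_eq)
  then have "1 - e \<le> measure_pmf.prob (rsub (nsets {..<n} 2) p) {E. good E}" using assms(2) by linarith
  also have "\<dots> \<le> measure_pmf.prob (rsub (nsets {..<n} 2) p) ((\<lambda>E. \<lparr>verts = {..<n}, edges = E\<rparr>) -` {\<Gamma>. P \<Gamma>})"
    using assms(1) by (intro measure_pmf.finite_measure_mono) auto
  also have "\<dots> = measure_pmf.prob (gnp n p) {\<Gamma>. P \<Gamma>}" unfolding gnp_eq_rsub by simp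
  finally show ?thesis .
qed

lemma failure_bound_tendsto:
  fixes a :: real
  shows "(\<lambda>n. 1 - (2 * exp (- real n) + (exp (1 / real n) - 1) * exp 1 + a * (2 * (exp (3 / real n) - 1)))) \<longlonglongrightarrow> 1"
proof -
  have "(\<lambda>n. exp (- 1) ^ n :: real) \<longlonglongrightarrow> 0" by (rule LIMSEQ_realpow_zero) auto
  then have 1: "(\<lambda>n. exp (- real n)) \<longlonglongrightarrow> 0" by (simp flip: exp_of_nat_mult)
  have 2: "(\<lambda>n. exp (c / real n)) \<longlonglongrightarrow> exp 0" for c :: real by (intro tendsto_exp lim_const_over_n)
  have "(\<lambda>n. 1 - (2 * exp (- real n) + (exp (1 / real n) - 1) * exp 1 + a * (2 * (exp (3 / real n) - 1))))
    \<longlonglongrightarrow> 1 - (2 * 0 + (exp 0 - 1) * exp 1 + a * (2 * (exp 0 - 1)))"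
    by (intro tendsto_intros 1 2)
  then show ?thesis by simp
qed

theorem theorem1p9:
  fixes \<gamma> :: real and \<Delta> :: nat
  assumes "\<gamma> > 0" and "\<Delta> \<ge> 1"
  shows "\<exists>\<beta>>0::real. \<exists>C::real. \<forall>p :: nat \<Rightarrow> real.
    (\<forall>n. 0 \<le> p n \<and> p n \<le> 1) \<longrightarrow>
    (\<forall>\<^sub>F n in sequentially. p n \<ge> C * (log 2 (real n) / real n) powr (1 / real \<Delta>)) \<longrightarrow>
    asymptotically_almost_surely (\<lambda>n. gnp n (p n)) (\<lambda>n \<Gamma>.
      \<forall>(H :: nat ugraph) (G :: nat ugraph).
        simple_graph H \<and> int (card (verts H)) = \<lfloor>(1 - \<gamma>) * real n\<rfloor> \<and>
        max_degree H \<le> \<Delta> \<and> real (bandwidth H) \<le> \<beta> * real n \<and>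
        subgraph G \<Gamma> \<and> card (verts G) = n \<and>
        real (min_degree G) \<ge>
          ((real (chromatic_number H) - 1) / real (chromatic_number H) + \<gamma>) * p n * real n
        \<longrightarrow> contains_copy G H)"
proof (cases "\<gamma> < 1")
  \<comment> \<open>For \<gamma> \<ge> 1 the prescribed number of vertices is at most 0, so
    \<open>H\<close> is empty.\<close>
  case False
  have triv: "contains_copy G H" if H: "simple_graph H" "int (card (verts H)) = \<lfloor>(1 - \<gamma>) * real n\<rfloor>"
    for G H :: "nat ugraph" and n :: nat
  proof -
    have "(1 - \<gamma>) * real n \<le> 0" using False by (intro mult_nonpos_nonneg) auto
    then have "card (verts H) = 0" using H(2) by linarith
    then have "verts H = {}" using H(1) by (simp add: simple_graph_def)
    moreover from this have "edges H = {}" using H(1) by (auto simp: simple_graph_def nsets_def)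
    ultimately show ?thesis by (simp add: contains_copy_def)
  qed
  show ?thesis
    by (intro exI[of _ "1::real"] conjI allI impI)
      (auto simp: asymptotically_almost_surely_def triv)
next
  case \<gamma>1: True
  note \<gamma> = assms(1) \<gamma>1 and \<Delta> = assms(2)
  \<comment> \<open>Will bound the chromatic number of every nonempty \<open>H\<close> for which a
    \<open>G\<close> of the required minimum degree exists.\<close>
  obtain R where R: "2 / \<gamma> \<le> real R" using real_arch_simple by blast
  define q where "q = 3 * Suc ((\<Delta> + 1) ^ 3)"
  define \<zeta> where "\<zeta> = \<gamma> / (8 * real q)"
  define \<eta> where "\<eta> = \<gamma> / 8"
  define d where "d l = \<gamma> / 16 / 2 ^ (24 * l)" for l :: nat
  define \<kappa>0 where "\<kappa>0 = d (2 * \<Delta>)"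
  have "0 < q" unfolding q_def by simp
  then have q0: "0 < real q" by (simp only: of_nat_0_less_iff)
  have \<zeta>0: "0 < \<zeta>" using \<gamma> q0 by (simp add: \<zeta>_def)
  have \<eta>0: "0 < \<eta>" "\<eta> \<le> 1" using \<gamma> by (auto simp: \<eta>_def)
  have dpos: "0 < d l" for l using \<gamma> by (simp add: d_def)
  have d1: "d l \<le> 1" for l
  proof -
    have "\<gamma> / 16 / 2 ^ (24 * l) \<le> \<gamma> / 16 / 1" using \<gamma> by (intro divide_left_mono) auto
    then show ?thesis using \<gamma> unfolding d_def by linarith
  qed
  have \<kappa>00: "0 < \<kappa>0" using dpos by (simp add: \<kappa>0_def)
  have e1: "0 < 1 / (4 * real \<Delta>)" "1 / (4 * real \<Delta>) < 1" using \<Delta> by (auto simp: divide_less_eq)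
  obtain \<epsilon> C0 where C0: "1 \<le> C0" and \<epsilon>D: "\<epsilon> (2 * \<Delta>) = 1 / (4 * real \<Delta>)" and \<epsilon>0: "\<forall>l\<le>2 * \<Delta>. 0 < \<epsilon> l"
    and \<epsilon>S: "\<forall>l<2 * \<Delta>. \<epsilon> l \<le> \<epsilon> (Suc l)"
    and inh: "\<forall>(n::nat) p. \<forall>l<2 * \<Delta>. 3 \<le> n \<longrightarrow> 0 < p \<longrightarrow> p \<le> 1 \<longrightarrow> measure_pmf.prob (rsub (nsets {..<n} 2) p)
      {E. \<not> (inherit_one E {..<n} p (d l) (\<epsilon> l) (\<epsilon> (Suc l) * \<kappa>0) (\<epsilon> (Suc l)) (C0 * ln (real n) / p) (C0 * ln (real n) / p\<^sup>2) \<and>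
             inherit_two E {..<n} p (d l) (\<epsilon> l) (\<epsilon> (Suc l) * \<kappa>0) (C0 * ln (real n) / p\<^sup>2))} \<le> 2 * (exp (3 / real n) - 1)"
    using inheritance_chain[of d \<kappa>0 "1 / (4 * real \<Delta>)" "2 * \<Delta>", OF dpos d1 \<kappa>00 e1] by (elim exE conjE)
  have "0 < \<epsilon> 0 * \<zeta>" using \<epsilon>0 \<zeta>0 by simp
  from cluster_structure[OF this \<eta>0(1)] obtain K where K: "1 \<le> K"
    and Kst: "\<forall>n p \<delta> D \<tau> E G. 1 \<le> n \<longrightarrow> 0 < p \<longrightarrow> 0 \<le> \<delta> \<longrightarrow> 0 < D \<longrightarrow> upper_regular E n p \<delta> \<longrightarrow> G \<subseteq> E \<longrightarrow>
    (\<forall>v<n. \<tau> * p * real n \<le> real (card {u\<in>{..<n}. {v, u} \<in> G})) \<longrightarrow>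
    (\<exists>f I. I \<subseteq> {..<K} \<and> (\<forall>i\<in>I. \<eta> / real K * real n \<le> real (card (cell {..<n} f i))) \<and>
      (1 - 2 * \<eta>) * real n \<le> (\<Sum>i\<in>I. real (card (cell {..<n} f i))) \<and>
      (\<forall>i\<in>I. (\<Sum>j\<in>{j\<in>I. \<not> dense_pair (adj G) (D / 2 * p) (\<epsilon> 0 * \<zeta>) (cell {..<n} f i) (cell {..<n} f j)}. real (card (cell {..<n} f j)))
         \<le> (1 - \<tau> + D + \<delta> + 2 * \<delta> * real K / \<eta> + \<eta>) * real n))" by (elim exE conjE)
  have K0: "1 \<le> real K" using K by simp
  \<comment> \<open>In the cluster structure \<delta> enters as \<delta> + 2\<delta>K/\<eta>, that
    is \<delta> L. It is set to \<gamma>/8, like D and \<eta>, so the loss is 3\<gamma>/8 in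
    all.\<close>
  define L where "L = 1 + 2 * real K / \<eta>"
  have L16: "16 \<le> L"
  proof -
    have "16 * \<eta> \<le> 2 * real K" using K0 \<gamma> by (simp add: \<eta>_def)
    then have "16 \<le> 2 * real K / \<eta>" using \<eta>0 by (simp add: le_divide_eq)
    then show ?thesis by (simp add: L_def)
  qed
  define \<delta> where "\<delta> = \<gamma> / 8 / L"
  have \<delta>0: "0 < \<delta>" using \<gamma> L16 by (simp add: \<delta>_def)
  have \<delta>3: "3 * \<delta> \<le> \<gamma> / 2"
  proof -
    have "\<gamma> / 8 / L \<le> \<gamma> / 8 / 1" using \<gamma> L16 by (intro divide_left_mono) auto
    then show ?thesis using \<gamma> unfolding \<delta>_def by linarith
  qed
  have slack: "1 - \<tau> + \<gamma> / 8 + \<delta> + 2 * \<delta> * real K / \<eta> + \<eta> = 1 - \<tau> + 3 * \<gamma> / 8" for \<tau>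
  proof -
    have "\<delta> * L = \<gamma> / 8" using L16 by (simp add: \<delta>_def)
    moreover have "\<delta> * L = \<delta> + 2 * \<delta> * real K / \<eta>" by (simp add: L_def distrib_left)
    ultimately show ?thesis by (simp add: \<eta>_def)
  qed
  have dD: "\<gamma> / 8 / 2 = d 0" by (simp add: d_def)
  define g where "g = \<zeta> * (\<eta> / real K) * \<kappa>0 ^ \<Delta>"
  have g0: "0 < g" using \<zeta>0 \<eta>0 K0 \<kappa>00 by (simp add: g_def)
  define c where "c = \<zeta> * (\<eta> / real K) / 2 * \<kappa>0 ^ \<Delta>"
  have c0: "0 < c" using \<zeta>0 \<eta>0 K0 \<kappa>00 by (simp add: c_def)
  define \<xi> where "\<xi> = \<gamma>\<^sup>2 * \<eta>^3 / (1000 * (real K)^3)"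
  have \<xi>0: "0 < \<xi>" using \<gamma> \<eta>0 K0 by (simp add: \<xi>_def)
  obtain q' where q': "2 ^ R * 32 * real K / (\<gamma> * \<eta>) \<le> real q'" using real_arch_simple by blast
  have "0 < 2 ^ R * 32 * real K / (\<gamma> * \<eta>)" using \<gamma> \<eta>0 K0 by simp
  then have q'0: "0 < real q'" using q' by linarith
  \<comment> \<open>The three bounds serve, in order, the blocks spent on transitions, the length of
    a run compared with the clusters, and the limit on a layer in
    \<open>hall_property\<close>.\<close>
  define \<beta> where "\<beta> = min (\<gamma> * \<eta> / (128 * real K * 2 ^ R)) (min (\<xi> / (2 * real q')) (c / (2 * exp 2)))"
  have \<beta>0: "0 < \<beta>" using \<gamma> \<eta>0 K0 \<xi>0 q'0 c0 by (simp add: \<beta>_def)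
  have \<beta>1: "\<beta> \<le> \<gamma> * \<eta> / (128 * real K * 2 ^ R)" by (simp add: \<beta>_def)
  have \<beta>2: "2 * real q' * \<beta> \<le> \<xi>"
  proof -
    have "\<beta> \<le> \<xi> / (2 * real q')" by (simp add: \<beta>_def)
    then show ?thesis using q'0 by (simp add: le_divide_eq mult.commute)
  qed
  have \<beta>3: "2 * \<beta> \<le> c / exp 2"
  proof -
    have "\<beta> \<le> c / (2 * exp 2)" by (simp add: \<beta>_def)
    then show ?thesis by (simp add: le_divide_eq mult_ac)
  qed
  \<comment> \<open>The four terms serve, in order, the passage from C^\<Delta> to C, the candidate
    sizes demanded by inheritance, the Hall property, and upper regularity.\<close>
  define C where "C = max 1 (max (8 * (real \<Delta>)\<^sup>2 * C0 / g) (max ((real \<Delta> + 2) / c) (3 / (\<delta> * ln (1 + \<delta>)))))"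
  have C1: "1 \<le> C" and Cg: "8 * (real \<Delta>)\<^sup>2 * C0 / g \<le> C" and Cc: "(real \<Delta> + 2) / c \<le> C" and C\<delta>: "3 / (\<delta> * ln (1 + \<delta>)) \<le> C"
    by (simp_all add: C_def)
  have \<delta>ln: "0 < \<delta> * ln (1 + \<delta>)" using \<delta>0 by simp
  show ?thesis
  proof (rule exI[of _ \<beta>], rule conjI[OF \<beta>0], rule exI[of _ C], intro allI impI)
    fix p :: "nat \<Rightarrow> real"
    assume p01: "\<forall>n. 0 \<le> p n \<and> p n \<le> 1"
      and pC: "\<forall>\<^sub>F n in sequentially. p n \<ge> C * (log 2 (real n) / real n) powr (1 / real \<Delta>)"
    define e where "e n = 2 * exp (- real n) + (exp (1 / real n) - 1) * exp 1 + real (2 * \<Delta>) * (2 * (exp (3 / real n) - 1))" for n :: nat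
    define P where "P n \<Gamma> \<longleftrightarrow> (\<forall>(H :: nat ugraph) (G :: nat ugraph).
        simple_graph H \<and> int (card (verts H)) = \<lfloor>(1 - \<gamma>) * real n\<rfloor> \<and>
        max_degree H \<le> \<Delta> \<and> real (bandwidth H) \<le> \<beta> * real n \<and>
        subgraph G \<Gamma> \<and> card (verts G) = n \<and>
        real (min_degree G) \<ge>
          ((real (chromatic_number H) - 1) / real (chromatic_number H) + \<gamma>) * p n * real n
        \<longrightarrow> contains_copy G H)" for n \<Gamma>
    have main: "1 - e n \<le> measure_pmf.prob (gnp n (p n)) {\<Gamma>. P n \<Gamma>}"
      if n3: "3 \<le> n" and n1: "1 \<le> \<beta> * real n" and n2: "4 * real q / (\<gamma> * (\<eta> / real K)) \<le> real n"
        and pn: "p n \<ge> C * (log 2 (real n) / real n) powr (1 / real \<Delta>)" for n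
    proof -
      define \<pi> where "\<pi> = p n"
      define M1 where "M1 = C0 * ln (real n) / \<pi>"
      define M2 where "M2 = C0 * ln (real n) / \<pi>\<^sup>2"
      have \<pi>: "0 < \<pi>" "\<pi> \<le> 1" using threshold_power(1)[OF C1 \<Delta> n3 pn] p01 by (auto simp: \<pi>_def)
      have big: "C * ln (real n) \<le> \<pi> ^ \<Delta> * real n" unfolding \<pi>_def by (rule threshold_power(2)[OF C1 \<Delta> n3 pn])
      have ln1: "1 \<le> ln (real n)"
      proof -
        have "exp 1 \<le> real n" using exp_le n3 by linarith
        then show ?thesis using n3 by (simp add: ln_ge_iff)
      qed
      have bigx: "x * ln (real n) \<le> y * (\<pi> ^ \<Delta> * real n)" if "x / y \<le> C" "0 < y" for x y
      proof -
        have "x \<le> y * C" using that by (simp add: divide_le_eq mult.commute)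
        then have "x * ln (real n) \<le> y * C * ln (real n)" using ln1 by (intro mult_right_mono) auto
        also have "\<dots> = y * (C * ln (real n))" by simp
        also have "\<dots> \<le> y * (\<pi> ^ \<Delta> * real n)" using big that(2) by (intro mult_left_mono) auto
        finally show ?thesis .
      qed
      define inhl where "inhl E l \<longleftrightarrow> inherit_one E {..<n} \<pi> (d l) (\<epsilon> l) (\<epsilon> (Suc l) * \<kappa>0) (\<epsilon> (Suc l)) M1 M2 \<and>
             inherit_two E {..<n} \<pi> (d l) (\<epsilon> l) (\<epsilon> (Suc l) * \<kappa>0) M2" for E l
      define good where "good E \<longleftrightarrow> upper_regular E n \<pi> \<delta> \<and> hall_property E n \<pi> \<Delta> c \<and> (\<forall>l<2 * \<Delta>. inhl E l)" for E
      let ?M = "rsub (nsets {..<n} 2) \<pi>"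
      have b1: "measure_pmf.prob ?M {E. \<not> upper_regular E n \<pi> \<delta>} \<le> 2 * exp (- real n)"
      proof (rule upper_regular_prob[OF \<delta>0])
        have "3 \<le> 3 * ln (real n)" using ln1 by simp
        also have "\<dots> \<le> \<delta> * ln (1 + \<delta>) * (\<pi> ^ \<Delta> * real n)" by (rule bigx[OF C\<delta> \<delta>ln])
        also have "\<dots> \<le> \<delta> * ln (1 + \<delta>) * (\<pi> ^ 1 * real n)"
          using \<delta>ln \<pi> \<Delta> by (intro mult_left_mono mult_right_mono power_decreasing) auto
        finally show "3 \<le> \<delta> * ln (1 + \<delta>) * \<pi> * real n" by (simp add: mult.assoc)
      qed (use \<pi> in auto)
      have b2: "measure_pmf.prob ?M {E. \<not> hall_property E n \<pi> \<Delta> c} \<le> (exp (1 / real n) - 1) * exp 1"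
      proof (rule hall_property_prob[OF c0])
        show "(real \<Delta> + 2) * ln (real n) \<le> c * \<pi> ^ \<Delta> * real n" using bigx[OF Cc c0] by (simp add: mult.assoc)
      qed (use \<pi> n3 in auto)
      have b3: "measure_pmf.prob ?M {E. \<not> inhl E l} \<le> 2 * (exp (3 / real n) - 1)" if "l < 2 * \<Delta>" for l
        unfolding inhl_def M1_def M2_def using inh that n3 \<pi> by blast
      have b4: "measure_pmf.prob ?M (\<Union>l<2 * \<Delta>. {E. \<not> inhl E l}) \<le> real (2 * \<Delta>) * (2 * (exp (3 / real n) - 1))"
      proof -
        have "measure_pmf.prob ?M (\<Union>l<2 * \<Delta>. {E. \<not> inhl E l}) \<le> (\<Sum>l<2 * \<Delta>. measure_pmf.prob ?M {E. \<not> inhl E l})"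
          by (rule measure_pmf.finite_measure_subadditive_finite) auto
        also have "\<dots> \<le> (\<Sum>l<2 * \<Delta>. 2 * (exp (3 / real n) - 1))" by (rule sum_mono) (rule b3, simp)
        finally show ?thesis by simp
      qed
      have bad: "measure_pmf.prob ?M {E. \<not> good E} \<le> e n"
      proof -
        have "measure_pmf.prob ?M {E. \<not> good E} \<le>
          measure_pmf.prob ?M ({E. \<not> upper_regular E n \<pi> \<delta>} \<union> ({E. \<not> hall_property E n \<pi> \<Delta> c} \<union> (\<Union>l<2 * \<Delta>. {E. \<not> inhl E l})))"
          by (rule measure_pmf.finite_measure_mono) (auto simp: good_def)
        also have "\<dots> \<le> measure_pmf.prob ?M {E. \<not> upper_regular E n \<pi> \<delta>} +
          measure_pmf.prob ?M ({E. \<not> hall_property E n \<pi> \<Delta> c} \<union> (\<Union>l<2 * \<Delta>. {E. \<not> inhl E l}))"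
          by (rule measure_Un_le) auto
        also have "measure_pmf.prob ?M ({E. \<not> hall_property E n \<pi> \<Delta> c} \<union> (\<Union>l<2 * \<Delta>. {E. \<not> inhl E l})) \<le>
          measure_pmf.prob ?M {E. \<not> hall_property E n \<pi> \<Delta> c} + measure_pmf.prob ?M (\<Union>l<2 * \<Delta>. {E. \<not> inhl E l})"
          by (rule measure_Un_le) auto
        finally show ?thesis using b1 b2 b4 unfolding e_def by linarith
      qed
      have M0: "0 \<le> M1" "0 \<le> M2" using C0 ln1 \<pi> by (auto simp: M1_def M2_def)
      have S: "8 * (real \<Delta>)\<^sup>2 * (C0 * ln (real n)) \<le> \<zeta> * (\<eta> / real K * real n) * (\<kappa>0 * \<pi>) ^ \<Delta>"
        using bigx[OF Cg g0] unfolding g_def by (simp add: power_mult_distrib mult_ac)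
      have "M1 * \<pi> = C0 * ln (real n)" "M2 * \<pi>\<^sup>2 = C0 * ln (real n)" using \<pi> by (simp_all add: M1_def M2_def)
      note S1 = S[folded this(1)] and S2 = S[folded this(2)]
      have n2': "4 * real q \<le> \<gamma> * (\<eta> / real K * real n)"
      proof -
        have "0 < \<gamma> * (\<eta> / real K)" using \<gamma> \<eta>0 K0 by simp
        then show ?thesis using n2 by (simp only: pos_divide_le_eq mult.assoc mult.commute[of "real n"])
      qed
      have det: "P n \<lparr>verts = {..<n}, edges = E\<rparr>" if gd: "good E" for E
        unfolding P_def
      proof (intro allI impI, elim conjE)
        fix H G :: "nat ugraph"
        assume H: "simple_graph H" "int (card (verts H)) = \<lfloor>(1 - \<gamma>) * real n\<rfloor>" "max_degree H \<le> \<Delta>" "real (bandwidth H) \<le> \<beta> * real n"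
          and G: "subgraph G \<lparr>verts = {..<n}, edges = E\<rparr>" "card (verts G) = n"
          and md: "((real (chromatic_number H) - 1) / real (chromatic_number H) + \<gamma>) * p n * real n \<le> real (min_degree G)"
        have up: "upper_regular E n \<pi> \<delta>" and hall: "hall_property E n \<pi> \<Delta> c" using gd by (auto simp: good_def)
        show "contains_copy G H"
        proof (rule embedding_of_bounded_bandwidth[OF \<gamma> \<Delta> R q_def \<zeta>_def \<eta>_def d_def \<kappa>0_def _ _ _ K _ less_imp_le[OF \<delta>0] \<delta>3 up q' \<xi>_def
              \<beta>0 \<beta>1 \<beta>2 \<beta>3 c_def n1 n2' \<pi> M0 S1 S2 _ _ hall H G md[folded \<pi>_def]])
          show "0 < \<epsilon> l" if "l \<le> 2 * \<Delta>" for l using \<epsilon>0 that by blast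
          show "\<epsilon> l \<le> \<epsilon> (Suc l)" if "l < 2 * \<Delta>" for l using \<epsilon>S that by blast
          show "\<epsilon> (2 * \<Delta>) * (4 * real \<Delta>) \<le> 1" unfolding \<epsilon>D using \<Delta> by simp
          show "inherit_one E {..<n} \<pi> (d l) (\<epsilon> l) (\<epsilon> (Suc l) * \<kappa>0) (\<epsilon> (Suc l)) M1 M2" if "l < 2 * \<Delta>" for l
            using gd that unfolding good_def inhl_def by blast
          show "inherit_two E {..<n} \<pi> (d l) (\<epsilon> l) (\<epsilon> (Suc l) * \<kappa>0) M2" if "l < 2 * \<Delta>" for l
            using gd that unfolding good_def inhl_def by blast
          fix \<tau> G'
          assume G': "G' \<subseteq> E" "\<forall>v<n. \<tau> * \<pi> * real n \<le> real (card {u\<in>{..<n}. {v, u} \<in> G'})"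
          have D0: "0 < \<gamma> / 8" using \<gamma> by simp
          have n1': "1 \<le> n" using n3 by linarith
          note st = Kst[THEN spec[of _ n], THEN spec[of _ \<pi>], THEN spec[of _ \<delta>], THEN spec[of _ "\<gamma> / 8"], THEN spec[of _ \<tau>], THEN spec[of _ E], THEN spec[of _ G'],
            THEN mp, OF n1', THEN mp, OF \<pi>(1), THEN mp, OF less_imp_le[OF \<delta>0], THEN mp, OF D0, THEN mp, OF up, THEN mp, OF G'(1), THEN mp, OF G'(2)]
          show "\<exists>f I. I \<subseteq> {..<K} \<and> (\<forall>i\<in>I. \<eta> / real K * real n \<le> real (card (cell {..<n} f i))) \<and>
            (1 - 2 * \<eta>) * real n \<le> (\<Sum>i\<in>I. real (card (cell {..<n} f i))) \<and>
            (\<forall>i\<in>I. (\<Sum>j\<in>{j\<in>I. \<not> dense_pair (adj G') (d 0 * \<pi>) (\<epsilon> 0 * \<zeta>) (cell {..<n} f i) (cell {..<n} f j)}. real (card (cell {..<n} f j)))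
              \<le> (1 - \<tau> + 3 * \<gamma> / 8) * real n)"
            using st unfolding slack dD .
        qed
      qed
      show ?thesis
      proof (rule prob_gnp_ge[where good = good])
        show "P n \<lparr>verts = {..<n}, edges = E\<rparr>" if "good E" for E by (rule det[OF that])
        show "measure_pmf.prob (rsub (nsets {..<n} 2) (p n)) {E. \<not> good E} \<le> e n" using bad unfolding \<pi>_def .
      qed
    qed
    have ev: "\<forall>\<^sub>F n in sequentially. 1 - e n \<le> measure_pmf.prob (gnp n (p n)) {\<Gamma>. P n \<Gamma>}"
      using pC eventually_ge_at_top[of 3] eventually_ge_at_top[of "nat \<lceil>1 / \<beta>\<rceil>"]
        eventually_ge_at_top[of "nat \<lceil>4 * real q / (\<gamma> * (\<eta> / real K))\<rceil>"]
    proof eventually_elim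
      case (elim n)
      have "1 / \<beta> \<le> real n" using elim(3) by linarith
      then have 1: "1 \<le> \<beta> * real n" using \<beta>0 by (simp add: divide_le_eq mult.commute)
      have 2: "4 * real q / (\<gamma> * (\<eta> / real K)) \<le> real n" using elim(4) by linarith
      show ?case by (rule main[OF elim(2) 1 2 elim(1)])
    qed
    have "(\<lambda>n. measure_pmf.prob (gnp n (p n)) {\<Gamma>. P n \<Gamma>}) \<longlonglongrightarrow> 1"
    proof (rule tendsto_sandwich[OF ev _ _ tendsto_const])
      show "(\<lambda>n. 1 - e n) \<longlonglongrightarrow> 1" unfolding e_def by (rule failure_bound_tendsto)
    qed simp
    then show "asymptotically_almost_surely (\<lambda>n. gnp n (p n)) (\<lambda>n \<Gamma>.
      \<forall>(H :: nat ugraph) (G :: nat ugraph).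
        simple_graph H \<and> int (card (verts H)) = \<lfloor>(1 - \<gamma>) * real n\<rfloor> \<and>
        max_degree H \<le> \<Delta> \<and> real (bandwidth H) \<le> \<beta> * real n \<and>
        subgraph G \<Gamma> \<and> card (verts G) = n \<and>
        real (min_degree G) \<ge>
          ((real (chromatic_number H) - 1) / real (chromatic_number H) + \<gamma>) * p n * real n
        \<longrightarrow> contains_copy G H)"
      unfolding asymptotically_almost_surely_def P_def .
  qed
qed

end
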